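(* Let $d\ge2$ and $p^*(d)=2+\frac4d$. Let $\mu$ be the Gaussian measure on radial distributions on $\mathbb R^d$ associated with the radial harmonic oscillator $\mathcal L=-\Delta+|x|^2$, described in the context, and for $u$ distributed according to $\mu$ write $u_N=\mathbf P_Nu$. For $K>0$, $p>2$, $N\in\mathbb N$ let $$\mathcal Z_{K,N}=\int \mathbf 1_{\{|\int_{\mathbb R^d}:|u_N|^2:\,dx|\le K\}}\,e^{\frac1p\|u_N\|_{L^p(\mathbb R^d)}^p}\,d\mu(u),\qquad d\rho_{N,K}(u)=\mathcal Z_{K,N}^{-1}\mathbf 1_{\{|\int_{\mathbb R^d}:|u_N|^2:\,dx|\le K\}}\,e^{\frac1p\|u_N\|_{L^p(\mathbb R^d)}^p}\,d\mu(u),$$ $$\mathcal Z_{K}=\int \mathbf 1_{\{|\int_{\mathbb R^d}:|u|^2:\,dx|\le K\}}\,e^{\frac1p\|u\|_{L^p(\mathbb R^d)}^p}\,d\mu(u).$$ Then the following hold. (i) (subcritical case) Let $K>0$ and $2<p<p^*(d)$. For every finite $r\ge1$, $$\sup_{N\in\mathbb N}\Big\|\mathbf 1_{\{|\int_{\mathbb R^d}:|u_N|^2:\,dx|\le K\}}\,e^{\frac1p\|u_N\|_{L^p(\mathbb R^d)}^p}\Big\|_{L^r(\mu)}<\infty,$$ and moreover $$\lim_{N\to\infty}\mathbf 1_{\{|\int_{\mathbb R^d}:|u_N|^2:\,dx|\le K\}}\,e^{\frac1p\|u_N\|_{L^p(\mathbb R^d)}^p}=\mathbf 1_{\{|\int_{\mathbb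 R^d}:|u|^2:\,dx|\le K\}}\,e^{\frac1p\|u\|_{L^p(\mathbb R^d)}^p}\quad\text{in }L^r(\mu).$$ As a consequence, $\rho_{N,K}$ converges in total variation, as $N\to\infty$, to the probability measure $\rho$ defined by $$d\rho(u)=\mathcal Z_K^{-1}\mathbf 1_{\{|\int_{\mathbb R^d}:|u|^2:\,dx|\le K\}}\,e^{\frac1p\|u\|_{L^p(\mathbb R^d)}^p}\,d\mu(u),$$ and $\rho$ is absolutely continuous with respect to $\mu$. (ii) (critical/supercritical cases) Let $p\ge p^*(d)$ if $d=2$, and $p^*(d)\le p<\frac{2d}{d-2}$ if $d\ge3$. Then for every $K>0$, $$\sup_{N\in\mathbb N}\mathcal Z_{K,N}=\sup_{N\in\mathbb N}\Big\|\mathbf 1_{\{|\int_{\mathbb R^d}:|u_N|^2:\,dx|\le K\}}\,e^{\frac1p\|u_N\|_{L^p(\mathbb R^d)}^p}\Big\|_{L^1(\mu)}=\infty ,$$ and moreover $\mathcal Z_K=\infty$. In particular, for such $p$ the measure $\mathbf 1_{\{|\int_{\mathbb R^d}:|u|^2:\,dx|\le K\}}\,e^{\frac1p\|u\|_{L^p(\mathbb R^d)}^p}\,d\mu(u)$ cannot be normalized to a probability measure.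
   Context: Let $d\ge2$. The operator $\mathcal L=-\Delta+|x|^2$ restricted to radial functions on $\mathbb R^d$ has eigenvalues $\lambda_n^2=4n+d$, $n\ge0$, with real-valued radial eigenfunctions $h_n$, $\mathcal Lh_n=\lambda_n^2h_n$, normalized to form an orthonormal basis of $L^2_{\mathrm{rad}}(\mathbb R^d)$ (the radial functions in $L^2(\mathbb R^d)$). The radial harmonic Sobolev space $\mathcal H^s_{\mathrm{rad}}(\mathbb R^d)$ has norm $\|\sum_nc_nh_n\|_{\mathcal H^s}^2=\sum_n\lambda_n^{2s}|c_n|^2$. Let $\{g_n\}_{n\ge0}$ be independent standard complex-valued Gaussian random variables ($\mathbb E g_n=0$, $\mathbb E|g_n|^2=1$, rotationally invariant). The Gaussian measure $\mu$ is the law of $u^\omega=\sum_{n\ge0}\frac{g_n(\omega)}{\lambda_n}h_n$, which converges in $\mathcal H^{-s}_{\mathrm{rad}}(\mathbb R^d)$ almost surely for every $s>0$. The spectral projector is $\mathbf P_N(\sum_{n\ge0}u_nh_n)=\sum_{n=0}^Nu_nh_n$. Under $\mu$, set $\sigma_N(x)=\mathbb E_\mu[|u_N(x)|^2]=\sum_{n=0}^N\frac{h_n(x)^2}{\lambda_n^2}$ and $:|u_N|^2:\;=|u_N|^2-\sigma_N$. The random variables $\int_{\mathbb R^d}:|u_N|^2:\,dx$ form a Cauchy sequence in $L^2(\mu)$, and $\int_{\mathbb R^d}:|u|^2:\,dx$ denotes their limit. For $2<p<\infty$ if $d=2$, and $2<p<\frac{2d}{d-2}$ if $d\ge3$, $\|u\|_{L^p(\mathbb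 R^d)}<\infty$ for $\mu$-almost every $u$. *)

theory Defs
  imports "HOL-Probability.Probability"
begin

section \<open>Lebesgue spaces\<close>

text \<open>The value is \<open>\<infinity>\<close> when the integral diverges; the exponent is meant to satisfy \<open>1 \<le> p < \<infinity>\<close>.\<close>

definition Lp_norm :: "'a measure \<Rightarrow> real \<Rightarrow> ('a \<Rightarrow> 'b::real_normed_vector) \<Rightarrow> ennreal" where
  "Lp_norm M p f =
     (let I = \<integral>\<^sup>+x. ennreal (norm (f x) powr p) \<partial>M
      in if I = \<infinity> then \<infinity> else ennreal (enn2real I powr (1 / p)))"

definition in_Lp :: "'a measure \<Rightarrow> real \<Rightarrow> ('a \<Rightarrow> 'b::real_normed_vector) \<Rightarrow> bool" where
  "in_Lp M p f \<longleftrightarrow> f \<in> borel_measurable M \<and> Lp_norm M p f < \<infinity>"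

definition tendsto_Lp ::
    "'a measure \<Rightarrow> real \<Rightarrow> (nat \<Rightarrow> 'a \<Rightarrow> 'b::real_normed_vector) \<Rightarrow> ('a \<Rightarrow> 'b) \<Rightarrow> bool" where
  "tendsto_Lp M p F f \<longleftrightarrow>
     (\<forall>N. in_Lp M p (F N)) \<and> in_Lp M p f \<and> (\<lambda>N. Lp_norm M p (\<lambda>x. F N x - f x)) \<longlonglongrightarrow> 0"

definition tv_dist :: "'a measure \<Rightarrow> 'a measure \<Rightarrow> ennreal" where
  "tv_dist M N = (SUP A\<in>sets M. ennreal \<bar>measure M A - measure N A\<bar>)"


section \<open>The radial harmonic oscillator\<close>

definition radial :: "('a::real_normed_vector \<Rightarrow> 'b) \<Rightarrow> bool" where
  "radial f \<longleftrightarrow> (\<forall>x y. norm x = norm y \<longrightarrow> f x = f y)"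

definition partial_deriv :: "'a::euclidean_space \<Rightarrow> ('a \<Rightarrow> real) \<Rightarrow> 'a \<Rightarrow> real" where
  "partial_deriv b f x = deriv (\<lambda>t. f (x + t *\<^sub>R b)) 0"

definition C1 :: "('a::euclidean_space \<Rightarrow> real) \<Rightarrow> bool" where
  "C1 f \<longleftrightarrow> (\<forall>b\<in>Basis. (\<forall>x. (\<lambda>t. f (x + t *\<^sub>R b)) differentiable (at (0::real))) \<and>
                      continuous_on UNIV (partial_deriv b f))"

definition C2 :: "('a::euclidean_space \<Rightarrow> real) \<Rightarrow> bool" where
  "C2 f \<longleftrightarrow> C1 f \<and> (\<forall>b\<in>Basis. C1 (partial_deriv b f))"

definition laplacian :: "('a::euclidean_space \<Rightarrow> real) \<Rightarrow> 'a \<Rightarrow> real" where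
  "laplacian f x = (\<Sum>b\<in>Basis. partial_deriv b (partial_deriv b f) x)"

definition harmonic_oscillator :: "('a::euclidean_space \<Rightarrow> real) \<Rightarrow> 'a \<Rightarrow> real" where
  "harmonic_oscillator f x = - laplacian f x + (norm x)\<^sup>2 * f x"

definition ho_freq :: "nat \<Rightarrow> nat \<Rightarrow> real" where
  "ho_freq d n = sqrt (4 * real n + real d)"

text \<open>
  Eigenfunctions of \<open>-\<Delta> + |x|\<^sup>2\<close> are smooth, so they are taken as classical (pointwise) solutions of
  the eigenvalue equation. The last clause, for complex-valued \<open>f\<close>, says that the orthonormal
  system \<open>h\<close> is a basis of the radial functions in \<open>L\<^sup>2\<close>.
\<close>

definition radial_eigenbasis :: "(nat \<Rightarrow> 'a::euclidean_space \<Rightarrow> real) \<Rightarrow> bool" where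
  "radial_eigenbasis h \<longleftrightarrow>
     (\<forall>n. radial (h n) \<and> C2 (h n) \<and>
          (\<forall>x. harmonic_oscillator (h n) x = (ho_freq DIM('a) n)\<^sup>2 * h n x)) \<and>
     (\<forall>n. in_Lp lborel 2 (h n)) \<and>
     (\<forall>m n. (\<integral>x. h m x * h n x \<partial>lborel) = (if m = n then 1 else 0)) \<and>
     (\<forall>f :: 'a \<Rightarrow> complex. radial f \<and> in_Lp lborel 2 f \<longrightarrow>
        (\<lambda>N. Lp_norm lborel 2
               (\<lambda>x. f x - (\<Sum>n\<le>N. (\<integral>y. f y * of_real (h n y) \<partial>lborel) * of_real (h n x)))) \<longlonglongrightarrow> 0)"


section \<open>Radial distributions and the Gaussian measure\<close>

text \<open>
  An element \<open>\<Sum>n. u\<^sub>n h\<^sub>n\<close> of a radial harmonic Sobolev space is represented by its coefficient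
  sequence \<open>u :: nat \<Rightarrow> complex\<close>; the Sobolev norms are weighted \<open>\<ell>\<^sup>2\<close> norms of that sequence. The
  Gaussian measure, the law of \<open>\<Sum>n. g\<^sub>n / \<lambda>\<^sub>n h\<^sub>n\<close>, is thus a measure on sequences with the product
  \<open>\<sigma>\<close>-algebra, whose trace on each of these Sobolev spaces is the Borel \<open>\<sigma>\<close>-algebra.
\<close>

definition std_complex_gaussian :: "'w measure \<Rightarrow> ('w \<Rightarrow> complex) \<Rightarrow> bool" where
  "std_complex_gaussian M X \<longleftrightarrow>
     distributed M lborel X (\<lambda>z. ennreal (exp (- (cmod z)\<^sup>2) / pi))"

definition gaussian_law ::
    "nat \<Rightarrow> 'w measure \<Rightarrow> (nat \<Rightarrow> 'w \<Rightarrow> complex) \<Rightarrow> (nat \<Rightarrow> complex) measure" where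
  "gaussian_law d M g =
     distr M (PiM UNIV (\<lambda>_. borel)) (\<lambda>\<omega> n. g n \<omega> / of_real (ho_freq d n))"

definition proj :: "(nat \<Rightarrow> 'a \<Rightarrow> real) \<Rightarrow> nat \<Rightarrow> (nat \<Rightarrow> complex) \<Rightarrow> 'a \<Rightarrow> complex" where
  "proj h N u x = (\<Sum>n\<le>N. u n * of_real (h n x))"

text \<open>
  The \<open>L\<^sup>p\<close> norm of the radial distribution with coefficients \<open>u\<close>: it is \<open>\<infinity>\<close> (infimum of the empty
  set) unless the distribution is a radial \<open>L\<^sup>p\<close> function \<open>f\<close>. Such an \<open>f\<close> is unique up to null sets.
\<close>

definition Lp_norm_distribution ::
    "(nat \<Rightarrow> 'a::euclidean_space \<Rightarrow> real) \<Rightarrow> real \<Rightarrow> (nat \<Rightarrow> complex) \<Rightarrow> ennreal" where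
  "Lp_norm_distribution h p u =
     (INF f\<in>{f :: 'a \<Rightarrow> complex. radial f \<and> in_Lp lborel p f \<and>
               (\<forall>n. has_bochner_integral lborel (\<lambda>x. f x * of_real (h n x)) (u n))}.
        Lp_norm lborel p f)"

definition wick_var ::
    "(nat \<Rightarrow> 'a \<Rightarrow> real) \<Rightarrow> (nat \<Rightarrow> complex) measure \<Rightarrow> nat \<Rightarrow> 'a \<Rightarrow> real" where
  "wick_var h \<mu> N x = (\<integral>u. (cmod (proj h N u x))\<^sup>2 \<partial>\<mu>)"

definition wick_mass ::
    "(nat \<Rightarrow> 'a::euclidean_space \<Rightarrow> real) \<Rightarrow> (nat \<Rightarrow> complex) measure \<Rightarrow> nat \<Rightarrow> (nat \<Rightarrow> complex) \<Rightarrow> real" where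
  "wick_mass h \<mu> N u = (\<integral>x. (cmod (proj h N u x))\<^sup>2 - wick_var h \<mu> N x \<partial>lborel)"


section \<open>Gibbs weights\<close>

definition gibbs_weight_trunc ::
    "(nat \<Rightarrow> 'a::euclidean_space \<Rightarrow> real) \<Rightarrow> (nat \<Rightarrow> complex) measure \<Rightarrow> real \<Rightarrow> real \<Rightarrow> nat
      \<Rightarrow> (nat \<Rightarrow> complex) \<Rightarrow> real" where
  "gibbs_weight_trunc h \<mu> K p N u =
     indicator {v. \<bar>wick_mass h \<mu> N v\<bar> \<le> K} u
       * exp (1 / p * enn2real (Lp_norm lborel p (proj h N u)) powr p)"

text \<open>
  Here \<open>X\<close> is a version of the \<open>L\<^sup>2(\<mu>)\<close> limit of \<open>wick_mass h \<mu> N\<close>. The weight is real-valued: the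
  \<open>L\<^sup>p\<close> norm is finite almost surely in the range of \<open>p\<close> considered, and the null set on which it is
  infinite is irrelevant.
\<close>

definition gibbs_weight ::
    "(nat \<Rightarrow> 'a::euclidean_space \<Rightarrow> real) \<Rightarrow> ((nat \<Rightarrow> complex) \<Rightarrow> real) \<Rightarrow> real \<Rightarrow> real
      \<Rightarrow> (nat \<Rightarrow> complex) \<Rightarrow> real" where
  "gibbs_weight h X K p u =
     indicator {v. \<bar>X v\<bar> \<le> K} u * exp (1 / p * enn2real (Lp_norm_distribution h p u) powr p)"

definition partition_fun :: "'b measure \<Rightarrow> ('b \<Rightarrow> real) \<Rightarrow> ennreal" where
  "partition_fun \<mu> W = (\<integral>\<^sup>+u. ennreal (W u) \<partial>\<mu>)"

definition gibbs_measure :: "'b measure \<Rightarrow> ('b \<Rightarrow> real) \<Rightarrow> 'b measure" where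
  "gibbs_measure \<mu> W = density \<mu> (\<lambda>u. inverse (partition_fun \<mu> W) * ennreal (W u))"

end

theory Submission
 imports Defs "HOL-Probability.Probability"
begin

text \<open>
 The radial eigenfunctions satisfy a radial ordinary differential equation. Energy estimates bound the
 covariance of the field restricted to frequencies above \<open>\<Lambda>\<close> in \<open>L\<^bsup>p/2\<^esup>\<close> by a negative power
 of \<open>\<Lambda>\<close>, so the \<open>L\<^sup>p\<close> norm of the high frequencies has Gaussian tails of width tending to \<open>0\<close>.
 Below the critical exponent, on the event that the norm is at least \<open>j\<close>, the mass cutoff controls the
 frequencies below a power of \<open>j\<close>, and the tails of the remaining ones are summable against
 \<open>exp (j\<^sup>p)\<close>. Uniform bounds of all moments and convergence in probability then give convergence in
 \<open>L\<^sup>r\<close>; the law of the limiting mass has no atoms because the coordinate \<open>u\<^sub>0\<close> is independent of the others.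
 From the critical exponent on, the first \<open>M + 1\<close> coordinates are placed in a small ball around a profile
 concentrated at scale \<open>M\<^bsup>-1/2\<^esup>\<close> whose mass is that of \<open>\<sigma>\<^sub>M\<close>, a sum diverging like \<open>log M\<close>; the
 exponential weight beats the probability of this event.
\<close>

text \<open>The threshold comes from one balance. A profile of mass m concentrated on a ball of
  radius 1/\<Lambda> has an L^p norm whose p-th power is of order m^(p/2) \<Lambda>^(D(p-2)/2),
  while reaching it costs the Gaussian measure an exponent of order m \<Lambda>^2; the powers of
  \<Lambda> agree exactly for p = 2 + 4/D. There only m decides. The cutoff fixes the mass after
  subtraction of its divergent mean, so m may grow like log \<Lambda>, and m^(p/2) beats m whatever
  K is. Below the threshold the same logarithm is harmless, being dominated by any small power of
  \<Lambda>. A separate obstacle is the limiting weight: \<open>Lp_norm_distribution\<close> is an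
  infimum over representatives, for which neither uniqueness nor measurability is evident.
  Uniqueness is obtained by testing against compactly supported radial functions of finite energy,
  measurability by writing the value as a supremum of infima that depend on finitely many
  coefficients. No asymptotics of special functions enter: the bounds on the eigenfunctions come
  from their differential equation and energy identities.\<close>

abbreviation (input) enn :: "real => ennreal" where
 "enn \<equiv> ennreal"

abbreviation lebesgue_integral_real :: "('a::euclidean_space => 'b::{banach, second_countable_topology}) => 'b" (binder "\<I>" 10) where
 "lebesgue_integral_real f \<equiv> integral\<^sup>L lborel f"

abbreviation nn_lebesgue :: "('a::euclidean_space => ennreal) => ennreal" (binder "\<L>" 10) where
 "nn_lebesgue f \<equiv> nn_integral lborel f"

section \<open>Lebesgue spaces\<close>

text \<open>The integral before the root is taken: it is monotone and has no case distinction, so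
  most estimates are made here and are carried over to \<open>Lp_norm\<close> at the end.\<close>

definition Lp_int :: "'a measure => real => ('a => 'b::real_normed_vector) => ennreal" where
 "Lp_int M p f = (\<integral>\<^sup>+x. enn (norm (f x) powr p) \<partial>M)"

lemma Lp_norm_Lp_int:
 "Lp_norm M p f = (if Lp_int M p f = \<infinity> then \<infinity> else enn (enn2real (Lp_int M p f) powr (1 / p)))"
 by (simp add: Lp_norm_def Lp_int_def Let_def)

lemma Lp_norm_finite_iff: "Lp_norm M p f < \<top> \<longleftrightarrow> Lp_int M p f < \<top>"
 by (simp add: Lp_norm_Lp_int less_top)

lemma Lp_int_eq_norm:
 assumes "0 < p" "Lp_int M p f < \<infinity>"
 shows "Lp_int M p f = enn (enn2real (Lp_norm M p f) powr p)"
proof -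
 have "Lp_int M p f ~= top" using assms by auto
 thus ?thesis using assms
  by (simp add: Lp_norm_Lp_int powr_powr ennreal_enn2real_if)
qed

lemma Lp_norm_le_iff:
 assumes "0 < p" "0 <= A"
 shows "Lp_norm M p f <= enn A \<longleftrightarrow> Lp_int M p f <= enn (A powr p)"
proof (cases "Lp_int M p f = \<infinity>")
 case True
 thus ?thesis by (simp add: Lp_norm_Lp_int top_unique)
next
 case False
 then obtain x where x: "Lp_int M p f = enn x" "x >= 0"
  by (cases "Lp_int M p f") auto
 have "x powr (1 / p) <= A \<longleftrightarrow> x <= A powr p"
 proof
  assume "x powr (1 / p) <= A"
  hence "(x powr (1 / p)) powr p <= A powr p" using assms by (intro powr_mono2) auto
  thus "x <= A powr p" using assms x by (simp add: powr_powr)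
 next
  assume "x <= A powr p"
  hence "x powr (1 / p) <= (A powr p) powr (1 / p)" using assms x by (intro powr_mono2) auto
  thus "x powr (1 / p) <= A" using assms by (simp add: powr_powr)
 qed
 thus ?thesis using x assms by (simp add: Lp_norm_Lp_int)
qed

lemma Lp_int_eq_norm_powr:
 assumes "0 < p" "Lp_norm M p f = enn A" "0 <= A"
 shows "Lp_int M p f = enn (A powr p)"
proof -
 have "Lp_int M p f < \<infinity>" using assms(2) Lp_norm_finite_iff[of M p f] by simp
 from Lp_int_eq_norm[OF assms(1) this] show ?thesis using assms by simp
qed

lemma Lp_int_cong_AE:
 assumes "AE x in M. f x = g x"
 shows "Lp_int M p f = Lp_int M p g"
 unfolding Lp_int_def by (intro nn_integral_cong_AE) (use assms in auto)

lemma Lp_norm_cong_AE: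
 assumes "AE x in M. f x = g x"
 shows "Lp_norm M p f = Lp_norm M p g"
 unfolding Lp_norm_Lp_int using Lp_int_cong_AE[OF assms] by simp

text \<open>Convexity of the power on the open half-line covers positive arguments; if an argument
  vanishes, the claim reduces to \<open>s powr p <= s\<close> for 0 < s < 1.\<close>

lemma powr_convex_combination:
 fixes a b t p :: real
 assumes "p >= 1" "0 <= a" "0 <= b" "0 < t" "t < 1"
 shows "(t * a + (1 - t) * b) powr p <= t * a powr p + (1 - t) * b powr p"
proof -
 have *: "(s * c) powr p <= s * c powr p" if "0 < s" "s < 1" "0 <= c" for s c :: real
 proof -
  have "s powr p <= s powr 1" using that assms by (intro powr_mono') auto
  thus ?thesis using that by (simp add: powr_mult mult_right_mono)
 qed
 show ?thesis
 proof (cases "a = 0 \<or> b = 0")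
  case True
  thus ?thesis using *[of t a] *[of "1-t" b] assms by auto
 next
  case False
  hence "a \<in> {0<..}" "b \<in> {0<..}" using assms by auto
  from convex_onD[OF powr_convex[OF assms(1)] _ _ this(2,1), of t] assms
  show ?thesis by (simp add: algebra_simps)
 qed
qed

text \<open>Minkowski's inequality from convexity alone: f + g is the convex combination of f/t and
  g/(1-t), and with t = A/(A+B) the two contributions add up to (A+B)^p.\<close>

lemma Lp_int_add_le:
 fixes f g :: "'a => 'b::{real_normed_vector, second_countable_topology}"
 assumes [measurable]: "f \<in> borel_measurable M" "g \<in> borel_measurable M"
  and p: "p >= 1" and A: "0 < A" "0 < B"
  and f: "Lp_int M p f <= enn (A powr p)" and g: "Lp_int M p g <= enn (B powr p)"
 shows "Lp_int M p (%x. f x + g x) <= enn ((A + B) powr p)"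
proof -
 define t where "t = A / (A + B)"
 have t: "0 < t" "t < 1" using A by (auto simp: t_def field_simps)
 have 1: "1 - t = B / (A + B)" using A by (auto simp: t_def field_simps)
 have pt: "norm (f x + g x) powr p <= t powr (1 - p) * norm (f x) powr p + (1 - t) powr (1 - p) * norm (g x) powr p" for x
 proof -
  have e: "s * (c / s) powr p = s powr (1 - p) * c powr p" if "0 < s" "0 <= c" for s c :: real
   using that by (simp add: powr_divide powr_diff)
  have "norm (f x + g x) powr p <= (norm (f x) + norm (g x)) powr p"
   using p by (intro powr_mono2 norm_triangle_ineq) auto
  also have "norm (f x) + norm (g x) = t * (norm (f x) / t) + (1 - t) * (norm (g x) / (1 - t))"
   using t by simp
  also have "... powr p <= t * (norm (f x) / t) powr p + (1 - t) * (norm (g x) / (1 - t)) powr p"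
   using t p by (intro powr_convex_combination) auto
  finally show ?thesis using t by (simp add: e)
 qed
 have "Lp_int M p (%x. f x + g x)
   <= (\<integral>\<^sup>+x. enn (t powr (1 - p)) * enn (norm (f x) powr p)
      + enn ((1 - t) powr (1 - p)) * enn (norm (g x) powr p) \<partial>M)"
  unfolding Lp_int_def using pt
  by (intro nn_integral_mono) (simp flip: ennreal_mult ennreal_plus)
 also have "... = enn (t powr (1 - p)) * Lp_int M p f + enn ((1 - t) powr (1 - p)) * Lp_int M p g"
  unfolding Lp_int_def by (subst nn_integral_add) (auto simp: nn_integral_cmult)
 also have "... <= enn (t powr (1 - p)) * enn (A powr p) + enn ((1 - t) powr (1 - p)) * enn (B powr p)"
  by (intro add_mono mult_left_mono f g) auto
 also have "... = enn (t powr (1 - p) * A powr p + (1 - t) powr (1 - p) * B powr p)"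
  by (simp add: ennreal_mult ennreal_plus)
 also have "t powr (1 - p) * A powr p = A * (A + B) powr (p - 1)"
 proof -
  have "t powr (1 - p) * A powr p = A powr (1 - p) * A powr p / (A + B) powr (1 - p)"
   using A by (simp add: t_def powr_divide)
  also have "A powr (1 - p) * A powr p = A" using A by (simp flip: powr_add)
  also have "A / (A + B) powr (1 - p) = A * (A + B) powr (p - 1)"
   by (metis divide_inverse minus_diff_eq powr_minus)
  finally show ?thesis .
 qed
 also have "(1 - t) powr (1 - p) * B powr p = B * (A + B) powr (p - 1)"
 proof -
  have "(1 - t) powr (1 - p) * B powr p = B powr (1 - p) * B powr p / (A + B) powr (1 - p)"
   using A unfolding 1 by (simp add: powr_divide)
  also have "B powr (1 - p) * B powr p = B" using A by (simp flip: powr_add)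
  also have "B / (A + B) powr (1 - p) = B * (A + B) powr (p - 1)"
   by (metis divide_inverse minus_diff_eq powr_minus)
  finally show ?thesis .
 qed
 also have "A * (A + B) powr (p - 1) + B * (A + B) powr (p - 1) = (A + B) powr p"
 proof -
  have "(A + B) powr (p - 1) = (A + B) powr p / (A + B)" using A by (simp add: powr_diff)
  moreover have "A * (A + B) powr (p - 1) + B * (A + B) powr (p - 1) = (A + B) * (A + B) powr (p - 1)"
   by (rule distrib_right[symmetric])
  ultimately show ?thesis using A by simp
 qed
 finally show ?thesis .
qed

lemma Lp_norm_triangle:
 fixes f g :: "'a => 'b::{real_normed_vector, second_countable_topology}"
 assumes "f \<in> borel_measurable M" "g \<in> borel_measurable M" "p >= 1"
 shows "Lp_norm M p (%x. f x + g x) <= Lp_norm M p f + Lp_norm M p g"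
proof (cases "Lp_norm M p f = top \<or> Lp_norm M p g = top")
 case True
 thus ?thesis by auto
next
 case False
 then obtain a b where ab: "Lp_norm M p f = enn a" "a >= 0" "Lp_norm M p g = enn b" "b >= 0"
  by (cases "Lp_norm M p f"; cases "Lp_norm M p g") auto
 show ?thesis
 proof (rule ennreal_le_epsilon)
  \<comment> \<open>\<open>Lp_int_add_le\<close> wants strictly positive bounds, so each norm is
    enlarged by e/2; this includes norms equal to 0.\<close>
  fix e :: real assume e: "e > 0"
  have "Lp_int M p (%x. f x + g x) <= enn (((a + e/2) + (b + e/2)) powr p)"
  proof (rule Lp_int_add_le[OF assms])
   show "Lp_int M p f <= enn ((a + e/2) powr p)"
    using assms ab e by (subst Lp_norm_le_iff[symmetric]) auto
   show "Lp_int M p g <= enn ((b + e/2) powr p)"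
    using assms ab e by (subst Lp_norm_le_iff[symmetric]) auto
  qed (use ab e in auto)
  hence "Lp_norm M p (%x. f x + g x) <= enn ((a + e/2) + (b + e/2))" (is "?a <= _")
   using assms ab e by (subst Lp_norm_le_iff) auto
  also have "... = enn a + enn b + enn e"
   using ab e by (simp flip: ennreal_plus)
  finally show "?a <= Lp_norm M p f + Lp_norm M p g + enn e"
   using ab by simp
 qed
qed

lemma Lp_norm_minus_commute: "Lp_norm M p (%x. f x - g x) = Lp_norm M p (%x. g x - f x)"
 unfolding Lp_norm_Lp_int Lp_int_def by (simp add: norm_minus_commute)

lemma Lp_norm_triangle_real:
 fixes f g :: "'a => 'b::{real_normed_vector, second_countable_topology}"
 assumes "f \<in> borel_measurable M" "g \<in> borel_measurable M" "p >= 1"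
  and "Lp_norm M p (%x. f x - g x) < \<infinity>" "Lp_norm M p g < \<infinity>"
 shows "Lp_norm M p f < \<infinity>"
  "\<bar>enn2real (Lp_norm M p f) - enn2real (Lp_norm M p g)\<bar> <= enn2real (Lp_norm M p (%x. f x - g x))"
proof -
 have 1: "Lp_norm M p (%x. (f x - g x) + g x) <= Lp_norm M p (%x. f x - g x) + Lp_norm M p g"
  using assms by (intro Lp_norm_triangle) auto
 thus fin: "Lp_norm M p f < \<infinity>"
  using assms(4,5) by (simp add: order_le_less_trans)
 have 2: "Lp_norm M p (%x. (g x - f x) + f x) <= Lp_norm M p (%x. g x - f x) + Lp_norm M p f"
  using assms by (intro Lp_norm_triangle) auto
 obtain a b c where "Lp_norm M p f = enn a" "a >= 0" "Lp_norm M p g = enn b" "b >= 0"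
   "Lp_norm M p (%x. f x - g x) = enn c" "c >= 0"
  using fin assms(4,5)
  by (cases "Lp_norm M p f"; cases "Lp_norm M p g"; cases "Lp_norm M p (%x. f x - g x)") auto
 thus "\<bar>enn2real (Lp_norm M p f) - enn2real (Lp_norm M p g)\<bar> <= enn2real (Lp_norm M p (%x. f x - g x))"
  using 1 2 by (simp add: Lp_norm_minus_commute[of M p g f] abs_le_iff flip: ennreal_plus)
qed

lemma Lp_norm_mult_const:
 fixes f :: "'a => 'b::real_normed_algebra_1"
 assumes "0 < p" "f \<in> borel_measurable M" "\<And>x. norm (g x) = c * norm (f x)" "c >= 0"
 shows "Lp_int M p g = enn (c powr p) * Lp_int M p f"
 unfolding Lp_int_def using assms
 by (subst nn_integral_cmult[symmetric]) (auto simp: powr_mult ennreal_mult)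

lemma Lp_int_Fatou:
 fixes f :: "'a => 'b::{real_normed_vector, second_countable_topology}"
 assumes [measurable]: "\<And>j. F j \<in> borel_measurable M" and "p > 0"
  and "AE x in M. (%j. F j x) \<longlonglongrightarrow> f x"
 shows "Lp_int M p f <= liminf (%j. Lp_int M p (F j))"
proof -
 have "Lp_int M p f <= (\<integral>\<^sup>+x. liminf (%j. enn (norm (F j x) powr p)) \<partial>M)"
  unfolding Lp_int_def
 proof (rule nn_integral_mono_AE, use assms(3) in \<open>rule AE_mp\<close>, rule AE_I2, rule impI)
  fix x assume "(%j. F j x) \<longlonglongrightarrow> f x"
  hence "(%j. norm (F j x) powr p) \<longlonglongrightarrow> norm (f x) powr p"
   using assms(2) by (intro tendsto_powr' tendsto_norm tendsto_const) auto
  hence "(%j. enn (norm (F j x) powr p)) \<longlonglongrightarrow> enn (norm (f x) powr p)"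
   by (rule tendsto_ennrealI)
  from lim_imp_Liminf[OF trivial_limit_sequentially this]
  show "enn (norm (f x) powr p) <= liminf (%j. enn (norm (F j x) powr p))"
   by simp
 qed
 also have "... <= liminf (%j. Lp_int M p (F j))"
  unfolding Lp_int_def by (rule nn_integral_liminf) auto
 finally show ?thesis .
qed

text \<open>Riesz-Fischer, with the limit named as \<open>lim\<close> along a subsequence at every
  point. This form lets pointwise properties of the sequence, such as radiality, pass to the
  limit.\<close>

lemma Lp_int_complete:
 fixes F :: "nat => 'a => 'b::{banach, second_countable_topology}"
 assumes [measurable]: "\<And>j. F j \<in> borel_measurable M" and p: "p >= 1"
  and cauchy: "\<And>e. e > 0 ==> \<exists>K. \<forall>j\<ge>K. \<forall>k\<ge>K. Lp_int M p (%x. F j x - F k x) <= enn e"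
 obtains r where "strict_mono r" "AE x in M. (%k. F (r k) x) \<longlonglongrightarrow> lim (%k. F (r k) x)"
  "(%x. lim (%k. F (r k) x)) \<in> borel_measurable M"
  "(%k. Lp_int M p (%x. F k x - lim (%k. F (r k) x))) \<longlonglongrightarrow> 0"
proof -
 \<comment> \<open>After multiplication by 2^(kp) the bound is still (1/2)^k. So the sum of (2^k
   a_k)^p is integrable, and almost everywhere a_k is eventually at most (1/2)^k.\<close>
 define e where "e k = (1/2) powr (real k * p) * (1/2)^k" for k :: nat
 have e: "e k > 0" for k by (simp add: e_def)
 have "\<exists>K. \<forall>k. \<forall>j\<ge>K k. \<forall>i\<ge>K k. Lp_int M p (%x. F j x - F i x) <= enn (e k)"
  by (rule choice) (use cauchy[OF e] in blast)
 then obtain K where K: "\<And>k j i. j >= K k ==> i >= K k ==> Lp_int M p (%x. F j x - F i x) <= enn (e k)"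
  by blast
 define r where "r = rec_nat (K 0) (%k rk. max (Suc rk) (K (Suc k)))"
 have r_Suc: "r (Suc k) = max (Suc (r k)) (K (Suc k))" for k by (simp add: r_def)
 have r: "strict_mono r" by (auto simp: strict_mono_Suc_iff r_Suc)
 have rK: "r k >= K k" for k by (cases k) (auto simp: r_Suc r_def)
 define a where "a k x = norm (F (r (Suc k)) x - F (r k) x)" for k x
 have [measurable]: "a k \<in> borel_measurable M" for k unfolding a_def by measurable
 have "(\<integral>\<^sup>+x. (\<Sum>k. enn ((2^k * a k x) powr p)) \<partial>M) = (\<Sum>k. (\<integral>\<^sup>+x. enn ((2^k * a k x) powr p) \<partial>M))"
  by (rule nn_integral_suminf) auto
 also have "... <= (\<Sum>k. enn ((1/2)^k))"
 proof (rule suminf_le)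
  fix k
  have "(\<integral>\<^sup>+x. enn ((2^k * a k x) powr p) \<partial>M) = enn (2 powr (real k * p)) * Lp_int M p (%x. F (r (Suc k)) x - F (r k) x)" (is "?a = _")
   unfolding Lp_int_def a_def
   by (subst nn_integral_cmult[symmetric]) (auto simp: powr_mult powr_powr ennreal_mult simp flip: powr_realpow)
  also have "... <= enn (2 powr (real k * p)) * enn (e k)"
   using rK[of k] strict_mono_leD[OF r, of k "Suc k"]
   by (intro mult_left_mono K) (auto intro: order_trans)
  also have "... = enn ((1/2)^k)"
   by (simp add: e_def powr_divide flip: ennreal_mult)
  finally show "?a <= ..." .
 qed auto
 also have "... < \<infinity>"
  by (subst suminf_ennreal2) (auto simp: summable_geometric)
 finally have "AE x in M. (\<Sum>k. enn ((2^k * a k x) powr p)) ~= \<infinity>"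
  by (intro nn_integral_noteq_infinite) auto
 hence conv: "AE x in M. (%k. F (r k) x) \<longlonglongrightarrow> lim (%k. F (r k) x)"
 proof (rule AE_mp, intro AE_I2 impI)
  fix x assume "(\<Sum>k. enn ((2^k * a k x) powr p)) ~= \<infinity>"
  hence "summable (%k. (2^k * a k x) powr p)"
   by (intro summable_suminf_not_top) auto
  hence "(%k. (2^k * a k x) powr p) \<longlonglongrightarrow> 0" by (rule summable_LIMSEQ_zero)
  hence "eventually (%k. (2^k * a k x) powr p < 1) sequentially"
   by (rule order_tendstoD) auto
  hence "eventually (%k. norm (a k x) <= (1/2)^k) sequentially"
  proof (rule eventually_mono)
   fix k assume k: "(2^k * a k x) powr p < 1"
   have "2^k * a k x <= 1"
   proof (rule ccontr)
    assume "\<not> 2^k * a k x <= 1"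
    hence "(2^k * a k x) powr p >= 1" using p by (intro ge_one_powr_ge_zero) auto
    with k show False by simp
   qed
   moreover have "a k x >= 0" by (simp add: a_def)
   ultimately show "norm (a k x) <= (1/2)^k" by (simp add: power_one_over field_simps)
  qed
  hence "summable (%k. a k x)"
   by (rule summable_comparison_test_ev) (simp add: summable_geometric)
  hence "summable (%k. F (r (Suc k)) x - F (r k) x)"
   unfolding a_def by (rule summable_norm_cancel)
  hence "convergent (%n. \<Sum>k<n. F (r (Suc k)) x - F (r k) x)"
   by (simp add: summable_iff_convergent)
  hence "convergent (%n. F (r n) x - F (r 0) x)" by (simp add: sum_lessThan_telescope[of "%n. F (r n) x"])
  hence "convergent (%n. (F (r n) x - F (r 0) x) + F (r 0) x)"
   by (intro convergent_add convergent_const)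
  hence "convergent (%n. F (r n) x)" by simp
  thus "(%k. F (r k) x) \<longlonglongrightarrow> lim (%k. F (r k) x)" by (simp add: convergent_LIMSEQ_iff)
 qed
 have meas[measurable]: "(%x. lim (%k. F (r k) x)) \<in> borel_measurable M" by measurable
 have "(%k. Lp_int M p (%x. F k x - lim (%k. F (r k) x))) \<longlonglongrightarrow> 0"
 proof (rule order_tendstoI)
  fix c :: ennreal assume "0 < c"
  then obtain e' where e': "e' > 0" "enn e' < c"
  proof (cases c)
   case (real x)
   hence "0 < x / 2" "enn (x / 2) < c" using \<open>0 < c\<close> by (auto simp: ennreal_less_iff)
   thus ?thesis by (rule that)
  next
   case top
   thus ?thesis using that[of 1] by simp
  qed
  obtain K' where K': "\<And>j k. j >= K' ==> k >= K' ==> Lp_int M p (%x. F j x - F k x) <= enn e'"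
   using cauchy[OF e'(1)] by blast
  have "Lp_int M p (%x. F k x - lim (%k. F (r k) x)) < c" if k: "k >= K'" for k
  proof -
   have "Lp_int M p (%x. F k x - lim (%k. F (r k) x)) <= liminf (%j. Lp_int M p (%x. F k x - F (r j) x))"
   proof (rule Lp_int_Fatou)
    show "AE x in M. (%j. F k x - F (r j) x) \<longlonglongrightarrow> F k x - lim (%k. F (r k) x)"
     using conv by (rule eventually_mono) (intro tendsto_diff tendsto_const)
   qed (use p in auto)
   also have "... <= liminf (%j. enn e')"
   proof (rule Liminf_mono)
    show "\<forall>\<^sub>F j in sequentially. Lp_int M p (%x. F k x - F (r j) x) <= enn e'"
     using seq_suble[OF r] k by (intro eventually_sequentiallyI[of K'] K') (auto intro: order_trans)
   qed
   also have "... < c" using e' by (simp add: Liminf_const)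
   finally show ?thesis .
  qed
  thus "\<forall>\<^sub>F k in sequentially. Lp_int M p (%x. F k x - lim (%k. F (r k) x)) < c"
   by (auto simp: eventually_sequentially)
 qed auto
 from that[OF r conv meas this] show ?thesis .
qed

text \<open>Pointwise, superadditivity of t^(p/2) reduces the left side to the sum of two squares,
  the parallelogram law evaluates that sum, and convexity of t^(p/2) distributes the power
  again.\<close>

lemma Clarkson:
 fixes f g :: "'a => 'b::{real_inner, second_countable_topology}"
 assumes [measurable]: "f \<in> borel_measurable M" "g \<in> borel_measurable M" and p: "p >= 2"
 shows "Lp_int M p (%x. (1/2) *\<^sub>R (f x + g x)) + Lp_int M p (%x. (1/2) *\<^sub>R (f x - g x))
      <= enn (1/2) * (Lp_int M p f + Lp_int M p g)"
proof -
 have super: "x powr q + y powr q <= (x + y) powr q" if "x >= 0" "y >= 0" "q >= 1" for x y q :: real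
 proof (cases "x + y = 0")
  case False
  hence s: "x + y > 0" using that by simp
  have "(x / (x+y)) powr q <= x / (x+y)" "(y / (x+y)) powr q <= y / (x+y)"
   using that s powr_mono'[of 1 q "x / (x+y)"] powr_mono'[of 1 q "y / (x+y)"] by auto
  hence "x powr q / (x+y) powr q + y powr q / (x+y) powr q <= x / (x+y) + y / (x+y)"
   using that s by (auto simp: powr_divide)
  also have "... = 1" using s by (simp flip: add_divide_distrib)
  finally show ?thesis using s by (simp add: field_simps flip: add_divide_distrib)
 next
  case True
  hence "x = 0" "y = 0" using that by auto
  thus ?thesis by simp
 qed
 have sq: "norm v powr p = (norm v ^ 2) powr (p/2)" for v :: 'b
 proof (cases "v = 0")
  case False
  hence "norm v ^ 2 = norm v powr 2" by (simp add: powr_numeral)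
  hence "(norm v ^ 2) powr (p/2) = norm v powr (2 * (p/2))" by (simp only: powr_powr)
  thus ?thesis by simp
 qed simp
 have pt: "norm ((1/2) *\<^sub>R (a + b)) powr p + norm ((1/2) *\<^sub>R (a - b)) powr p
     <= 1/2 * (norm a powr p + norm b powr p)" for a b :: 'b
 proof -
  have "norm ((1/2) *\<^sub>R (a + b)) powr p + norm ((1/2) *\<^sub>R (a - b)) powr p
    <= (norm ((1/2) *\<^sub>R (a + b)) ^ 2 + norm ((1/2) *\<^sub>R (a - b)) ^ 2) powr (p/2)"
   unfolding sq using p by (intro super) auto
  also have "norm ((1/2) *\<^sub>R (a + b)) ^ 2 + norm ((1/2) *\<^sub>R (a - b)) ^ 2
     = 1/2 * norm a ^ 2 + (1 - 1/2) * norm b ^ 2"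
   by (simp add: power2_norm_eq_inner algebra_simps inner_commute)
  also have "... powr (p/2) <= 1/2 * (norm a ^ 2) powr (p/2) + (1 - 1/2) * (norm b ^ 2) powr (p/2)"
   using p by (intro powr_convex_combination) auto
  finally show ?thesis by (simp add: sq)
 qed
 have "Lp_int M p (%x. (1/2) *\<^sub>R (f x + g x)) + Lp_int M p (%x. (1/2) *\<^sub>R (f x - g x))
   = (\<integral>\<^sup>+x. enn (norm ((1/2) *\<^sub>R (f x + g x)) powr p) + enn (norm ((1/2) *\<^sub>R (f x - g x)) powr p) \<partial>M)"
  unfolding Lp_int_def by (rule nn_integral_add[symmetric]) auto
 also have "... <= (\<integral>\<^sup>+x. enn (1/2) * (enn (norm (f x) powr p) + enn (norm (g x) powr p)) \<partial>M)"
 proof (intro nn_integral_mono)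
  fix x
  have "enn (norm ((1/2) *\<^sub>R (f x + g x)) powr p) + enn (norm ((1/2) *\<^sub>R (f x - g x)) powr p)
    = enn (norm ((1/2) *\<^sub>R (f x + g x)) powr p + norm ((1/2) *\<^sub>R (f x - g x)) powr p)"
   by (rule ennreal_plus[symmetric]) auto
  also have "... <= enn (1/2 * (norm (f x) powr p + norm (g x) powr p))"
   by (intro ennreal_leI pt)
  also have "... = enn (1/2) * (enn (norm (f x) powr p) + enn (norm (g x) powr p))"
   by (subst ennreal_mult) (simp_all add: ennreal_plus)
  finally show "enn (norm ((1/2) *\<^sub>R (f x + g x)) powr p) + enn (norm ((1/2) *\<^sub>R (f x - g x)) powr p)
    <= enn (1/2) * (enn (norm (f x) powr p) + enn (norm (g x) powr p))" .
 qed
 also have "... = enn (1/2) * (Lp_int M p f + Lp_int M p g)"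
  unfolding Lp_int_def by (subst nn_integral_cmult) (auto simp: nn_integral_add)
 finally show ?thesis .
qed

text \<open>The free parameter t replaces Hoelder's inequality in all limit arguments: it makes the
  term of the fixed factor small, and the remaining term is then small for late indices.\<close>

lemma Young_scaled:
 fixes a b p q t :: real
 assumes "p > 1" "q > 1" "1/p + 1/q = 1" "a >= 0" "b >= 0" "t > 0"
 shows "a * b <= t powr (-p) * a powr p + t powr q * b powr q"
proof -
 have "(a / t) * (t * b) <= (a / t) powr p / p + (t * b) powr q / q"
  using assms by (intro Youngs_inequality) auto
 also have "... <= (a / t) powr p + (t * b) powr q"
 proof -
  have "c / s <= c" if "c >= 0" "s > 1" for c s :: real
   using mult_left_mono[of 1 s c] that by (simp add: field_simps)
  thus ?thesis using assms by (intro add_mono) auto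
 qed
 finally show ?thesis using assms by (simp add: powr_divide powr_mult powr_minus field_simps)
qed

lemma Lp_pairing:
 fixes f :: "'a => complex" and g :: "'a => real"
 assumes f: "in_Lp M p f" and g: "in_Lp M q g"
  and pq: "p > 1" "q > 1" "1/p + 1/q = 1" and t: "t > 0"
 shows "integrable M (%x. f x * of_real (g x))"
  "norm (\<integral>x. f x * of_real (g x) \<partial>M) <= t powr (-p) * enn2real (Lp_int M p f) + t powr q * enn2real (Lp_int M q g)"
proof -
 have [measurable]: "f \<in> borel_measurable M" "g \<in> borel_measurable M"
  and fin: "Lp_int M p f < \<infinity>" "Lp_int M q g < \<infinity>"
  using f g by (auto simp: in_Lp_def Lp_norm_finite_iff)
 have fint: "integrable M (%x. norm (f x) powr p)" "integrable M (%x. norm (g x) powr q)"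
  using fin by (auto intro!: integrableI_nonneg simp: Lp_int_def)
 have eq: "enn2real (Lp_int M p f) = (\<integral>x. norm (f x) powr p \<partial>M)" "enn2real (Lp_int M q g) = (\<integral>x. norm (g x) powr q \<partial>M)"
  unfolding Lp_int_def by (simp_all add: integral_eq_nn_integral)
 have bd: "norm (f x * of_real (g x)) <= t powr (-p) * norm (f x) powr p + t powr q * norm (g x) powr q" for x
  using Young_scaled[OF pq _ _ t, of "norm (f x)" "norm (g x)"] by (simp add: norm_mult)
 have int2: "integrable M (%x. t powr (-p) * norm (f x) powr p + t powr q * norm (g x) powr q)"
  using fint by auto
 show int: "integrable M (%x. f x * of_real (g x))"
 proof (rule Bochner_Integration.integrable_bound[OF int2])
  show "AE x in M. norm (f x * of_real (g x)) <= norm (t powr (-p) * norm (f x) powr p + t powr q * norm (g x) powr q)"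
   using bd by (auto intro: order_trans[OF bd])
 qed measurable
 have "norm (\<integral>x. f x * of_real (g x) \<partial>M) <= (\<integral>x. norm (f x * of_real (g x)) \<partial>M)" (is "?a <= _")
  by (rule integral_norm_bound)
 also have "... <= (\<integral>x. t powr (-p) * norm (f x) powr p + t powr q * norm (g x) powr q \<partial>M)"
  using int int2 bd by (intro integral_mono) auto
 also have "... = t powr (-p) * enn2real (Lp_int M p f) + t powr q * enn2real (Lp_int M q g)"
  unfolding eq using fint by simp
 finally show "?a <= ..." .
qed

lemma in_Lp_diff:
 fixes f g :: "'a => 'b::{real_normed_vector, second_countable_topology}"
 assumes "in_Lp M p f" "in_Lp M p g" "p >= 1"
 shows "in_Lp M p (%x. f x - g x)"
proof -
 have [measurable]: "f \<in> borel_measurable M" "g \<in> borel_measurable M" using assms by (auto simp: in_Lp_def)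
 have "Lp_norm M p (%x. f x + (- g x)) <= Lp_norm M p f + Lp_norm M p (%x. - g x)"
  by (rule Lp_norm_triangle) (use assms in auto)
 also have "Lp_norm M p (%x. - g x) = Lp_norm M p g" unfolding Lp_norm_Lp_int Lp_int_def by simp
 also have "Lp_norm M p f + Lp_norm M p g < \<infinity>" using assms by (simp add: in_Lp_def)
 finally show ?thesis by (simp add: in_Lp_def)
qed

lemma Lp_pairing_tendsto:
 fixes F :: "nat => 'a => complex" and g :: "'a => real"
 assumes F: "\<And>k. in_Lp M p (F k)" and f: "in_Lp M p f" and g: "in_Lp M q g"
  and pq: "p > 1" "q > 1" "1/p + 1/q = 1" and lim: "(%k. Lp_int M p (%x. F k x - f x)) \<longlonglongrightarrow> 0"
 shows "(%k. (\<integral>x. F k x * of_real (g x) \<partial>M)) \<longlonglongrightarrow> (\<integral>x. f x * of_real (g x) \<partial>M)"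
proof (rule LIMSEQ_I)
 fix e :: real assume e: "e > 0"
 \<comment> \<open>With this norm, t is chosen such that the term of the fixed g stays below e/2;
   adding 1 to G in the denominator avoids a division by zero.\<close>
 define G where "G = enn2real (Lp_int M q g)"
 have G: "G >= 0" by (simp add: G_def)
 define t where "t = (e / (2 * (G + 1))) powr (1/q)"
 have t: "t > 0" using e G by (simp add: t_def)
 have "t powr q = e / (2 * (G + 1))" using e G pq by (simp add: t_def powr_powr)
 hence "t powr q * G = e / 2 * (G / (G + 1))" using G by (simp add: field_simps)
 also have "... < e / 2 * 1" using e G by (intro mult_strict_left_mono) auto
 finally have tq: "t powr q * G < e / 2" by simp
 have "(%k. enn2real (Lp_int M p (%x. F k x - f x))) \<longlonglongrightarrow> enn2real 0"
  using lim by (intro tendsto_enn2real) auto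
 hence "(%k. t powr (-p) * enn2real (Lp_int M p (%x. F k x - f x))) \<longlonglongrightarrow> t powr (-p) * 0"
  by (intro tendsto_mult tendsto_const) simp
 hence "eventually (%k. t powr (-p) * enn2real (Lp_int M p (%x. F k x - f x)) < e / 2) sequentially"
  using e by (intro order_tendstoD) auto
 then obtain K where K: "\<And>k. k >= K ==> t powr (-p) * enn2real (Lp_int M p (%x. F k x - f x)) < e / 2"
  by (auto simp: eventually_sequentially)
 show "\<exists>K. \<forall>k\<ge>K. norm ((\<integral>x. F k x * of_real (g x) \<partial>M) - (\<integral>x. f x * of_real (g x) \<partial>M)) < e"
 proof (intro exI[of _ K] allI impI)
  fix k assume k: "k >= K"
  have "(\<integral>x. F k x * of_real (g x) \<partial>M) - (\<integral>x. f x * of_real (g x) \<partial>M) = (\<integral>x. (F k x - f x) * of_real (g x) \<partial>M)"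
   using Lp_pairing(1)[OF F[of k] g pq t] Lp_pairing(1)[OF f g pq t]
   by (simp add: left_diff_distrib)
  also have "norm ... <= t powr (-p) * enn2real (Lp_int M p (%x. F k x - f x)) + t powr q * G"
   unfolding G_def using F f pq by (intro Lp_pairing(2) g t in_Lp_diff) auto
  also have "... < e" using K[OF k] tq by simp
  finally show "norm ((\<integral>x. F k x * of_real (g x) \<partial>M) - (\<integral>x. f x * of_real (g x) \<partial>M)) < e" .
 qed
qed

section \<open>Complex Gaussian variables\<close>

lemma nn_integral_complex_scale:
 fixes f :: "complex => ennreal"
 assumes [measurable]: "f \<in> borel_measurable borel" and c: "c ~= 0"
 shows "(\<L> z. f z) = enn (c^2) * (\<L> z. f (w + c *\<^sub>R z))"
proof -
 have "(\<L> z. f z) = (\<integral>\<^sup>+z. f z \<partial>density (distr lborel borel (%x. w + c *\<^sub>R x)) (%_. enn (\<bar>c\<bar>^DIM(complex))))"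
  by (subst (1) lborel_affine[OF c, of w]) simp
 also have "... = enn (c^2) * (\<L> z. f (w + c *\<^sub>R z))"
  by (simp add: nn_integral_density nn_integral_distr nn_integral_cmult)
 finally show ?thesis .
qed

definition gauss :: "complex measure" where
 "gauss = density lborel (%z. enn (exp (- (cmod z)\<^sup>2) / pi))"

lemma sets_gauss [measurable_cong, simp]: "sets gauss = sets borel" and space_gauss [simp]: "space gauss = UNIV"
 by (auto simp: gauss_def)

locale gaussian_sequence = prob_space \<mu> for \<mu> :: "'s measure" +
 fixes G :: "nat => 's => complex"
 assumes indep_G: "indep_vars (%_. borel) G UNIV"
  and gauss_G: "\<And>n. std_complex_gaussian \<mu> (G n)"
begin

abbreviation nn_expectation :: "('s => ennreal) => ennreal" (binder "\<E>" 10) where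
 "nn_expectation f \<equiv> nn_integral \<mu> f"

lemma G_measurable [measurable]: "G n \<in> borel_measurable \<mu>"
 using indep_G by (auto simp: indep_vars_def)

lemma distr_G: "distr \<mu> borel (G n) = gauss"
 using gauss_G[of n] unfolding std_complex_gaussian_def distributed_def gauss_def
 by (metis distr_cong sets_lborel)

lemma prob_gauss: "prob_space gauss"
 using prob_space_distr[OF G_measurable[of 0]] by (simp add: distr_G)

lemma nn_integral_G:
 assumes [measurable]: "f \<in> borel_measurable borel"
 shows "(\<E> u. f (G n u)) = (\<integral>\<^sup>+z. f z \<partial>gauss)"
 unfolding distr_G[of n, symmetric] by (subst nn_integral_distr) auto

text \<open>No integral is computed: the constant is read off from the hypothesis that
  \<open>G 0\<close> has the stated function as its probability density.\<close>

lemma gauss_total: "(\<L> z. enn (exp (- (cmod z)\<^sup>2))) = enn pi"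
proof -
 interpret g: prob_space gauss by (rule prob_gauss)
 have "1 = (\<L> z. enn (exp (- (cmod z)\<^sup>2) / pi))"
  using g.emeasure_space_1 by (simp add: gauss_def emeasure_density)
 also have "... = (\<L> z. enn (1 / pi) * enn (exp (- (cmod z)\<^sup>2)))"
  by (intro nn_integral_cong) (simp flip: ennreal_mult)
 also have "... = enn (1 / pi) * (\<L> z. enn (exp (- (cmod z)\<^sup>2)))"
  by (rule nn_integral_cmult) auto
 finally have "enn pi * 1 = enn pi * (enn (1 / pi) * (\<L> z. enn (exp (- (cmod z)\<^sup>2))))" by simp
 also have "... = (\<L> z. enn (exp (- (cmod z)\<^sup>2)))"
  by (simp flip: mult.assoc ennreal_mult)
 finally show ?thesis by simp
qed

lemma nn_integral_gauss:
 assumes [measurable]: "f \<in> borel_measurable borel"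
 shows "(\<integral>\<^sup>+z. f z \<partial>gauss) = (\<L> z. enn (exp (- (cmod z)\<^sup>2) / pi) * f z)"
 unfolding gauss_def by (subst nn_integral_density) auto

text \<open>The exponents combine to -(1-t)|z|^2, and the dilation by sqrt (1-t) has Jacobian 1-t
  because the complex plane has real dimension 2.\<close>

lemma gauss_exp_square:
 assumes t: "t < 1"
 shows "(\<integral>\<^sup>+z. enn (exp (t * (cmod z)^2)) \<partial>gauss) = enn (1 / (1 - t))"
proof -
 define c where "c = sqrt (1 - t)"
 have c: "c > 0" "c^2 = 1 - t" using t by (auto simp: c_def)
 have "(\<integral>\<^sup>+z. enn (exp (t * (cmod z)^2)) \<partial>gauss) = (\<L> z. enn (1 / pi) * enn (exp (- (cmod (0 + c *\<^sub>R z))\<^sup>2)))"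
 proof (subst nn_integral_gauss, simp, intro nn_integral_cong)
  fix z :: complex
  have "exp (- (cmod z)\<^sup>2) / pi * exp (t * (cmod z)^2) = 1 / pi * exp (- ((1 - t) * (cmod z)^2))"
   by (simp add: algebra_simps flip: exp_add)
  also have "(1 - t) * (cmod z)^2 = (cmod (0 + c *\<^sub>R z))^2"
   using c by (simp add: power_mult_distrib)
  finally show "enn (exp (- (cmod z)\<^sup>2) / pi) * enn (exp (t * (cmod z)^2))
    = enn (1 / pi) * enn (exp (- (cmod (0 + c *\<^sub>R z))\<^sup>2))"
   by (simp flip: ennreal_mult)
 qed
 also have "... = enn (1 / pi) * (\<L> z. enn (exp (- (cmod (0 + c *\<^sub>R z))\<^sup>2)))"
  by (rule nn_integral_cmult) auto
 also have "(\<L> z. enn (exp (- (cmod (0 + c *\<^sub>R z))\<^sup>2))) = enn (pi / (1 - t))"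
 proof -
  have "enn pi = enn (c^2) * (\<L> z. enn (exp (- (cmod (0 + c *\<^sub>R z))\<^sup>2)))"
   unfolding gauss_total[symmetric] by (rule nn_integral_complex_scale) (use c in auto)
  hence "enn (1 / c^2) * enn pi = enn (1 / c^2) * enn (c^2) * (\<L> z. enn (exp (- (cmod (0 + c *\<^sub>R z))\<^sup>2)))"
   by (simp add: mult.assoc)
  also have "enn (1 / c^2) * enn (c^2) = 1"
   using c t by (subst ennreal_mult[symmetric]) auto
  finally show ?thesis using c t by (simp flip: ennreal_mult)
 qed
 also have "enn (1 / pi) * enn (pi / (1 - t)) = enn (1 / (1 - t))"
  using t by (simp flip: ennreal_mult)
 finally show ?thesis .
qed

text \<open>Completing the square: the weight is a translate of the Gaussian density.\<close>

lemma gauss_exp_linear: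
 "(\<integral>\<^sup>+z. enn (exp (Re (ze * z))) \<partial>gauss) = enn (exp ((cmod ze)^2 / 4))"
proof -
 have "(\<integral>\<^sup>+z. enn (exp (Re (ze * z))) \<partial>gauss)
   = (\<L> z. enn (exp ((cmod ze)^2 / 4) / pi) * enn (exp (- (cmod (- cnj ze / 2 + 1 *\<^sub>R z))\<^sup>2)))"
 proof (subst nn_integral_gauss, simp, intro nn_integral_cong)
  fix z :: complex
  have "(cmod (- cnj ze / 2 + 1 *\<^sub>R z))^2 = (cmod ze)^2 / 4 + (cmod z)^2 - Re (ze * z)"
   unfolding cmod_power2 by (simp add: power2_eq_square field_simps)
  hence "- (cmod z)\<^sup>2 + Re (ze * z) = (cmod ze)^2 / 4 + - (cmod (- cnj ze / 2 + 1 *\<^sub>R z))\<^sup>2" by linarith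
  hence "exp (- (cmod z)\<^sup>2) * exp (Re (ze * z)) = exp ((cmod ze)^2 / 4) * exp (- (cmod (- cnj ze / 2 + 1 *\<^sub>R z))\<^sup>2)"
   by (metis exp_add)
  thus "enn (exp (- (cmod z)\<^sup>2) / pi) * enn (exp (Re (ze * z)))
    = enn (exp ((cmod ze)^2 / 4) / pi) * enn (exp (- (cmod (- cnj ze / 2 + 1 *\<^sub>R z))\<^sup>2))"
   by (simp flip: ennreal_mult)
 qed
 also have "... = enn (exp ((cmod ze)^2 / 4) / pi) * (\<L> z. enn (exp (- (cmod (- cnj ze / 2 + 1 *\<^sub>R z))\<^sup>2)))"
  by (rule nn_integral_cmult) auto
 also have "(\<L> z. enn (exp (- (cmod (- cnj ze / 2 + 1 *\<^sub>R z))\<^sup>2))) = enn pi"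
  using nn_integral_complex_scale[of "%z. enn (exp (- (cmod z)\<^sup>2))" 1 "- cnj ze / 2"]
  unfolding gauss_total by simp
 also have "enn (exp ((cmod ze)^2 / 4) / pi) * enn pi = enn (exp ((cmod ze)^2 / 4))"
  by (simp flip: ennreal_mult)
 finally show ?thesis .
qed

lemma exp_linear_combination:
 assumes I: "finite I"
 shows "(\<E> u. enn (exp (Re (ze * (\<Sum>n\<in>I. of_real (c n) * G n u)))))
  = enn (exp ((cmod ze)^2 * (\<Sum>n\<in>I. (c n)^2) / 4))"
proof -
 have "(\<E> u. enn (exp (Re (ze * (\<Sum>n\<in>I. of_real (c n) * G n u)))))
   = (\<E> u. (\<Prod>n\<in>I. enn (exp (Re (ze * of_real (c n) * G n u)))))"
  by (intro nn_integral_cong) (simp add: sum_distrib_left exp_sum[OF I] prod_ennreal mult.assoc)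
 also have "... = (\<Prod>n\<in>I. (\<E> u. enn (exp (Re (ze * of_real (c n) * G n u)))))"
  by (intro indep_vars_nn_integral I indep_vars_compose2[OF indep_vars_subset[OF indep_G]]) auto
 also have "... = (\<Prod>n\<in>I. enn (exp ((cmod (ze * of_real (c n)))^2 / 4)))"
 proof (intro prod.cong refl)
  fix n
  show "(\<E> u. enn (exp (Re (ze * of_real (c n) * G n u)))) = enn (exp ((cmod (ze * of_real (c n)))^2 / 4))"
   using nn_integral_G[of "%z. enn (exp (Re (ze * of_real (c n) * z)))" n] gauss_exp_linear[of "ze * of_real (c n)"]
   by simp
 qed
 also have "... = enn (exp (\<Sum>n\<in>I. (cmod (ze * of_real (c n)))^2 / 4))"
  by (simp add: prod_ennreal exp_sum[OF I])
 also have "(\<Sum>n\<in>I. (cmod (ze * of_real (c n)))^2 / 4) = (cmod ze)^2 * (\<Sum>n\<in>I. (c n)^2) / 4"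
  by (simp add: norm_mult power_mult_distrib sum_distrib_left sum_divide_distrib)
 finally show ?thesis .
qed

text \<open>Averaging the exponential moments of the real-linear forms over a second Gaussian variable
 (the Hubbard--Stratonovich trick) turns them into the exponential moment of the square.\<close>

lemma exp_square_moment:
 assumes I: "finite I" and s: "s = (\<Sum>n\<in>I. (c n)^2)" and t: "t >= 0" "t * s < 1"
 shows "(\<E> u. enn (exp (t * (cmod (\<Sum>n\<in>I. of_real (c n) * G n u))^2))) = enn (1 / (1 - t * s))"
proof -
 interpret g: prob_space gauss by (rule prob_gauss)
 interpret pr: pair_sigma_finite gauss \<mu>
  by (intro pair_sigma_finite.intro g.sigma_finite_measure_axioms sigma_finite_measure_axioms)
 define Y where "Y u = (\<Sum>n\<in>I. of_real (c n) * G n u)" for u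
 have [measurable]: "Y \<in> borel_measurable \<mu>" unfolding Y_def by measurable
 \<comment> \<open>The factor 4 compensates the 1/4 in \<open>gauss_exp_linear\<close>, so that
   averaging over z yields exactly exp (t |Y|^2).\<close>
 define \<eta> where "\<eta> = sqrt (4 * t)"
 have \<eta>: "\<eta>^2 = 4 * t" using t by (simp add: \<eta>_def)
 have "(\<E> u. enn (exp (t * (cmod (Y u))^2)))
   = (\<E> u. (\<integral>\<^sup>+z. enn (exp (Re (of_real \<eta> * Y u * z))) \<partial>gauss))"
  unfolding gauss_exp_linear
  by (intro nn_integral_cong) (simp add: norm_mult power_mult_distrib \<eta>)
 also have "... = (\<integral>\<^sup>+z. (\<E> u. enn (exp (Re (of_real \<eta> * Y u * z)))) \<partial>gauss)"
  by (rule pr.Fubini') measurable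
 also have "... = (\<integral>\<^sup>+z. enn (exp ((t * s) * (cmod z)^2)) \<partial>gauss)"
 proof (intro nn_integral_cong)
  fix z :: complex
  have "(\<E> u. enn (exp (Re (of_real \<eta> * Y u * z)))) = (\<E> u. enn (exp (Re ((of_real \<eta> * z) * Y u))))" (is "?a = _")
   by (simp add: mult_ac)
  also have "... = enn (exp ((cmod (of_real \<eta> * z))^2 * s / 4))"
   unfolding Y_def s(1) by (rule exp_linear_combination[OF I])
  also have "(cmod (of_real \<eta> * z))^2 * s / 4 = (t * s) * (cmod z)^2"
   by (simp add: norm_mult power_mult_distrib \<eta>)
  finally show "?a = enn (exp ((t * s) * (cmod z)^2))" .
 qed
 also have "... = enn (1 / (1 - t * s))" by (rule gauss_exp_square[OF t(2)])
 finally show ?thesis unfolding Y_def .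
qed

text \<open>Each factor is exp (-t) / (1-t) with |t| <= 1/2. Centering cancels the linear term of
  -ln (1-t), and what is left is at most 2 t^2.\<close>

lemma exp_wick_sum:
 assumes I: "finite I" and a: "\<And>n. n \<in> I ==> \<bar>\<tau> * a n\<bar> <= 1/2"
 shows "(\<E> u. enn (exp (\<tau> * (\<Sum>n\<in>I. a n * ((cmod (G n u))^2 - 1)))))
  <= enn (exp (2 * \<tau>^2 * (\<Sum>n\<in>I. (a n)^2)))"
proof -
 have "(\<E> u. enn (exp (\<tau> * (\<Sum>n\<in>I. a n * ((cmod (G n u))^2 - 1)))))
   = (\<E> u. (\<Prod>n\<in>I. enn (exp (\<tau> * a n * ((cmod (G n u))^2 - 1)))))"
  by (intro nn_integral_cong) (simp add: sum_distrib_left exp_sum[OF I] prod_ennreal mult.assoc)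
 also have "... = (\<Prod>n\<in>I. (\<E> u. enn (exp (\<tau> * a n * ((cmod (G n u))^2 - 1)))))"
  by (intro indep_vars_nn_integral I indep_vars_compose2[OF indep_vars_subset[OF indep_G]]) auto
 also have "... <= (\<Prod>n\<in>I. enn (exp (2 * (\<tau> * a n)^2)))"
 proof (intro prod_mono_ennreal)
  fix n assume n: "n \<in> I"
  define t where "t = \<tau> * a n"
  have t: "t < 1" "\<bar>t\<bar> <= 1/2" using a[OF n] by (auto simp: t_def)
  have "(\<E> u. enn (exp (\<tau> * a n * ((cmod (G n u))^2 - 1)))) = (\<integral>\<^sup>+z. enn (exp (t * ((cmod z)^2 - 1))) \<partial>gauss)" (is "?a = _")
   unfolding t_def by (rule nn_integral_G) simp
  also have "... = (\<integral>\<^sup>+z. enn (exp (- t)) * enn (exp (t * (cmod z)^2)) \<partial>gauss)"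
   by (intro nn_integral_cong) (simp add: algebra_simps flip: ennreal_mult exp_add)
  also have "... = enn (exp (- t)) * enn (1 / (1 - t))"
   by (subst nn_integral_cmult) (auto simp: gauss_exp_square[OF t(1)])
  also have "... = enn (exp (- t) / (1 - t))"
   using t by (simp flip: ennreal_mult)
  also have "... <= enn (exp (2 * t^2))"
  proof (rule ennreal_leI)
   have "- t - 2 * t^2 <= ln (1 - t)"
   proof (cases "t >= 0")
    case True
    thus ?thesis using ln_one_minus_pos_lower_bound[of t] t by simp
   next
    case False
    hence "- t - t^2 <= ln (1 - t)" using ln_one_plus_pos_lower_bound[of "-t"] t by simp
    moreover have "0 <= t^2" by simp
    ultimately show ?thesis by linarith
   qed
   hence "exp (- t) <= exp (2 * t^2 + ln (1 - t))" by simp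
   also have "... = exp (2 * t^2) * (1 - t)" using t by (simp add: exp_add)
   finally show "exp (- t) / (1 - t) <= exp (2 * t^2)" using t by (simp add: field_simps)
  qed
  finally show "?a <= enn (exp (2 * (\<tau> * a n)^2))"
   by (simp add: t_def)
 qed
 also have "... = enn (exp (2 * \<tau>^2 * (\<Sum>n\<in>I. (a n)^2)))"
  by (simp add: prod_ennreal sum_distrib_left exp_sum[OF I] power_mult_distrib mult.assoc)
 finally show ?thesis .
qed

text \<open>On the disc the density is at least its value at modulus |w| + r, and the area is pi
  r^2, whose pi cancels the normalization.\<close>

lemma gauss_ball_lower:
 assumes r: "r >= 0"
 shows "emeasure gauss (cball w r) >= enn (r^2 * exp (- (cmod w + r)\<^sup>2))"
proof -
 have "enn (r^2 * exp (- (cmod w + r)\<^sup>2)) = enn (exp (- (cmod w + r)\<^sup>2) / pi) * emeasure lborel (cball w r)"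
  using r by (simp add: emeasure_cball unit_ball_vol_2 flip: ennreal_mult)
 also have "... = (\<L> z. enn (exp (- (cmod w + r)\<^sup>2) / pi) * indicator (cball w r) z)"
  by (simp add: nn_integral_cmult_indicator)
 also have "... <= (\<L> z. enn (exp (- (cmod z)\<^sup>2) / pi) * indicator (cball w r) z)"
 proof (intro nn_integral_mono)
  fix z :: complex
  have "exp (- (cmod w + r)\<^sup>2) / pi <= exp (- (cmod z)\<^sup>2) / pi" if "z \<in> cball w r"
  proof -
   have "cmod z <= cmod w + r"
    using that norm_triangle_sub[of z w] by (simp add: dist_norm norm_minus_commute)
   hence "(cmod z)^2 <= (cmod w + r)^2" by (intro power_mono) auto
   thus ?thesis by (intro divide_right_mono) auto
  qed
  thus "enn (exp (- (cmod w + r)\<^sup>2) / pi) * indicator (cball w r) z <= enn (exp (- (cmod z)\<^sup>2) / pi) * indicator (cball w r) z"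
   by (auto simp: indicator_def intro!: ennreal_leI)
 qed
 also have "... = emeasure gauss (cball w r)"
  unfolding gauss_def by (subst emeasure_density) auto
 finally show ?thesis .
qed

text \<open>The density is at most 1/pi and the annulus has area pi (b - a) when a >= 0; a negative
  a is replaced by 0. The bound depends only on b - a, which is what excludes atoms of the mass
  later.\<close>

lemma gauss_annulus:
 assumes ab: "a <= b"
 shows "emeasure gauss {z. a <= (cmod z)^2 \<and> (cmod z)^2 <= b} <= enn (b - a)"
proof (cases "b >= 0")
 case False
 have "\<not> (cmod z)^2 <= b" for z
  using False zero_le_power2[of "cmod z"] by linarith
 thus ?thesis by simp
next
 case True
 define a' where "a' = max 0 a"
 have a': "0 <= a'" "a' <= b" "a <= a'" using True ab by (auto simp: a'_def)
 have meas: "{z::complex. a <= (cmod z)^2 \<and> (cmod z)^2 <= b} \<in> sets borel" by measurable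
 have "emeasure gauss {z. a <= (cmod z)^2 \<and> (cmod z)^2 <= b}
   = (\<L> z. enn (exp (- (cmod z)\<^sup>2) / pi) * indicator {z. a <= (cmod z)^2 \<and> (cmod z)^2 <= b} z)"
  unfolding gauss_def using meas by (subst emeasure_density) auto
 also have "... <= (\<L> z. enn (1 / pi) * indicator {z. a <= (cmod z)^2 \<and> (cmod z)^2 <= b} z)"
  by (intro nn_integral_mono mult_right_mono ennreal_leI divide_right_mono) auto
 also have "... = enn (1 / pi) * emeasure lborel {z::complex. a <= (cmod z)^2 \<and> (cmod z)^2 <= b}"
  using meas by (simp add: nn_integral_cmult_indicator)
 also have "emeasure lborel {z::complex. a <= (cmod z)^2 \<and> (cmod z)^2 <= b}
   = emeasure lborel (cball (0::complex) (sqrt b) - ball 0 (sqrt a'))"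
 proof (rule arg_cong[where f="emeasure lborel"])
  have "cmod z <= sqrt b \<longleftrightarrow> (cmod z)^2 <= b" for z
   using real_sqrt_le_iff[of "(cmod z)^2" b] by simp
  moreover have "sqrt a' <= cmod z \<longleftrightarrow> a <= (cmod z)^2" for z
  proof -
   have "sqrt a' <= cmod z \<longleftrightarrow> a' <= (cmod z)^2"
    using real_sqrt_le_iff[of a' "(cmod z)^2"] by simp
   also have "... \<longleftrightarrow> a <= (cmod z)^2" by (auto simp: a'_def)
   finally show ?thesis .
  qed
  ultimately show "{z::complex. a <= (cmod z)^2 \<and> (cmod z)^2 <= b} = cball 0 (sqrt b) - ball 0 (sqrt a')"
   by (force simp: not_less)
 qed
 also have "emeasure lborel (cball (0::complex) (sqrt b) - ball 0 (sqrt a')) = emeasure lborel (cball (0::complex) (sqrt b)) - emeasure lborel (ball (0::complex) (sqrt a'))"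
 proof (rule emeasure_Diff)
  have "sqrt a' <= sqrt b" using a' by simp
  hence "ball (0::complex) (sqrt a') \<subseteq> ball 0 (sqrt b)" by (rule subset_ball)
  thus "ball (0::complex) (sqrt a') \<subseteq> cball 0 (sqrt b)" using ball_subset_cball by blast
 qed (use a' in \<open>auto simp: emeasure_ball\<close>)
 also have "... = enn (pi * b - pi * a')"
  using a' True by (simp add: emeasure_ball emeasure_cball unit_ball_vol_2 ennreal_minus)
 also have "enn (1 / pi) * ... = enn (b - a')"
  using a' by (simp add: right_diff_distrib[symmetric] flip: ennreal_mult)
 also have "... <= enn (b - a)" using a' by (intro ennreal_leI) simp
 finally show ?thesis .
qed

end

section \<open>Polar coordinates\<close>

definition sphere_vol :: "'a::euclidean_space itself => real" where
 "sphere_vol _ = real DIM('a) * unit_ball_vol (real DIM('a))"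

lemma sphere_vol_pos: "sphere_vol TYPE('a::euclidean_space) > 0"
 unfolding sphere_vol_def by (auto intro!: mult_pos_pos unit_ball_vol_pos)

text \<open>Half-lines generate the Borel sets and are stable under intersection, so it suffices to
  compare the volume of a ball with the integral of its derivative in the radius.\<close>

lemma distr_norm_lborel:
 "distr (lborel :: 'a::euclidean_space measure) borel norm
   = density lborel (%r. enn (sphere_vol TYPE('a) * r ^ (DIM('a) - 1)) * indicator {0..} r)"
 (is "?L = ?R")
proof (rule measure_eqI_generator_eq[where E="range (%a::real. {..a})" and \<Omega>="UNIV::real set" and A="%i. {..real i}"])
 show "Int_stable (range (%a::real. {..a}))"
  by (auto simp: Int_stable_def)
 show "sets ?L = sigma_sets UNIV (range (%a::real. {..a}))" "sets ?R = sigma_sets UNIV (range (%a::real. {..a}))"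
  by (simp_all add: borel_eq_atMost)
 show "(\<Union>i. {..real i}) = UNIV"
  using real_arch_simple by (auto simp: set_eq_iff)
 have eq: "emeasure ?L {..a} = enn (unit_ball_vol DIM('a) * max 0 a ^ DIM('a))" for a :: real
 proof -
  have "emeasure ?L {..a} = emeasure lborel {x::'a. norm x <= a}"
   by (subst emeasure_distr) (auto simp: vimage_def)
  also have "{x::'a. norm x <= a} = (if a < 0 then {} else cball 0 (max 0 a))"
  proof -
   have "\<not> norm x <= a" if "a < 0" for x :: 'a using norm_ge_zero[of x] that by linarith
   thus ?thesis by (auto simp: max_def)
  qed
  also have "emeasure lborel ... = enn (unit_ball_vol DIM('a) * max 0 a ^ DIM('a))"
   by (auto simp: emeasure_cball max_def power_0_left)
  finally show ?thesis .
 qed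
 show "emeasure ?L X = emeasure ?R X" if X: "X \<in> range (%a. {..a})" for X
 proof -
  from X obtain a where a: "X = {..a}" by auto
  have "emeasure ?R {..a} = (\<L> r. enn (sphere_vol TYPE('a) * r ^ (DIM('a) - 1)) * indicator {0..} r * indicator {..a} r)"
   by (subst emeasure_density) auto
  also have "... = enn (unit_ball_vol DIM('a) * max 0 a ^ DIM('a))"
  proof (cases "a >= 0")
   case True
   have "(\<L> r. enn (sphere_vol TYPE('a) * r ^ (DIM('a) - 1)) * indicator {0..} r * indicator {..a} r)
     = (\<L> r. enn (sphere_vol TYPE('a) * r ^ (DIM('a) - 1)) * indicator {0..a} r)"
    by (intro nn_integral_cong) (auto simp: indicator_def)
   also have "... = enn (unit_ball_vol DIM('a) * a ^ DIM('a) - unit_ball_vol DIM('a) * 0 ^ DIM('a))"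
   proof (rule nn_integral_FTC_Icc)
    fix x :: real assume "x \<in> {0..a}"
    thus "0 <= sphere_vol TYPE('a) * x ^ (DIM('a) - 1)"
     using sphere_vol_pos[where 'a='a] by simp
    show "((%x. unit_ball_vol DIM('a) * x ^ DIM('a)) has_real_derivative sphere_vol TYPE('a) * x ^ (DIM('a) - 1)) (at x)"
     using DERIV_cmult[OF DERIV_pow[of "DIM('a)" x UNIV], of "unit_ball_vol DIM('a)"]
     by (simp add: sphere_vol_def mult_ac)
   qed (use True in auto)
   finally show ?thesis using True by (simp add: power_0_left)
  next
   case False
   have "(\<L> r. enn (sphere_vol TYPE('a) * r ^ (DIM('a) - 1)) * indicator {0..} r * indicator {..a} r) = (\<integral>\<^sup>+r. 0 \<partial>(lborel::real measure))"
    using False by (intro nn_integral_cong) (auto simp: indicator_def)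
   thus ?thesis using False by (simp add: max_def power_0_left)
  qed
  finally show ?thesis using eq a by simp
 qed
 show "emeasure ?L {..real i} ~= \<infinity>" for i unfolding eq by simp
qed auto

lemma nn_integral_radial:
 assumes [measurable]: "g \<in> borel_measurable borel"
 shows "(\<L> x. g (norm (x::'a::euclidean_space)))
  = (\<L> r. enn (sphere_vol TYPE('a) * r ^ (DIM('a) - 1)) * indicator {0..} r * g r)"
proof -
 have "(\<L> x. g (norm (x::'a))) = (\<integral>\<^sup>+r. g r \<partial>distr (lborel :: 'a measure) borel norm)"
  by (subst nn_integral_distr) auto
 thus ?thesis unfolding distr_norm_lborel by (simp add: nn_integral_density)
qed

lemma integral_radial_cball:
 fixes g :: "real => real"
 assumes g: "continuous_on UNIV g" and R: "R >= 0"
 shows "(\<I> x. g (norm (x::'a::euclidean_space)) * indicator (cball 0 R) x)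
  = sphere_vol TYPE('a) * integral {0..R} (%s. s ^ (DIM('a) - 1) * g s)"
proof -
 have [measurable]: "g \<in> borel_measurable borel" using g by (rule borel_measurable_continuous_onI)
 have "(\<I> x. g (norm (x::'a)) * indicator (cball 0 R) x) = (\<I> x. g (norm (x::'a)) * indicator {..R} (norm x))"
  by (intro Bochner_Integration.integral_cong) (auto simp: indicator_def)
 also have "... = (\<integral>r. g r * indicator {..R} r \<partial>distr (lborel :: 'a measure) borel norm)"
  by (subst integral_distr) auto
 also have "distr (lborel :: 'a measure) borel norm = density lborel (%r. enn (sphere_vol TYPE('a) * r ^ (DIM('a) - 1) * indicator {0..} r))"
  unfolding distr_norm_lborel
  by (intro arg_cong[where f="density lborel"] ext) (auto simp: indicator_def)
 also have "(\<integral>r. g r * indicator {..R} r \<partial>...) = (\<I> r. (sphere_vol TYPE('a) * r ^ (DIM('a) - 1) * indicator {0..} r) *\<^sub>R (g r * indicator {..R} r))"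
  using sphere_vol_pos[where 'a='a]
  by (subst integral_density) (auto simp: indicator_def)
 also have "... = (\<I> r. sphere_vol TYPE('a) * (indicator {0..R} r *\<^sub>R (r ^ (DIM('a) - 1) * g r)))"
  by (intro Bochner_Integration.integral_cong) (auto simp: indicator_def)
 also have "... = sphere_vol TYPE('a) * (\<I> r. indicator {0..R} r *\<^sub>R (r ^ (DIM('a) - 1) * g r))"
  by simp
 also have "(\<I> r. indicator {0..R} r *\<^sub>R (r ^ (DIM('a) - 1) * g r)) = integral {0..R} (%r. r ^ (DIM('a) - 1) * g r)"
 proof -
  have "set_integrable lborel {0..R} (%r. r ^ (DIM('a) - 1) * g r)"
   by (intro borel_integrable_atLeastAtMost' continuous_intros continuous_on_subset[OF g]) auto
  from set_borel_integral_eq_integral(2)[OF this] show ?thesis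
   by (simp add: set_lebesgue_integral_def)
 qed
 finally show ?thesis .
qed

section \<open>Radial profiles of the eigenfunctions\<close>

locale radial_basis =
 fixes h :: "nat => 'a::euclidean_space => real" and D :: nat and om :: real
 assumes D_eq: "D = DIM('a)" and om_eq: "om = sphere_vol TYPE('a)"
  and dim: "D >= 2" and basis: "radial_eigenbasis h"
begin

abbreviation lam :: "nat => real" where "lam \<equiv> ho_freq D"

text \<open>By radiality, the restriction to one coordinate axis carries all information. Negative
  radii are kept, so the profiles are differentiable at 0 as well.\<close>

definition unit :: 'a where "unit = (SOME b. b \<in> Basis)"
definition F :: "nat => real => real" where "F n r = h n (r *\<^sub>R unit)"
definition F1 :: "nat => real => real" where "F1 n r = partial_deriv unit (h n) (r *\<^sub>R unit)"
definition F2 :: "nat => real => real" where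
 "F2 n r = partial_deriv unit (partial_deriv unit (h n)) (r *\<^sub>R unit)"

lemma unit_Basis: "unit \<in> Basis"
 unfolding unit_def using nonempty_Basis by (simp add: some_in_eq)

lemma norm_unit [simp]: "norm unit = 1"
 using unit_Basis by simp

lemma lam_sq: "(lam n)^2 = 4 * real n + real D"
 unfolding ho_freq_def by simp

lemma lam_ge: "lam n >= 1" "lam n > 0" "(lam n)^2 >= 2"
proof -
 show "(lam n)^2 >= 2" unfolding lam_sq using dim by linarith
 show 1: "lam n >= 1" unfolding ho_freq_def using dim by (simp add: real_le_rsqrt)
 thus "lam n > 0" by linarith
qed

lemma h_props:
 "radial (h n)" "C2 (h n)" "harmonic_oscillator (h n) x = (lam n)^2 * h n x" "in_Lp lborel 2 (h n)"
 "(\<I> x. h m x * h n x) = (if m = n then 1 else 0)"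
 using basis unfolding radial_eigenbasis_def D_eq by auto

lemma h_F: "h n x = F n (norm x)"
proof -
 have "norm x = norm (norm x *\<^sub>R unit)" by simp
 thus ?thesis unfolding F_def using h_props(1)[of n] unfolding radial_def by blast
qed

lemma F_deriv: "(F n has_real_derivative F1 n r) (at r)"
proof -
 have "(%t. h n (r *\<^sub>R unit + t *\<^sub>R unit)) differentiable (at (0::real))"
  using h_props(2)[of n] unit_Basis unfolding C2_def C1_def by blast
 hence "((%t. h n (r *\<^sub>R unit + t *\<^sub>R unit)) has_real_derivative F1 n r) (at 0)"
  unfolding F1_def partial_deriv_def by (simp add: DERIV_deriv_iff_real_differentiable)
 hence "((%t. F n (r + t)) has_real_derivative F1 n r) (at 0)"
  by (simp add: F_def scaleR_add_left)
 thus ?thesis using DERIV_shift[of "F n" "F1 n r" 0 r] by (simp add: add.commute)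
qed

lemma F1_deriv: "(F1 n has_real_derivative F2 n r) (at r)"
proof -
 have "(%t. partial_deriv unit (h n) (r *\<^sub>R unit + t *\<^sub>R unit)) differentiable (at (0::real))"
  using h_props(2)[of n] unit_Basis unfolding C2_def C1_def by blast
 hence "((%t. partial_deriv unit (h n) (r *\<^sub>R unit + t *\<^sub>R unit)) has_real_derivative F2 n r) (at 0)"
  unfolding F2_def partial_deriv_def[of unit "partial_deriv unit (h n)"]
  by (simp add: DERIV_deriv_iff_real_differentiable)
 hence "((%t. F1 n (r + t)) has_real_derivative F2 n r) (at 0)"
  by (simp add: F1_def scaleR_add_left)
 thus ?thesis using DERIV_shift[of "F1 n" "F2 n r" 0 r] by (simp add: add.commute)
qed

lemma F_cont: "continuous_on A (F n)" and F1_cont: "continuous_on A (F1 n)"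
 using DERIV_isCont[OF F_deriv] DERIV_isCont[OF F1_deriv]
 by (simp_all add: continuous_at_imp_continuous_on)

lemma h_cont: "continuous_on A (h n)"
proof -
 have "h n = (%x. F n (norm x))" using h_F by auto
 thus ?thesis
  using continuous_on_compose2[OF F_cont[of UNIV n], of A norm] by (auto intro!: continuous_intros)
qed

lemma h_measurable [measurable]: "h n \<in> borel_measurable borel"
 using h_cont by (rule borel_measurable_continuous_onI)

text \<open>Along an orthogonal direction the function is F (sqrt (r^2 + t^2)), whose first
  derivative is F' times t / sqrt (r^2 + t^2); at t = 0 only the derivative of the second factor
  survives. These D - 1 directions give the first-order term of the radial equation.\<close>

lemma partial_deriv_orthogonal:
 assumes b: "b \<in> Basis" "b ~= unit" and r: "r > 0"
 shows "partial_deriv b (partial_deriv b (h n)) (r *\<^sub>R unit) = F1 n r / r"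
proof -
 have orth: "unit \<bullet> b = 0" "b \<bullet> b = 1" "unit \<bullet> unit = 1"
  using inner_not_same_Basis[OF unit_Basis b(1)] b(2) inner_same_Basis[OF b(1)] inner_same_Basis[OF unit_Basis]
  by auto
 have nrm: "norm (r *\<^sub>R unit + t *\<^sub>R b) = sqrt (r^2 + t^2)" for t
  unfolding norm_eq_sqrt_inner
  by (simp add: inner_add_left inner_add_right orth inner_commute[of b unit] power2_eq_square)
 have pos: "r^2 + t^2 > 0" for t
  using r by (intro add_pos_nonneg) auto
 have 1: "partial_deriv b (h n) (r *\<^sub>R unit + t *\<^sub>R b) = F1 n (sqrt (r^2 + t^2)) * (t / sqrt (r^2 + t^2))" for t
 proof -
  have "r *\<^sub>R unit + t *\<^sub>R b + \<tau> *\<^sub>R b = r *\<^sub>R unit + (t + \<tau>) *\<^sub>R b" for \<tau>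
   by (simp add: scaleR_add_left add.assoc)
  hence eq: "(%\<tau>. h n (r *\<^sub>R unit + t *\<^sub>R b + \<tau> *\<^sub>R b)) = (%\<tau>. F n (sqrt (r^2 + (t + \<tau>)^2)))"
   by (simp only: h_F nrm)
  have "((%\<tau>. r^2 + (t + \<tau>)^2) has_real_derivative 2 * t) (at 0)"
   by (auto intro!: derivative_eq_intros)
  moreover have "(sqrt has_real_derivative inverse (sqrt (r^2 + t^2)) / 2) (at (r^2 + (t + 0)^2))"
   using DERIV_real_sqrt[OF pos[of t]] by simp
  ultimately have "((%\<tau>. sqrt (r^2 + (t + \<tau>)^2)) has_real_derivative inverse (sqrt (r^2 + t^2)) / 2 * (2 * t)) (at 0)"
   by (rule DERIV_chain2[rotated])
  moreover have "(F n has_real_derivative F1 n (sqrt (r^2 + t^2))) (at (sqrt (r^2 + (t + 0)^2)))"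
   using F_deriv by simp
  ultimately have "((%\<tau>. F n (sqrt (r^2 + (t + \<tau>)^2))) has_real_derivative F1 n (sqrt (r^2 + t^2)) * (inverse (sqrt (r^2 + t^2)) / 2 * (2 * t))) (at 0)"
   by (rule DERIV_chain2[rotated])
  moreover have "inverse S / 2 * (2 * t) = t / S" for S :: real
   by (cases "S = 0") (auto simp: field_simps)
  ultimately have "((%\<tau>. F n (sqrt (r^2 + (t + \<tau>)^2))) has_real_derivative F1 n (sqrt (r^2 + t^2)) * (t / sqrt (r^2 + t^2))) (at 0)"
   by (simp only:)
  thus ?thesis unfolding partial_deriv_def eq by (rule DERIV_imp_deriv)
 qed
 have "((%t. F1 n (sqrt (r^2 + t^2)) * (t / sqrt (r^2 + t^2))) has_real_derivative F1 n r / r) (at 0)"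
 proof -
  have s: "((%\<tau>. sqrt (r^2 + \<tau>^2)) has_real_derivative 0) (at 0)"
  proof -
   have "((%\<tau>. r^2 + \<tau>^2) has_real_derivative 0) (at 0)"
    by (auto intro!: derivative_eq_intros)
   moreover have "(sqrt has_real_derivative inverse (sqrt (r^2 + 0^2)) / 2) (at (r^2 + 0^2))"
    using DERIV_real_sqrt[OF pos[of 0]] .
   ultimately have "((%\<tau>. sqrt (r^2 + \<tau>^2)) has_real_derivative inverse (sqrt (r^2 + 0^2)) / 2 * 0) (at 0)"
    by (rule DERIV_chain2[rotated])
   thus ?thesis by simp
  qed
  have "(F1 n has_real_derivative F2 n r) (at (sqrt (r^2 + 0^2)))" using F1_deriv[of n r] r by simp
  from DERIV_chain2[OF this s]
  have 1: "((%t. F1 n (sqrt (r^2 + t^2))) has_real_derivative 0) (at 0)" by simp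
  have 2: "((%t. t / sqrt (r^2 + t^2)) has_real_derivative 1 / r) (at 0)"
   using r DERIV_divide[OF DERIV_ident s] by (simp add: power2_eq_square)
  from DERIV_mult[OF 1 2] r show ?thesis by simp
 qed
 thus ?thesis
  unfolding partial_deriv_def[of b "partial_deriv b (h n)"] 1 by (rule DERIV_imp_deriv)
qed

lemma ODE:
 assumes r: "r > 0"
 shows "F2 n r + (real D - 1) * F1 n r / r = (r^2 - (lam n)^2) * F n r"
proof -
 have "laplacian (h n) (r *\<^sub>R unit) = F2 n r + (\<Sum>b\<in>Basis - {unit}. F1 n r / r)"
  unfolding laplacian_def using unit_Basis r
  by (subst sum.remove[of _ unit]) (auto simp: F2_def partial_deriv_orthogonal)
 also have "... = F2 n r + (real D - 1) * F1 n r / r"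
  using unit_Basis dim by (simp add: of_nat_diff D_eq)
 finally show ?thesis
  using h_props(3)[of n "r *\<^sub>R unit"] r
  by (simp add: harmonic_oscillator_def algebra_simps flip: F_def)
qed

text \<open>The flux, which brings the radial equation into divergence form: its derivative contains
  no F' any more, and it vanishes at the origin.\<close>

definition P :: "nat => real => real" where "P n r = r ^ (D - 1) * F1 n r"

lemma P_0: "P n 0 = 0"
 unfolding P_def using dim by simp

lemma P_cont: "continuous_on A (P n)"
 unfolding P_def by (intro continuous_intros F1_cont)

lemma P_deriv:
 assumes r: "r > 0"
 shows "(P n has_real_derivative r ^ (D - 1) * (r^2 - (lam n)^2) * F n r) (at r)"
proof -
 have "(P n has_real_derivative real (D - 1) * r ^ (D - 1 - 1) * F1 n r + r ^ (D - 1) * F2 n r) (at r)"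
  using DERIV_mult[OF DERIV_pow[of "D - 1" r] F1_deriv[of n r]] by (simp add: P_def [abs_def] mult_ac)
 moreover have "real (D - 1) * r ^ (D - 1 - 1) * F1 n r + r ^ (D - 1) * F2 n r
    = r ^ (D - 1) * (F2 n r + (real D - 1) * F1 n r / r)"
 proof -
  obtain k where "D = k + 2" using dim by (metis add.commute le_Suc_ex)
  thus ?thesis using r by (simp add: field_simps)
 qed
 ultimately show ?thesis unfolding ODE[OF r] by (simp add: mult.assoc)
qed

text \<open>The complement of a ball has infinite volume, so a lower bound at infinity contradicts
  square integrability. This is how the growing solution of the equation is excluded.\<close>

lemma no_lower_bound:
 assumes c: "c > 0" and r: "\<And>s. s >= r ==> (F n s)^2 >= c"
 shows False
proof -
 have fin: "(\<L> x. enn (norm (h n x) powr 2)) < \<infinity>"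
  using h_props(4)[of n] Lp_norm_finite_iff[of lborel 2 "h n"] by (simp add: in_Lp_def Lp_int_def)
 have "enn c * emeasure lborel {x::'a. norm x >= r} = (\<integral>\<^sup>+x. enn c * indicator {x. norm x >= r} x \<partial>(lborel::'a measure))" (is "?a = _")
  by (simp add: nn_integral_cmult_indicator)
 also have "... <= (\<L> x. enn (norm (h n x) powr 2))"
 proof (intro nn_integral_mono)
  fix x :: 'a
  have "(F n (norm x))^2 = norm (h n x) powr 2" by (simp add: h_F powr_numeral)
  thus "enn c * indicator {x. r <= norm x} x <= enn (norm (h n x) powr 2)"
   using r[of "norm x"] by (auto simp: indicator_def intro!: ennreal_leI)
 qed
 finally have "?a < \<infinity>" using fin by (rule le_less_trans)
 hence 1: "emeasure lborel {x::'a. norm x >= r} < \<infinity>"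
  using c by (auto simp: ennreal_mult_less_top)
 have "emeasure lborel (UNIV::'a set) <= emeasure lborel (cball (0::'a) \<bar>r\<bar> \<union> {x::'a. norm x >= r})"
  by (intro emeasure_mono) auto
 also have "... <= emeasure lborel (cball (0::'a) \<bar>r\<bar>) + emeasure lborel {x::'a. norm x >= r}"
  by (intro emeasure_subadditive) auto
 also have "... < \<infinity>" using 1 by (simp add: emeasure_cball)
 finally show False by simp
qed

text \<open>The product w = F P satisfies w' >= 2 |w| in the region where the potential exceeds the
  eigenvalue. A positive value of w would make F^2 nondecreasing; hence w <= 0, and the same
  inequality forces w, and then F^2, to decay like exp (-2r).\<close>

lemma F_decay: obtains C where "C >= 0" "\<And>r. r >= 0 ==> \<bar>F n r\<bar> <= C * exp (- r)"
proof -
 \<comment> \<open>Beyond this radius r^2 - lam^2 >= 1, so w' dominates r^(D-1) (F'^2 + F^2), which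
   is at least 2 |w|.\<close>
 define \<rho> where "\<rho> = sqrt ((lam n)^2 + 1)"
 have \<rho>1: "\<rho> >= 1" unfolding \<rho>_def by simp
 have \<rho>sq: "r^2 - (lam n)^2 >= 1" if "r >= \<rho>" for r
 proof -
  have "\<rho>^2 <= r^2" using that \<rho>1 by (intro power_mono) auto
  thus ?thesis unfolding \<rho>_def by simp
 qed
 define w where "w r = F n r * P n r" for r
 define w' where "w' r = F1 n r * P n r + F n r * (r ^ (D - 1) * (r^2 - (lam n)^2) * F n r)" for r
 have w_deriv: "(w has_real_derivative w' r) (at r)" if "r >= \<rho>" for r
  using DERIV_mult[OF F_deriv[of n r] P_deriv[of r n]] that \<rho>1
  by (simp add: w_def [abs_def] w'_def mult_ac)
 have w'_ge: "w' r >= 2 * \<bar>w r\<bar>" if "r >= \<rho>" for r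
 proof -
  have "w' r = r ^ (D - 1) * ((F1 n r)^2 + (r^2 - (lam n)^2) * (F n r)^2)"
   unfolding w'_def P_def by (simp add: algebra_simps power2_eq_square)
  also have "... >= r ^ (D - 1) * ((F1 n r)^2 + 1 * (F n r)^2)"
   using \<rho>sq[OF that] that \<rho>1 by (intro mult_left_mono add_left_mono mult_right_mono) auto
  finally have 1: "w' r >= r ^ (D - 1) * ((F1 n r)^2 + (F n r)^2)" by simp
  have "2 * \<bar>F1 n r * F n r\<bar> <= (F1 n r)^2 + (F n r)^2"
   using sum_squares_bound[of "\<bar>F1 n r\<bar>" "\<bar>F n r\<bar>"] by (simp add: abs_mult)
  hence "r ^ (D - 1) * (2 * \<bar>F1 n r * F n r\<bar>) <= r ^ (D - 1) * ((F1 n r)^2 + (F n r)^2)"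
   using that \<rho>1 by (intro mult_left_mono) auto
  moreover have "r ^ (D - 1) * (2 * \<bar>F1 n r * F n r\<bar>) = 2 * \<bar>w r\<bar>"
   using that \<rho>1 by (simp add: w_def P_def abs_mult)
  ultimately show ?thesis using 1 by linarith
 qed
 have sq_deriv: "((%s. (F n s)^2) has_real_derivative 2 * w r / r ^ (D - 1)) (at r)" if "r >= \<rho>" for r
  using DERIV_power[OF F_deriv[of n r], of 2] that \<rho>1 by (simp add: w_def P_def mult_ac)
 have w_le: "w r0 <= 0" if r0: "r0 >= \<rho>" for r0
 proof (rule ccontr)
  assume "\<not> w r0 <= 0"
  hence pos: "w r0 > 0" by simp
  have w_pos: "w s > 0" if "s >= r0" for s
  proof -
   have "w r0 <= w s"
   proof (intro DERIV_nonneg_imp_nondecreasing[OF that])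
    fix x assume "r0 <= x" "x <= s"
    hence "x >= \<rho>" using r0 by simp
    thus "\<exists>y. (w has_real_derivative y) (at x) \<and> 0 <= y"
     using w_deriv[of x] w'_ge[of x] by (intro exI[of _ "w' x"]) auto
   qed
   thus ?thesis using pos by simp
  qed
  have "(F n r0)^2 <= (F n s)^2" if "s >= r0" for s
  proof (rule DERIV_nonneg_imp_nondecreasing[OF that])
   fix x assume x: "r0 <= x" "x <= s"
   show "\<exists>y. ((%s. (F n s)^2) has_real_derivative y) (at x) \<and> 0 <= y"
    using sq_deriv[of x] w_pos[of x] x r0 \<rho>1
    by (intro exI[of _ "2 * w x / x ^ (D - 1)"]) auto
  qed
  moreover have "(F n r0)^2 > 0" using pos by (auto simp: w_def)
  ultimately show False using no_lower_bound by blast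
 qed
 \<comment> \<open>The function w exp (2r) is nondecreasing beyond \<rho>; A is minus its value at
   \<rho> and therefore bounds it from below.\<close>
 define A where "A = - w \<rho> * exp (2 * \<rho>)"
 have A0: "A >= 0" unfolding A_def using w_le[of \<rho>] by (auto intro!: mult_nonpos_nonneg)
 have w_ge: "w r >= - A * exp (- 2 * r)" if "r >= \<rho>" for r
 proof -
  have "w \<rho> * exp (2 * \<rho>) <= w r * exp (2 * r)"
  proof (rule DERIV_nonneg_imp_nondecreasing[OF that])
   fix x assume x: "\<rho> <= x" "x <= r"
   have "((%x. w x * exp (2 * x)) has_real_derivative (w' x + 2 * w x) * exp (2 * x)) (at x)"
   proof -
    have "((%x. exp (2 * x)) has_real_derivative 2 * exp (2 * x)) (at x)"
     by (auto intro!: derivative_eq_intros)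
    from DERIV_mult[OF w_deriv[OF x(1)] this] show ?thesis by (simp add: algebra_simps)
   qed
   moreover have "(w' x + 2 * w x) * exp (2 * x) >= 0" using w'_ge[OF x(1)] by (intro mult_nonneg_nonneg) auto
   ultimately show "\<exists>y. ((%x. w x * exp (2 * x)) has_real_derivative y) (at x) \<and> 0 <= y" by blast
  qed
  hence "- A * exp (- 2 * r) <= w r * exp (2 * r) * exp (- 2 * r)"
   unfolding A_def by (intro mult_right_mono) auto
  also have "... = w r" by (simp add: mult.assoc flip: exp_add)
  finally show ?thesis .
 qed
 \<comment> \<open>The excess F^2 - A exp (-2r) is nondecreasing, because w >= -A exp (-2r). Were it
   positive somewhere, F^2 would have a positive lower bound from there on.\<close>
 have sq_le: "(F n r)^2 <= A * exp (- 2 * r)" if r: "r >= \<rho>" for r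
 proof (rule ccontr)
  assume "\<not> ?thesis"
  hence c: "(F n r)^2 - A * exp (- 2 * r) > 0" by simp
  have "(F n r)^2 - A * exp (- 2 * r) <= (F n s)^2" if s: "s >= r" for s
  proof -
   have "(F n r)^2 - A * exp (- 2 * r) <= (F n s)^2 - A * exp (- 2 * s)"
   proof (rule DERIV_nonneg_imp_nondecreasing[OF s])
    fix x assume x: "r <= x" "x <= s"
    hence xr: "x >= \<rho>" "x >= 1" using r \<rho>1 by auto
    have "((%x. (F n x)^2 - A * exp (- 2 * x)) has_real_derivative 2 * w x / x ^ (D - 1) + 2 * A * exp (- 2 * x)) (at x)"
    proof -
     have "((%x. A * exp (- 2 * x)) has_real_derivative - 2 * A * exp (- 2 * x)) (at x)"
      by (auto intro!: derivative_eq_intros)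
     from DERIV_diff[OF sq_deriv[OF xr(1)] this] show ?thesis by simp
    qed
    moreover have "2 * w x / x ^ (D - 1) >= 2 * w x"
    proof -
     have "1 <= x ^ (D - 1)" using xr by simp
     hence "- w x / x ^ (D - 1) <= - w x" using w_le[OF xr(1)]
      using mult_left_mono[of 1 "x ^ (D - 1)" "- w x"] xr by (simp add: field_simps)
     hence "w x <= w x / x ^ (D - 1)" by simp
     thus ?thesis by (simp only: times_divide_eq_right[symmetric])
    qed
    ultimately show "\<exists>y. ((%x. (F n x)^2 - A * exp (- 2 * x)) has_real_derivative y) (at x) \<and> 0 <= y"
     using w_ge[OF xr(1)] by (intro exI conjI) (assumption, linarith)
   qed
   also have "... <= (F n s)^2" using A0 by simp
   finally show ?thesis .
  qed
  thus False using no_lower_bound[OF c] by blast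
 qed
 have "\<exists>B\<ge>0. \<forall>r\<in>{0..\<rho>}. \<bar>F n r\<bar> <= B"
 proof -
  have "compact (F n ` {0..\<rho>})" by (intro compact_continuous_image F_cont) auto
  hence "bounded (F n ` {0..\<rho>})" by (rule compact_imp_bounded)
  then obtain B where "\<forall>r\<in>{0..\<rho>}. norm (F n r) <= B" by (auto simp: bounded_iff)
  thus ?thesis by (intro exI[of _ "max 0 B"]) fastforce
 qed
 then obtain B where B: "B >= 0" "\<And>r. 0 <= r ==> r <= \<rho> ==> \<bar>F n r\<bar> <= B" by auto
 define C where "C = max (sqrt A) (B * exp \<rho>)"
 show ?thesis
 proof (rule that[of C])
  show "C >= 0" using A0 unfolding C_def by (simp add: max.coboundedI1)
  fix r :: real assume r: "r >= 0"
  show "\<bar>F n r\<bar> <= C * exp (- r)"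
  proof (cases "r <= \<rho>")
   case True
   have "\<bar>F n r\<bar> <= B * 1" using B r True by simp
   also have "... <= B * (exp \<rho> * exp (- r))" using True B by (intro mult_left_mono) (auto simp flip: exp_add)
   also have "... <= C * exp (- r)" unfolding mult.assoc[symmetric] C_def by (intro mult_right_mono) auto
   finally show ?thesis .
  next
   case False
   hence "(F n r)^2 <= A * exp (- 2 * r)" by (intro sq_le) simp
   also have "... = (sqrt A * exp (- r))^2"
    using A0 by (simp add: power_mult_distrib exp_double flip: exp_of_nat_mult)
   finally have "\<bar>F n r\<bar> <= sqrt A * exp (- r)" using A0 by (metis abs_le_square_iff abs_of_nonneg exp_ge_zero mult_nonneg_nonneg real_sqrt_ge_zero)
   also have "... <= C * exp (- r)" unfolding C_def by (intro mult_right_mono) auto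
   finally show ?thesis .
  qed
 qed
qed

end

context radial_basis
begin

section \<open>Energy identities\<close>

lemma om_pos: "om > 0"
 unfolding om_eq by (rule sphere_vol_pos)

lemma power_exp_tendsto: "((%r::real. r ^ k * exp (- r)) \<longlongrightarrow> 0) at_top"
 using tendsto_power_div_exp_0[of k] by (simp add: exp_minus divide_inverse)

lemma F_tendsto: "(F n \<longlongrightarrow> 0) at_top"
proof -
 obtain C where C: "C >= 0" "\<And>r. r >= 0 ==> \<bar>F n r\<bar> <= C * exp (- r)" by (rule F_decay[of n]) blast
 have "((%r. C * (r ^ 0 * exp (- r))) \<longlongrightarrow> C * 0) at_top"
  by (intro tendsto_mult tendsto_const power_exp_tendsto)
 hence "((%r. C * exp (- r)) \<longlongrightarrow> 0) at_top" by simp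
 thus ?thesis
  by (rule Lim_null_comparison[rotated])
   (use C in \<open>auto intro!: eventually_mono[OF eventually_ge_at_top[of 0]]\<close>)
qed

text \<open>Integrating the divergence form from 0 gives a polynomial bound, crude but sufficient:
  it only has to lose against the exponential decay of F in boundary terms.\<close>

lemma P_growth: obtains C where "C >= 0" "\<And>r. r >= 0 ==> \<bar>P n r\<bar> <= C * (r ^ D * (r^2 + (lam n)^2))"
proof -
 obtain C where C: "C >= 0" "\<And>r. r >= 0 ==> \<bar>F n r\<bar> <= C * exp (- r)" by (rule F_decay[of n]) blast
 show ?thesis
 proof (rule that[OF C(1)])
  fix r :: real assume r: "r >= 0"
  have "((%s. s ^ (D - 1) * (s^2 - (lam n)^2) * F n s) has_integral (P n r - P n 0)) {0..r}"
  proof (rule fundamental_theorem_of_calculus_interior[OF r P_cont])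
   fix s assume "s \<in> {0<..<r}"
   thus "(P n has_vector_derivative s ^ (D - 1) * (s^2 - (lam n)^2) * F n s) (at s)"
    using P_deriv[of s n] by (simp add: has_real_derivative_iff_has_vector_derivative)
  qed
  hence hi: "((%s. s ^ (D - 1) * (s^2 - (lam n)^2) * F n s) has_integral (P n r - P n 0)) (cbox 0 r)"
   by simp
  have "norm (P n r - P n 0) <= (r ^ (D - 1) * (r^2 + (lam n)^2) * C) * measure lborel (cbox 0 r)"
  proof (rule has_integral_bound[OF _ hi])
   show "0 <= r ^ (D - 1) * (r^2 + (lam n)^2) * C" using C r by (intro mult_nonneg_nonneg) auto
   fix s assume "s \<in> cbox 0 r"
   hence s: "0 <= s" "s <= r" by auto
   have "\<bar>F n s\<bar> <= C * exp (- s)" using C s by auto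
   also have "... <= C * 1" using C s by (intro mult_left_mono) auto
   finally have "\<bar>F n s\<bar> <= C" by simp
   moreover have "\<bar>s^2 - (lam n)^2\<bar> <= r^2 + (lam n)^2"
   proof -
    have "s^2 <= r^2" using s by (intro power_mono) auto
    moreover have "0 <= s^2" "0 <= (lam n)^2" by auto
    ultimately show ?thesis by linarith
   qed
   moreover have "s ^ (D - 1) <= r ^ (D - 1)" using s by (intro power_mono) auto
   ultimately show "norm (s ^ (D - 1) * (s^2 - (lam n)^2) * F n s) <= r ^ (D - 1) * (r^2 + (lam n)^2) * C"
    using s C by (simp add: abs_mult) (intro mult_mono; auto)
  qed
  hence "\<bar>P n r\<bar> <= (r ^ (D - 1) * (r^2 + (lam n)^2) * C) * r"
   using r by (simp add: P_0)
  also have "... = C * ((r * r ^ (D - 1)) * (r^2 + (lam n)^2))" by (simp only: mult_ac)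
  also have "r * r ^ (D - 1) = r ^ D" using dim by (simp flip: power_Suc)
  finally show "\<bar>P n r\<bar> <= C * (r ^ D * (r^2 + (lam n)^2))" .
 qed
qed

lemma FP_tendsto: "((%r. F m r * P n r) \<longlongrightarrow> 0) at_top"
proof -
 obtain C where C: "C >= 0" "\<And>r. r >= 0 ==> \<bar>F m r\<bar> <= C * exp (- r)" by (rule F_decay[of m]) blast
 obtain C' where C': "C' >= 0" "\<And>r. r >= 0 ==> \<bar>P n r\<bar> <= C' * (r ^ D * (r^2 + (lam n)^2))" by (rule P_growth[of n]) blast
 have "((%r. C * C' * (r ^ (D + 2) * exp (- r) + (lam n)^2 * (r ^ D * exp (- r)))) \<longlongrightarrow> C * C' * (0 + (lam n)^2 * 0)) at_top"
  by (intro tendsto_mult tendsto_add tendsto_const power_exp_tendsto)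
 hence "((%r. C * C' * (r ^ (D + 2) * exp (- r) + (lam n)^2 * (r ^ D * exp (- r)))) \<longlongrightarrow> 0) at_top" by simp
 thus ?thesis
 proof (rule Lim_null_comparison[rotated], intro eventually_mono[OF eventually_ge_at_top[of 0]])
  fix r :: real assume r: "0 <= r"
  have "norm (F m r * P n r) <= (C * exp (- r)) * (C' * (r ^ D * (r^2 + (lam n)^2)))"
   unfolding real_norm_def abs_mult using C C' r by (intro mult_mono) auto
  also have "... = C * C' * (r ^ (D + 2) * exp (- r) + (lam n)^2 * (r ^ D * exp (- r)))"
   by (simp add: algebra_simps power_add power2_eq_square)
  finally show "norm (F m r * P n r) <= ..." .
 qed
qed

lemma h_square_integrable: "integrable lborel (%x. (h n x)^2)"
proof -
 have "(\<L> x. enn (norm (h n x) powr 2)) < \<infinity>"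
  using h_props(4)[of n] Lp_norm_finite_iff[of lborel 2 "h n"] by (simp add: in_Lp_def Lp_int_def)
 thus ?thesis
  by (intro integrableI_nonneg) (auto simp: powr_numeral)
qed

lemma h_prod_integrable: "integrable lborel (%x. h m x * h n x)"
proof (rule Bochner_Integration.integrable_bound[OF Bochner_Integration.integrable_add[OF h_square_integrable[of m] h_square_integrable[of n]]])
 show "AE x in lborel. norm (h m x * h n x) <= norm ((h m x)^2 + (h n x)^2)"
 proof (intro AE_I2)
  fix x
  have "2 * \<bar>h m x\<bar> * \<bar>h n x\<bar> <= \<bar>h m x\<bar>^2 + \<bar>h n x\<bar>^2" by (rule sum_squares_bound)
  moreover have "0 <= \<bar>h m x\<bar> * \<bar>h n x\<bar>" by simp
  ultimately have "\<bar>h m x\<bar> * \<bar>h n x\<bar> <= (h m x)^2 + (h n x)^2" unfolding power2_abs by linarith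
  thus "norm (h m x * h n x) <= norm ((h m x)^2 + (h n x)^2)" by (simp add: abs_mult)
 qed
qed simp

text \<open>Orthonormality in polar coordinates. It is phrased with integrals over bounded intervals
  and a limit, so that only continuous functions on compact intervals are integrated in the energy
  identities.\<close>

lemma inner_tendsto:
 "((%R. integral {0..R} (%s. s ^ (D - 1) * (F m s * F n s))) \<longlongrightarrow> (if m = n then 1 / om else 0)) at_top"
proof -
 have "((%R. \<integral>x. h m x * h n x * indicator (cball 0 R) x \<partial>lborel) \<longlongrightarrow> (\<I> x. h m x * h n x)) at_top"
 proof (rule integral_dominated_convergence_at_top[where w="%x. norm (h m x * h n x)"])
  show "integrable lborel (%x. norm (h m x * h n x))" by (intro integrable_norm h_prod_integrable)
  show "AE x in lborel. ((%R. h m x * h n x * indicator (cball 0 R) x) \<longlongrightarrow> h m x * h n x) at_top"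
  proof (intro AE_I2 tendsto_eventually)
   fix x :: 'a
   show "\<forall>\<^sub>F R in at_top. h m x * h n x * indicator (cball 0 R) x = h m x * h n x"
    by (rule eventually_mono[OF eventually_ge_at_top[of "norm x"]]) (auto simp: indicator_def)
  qed
  show "\<forall>\<^sub>F R in at_top. AE x in lborel. norm (h m x * h n x * indicator (cball 0 R) x) <= norm (h m x * h n x)"
   by (intro always_eventually allI AE_I2) (auto simp: indicator_def)
  show "(%x. h m x * h n x * indicator (cball 0 R) x) \<in> borel_measurable lborel" for R
   by (intro borel_measurable_times borel_measurable_indicator) auto
 qed auto
 hence "((%R. \<integral>x. h m x * h n x * indicator (cball 0 R) x \<partial>lborel) \<longlongrightarrow> (if m = n then 1 else 0)) at_top"
  unfolding h_props(5) .
 hence "((%R. (\<I> x. h m x * h n x * indicator (cball 0 R) x) / om) \<longlongrightarrow> (if m = n then 1 else 0) / om) at_top"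
  using om_pos by (intro tendsto_divide tendsto_const) auto
 moreover have "\<forall>\<^sub>F R in at_top. (\<I> x. h m x * h n x * indicator (cball 0 R) x) / om = integral {0..R} (%s. s ^ (D - 1) * (F m s * F n s))"
 proof (rule eventually_mono[OF eventually_ge_at_top[of 0]])
  fix R :: real assume "0 <= R"
  thus "(\<I> x. h m x * h n x * indicator (cball 0 R) x) / om = integral {0..R} (%s. s ^ (D - 1) * (F m s * F n s))"
   using integral_radial_cball[where 'a='a, of "%s. F m s * F n s" R] om_pos
   by (simp add: h_F om_eq D_eq F_cont continuous_on_mult)
 qed
 ultimately show ?thesis
  by (auto elim!: Lim_transform_eventually)
qed

definition comb :: "nat set => (nat => real) => real => real" where
 "comb I c r = (\<Sum>n\<in>I. c n * F n r)"
definition comb1 :: "nat set => (nat => real) => real => real" where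
 "comb1 I c r = (\<Sum>n\<in>I. c n * F1 n r)"
text \<open>The quadratic form of the harmonic oscillator on f = sum of c_n h_n, that is, the
  squared norm of f in the harmonic Sobolev space of order 1.\<close>

definition energy :: "nat set => (nat => real) => real" where
 "energy I c = (\<Sum>n\<in>I. (lam n)^2 * (c n)^2)"

lemma comb_deriv: "(comb I c has_real_derivative comb1 I c r) (at r)"
 unfolding comb_def comb1_def by (intro DERIV_sum DERIV_cmult F_deriv)

lemma comb_cont [continuous_intros]: "continuous_on A (comb I c)" and comb1_cont [continuous_intros]: "continuous_on A (comb1 I c)"
 unfolding comb_def comb1_def by (intro continuous_intros F_cont F1_cont)+

lemma comb_tendsto: "(comb I c \<longlongrightarrow> 0) at_top"
proof -
 have "((%r. \<Sum>n\<in>I. c n * F n r) \<longlongrightarrow> (\<Sum>n\<in>I. c n * 0)) at_top"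
  by (intro tendsto_sum tendsto_mult tendsto_const F_tendsto)
 thus ?thesis unfolding comb_def by simp
qed

lemma comb_inner_tendsto:
 assumes I: "finite I"
 shows "((%R. integral {0..R} (%s. s ^ (D - 1) * (comb I a s * comb I b s))) \<longlongrightarrow> (\<Sum>n\<in>I. a n * b n) / om) at_top"
proof -
 have eq: "integral {0..R} (%s. s ^ (D - 1) * (comb I a s * comb I b s))
   = (\<Sum>m\<in>I. \<Sum>n\<in>I. a m * b n * integral {0..R} (%s. s ^ (D - 1) * (F m s * F n s)))" for R
 proof -
  have "integral {0..R} (%s. s ^ (D - 1) * (comb I a s * comb I b s))
    = integral {0..R} (%s. \<Sum>m\<in>I. \<Sum>n\<in>I. a m * b n * (s ^ (D - 1) * (F m s * F n s)))"
   unfolding comb_def sum_product by (simp add: sum_distrib_left mult_ac)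
  also have "... = (\<Sum>m\<in>I. integral {0..R} (%s. \<Sum>n\<in>I. a m * b n * (s ^ (D - 1) * (F m s * F n s))))"
   by (intro integral_sum I integrable_continuous_real continuous_intros F_cont)
  also have "... = (\<Sum>m\<in>I. \<Sum>n\<in>I. integral {0..R} (%s. a m * b n * (s ^ (D - 1) * (F m s * F n s))))"
   by (intro sum.cong refl integral_sum I integrable_continuous_real continuous_intros F_cont)
  finally show ?thesis by simp
 qed
 have "((%R. \<Sum>m\<in>I. \<Sum>n\<in>I. a m * b n * integral {0..R} (%s. s ^ (D - 1) * (F m s * F n s)))
    \<longlongrightarrow> (\<Sum>m\<in>I. \<Sum>n\<in>I. a m * b n * (if m = n then 1 / om else 0))) at_top"
  by (intro tendsto_sum tendsto_mult tendsto_const inner_tendsto)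
 moreover have "(\<Sum>m\<in>I. \<Sum>n\<in>I. a m * b n * (if m = n then 1 / om else 0)) = (\<Sum>n\<in>I. a n * b n) / om"
  using I by (simp add: if_distrib sum.delta sum_divide_distrib cong: if_cong)
 ultimately show ?thesis unfolding eq by simp
qed

lemma mono_le_limit:
 fixes f :: "real => real"
 assumes "(f \<longlongrightarrow> L) at_top" "\<And>S. S >= R ==> f R <= f S"
 shows "f R <= L"
 by (rule tendsto_lowerbound[OF assms(1)]) (auto intro!: eventually_mono[OF eventually_ge_at_top[of R]] assms(2))

lemma comb_mass_le:
 assumes I: "finite I"
 shows "integral {0..R} (%s. s ^ (D - 1) * (comb I c s)^2) <= (\<Sum>n\<in>I. (c n)^2) / om"
proof (rule mono_le_limit[where f="%R. integral {0..R} (%s. s ^ (D - 1) * (comb I c s)^2)"])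
 show "((%R. integral {0..R} (%s. s ^ (D - 1) * (comb I c s)^2)) \<longlongrightarrow> (\<Sum>n\<in>I. (c n)^2) / om) at_top"
  using comb_inner_tendsto[OF I, of c c] by (simp add: power2_eq_square)
 show "integral {0..R} (%s. s ^ (D - 1) * (comb I c s)^2) <= integral {0..S} (%s. s ^ (D - 1) * (comb I c s)^2)"
  if "S >= R" for S
  using that by (intro integral_subset_le integrable_continuous_real continuous_intros) auto
qed

text \<open>Integration by parts on a bounded interval; the boundary term vanishes at 0 and tends to
  0 at infinity. Since the integrand is nonnegative, each truncated integral lies below the
  limit.\<close>

lemma comb_energy_le:
 assumes I: "finite I"
 shows "integral {0..R} (%s. s ^ (D - 1) * ((comb1 I c s)^2 + s^2 * (comb I c s)^2)) <= energy I c / om"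
proof -
 define W where "W r = comb I c r * (\<Sum>n\<in>I. c n * P n r)" for r
 \<comment> \<open>These are the coefficients of the oscillator applied to the combination, so its
   product with f integrates to the energy.\<close>
 define b where "b n = (lam n)^2 * c n" for n
 define E where "E R = integral {0..R} (%s. s ^ (D - 1) * ((comb1 I c s)^2 + s^2 * (comb I c s)^2))" for R
 have PS: "(\<Sum>n\<in>I. c n * P n r) = r ^ (D - 1) * comb1 I c r" for r
  unfolding P_def comb1_def by (simp add: sum_distrib_left mult_ac)
 have W_lim: "(W \<longlongrightarrow> 0) at_top"
 proof -
  have "((%r. \<Sum>m\<in>I. \<Sum>n\<in>I. (c m * c n) * (F m r * P n r)) \<longlongrightarrow> (\<Sum>m\<in>I. \<Sum>n\<in>I. (c m * c n) * 0)) at_top"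
   by (intro tendsto_sum tendsto_mult[OF tendsto_const] FP_tendsto)
  thus ?thesis unfolding W_def comb_def sum_product by (simp add: mult_ac)
 qed
 have E_eq: "E R = W R + integral {0..R} (%s. s ^ (D - 1) * (comb I c s * comb I b s))" if R: "R >= 0" for R
 proof -
  have "((%s. s ^ (D - 1) * ((comb1 I c s)^2 + s^2 * (comb I c s)^2) - s ^ (D - 1) * (comb I c s * comb I b s)) has_integral (W R - W 0)) {0..R}"
  proof (rule fundamental_theorem_of_calculus_interior[OF R])
   show "continuous_on {0..R} W"
    unfolding W_def by (intro continuous_intros P_cont)
   fix s :: real assume s: "s \<in> {0<..<R}"
   have "((%r. \<Sum>n\<in>I. c n * P n r) has_real_derivative (\<Sum>n\<in>I. c n * (s ^ (D - 1) * (s^2 - (lam n)^2) * F n s))) (at s)"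
    using s by (intro DERIV_sum DERIV_cmult P_deriv) auto
   from DERIV_mult[OF comb_deriv[of I c s] this]
   have "(W has_real_derivative comb1 I c s * (\<Sum>n\<in>I. c n * P n s) + (\<Sum>n\<in>I. c n * (s ^ (D - 1) * (s^2 - (lam n)^2) * F n s)) * comb I c s) (at s)"
    unfolding W_def [abs_def] .
   also have "(\<Sum>n\<in>I. c n * (s ^ (D - 1) * (s^2 - (lam n)^2) * F n s)) = s ^ (D - 1) * (s^2 * comb I c s - comb I b s)"
    unfolding comb_def b_def by (simp add: sum_distrib_left sum_subtractf[symmetric] algebra_simps)
   also have "comb1 I c s * (\<Sum>n\<in>I. c n * P n s) + s ^ (D - 1) * (s^2 * comb I c s - comb I b s) * comb I c s
     = s ^ (D - 1) * ((comb1 I c s)^2 + s^2 * (comb I c s)^2) - s ^ (D - 1) * (comb I c s * comb I b s)"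
    unfolding PS by (simp add: algebra_simps power2_eq_square)
   finally show "(W has_vector_derivative s ^ (D - 1) * ((comb1 I c s)^2 + s^2 * (comb I c s)^2) - s ^ (D - 1) * (comb I c s * comb I b s)) (at s)"
    by (simp add: has_real_derivative_iff_has_vector_derivative)
  qed
  hence "integral {0..R} (%s. s ^ (D - 1) * ((comb1 I c s)^2 + s^2 * (comb I c s)^2) - s ^ (D - 1) * (comb I c s * comb I b s)) = W R - W 0"
   by (rule integral_unique)
  moreover have "W 0 = 0" unfolding W_def by (simp add: P_0)
  moreover have "integral {0..R} (%s. s ^ (D - 1) * ((comb1 I c s)^2 + s^2 * (comb I c s)^2) - s ^ (D - 1) * (comb I c s * comb I b s))
    = E R - integral {0..R} (%s. s ^ (D - 1) * (comb I c s * comb I b s))"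
   unfolding E_def by (intro Henstock_Kurzweil_Integration.integral_diff integrable_continuous_real continuous_intros)
  ultimately show ?thesis by simp
 qed
 have "((%R. W R + integral {0..R} (%s. s ^ (D - 1) * (comb I c s * comb I b s))) \<longlongrightarrow> 0 + (\<Sum>n\<in>I. c n * b n) / om) at_top"
  by (intro tendsto_add W_lim comb_inner_tendsto I)
 moreover have "\<forall>\<^sub>F R in at_top. W R + integral {0..R} (%s. s ^ (D - 1) * (comb I c s * comb I b s)) = E R"
  by (rule eventually_mono[OF eventually_ge_at_top[of 0]]) (simp add: E_eq)
 ultimately have "(E \<longlongrightarrow> 0 + (\<Sum>n\<in>I. c n * b n) / om) at_top"
  by (rule Lim_transform_eventually)
 hence "(E \<longlongrightarrow> energy I c / om) at_top"
  by (simp add: energy_def b_def power2_eq_square mult_ac)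
 hence "E R <= energy I c / om"
 proof (rule mono_le_limit)
  fix S assume "S >= R"
  thus "E R <= E S"
   unfolding E_def by (intro integral_subset_le integrable_continuous_real continuous_intros) auto
 qed
 thus ?thesis by (simp add: E_def)
qed

text \<open>Since f vanishes at infinity, f(r)^2 is at most the integral of 2 |f f'| from r on, and
  there r^k <= s^k lets the weight move under the integral.\<close>

lemma sup_by_integral:
 assumes r: "r > 0" and g: "continuous_on UNIV g"
  and le: "\<And>s. s >= 0 ==> s ^ k * (2 * \<bar>comb I c s * comb1 I c s\<bar>) <= g s"
  and B: "\<And>R. integral {0..R} g <= B"
 shows "r ^ k * (comb I c r)^2 <= B"
proof -
 have g0: "g s >= 0" if "s >= 0" for s
  by (rule order_trans[OF _ le[OF that]]) (use that in auto)
 have "r ^ k * (comb I c r)^2 - B <= r ^ k * (comb I c R)^2" if R: "R >= r" for R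
 proof -
  have hi: "((%s. 2 * comb I c s * comb1 I c s) has_integral ((comb I c R)^2 - (comb I c r)^2)) {r..R}"
  proof (rule fundamental_theorem_of_calculus[OF R])
   fix s
   have "((%s. (comb I c s)^2) has_real_derivative 2 * comb I c s * comb1 I c s) (at s within {r..R})"
    using DERIV_power[OF DERIV_subset[OF comb_deriv[of I c s], of "{r..R}"], of 2] by (simp add: mult_ac)
   thus "((%s. (comb I c s)^2) has_vector_derivative 2 * comb I c s * comb1 I c s) (at s within {r..R})"
    by (simp add: has_real_derivative_iff_has_vector_derivative)
  qed
  hence "((%s. (- (r ^ k)) * (2 * comb I c s * comb1 I c s)) has_integral ((- (r ^ k)) * ((comb I c R)^2 - (comb I c r)^2))) {r..R}"
   by (rule has_integral_mult_right)
  moreover have "(g has_integral integral {r..R} g) {r..R}"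
   by (intro integrable_integral integrable_continuous_real continuous_on_subset[OF g]) auto
  ultimately have "(- (r ^ k)) * ((comb I c R)^2 - (comb I c r)^2) <= integral {r..R} g"
  proof (rule has_integral_le)
   fix s assume s: "s \<in> {r..R}"
   have "(- (r ^ k)) * (2 * comb I c s * comb1 I c s) <= \<bar>(- (r ^ k)) * (2 * comb I c s * comb1 I c s)\<bar>" (is "?a <= _") by (rule abs_ge_self)
   also have "... = r ^ k * (2 * \<bar>comb I c s * comb1 I c s\<bar>)" using r by (simp add: abs_mult)
   also have "... <= s ^ k * (2 * \<bar>comb I c s * comb1 I c s\<bar>)"
    using s r by (intro mult_right_mono power_mono) auto
   also have "... <= g s" using s r by (intro le) auto
   finally show "?a <= g s" .
  qed
  also have "... <= integral {0..R} g"
   using r R g0 by (intro integral_subset_le integrable_continuous_real continuous_on_subset[OF g]) auto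
  also have "... <= B" by (rule B)
  finally show ?thesis by (simp add: algebra_simps)
 qed
 moreover have "((%R. r ^ k * (comb I c R)^2) \<longlongrightarrow> r ^ k * 0^2) at_top"
  by (intro tendsto_intros comb_tendsto)
 ultimately have "r ^ k * (comb I c r)^2 - B <= r ^ k * 0^2"
  by (intro tendsto_lowerbound[of "%R. r ^ k * (comb I c R)^2"]) (auto intro!: eventually_mono[OF eventually_ge_at_top[of r]])
 thus ?thesis by simp
qed

text \<open>Strauss' inequality with a free parameter: 2 |f f'| <= ka f^2 + f'^2 / ka. The choice of
  \<open>ka\<close> as a frequency bound will balance mass against energy.\<close>

lemma radial_bound_mid:
 assumes I: "finite I" and r: "r > 0" and ka: "ka > 0"
 shows "r ^ (D - 1) * (comb I c r)^2 <= (ka * (\<Sum>n\<in>I. (c n)^2) + energy I c / ka) / om"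
proof (rule sup_by_integral[OF r, where g="%s. s ^ (D - 1) * (ka * (comb I c s)^2 + (comb1 I c s)^2 / ka)"])
 show "continuous_on UNIV (%s. s ^ (D - 1) * (ka * (comb I c s)^2 + (comb1 I c s)^2 / ka))"
  using ka by (intro continuous_intros) auto
 show "s ^ (D - 1) * (2 * \<bar>comb I c s * comb1 I c s\<bar>) <= s ^ (D - 1) * (ka * (comb I c s)^2 + (comb1 I c s)^2 / ka)"
  if "s >= 0" for s
 proof (rule mult_left_mono)
  define x y where "x = sqrt ka * \<bar>comb I c s\<bar>" and "y = \<bar>comb1 I c s\<bar> / sqrt ka"
  have "2 * x * y <= x^2 + y^2" by (rule sum_squares_bound)
  moreover have "x * y = \<bar>comb I c s * comb1 I c s\<bar>" "x^2 = ka * (comb I c s)^2" "y^2 = (comb1 I c s)^2 / ka"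
   using ka by (auto simp: x_def y_def power_mult_distrib power_divide abs_mult)
  ultimately show "2 * \<bar>comb I c s * comb1 I c s\<bar> <= ka * (comb I c s)^2 + (comb1 I c s)^2 / ka" by simp
 qed (use that in auto)
 fix R
 have "integral {0..R} (%s. s ^ (D - 1) * (ka * (comb I c s)^2 + (comb1 I c s)^2 / ka))
   <= integral {0..R} (%s. ka * (s ^ (D - 1) * (comb I c s)^2) + (1 / ka) * (s ^ (D - 1) * ((comb1 I c s)^2 + s^2 * (comb I c s)^2)))"
 proof (intro integral_le integrable_continuous_real)
  have ka0: "ka ~= 0" using ka by simp
  thus "continuous_on {0..R} (%s. s ^ (D - 1) * (ka * (comb I c s)^2 + (comb1 I c s)^2 / ka))"
   "continuous_on {0..R} (%s. ka * (s ^ (D - 1) * (comb I c s)^2) + (1 / ka) * (s ^ (D - 1) * ((comb1 I c s)^2 + s^2 * (comb I c s)^2)))"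
   by (intro continuous_intros; simp)+
  fix s assume s: "s \<in> {0..R}"
  have "0 <= (1 / ka) * (s ^ (D - 1) * (s^2 * (comb I c s)^2))" using s ka by auto
  thus "s ^ (D - 1) * (ka * (comb I c s)^2 + (comb1 I c s)^2 / ka)
    <= ka * (s ^ (D - 1) * (comb I c s)^2) + (1 / ka) * (s ^ (D - 1) * ((comb1 I c s)^2 + s^2 * (comb I c s)^2))"
   using ka0 by (simp add: algebra_simps add_divide_distrib)
 qed
 also have "... = ka * integral {0..R} (%s. s ^ (D - 1) * (comb I c s)^2) + (1 / ka) * integral {0..R} (%s. s ^ (D - 1) * ((comb1 I c s)^2 + s^2 * (comb I c s)^2))"
  using ka by (subst Henstock_Kurzweil_Integration.integral_add)
   (auto intro!: integrable_continuous_real continuous_intros simp: less_imp_neq[OF ka, symmetric])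
 also have "... <= ka * ((\<Sum>n\<in>I. (c n)^2) / om) + (1 / ka) * (energy I c / om)"
  using ka by (intro add_mono mult_left_mono comb_mass_le comb_energy_le I) auto
 also have "... = (ka * (\<Sum>n\<in>I. (c n)^2) + energy I c / ka) / om"
  by (simp add: add_divide_distrib)
 finally show "integral {0..R} (%s. s ^ (D - 1) * (ka * (comb I c s)^2 + (comb1 I c s)^2 / ka)) <= ..." .
qed

text \<open>The confining potential gives one power of r more than Strauss' inequality, through 2
  |f'| s |f| <= f'^2 + s^2 f^2. This decides integrability at infinity.\<close>

lemma radial_bound_far:
 assumes I: "finite I" and r: "r > 0"
 shows "r ^ D * (comb I c r)^2 <= energy I c / om"
proof (rule sup_by_integral[OF r, where g="%s. s ^ (D - 1) * ((comb1 I c s)^2 + s^2 * (comb I c s)^2)"])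
 show "s ^ D * (2 * \<bar>comb I c s * comb1 I c s\<bar>) <= s ^ (D - 1) * ((comb1 I c s)^2 + s^2 * (comb I c s)^2)" if "s >= 0" for s
 proof -
  have "2 * \<bar>comb1 I c s\<bar> * (s * \<bar>comb I c s\<bar>) <= \<bar>comb1 I c s\<bar>^2 + (s * \<bar>comb I c s\<bar>)^2" by (rule sum_squares_bound)
  hence "2 * \<bar>comb1 I c s\<bar> * (s * \<bar>comb I c s\<bar>) <= (comb1 I c s)^2 + s^2 * (comb I c s)^2"
   by (simp add: power_mult_distrib)
  hence "s ^ (D - 1) * (2 * \<bar>comb1 I c s\<bar> * (s * \<bar>comb I c s\<bar>)) <= s ^ (D - 1) * ((comb1 I c s)^2 + s^2 * (comb I c s)^2)"
   using that by (intro mult_left_mono) auto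
  moreover have "s ^ D = s * s ^ (D - 1)" using dim by (simp flip: power_Suc)
  ultimately show ?thesis by (simp add: abs_mult mult_ac)
 qed
qed (intro continuous_intros comb_energy_le I)+

text \<open>A Hardy-type bound at the origin. The exponent D - 2 is the natural one; requiring be >
  0 avoids the logarithm that would appear for D = 2.\<close>

lemma radial_bound_near:
 assumes I: "finite I" and r: "0 < r" "r <= 1" and be: "be > 0" "be >= real D - 2"
 shows "r powr be * (comb I c r)^2 <= (1 + 1 / be) * energy I c / om"
proof -
 let ?f = "comb I c" and ?f1 = "comb1 I c"
 have hi1: "((%s. be * s powr (be - 1) * (?f s)^2 + s powr be * (2 * ?f s * ?f1 s)) has_integral (1 powr be * (?f 1)^2 - r powr be * (?f r)^2)) {r..1}"
 proof (rule fundamental_theorem_of_calculus[OF r(2)])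
  fix s assume s: "s \<in> {r..1}"
  have "((%s. (?f s)^2) has_real_derivative 2 * ?f s * ?f1 s) (at s)"
   using DERIV_power[OF comb_deriv[of I c s], of 2] by (simp add: mult_ac)
  moreover have "((%s. s powr be) has_real_derivative be * s powr (be - 1)) (at s)"
   using s r by (intro has_real_derivative_powr) auto
  ultimately have "((%s. s powr be * (?f s)^2) has_real_derivative be * s powr (be - 1) * (?f s)^2 + 2 * ?f s * ?f1 s * s powr be) (at s)"
   by (rule DERIV_mult[rotated])
  thus "((%s. s powr be * (?f s)^2) has_vector_derivative be * s powr (be - 1) * (?f s)^2 + s powr be * (2 * ?f s * ?f1 s)) (at s within {r..1})"
   by (simp add: has_real_derivative_iff_has_vector_derivative mult.commute has_vector_derivative_at_within)
 qed
 have hi2: "((%s. (- 1 / be) * (s ^ (D - 1) * ((?f1 s)^2 + s^2 * (?f s)^2))) has_integral (- 1 / be) * integral {r..1} (%s. s ^ (D - 1) * ((?f1 s)^2 + s^2 * (?f s)^2))) {r..1}"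
  by (intro has_integral_mult_right integrable_integral integrable_continuous_real continuous_intros)
 have "(- 1 / be) * integral {r..1} (%s. s ^ (D - 1) * ((?f1 s)^2 + s^2 * (?f s)^2)) <= 1 powr be * (?f 1)^2 - r powr be * (?f r)^2"
 proof (rule has_integral_le[OF hi2 hi1])
  fix s assume s: "s \<in> {r..1}"
  hence s0: "s > 0" "s <= 1" using r by auto
  have e1: "s powr be = s powr (be - 1) * s" using s0 by (simp add: powr_diff)
  \<comment> \<open>Dropping a square from the derivative of s^be f^2 leaves only - s^(be+1) f'^2 /
    be. For s <= 1 the energy density controls it, because be + 1 >= D - 1.\<close>
  have "0 <= s powr (be - 1) * (be * (?f s + s * ?f1 s / be)^2)" using be by auto
  also have "... = be * s powr (be - 1) * (?f s)^2 + s powr be * (2 * ?f s * ?f1 s) + s powr be * s * (?f1 s)^2 / be"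
   unfolding e1 using be by (simp add: power2_eq_square field_simps)
  finally have 1: "- (s powr be * s * (?f1 s)^2 / be) <= be * s powr (be - 1) * (?f s)^2 + s powr be * (2 * ?f s * ?f1 s)" by linarith
  have "s powr be * s = s powr (be + 1)" using s0 by (simp add: powr_add)
  also have "... <= s powr (real (D - 1))" using s0 be dim by (intro powr_mono') (auto simp: of_nat_diff)
  also have "... = s ^ (D - 1)" using s0 by (simp add: powr_realpow)
  finally have "s powr be * s * (?f1 s)^2 <= s ^ (D - 1) * ((?f1 s)^2 + s^2 * (?f s)^2)"
   by (intro mult_mono) (use s0 in auto)
  hence "s powr be * s * (?f1 s)^2 / be <= s ^ (D - 1) * ((?f1 s)^2 + s^2 * (?f s)^2) / be"
   using be by (intro divide_right_mono) auto
  with 1 show "(- 1 / be) * (s ^ (D - 1) * ((?f1 s)^2 + s^2 * (?f s)^2)) <= be * s powr (be - 1) * (?f s)^2 + s powr be * (2 * ?f s * ?f1 s)"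
   by simp
 qed
 moreover have "integral {r..1} (%s. s ^ (D - 1) * ((?f1 s)^2 + s^2 * (?f s)^2)) <= energy I c / om"
 proof (rule order_trans[OF _ comb_energy_le[OF I, of 1]])
  show "integral {r..1} (%s. s ^ (D - 1) * ((?f1 s)^2 + s^2 * (?f s)^2)) <= integral {0..1} (%s. s ^ (D - 1) * ((?f1 s)^2 + s^2 * (?f s)^2))"
   using r by (intro integral_subset_le integrable_continuous_real continuous_intros) auto
 qed
 moreover have "(?f 1)^2 <= energy I c / om"
  using radial_bound_far[OF I, of 1 c] by simp
 ultimately have "r powr be * (?f r)^2 <= energy I c / om + (1 / be) * (energy I c / om)"
 proof -
  assume 1: "(- 1 / be) * integral {r..1} (%s. s ^ (D - 1) * ((?f1 s)^2 + s^2 * (?f s)^2)) <= 1 powr be * (?f 1)^2 - r powr be * (?f r)^2"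
   and 2: "integral {r..1} (%s. s ^ (D - 1) * ((?f1 s)^2 + s^2 * (?f s)^2)) <= energy I c / om"
   and 3: "(?f 1)^2 <= energy I c / om"
  have "(1 / be) * integral {r..1} (%s. s ^ (D - 1) * ((?f1 s)^2 + s^2 * (?f s)^2)) <= (1 / be) * (energy I c / om)"
   using be by (intro mult_left_mono 2) auto
  with 1 3 show ?thesis by simp
 qed
 thus ?thesis by (simp add: algebra_simps add_divide_distrib)
qed

end

section \<open>Integrability of the covariance and of band-limited functions\<close>

lemma nn_integral_powr_near:
 fixes a c :: real
 assumes "a > -1" "c >= 0"
 shows "(\<L> r. enn (r powr a) * indicator {0..c} r) = enn (c powr (a + 1) / (a + 1))"
 by (rule nn_integral_has_integral_lebesgue'[OF _ has_integral_powr_from_0[OF assms]]) auto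

lemma nn_integral_powr_far:
 fixes a c :: real
 assumes "a < -1" "c > 0"
 shows "(\<L> r. enn (r powr a) * indicator {c..} r) = enn (- (c powr (a + 1)) / (a + 1))"
 by (rule nn_integral_has_integral_lebesgue'[OF _ has_integral_powr_to_inf[OF assms]]) auto

lemma powr_move:
 fixes x y b B :: real
 assumes "x > 0" "x powr b * y <= B"
 shows "y <= B * x powr (- b)"
proof -
 have "y = x powr (- b) * (x powr b * y)" using assms(1) by (simp add: powr_minus)
 also have "... <= x powr (- b) * B" using assms by (intro mult_left_mono) auto
 finally show ?thesis by (simp add: mult.commute)
qed

context radial_basis
begin

lemma nn_integral_radial':
 assumes [measurable]: "g \<in> borel_measurable borel"
 shows "(\<L> x. g (norm (x::'a))) = ennreal om * (\<L> r. enn (r ^ (D - 1)) * indicator {0..} r * g r)"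
proof -
 have "(\<L> x. g (norm (x::'a))) = (\<L> r. ennreal om * (enn (r ^ (D - 1)) * indicator {0..} r * g r))"
  unfolding nn_integral_radial[OF assms] om_eq[symmetric] D_eq[symmetric] using om_pos
  by (intro nn_integral_cong) (auto simp: indicator_def ennreal_mult mult.assoc)
 also have "... = ennreal om * (\<L> r. enn (r ^ (D - 1)) * indicator {0..} r * g r)"
  by (rule nn_integral_cmult) measurable
 finally show ?thesis .
qed

lemma nn_integral_norm_powr_near:
 assumes e: "e < real D" and c: "c >= 0"
 shows "(\<L> x. enn (norm (x::'a) powr (- e)) * indicator {0<..c} (norm x)) = enn (om * c powr (real D - e) / (real D - e))"
proof -
 have "(\<L> x. enn (norm (x::'a) powr (- e)) * indicator {0<..c} (norm x))
   = ennreal om * (\<L> r. enn (r ^ (D - 1)) * indicator {0..} r * (enn (r powr (- e)) * indicator {0<..c} r))"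
  by (rule nn_integral_radial') measurable
 also have "(\<L> r. enn (r ^ (D - 1)) * indicator {0..} r * (enn (r powr (- e)) * indicator {0<..c} r))
   = (\<L> r. enn (r powr (real D - 1 - e)) * indicator {0..c} r)"
 proof (intro nn_integral_cong)
  fix r :: real
  have "r ^ (D - 1) * r powr (- e) = r powr (real D - 1 - e)" if "r > 0"
   using that dim by (simp add: powr_realpow[symmetric] of_nat_diff flip: powr_add)
  thus "enn (r ^ (D - 1)) * indicator {0..} r * (enn (r powr (- e)) * indicator {0<..c} r) = enn (r powr (real D - 1 - e)) * indicator {0..c} r"
   by (cases "r = 0") (auto simp: indicator_def simp flip: ennreal_mult)
 qed
 also have "... = enn (c powr (real D - 1 - e + 1) / (real D - 1 - e + 1))"
  using e c by (intro nn_integral_powr_near) auto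
 finally show ?thesis using om_pos e by (simp flip: ennreal_mult)
qed

lemma nn_integral_norm_powr_far:
 assumes e: "e > real D" and c: "c > 0"
 shows "(\<L> x. enn (norm (x::'a) powr (- e)) * indicator {c..} (norm x)) = enn (om * c powr (real D - e) / (e - real D))"
proof -
 have "(\<L> x. enn (norm (x::'a) powr (- e)) * indicator {c..} (norm x))
   = ennreal om * (\<L> r. enn (r ^ (D - 1)) * indicator {0..} r * (enn (r powr (- e)) * indicator {c..} r))"
  by (rule nn_integral_radial') measurable
 also have "(\<L> r. enn (r ^ (D - 1)) * indicator {0..} r * (enn (r powr (- e)) * indicator {c..} r))
   = (\<L> r. enn (r powr (real D - 1 - e)) * indicator {c..} r)"
 proof (intro nn_integral_cong)
  fix r :: real
  have "r ^ (D - 1) * r powr (- e) = r powr (real D - 1 - e)" if "r > 0"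
   using that dim by (simp add: powr_realpow[symmetric] of_nat_diff flip: powr_add)
  thus "enn (r ^ (D - 1)) * indicator {0..} r * (enn (r powr (- e)) * indicator {c..} r) = enn (r powr (real D - 1 - e)) * indicator {c..} r"
   using c by (auto simp: indicator_def simp flip: ennreal_mult)
 qed
 also have "... = enn (- (c powr (real D - 1 - e + 1)) / (real D - 1 - e + 1))"
  using e c by (intro nn_integral_powr_far) auto
 also have "- (c powr (real D - 1 - e + 1)) / (real D - 1 - e + 1) = c powr (real D - e) / (e - real D)"
  using e by (simp add: field_simps)
 finally show ?thesis using om_pos e by (simp flip: ennreal_mult)
qed

lemma AE_norm_pos: "AE x in lborel. norm (x::'a) > 0"
proof -
 have "AE x in lborel. (x::'a) ~= 0"
  by (rule AE_lborel_singleton)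
 thus ?thesis by simp
qed

text \<open>The variance at x of the Gaussian field with frequencies in I; for I = {..N} it is the
  function subtracted in Wick ordering.\<close>

definition kern :: "nat set => 'a => real" where
 "kern I x = (\<Sum>n\<in>I. (h n x)^2 / (lam n)^2)"

lemma lam_nz: "lam n ~= 0"
 using lam_ge(2)[of n] by simp

lemma kern_nonneg: "kern I x >= 0"
 unfolding kern_def by (intro sum_nonneg) auto

lemma kern_measurable [measurable]: "kern I \<in> borel_measurable borel"
 unfolding kern_def [abs_def]
 by (intro borel_measurable_continuous_onI continuous_intros h_cont) (simp add: lam_nz)

text \<open>The coefficients \<open>h\<^sub>n(x)/\<lambda>\<^sub>n\<^sup>2\<close> are extremal for point evaluation at \<open>x\<close> on the energy ball, so
 the pointwise bounds for functions of finite energy become bounds for the covariance.\<close>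

lemma kern_bounds:
 assumes I: "finite I" and x: "norm x > 0"
 shows "[|Lm > 0; \<And>n. n \<in> I ==> Lm <= lam n|] ==> norm x ^ (D - 1) * kern I x <= 2 / (om * Lm)"
  and "norm x ^ D * kern I x <= 1 / om"
  and "[|norm x <= 1; be > 0; be >= real D - 2|] ==> norm x powr be * kern I x <= (1 + 1 / be) / om"
proof -
 define c where "c n = F n (norm x) / (lam n)^2" for n
 define s where "s = kern I x"
 have s0: "s >= 0" unfolding s_def by (rule kern_nonneg)
 have comb: "comb I c (norm x) = s"
  unfolding comb_def c_def s_def kern_def by (simp add: h_F power2_eq_square)
 have lam0: "lam n ~= 0" for n using lam_ge(2)[of n] by simp
 have en: "energy I c = s"
  unfolding energy_def c_def s_def kern_def
  by (intro sum.cong refl) (simp add: h_F power_divide lam0 power2_eq_square)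
 \<comment> \<open>The value at x and the energy of the chosen combination both equal s, so every
   pointwise bound has the form A s^2 <= B s and may be divided by s.\<close>
 have cancel: "A * s <= B" if "A * s^2 <= B * s" "B >= 0" for A B
 proof (cases "s = 0")
  case False
  hence "s > 0" using s0 by simp
  thus ?thesis using that by (simp add: power2_eq_square flip: mult.assoc)
 qed (use that in auto)
 show "norm x ^ (D - 1) * kern I x <= 2 / (om * Lm)" if L: "Lm > 0" "\<And>n. n \<in> I ==> Lm <= lam n"
 proof -
  have "(\<Sum>n\<in>I. (c n)^2) <= (\<Sum>n\<in>I. (h n x)^2 / (lam n)^2 / Lm^2)"
  proof (intro sum_mono)
   fix n assume "n \<in> I"
   hence "Lm^2 <= (lam n)^2" using L by (intro power_mono) auto
   hence "(h n x)^2 / (lam n)^2 / (lam n)^2 <= (h n x)^2 / (lam n)^2 / Lm^2"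
    using L lam_ge(2)[of n] by (intro divide_left_mono) auto
   thus "(c n)^2 <= (h n x)^2 / (lam n)^2 / Lm^2"
    by (simp add: c_def h_F power_divide power2_eq_square mult.assoc)
  qed
  hence "(\<Sum>n\<in>I. (c n)^2) <= s / Lm^2" by (simp add: s_def kern_def sum_divide_distrib)
  hence "Lm * (\<Sum>n\<in>I. (c n)^2) <= Lm * (s / Lm^2)" using L by (intro mult_left_mono) auto
  also have "... = s / Lm" using L by (simp add: power2_eq_square)
  finally have "(Lm * (\<Sum>n\<in>I. (c n)^2) + energy I c / Lm) / om <= (s / Lm + s / Lm) / om"
   using om_pos unfolding en by (intro divide_right_mono) auto
  also have "... = 2 / (om * Lm) * s" using om_pos L by (simp add: field_simps)
  finally have "norm x ^ (D - 1) * s^2 <= ..."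
   using radial_bound_mid[OF I x L(1), of c] unfolding comb by linarith
  thus ?thesis using om_pos L unfolding s_def[symmetric] by (intro cancel) auto
 qed
 show "norm x ^ D * kern I x <= 1 / om"
  using radial_bound_far[OF I x, of c] om_pos unfolding comb en s_def[symmetric]
  by (intro cancel) auto
 show "norm x powr be * kern I x <= (1 + 1 / be) / om" if "norm x <= 1" "be > 0" "be >= real D - 2"
  using radial_bound_near[OF I x that, of c] om_pos that unfolding comb en s_def[symmetric]
  by (intro cancel) auto
qed

text \<open>Here a is the gain in frequency: the covariance above frequency Lm will have size
  Lm^(-a). The last two conditions express integrability of the interpolated p/2-th power at
  infinity and at the origin.\<close>

definition admissible :: "real => real => bool" where
 "admissible p a \<longleftrightarrow> p > 2 \<and> 0 < a \<and> a < 1 \<and> real D - a > 2 * real D / p \<and> real D - 2 + a < 2 * real D / p"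

text \<open>Geometric interpolation with weights a and 1 - a. Only the middle bound of
  \<open>kern_bounds\<close> carries a negative power of Lm; it is combined with the near bound
  inside the unit ball and with the far bound outside.\<close>

lemma kern_integral:
 assumes adm: "admissible p a"
 obtains C where "C > 0"
  "\<And>I Lm. [|finite I; Lm > 0; \<And>n. n \<in> I ==> Lm <= lam n|] ==>
    (\<L> x. enn (kern I x powr (p / 2))) <= enn (C * Lm powr (- (a * p / 2)))"
proof -
 have p: "p > 2" and a: "0 < a" "a < 1" and far: "real D - a > 2 * real D / p" and near: "real D - 2 + a < 2 * real D / p"
  using adm by (auto simp: admissible_def)
 \<comment> \<open>Admissibility makes this exponent larger than D - 2, as the near bound requires,
   while the interpolated exponent \<open>e0\<close> remains below 2D/p.\<close>
 define be where "be = 2 * real D / p - a"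
 have be: "be > 0" "be >= real D - 2" using near dim by (auto simp: be_def)
 define e0 where "e0 = (real D - 1) * a + be * (1 - a)"
 define e1 where "e1 = real D - a"
 have e0: "e0 * (p / 2) < real D"
 proof -
  have "e0 = real D - 2 + a + (be - (real D - 2)) * (1 - a)" by (simp add: e0_def algebra_simps)
  also have "... < real D - 2 + a + (be - (real D - 2))"
   using near a mult_strict_left_mono[of "1 - a" 1 "be - (real D - 2)"]
   by (intro add_strict_left_mono) (simp add: be_def)
  also have "... = 2 * real D / p" by (simp add: be_def)
  finally show ?thesis using p by (simp add: field_simps)
 qed
 have e1: "e1 * (p / 2) > real D" using far p by (simp add: e1_def field_simps)
 define A where "A = (2 / om) powr a * ((1 + 1 / be) / om) powr (1 - a)"
 have "1 + 1 / be > 0" using be by (intro add_pos_pos) auto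
 hence A: "A > 0" using om_pos by (simp add: A_def)
 define C where "C = A powr (p / 2) * (om / (real D - e0 * (p / 2)) + om / (e1 * (p / 2) - real D))"
 show ?thesis
 proof (rule that[of C])
  show "C > 0" unfolding C_def using A om_pos e0 e1 by (intro mult_pos_pos add_pos_pos) auto
  fix I :: "nat set" and Lm :: real
  assume I: "finite I" and L: "Lm > 0" "\<And>n. n \<in> I ==> Lm <= lam n"
  have interp: "kern I x <= A * Lm powr (- a) * norm x powr (- ((real D - 1) * a + b * (1 - a)))"
   if x: "norm x > 0" and b: "norm x powr b * kern I x <= (1 + 1 / be) / om" for x b
  proof -
   have 1: "kern I x <= 2 / om * Lm powr (- 1) * norm x powr (- (real D - 1))"
   proof -
    have "norm x powr (real D - 1) * kern I x <= 2 / (om * Lm)"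
     using kern_bounds(1)[OF I x L] x dim by (simp add: powr_realpow[symmetric] of_nat_diff)
    from powr_move[OF x this] show ?thesis using L by (simp add: powr_minus divide_inverse mult_ac)
   qed
   have 2: "kern I x <= (1 + 1 / be) / om * norm x powr (- b)"
    by (rule powr_move[OF x b])
   have "kern I x = kern I x powr a * kern I x powr (1 - a)"
    using kern_nonneg[of I x] by (subst powr_add[symmetric]) simp
   also have "... <= (2 / om * Lm powr (- 1) * norm x powr (- (real D - 1))) powr a * ((1 + 1 / be) / om * norm x powr (- b)) powr (1 - a)"
    using a 1 2 kern_nonneg[of I x] by (intro mult_mono powr_mono2) auto
   also have "... = A * Lm powr (- a) * (norm x powr (- (real D - 1) * a) * norm x powr (- b * (1 - a)))"
    unfolding A_def by (simp only: powr_mult powr_powr) (simp add: mult_ac)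
   also have "norm x powr (- (real D - 1) * a) * norm x powr (- b * (1 - a)) = norm x powr (- ((real D - 1) * a + b * (1 - a)))"
    by (subst powr_add[symmetric]) (simp add: algebra_simps)
   finally show ?thesis .
  qed
  define B where "B = A powr (p / 2) * Lm powr (- (a * p / 2))"
  have B0: "B >= 0" by (simp add: B_def)
  have pw: "(A * Lm powr (- a) * norm x powr (- e)) powr (p / 2) = B * norm x powr (- (e * (p / 2)))" for x :: 'a and e
   unfolding B_def by (simp only: powr_mult powr_powr) (simp add: mult_ac)
  have pt: "enn (kern I x powr (p / 2))
    <= enn B * (enn (norm x powr (- (e0 * (p / 2)))) * indicator {0<..1} (norm x))
     + enn B * (enn (norm x powr (- (e1 * (p / 2)))) * indicator {1..} (norm x))"
   if x: "norm x > 0" for x :: 'a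
  proof (cases "norm x <= 1")
   case True
   have "kern I x powr (p / 2) <= (A * Lm powr (- a) * norm x powr (- e0)) powr (p / 2)"
    unfolding e0_def using p kern_nonneg
    by (intro powr_mono2 interp x kern_bounds(3)[OF I x True be]) auto
   hence "enn (kern I x powr (p / 2)) <= enn (B * norm x powr (- (e0 * (p / 2))))"
    unfolding pw by (rule ennreal_leI)
   also have "... = enn B * (enn (norm x powr (- (e0 * (p / 2)))) * indicator {0<..1} (norm x))"
    using True x B0 by (simp add: ennreal_mult)
   also have "... <= ... + enn B * (enn (norm x powr (- (e1 * (p / 2)))) * indicator {1..} (norm x))"
    by simp
   finally show ?thesis .
  next
   case False
   have e1_eq: "e1 = (real D - 1) * a + real D * (1 - a)" by (simp add: e1_def algebra_simps)
   have "1 / om <= (1 + 1 / be) / om" using om_pos be by (intro divide_right_mono) auto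
   hence "norm x powr real D * kern I x <= (1 + 1 / be) / om"
    using kern_bounds(2)[OF I x] x by (simp add: powr_realpow)
   hence "kern I x powr (p / 2) <= (A * Lm powr (- a) * norm x powr (- e1)) powr (p / 2)"
    unfolding e1_eq using p kern_nonneg by (intro powr_mono2 interp x) auto
   hence "enn (kern I x powr (p / 2)) <= enn (B * norm x powr (- (e1 * (p / 2))))"
    unfolding pw by (rule ennreal_leI)
   also have "... = enn B * (enn (norm x powr (- (e1 * (p / 2)))) * indicator {1..} (norm x))"
    using False x B0 by (simp add: ennreal_mult)
   also have "... <= enn B * (enn (norm x powr (- (e0 * (p / 2)))) * indicator {0<..1} (norm x)) + ..."
    by simp
   finally show ?thesis .
  qed
  have "(\<L> x. enn (kern I x powr (p / 2)))
   <= (\<L> x. enn B * (enn (norm (x::'a) powr (- (e0 * (p / 2)))) * indicator {0<..1} (norm x))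
     + enn B * (enn (norm x powr (- (e1 * (p / 2)))) * indicator {1..} (norm x)))"
   by (intro nn_integral_mono_AE eventually_mono[OF AE_norm_pos] pt)
  also have "... = enn B * (\<L> x. enn (norm (x::'a) powr (- (e0 * (p / 2)))) * indicator {0<..1} (norm x))
    + enn B * (\<L> x. enn (norm (x::'a) powr (- (e1 * (p / 2)))) * indicator {1..} (norm x))"
   by (subst nn_integral_add) (auto simp: nn_integral_cmult)
  also have "... = enn (B * (om / (real D - e0 * (p / 2)) + om / (e1 * (p / 2) - real D)))"
   unfolding nn_integral_norm_powr_near[OF e0 zero_le_one] nn_integral_norm_powr_far[OF e1 zero_less_one]
   using B0 om_pos e0 e1 by (simp add: distrib_left flip: ennreal_mult ennreal_plus)
  also have "B * (om / (real D - e0 * (p / 2)) + om / (e1 * (p / 2) - real D)) = C * Lm powr (- (a * p / 2))"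
   by (simp add: B_def C_def mult_ac)
  finally show "(\<L> x. enn (kern I x powr (p / 2))) <= enn (C * Lm powr (- (a * p / 2)))" .
 qed
qed

definition field :: "nat set => (nat => complex) => 'a => complex" where
 "field I u x = (\<Sum>n\<in>I. u n * of_real (h n x))"

lemma field_measurable [measurable]: "field I u \<in> borel_measurable borel"
 unfolding field_def [abs_def]
 by (intro borel_measurable_continuous_onI continuous_intros h_cont)

lemma field_Re: "Re (field I u x) = comb I (%n. Re (u n)) (norm x)"
 and field_Im: "Im (field I u x) = comb I (%n. Im (u n)) (norm x)"
proof -
 have "Re (z * of_real r) = Re z * r" "Im (z * of_real r) = Im z * r" for z r by simp_all
 thus "Re (field I u x) = comb I (%n. Re (u n)) (norm x)" "Im (field I u x) = comb I (%n. Im (u n)) (norm x)"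
  by (simp_all only: field_def comb_def h_F Re_sum Im_sum)
qed

lemma field_sq: "(cmod (field I u x))^2 = (comb I (%n. Re (u n)) (norm x))^2 + (comb I (%n. Im (u n)) (norm x))^2"
 by (simp only: cmod_power2 field_Re field_Im)

lemma field_radial: "radial (field I u)"
 by (simp only: radial_def field_def h_F) simp

lemma field_expand: "(cmod (field I u x))^2 = (\<Sum>m\<in>I. \<Sum>n\<in>I. (Re (u m) * Re (u n) + Im (u m) * Im (u n)) * (h m x * h n x))"
proof -
 have sq: "(comb I c (norm x))^2 = (\<Sum>m\<in>I. \<Sum>n\<in>I. c m * c n * (h m x * h n x))" for c
 proof -
  have "(comb I c (norm x))^2 = (\<Sum>m\<in>I. c m * h m x) * (\<Sum>n\<in>I. c n * h n x)"
   by (simp only: comb_def power2_eq_square h_F)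
  also have "... = (\<Sum>m\<in>I. \<Sum>n\<in>I. c m * h m x * (c n * h n x))" by (rule sum_product)
  finally show ?thesis by (simp only: mult_ac)
 qed
 show ?thesis
  by (simp only: field_sq sq distrib_right sum.distrib)
qed

lemma field_mass:
 assumes I: "finite I"
 shows "integrable lborel (%x. (cmod (field I u x))^2)" "(\<I> x. (cmod (field I u x))^2) = (\<Sum>n\<in>I. (cmod (u n))^2)"
proof -
 show "integrable lborel (%x. (cmod (field I u x))^2)"
  unfolding field_expand by (intro Bochner_Integration.integrable_sum integrable_mult_right h_prod_integrable)
 have "(\<I> x. (cmod (field I u x))^2) = (\<Sum>m\<in>I. \<Sum>n\<in>I. (Re (u m) * Re (u n) + Im (u m) * Im (u n)) * (\<I> x. h m x * h n x))" (is "?a = _")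
  unfolding field_expand
  by (simp add: Bochner_Integration.integral_sum Bochner_Integration.integrable_sum integrable_mult_right h_prod_integrable)
 also have "... = (\<Sum>n\<in>I. (cmod (u n))^2)"
  unfolding h_props(5) cmod_power2 using I
  by (simp add: if_distrib sum.delta power2_eq_square cong: if_cong)
 finally show "?a = ..." .
qed

lemma field_mass_nn:
 assumes I: "finite I"
 shows "(\<L> x. enn ((cmod (field I u x))^2)) = enn (\<Sum>n\<in>I. (cmod (u n))^2)"
 by (subst nn_integral_eq_integral[OF field_mass(1)[OF I]]) (simp_all add: field_mass(2)[OF I])

text \<open>A Gagliardo--Nirenberg inequality for functions of frequency at most \<open>\<Lambda>\<close>.  Away from the ball of
 radius \<open>1/\<Lambda>\<close> the function is bounded; inside it the singular pointwise bound is integrated.\<close>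

lemma low_frequency_Lp:
 assumes p: "p > 2" and \<eta>: "\<eta> > 0" "(real D - 2 + \<eta>) * (p / 2) < real D"
 obtains C where "C > 0"
  "\<And>I u Lm. [|finite I; Lm >= 1; \<And>n. n \<in> I ==> lam n <= Lm|] ==>
   Lp_int lborel p (field I u) <= enn (C * (\<Sum>n\<in>I. (cmod (u n))^2) powr (p / 2) * Lm powr (real D * (p - 2) / 2 + \<eta> * p / 2))"
proof -
 define be where "be = real D - 2 + \<eta>"
 have be: "be > 0" "be >= real D - 2" "be * (p / 2) < real D" using \<eta> dim by (auto simp: be_def)
 define C1 where "C1 = (2 / om) powr ((p - 2) / 2)"
 define C2 where "C2 = ((1 + 1 / be) / om) powr (p / 2) * (om / (real D - be * (p / 2)))"
 show ?thesis
 proof (rule that[of "C1 + C2"])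
  show "C1 + C2 > 0" unfolding C1_def C2_def using om_pos be
   by (intro add_pos_nonneg mult_nonneg_nonneg) auto
  fix I :: "nat set" and u :: "nat => complex" and Lm :: real
  assume I: "finite I" and L: "Lm >= 1" "\<And>n. n \<in> I ==> lam n <= Lm"
  define m where "m = (\<Sum>n\<in>I. (cmod (u n))^2)"
  have m0: "m >= 0" unfolding m_def by (intro sum_nonneg) auto
  have m_split: "m = (\<Sum>n\<in>I. (Re (u n))^2) + (\<Sum>n\<in>I. (Im (u n))^2)"
   unfolding m_def by (simp add: cmod_power2 sum.distrib)
  have en: "energy I c <= Lm^2 * (\<Sum>n\<in>I. (c n)^2)" for c
   unfolding energy_def sum_distrib_left
  proof (intro sum_mono mult_right_mono)
   fix n assume "n \<in> I"
   thus "(lam n)^2 <= Lm^2" using L lam_ge(2)[of n] by (intro power_mono) auto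
  qed auto
  have mid: "norm x ^ (D - 1) * (cmod (field I u x))^2 <= 2 * Lm * m / om" if x: "norm x > 0" for x
  proof -
   have "norm x ^ (D - 1) * (comb I c (norm x))^2 <= 2 * Lm * (\<Sum>n\<in>I. (c n)^2) / om" for c
   proof -
    have "energy I c / Lm <= Lm^2 * (\<Sum>n\<in>I. (c n)^2) / Lm" using L en by (intro divide_right_mono) auto
    also have "... = Lm * (\<Sum>n\<in>I. (c n)^2)" using L by (simp add: power2_eq_square)
    finally have "(Lm * (\<Sum>n\<in>I. (c n)^2) + energy I c / Lm) / om <= (Lm * (\<Sum>n\<in>I. (c n)^2) + Lm * (\<Sum>n\<in>I. (c n)^2)) / om"
     using om_pos by (intro divide_right_mono) auto
    moreover have "norm x ^ (D - 1) * (comb I c (norm x))^2 <= (Lm * (\<Sum>n\<in>I. (c n)^2) + energy I c / Lm) / om"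
     using L by (intro radial_bound_mid I x) auto
    ultimately show ?thesis by (simp add: mult_ac)
   qed
   from this[of "%n. Re (u n)"] this[of "%n. Im (u n)"] show ?thesis
    unfolding field_sq m_split by (simp add: distrib_left add_divide_distrib)
  qed
  have near: "norm x powr be * (cmod (field I u x))^2 <= (1 + 1 / be) * (Lm^2 * m) / om" if x: "norm x > 0" "norm x <= 1" for x
  proof -
   have "norm x powr be * (comb I c (norm x))^2 <= (1 + 1 / be) * (Lm^2 * (\<Sum>n\<in>I. (c n)^2)) / om" for c
   proof -
    have "(1 + 1 / be) * energy I c / om <= (1 + 1 / be) * (Lm^2 * (\<Sum>n\<in>I. (c n)^2)) / om"
     using om_pos be by (intro divide_right_mono mult_left_mono en) auto
    with radial_bound_near[OF I x be(1,2), of c] show ?thesis by linarith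
   qed
   from this[of "%n. Re (u n)"] this[of "%n. Im (u n)"] show ?thesis
    unfolding field_sq m_split by (simp add: distrib_left add_divide_distrib)
  qed
  have sq: "cmod z powr q = ((cmod z)^2) powr (q / 2)" for z q
  proof (cases "z = 0")
   case False
   hence "(cmod z)^2 = cmod z powr 2" by (simp add: powr_numeral)
   hence "(cmod z)\<^sup>2 powr (q / 2) = cmod z powr (2 * (q / 2))" by (simp only: powr_powr)
   thus ?thesis by simp
  qed simp
  \<comment> \<open>Outside the ball of radius 1/Lm, |f|^p is at most sup |f|^(p-2) times |f|^2, and
    K1 is the resulting factor; K2 is the factor in front of the power of |x| inside.\<close>
  define K1 where "K1 = (2 / om * m * Lm powr real D) powr ((p - 2) / 2)"
  define K2 where "K2 = ((1 + 1 / be) * (Lm^2 * m) / om) powr (p / 2)"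
  have K0: "K1 >= 0" "K2 >= 0" by (auto simp: K1_def K2_def)
  have pt: "enn (cmod (field I u x) powr p)
    <= enn K1 * enn ((cmod (field I u x))^2)
     + enn K2 * (enn (norm x powr (- (be * (p / 2)))) * indicator {0<..1 / Lm} (norm x))"
   if x: "norm x > 0" for x
  proof (cases "norm x <= 1 / Lm")
   case True
   hence x1: "norm x <= 1" using L by (auto intro: order_trans)
   have "(cmod (field I u x))^2 <= (1 + 1 / be) * (Lm^2 * m) / om * norm x powr (- be)"
    by (rule powr_move[OF x near[OF x x1]])
   hence "cmod (field I u x) powr p <= ((1 + 1 / be) * (Lm^2 * m) / om * norm x powr (- be)) powr (p / 2)"
    unfolding sq[of _ p] using p by (intro powr_mono2) auto
   also have "... = K2 * norm x powr (- (be * (p / 2)))"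
    unfolding K2_def by (subst powr_mult) (simp add: powr_powr)
   finally have "enn (cmod (field I u x) powr p) <= enn (K2 * norm x powr (- (be * (p / 2))))" by (rule ennreal_leI)
   also have "... = enn K2 * (enn (norm x powr (- (be * (p / 2)))) * indicator {0<..1 / Lm} (norm x))"
    using True x K0 by (simp add: ennreal_mult)
   also have "... <= enn K1 * enn ((cmod (field I u x))^2) + ..." by simp
   finally show ?thesis .
  next
   case False
   have "(1 / Lm) ^ (D - 1) * (cmod (field I u x))^2 <= norm x ^ (D - 1) * (cmod (field I u x))^2"
    using False L by (intro mult_right_mono power_mono) auto
   also have "... <= 2 * Lm * m / om" by (rule mid[OF x])
   finally have "(cmod (field I u x))^2 <= 2 / om * m * (Lm * Lm ^ (D - 1))"
    using L by (simp add: power_one_over field_simps)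
   also have "Lm * Lm ^ (D - 1) = Lm ^ D" using dim by (simp flip: power_Suc)
   finally have 1: "(cmod (field I u x))^2 <= 2 / om * m * Lm powr real D" using L by (simp add: powr_realpow)
   have "cmod (field I u x) powr p = cmod (field I u x) powr (p - 2) * cmod (field I u x) powr 2"
    by (subst powr_add[symmetric]) simp
   also have "... <= K1 * (cmod (field I u x))^2"
    unfolding sq[of _ "p - 2"] K1_def using p 1 by (intro mult_mono powr_mono2) (auto simp: powr_numeral)
   finally have "enn (cmod (field I u x) powr p) <= enn K1 * enn ((cmod (field I u x))^2)"
    using K0 by (simp add: ennreal_leI flip: ennreal_mult)
   also have "... <= ... + enn K2 * (enn (norm x powr (- (be * (p / 2)))) * indicator {0<..1 / Lm} (norm x))" by simp
   finally show ?thesis .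
  qed
  have "Lp_int lborel p (field I u)
   <= (\<L> x. enn K1 * enn ((cmod (field I u x))^2)
     + enn K2 * (enn (norm x powr (- (be * (p / 2)))) * indicator {0<..1 / Lm} (norm x)))"
   unfolding Lp_int_def by (intro nn_integral_mono_AE eventually_mono[OF AE_norm_pos] pt)
  also have "... = enn K1 * (\<L> x. enn ((cmod (field I u x))^2))
    + enn K2 * (\<L> x. enn (norm (x::'a) powr (- (be * (p / 2)))) * indicator {0<..1 / Lm} (norm x))"
   by (subst nn_integral_add) (auto simp: nn_integral_cmult)
  also have "... = enn (K1 * m + K2 * (om * (1 / Lm) powr (real D - be * (p / 2)) / (real D - be * (p / 2))))"
   using K0 m0 om_pos be L
   by (subst nn_integral_norm_powr_near) (auto simp: field_mass_nn[OF I] m_def[symmetric] simp flip: ennreal_mult ennreal_plus)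
  also have "K1 * m + K2 * (om * (1 / Lm) powr (real D - be * (p / 2)) / (real D - be * (p / 2)))
    <= C1 * (m powr (p / 2) * Lm powr (real D * (p - 2) / 2 + \<eta> * p / 2)) + C2 * (m powr (p / 2) * Lm powr (real D * (p - 2) / 2 + \<eta> * p / 2))"
  proof (intro add_mono)
   have "K1 * m = C1 * (m powr ((p - 2) / 2) * m powr 1) * Lm powr (real D * ((p - 2) / 2))"
   proof -
    have "K1 = C1 * m powr ((p - 2) / 2) * Lm powr (real D * ((p - 2) / 2))"
     unfolding K1_def C1_def by (simp only: powr_mult powr_powr)
    thus ?thesis using m0 by simp
   qed
   also have "m powr ((p - 2) / 2) * m powr 1 = m powr (p / 2)"
    by (subst powr_add[symmetric]) (simp add: field_simps)
   also have "Lm powr (real D * ((p - 2) / 2)) <= Lm powr (real D * (p - 2) / 2 + \<eta> * p / 2)"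
    using L \<eta> p by (intro powr_mono) auto
   finally show "K1 * m <= C1 * (m powr (p / 2) * Lm powr (real D * (p - 2) / 2 + \<eta> * p / 2))"
    by (simp add: C1_def mult_left_mono mult.assoc)
   have e: "(Lm^2) powr (p / 2) * (1 / Lm) powr (real D - be * (p / 2)) = Lm powr (real D * (p - 2) / 2 + \<eta> * p / 2)"
   proof -
    have "(Lm^2) powr (p / 2) = (Lm powr 2) powr (p / 2)" using L by (simp add: powr_numeral)
    also have "... = Lm powr p" by (simp only: powr_powr) simp
    moreover have "(1 / Lm) powr y = Lm powr (- y)" for y
     by (simp add: powr_minus_divide powr_divide)
    ultimately have "(Lm^2) powr (p / 2) * (1 / Lm) powr (real D - be * (p / 2)) = Lm powr p * Lm powr (- (real D - be * (p / 2)))"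
     by (simp only:)
    also have "... = Lm powr (p - (real D - be * (p / 2)))" by (subst powr_add[symmetric]) (simp add: algebra_simps)
    also have "p - (real D - be * (p / 2)) = real D * (p - 2) / 2 + \<eta> * p / 2"
     by (simp add: be_def field_simps)
    finally show ?thesis .
   qed
   have "K2 = ((1 + 1 / be) / om) powr (p / 2) * ((Lm^2) powr (p / 2) * m powr (p / 2))"
   proof -
    have "(1 + 1 / be) * (Lm^2 * m) / om = ((1 + 1 / be) / om) * (Lm^2 * m)" by simp
    thus ?thesis unfolding K2_def using be om_pos m0 by (simp only: powr_mult)
   qed
   hence "K2 * (om * (1 / Lm) powr (real D - be * (p / 2)) / (real D - be * (p / 2)))
     = C2 * (m powr (p / 2) * ((Lm^2) powr (p / 2) * (1 / Lm) powr (real D - be * (p / 2))))"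
    unfolding C2_def by (simp add: mult_ac)
   thus "K2 * (om * (1 / Lm) powr (real D - be * (p / 2)) / (real D - be * (p / 2)))
     <= C2 * (m powr (p / 2) * Lm powr (real D * (p - 2) / 2 + \<eta> * p / 2))"
    unfolding e by simp
  qed
  finally show "Lp_int lborel p (field I u) <= enn ((C1 + C2) * (\<Sum>n\<in>I. (cmod (u n))^2) powr (p / 2) * Lm powr (real D * (p - 2) / 2 + \<eta> * p / 2))"
   by (simp add: m_def distrib_right mult.assoc ennreal_leI)
 qed
qed

end

section \<open>Uniqueness of the expansion\<close>

lemma nn_integral_cutoff_le:
 fixes f :: "real => ennreal"
 assumes [measurable]: "f \<in> borel_measurable borel"
  and B: "\<And>k::nat. (\<L> r. f r * indicator {0..real k} r) <= B"
 shows "(\<L> r. f r * indicator {0..} r) <= B"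
proof -
 have "(\<L> r. f r * indicator {0..} r) = (\<L> r. liminf (%k. f r * indicator {0..real k} r))"
 proof (rule nn_integral_cong)
  fix r :: real
  have "(%k. f r * indicator {0..real k} r) \<longlonglongrightarrow> f r * indicator {0..} r"
  proof (rule tendsto_eventually)
   obtain K :: nat where K: "r <= real K" using real_arch_simple by blast
   show "\<forall>\<^sub>F k in sequentially. f r * indicator {0..real k} r = f r * indicator {0..} r"
    by (rule eventually_sequentiallyI[of K]) (use K in \<open>auto simp: indicator_def\<close>)
  qed
  from lim_imp_Liminf[OF trivial_limit_sequentially this]
  show "f r * indicator {0..} r = liminf (%k. f r * indicator {0..real k} r)" by simp
 qed
 also have "... <= liminf (%k. (\<L> r. f r * indicator {0..real k} r))"
  by (rule nn_integral_liminf) measurable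
 also have "... <= liminf (%k. B)"
  by (intro Liminf_mono always_eventually allI B)
 finally show ?thesis by (simp add: Liminf_const)
qed

lemma Lp_pairing_tendsto_right:
 fixes f :: "'a => complex" and G :: "nat => 'a => real"
 assumes f: "in_Lp M p f" and G: "\<And>k. in_Lp M q (G k)" and g: "in_Lp M q g"
  and pq: "p > 1" "q > 1" "1/p + 1/q = 1" and lim: "(%k. Lp_int M q (%x. G k x - g x)) \<longlonglongrightarrow> 0"
 shows "(%k. (\<integral>x. f x * of_real (G k x) \<partial>M)) \<longlonglongrightarrow> (\<integral>x. f x * of_real (g x) \<partial>M)"
proof (rule LIMSEQ_I)
 fix e :: real assume e: "e > 0"
 define J where "J = enn2real (Lp_int M p f)"
 have J: "J >= 0" by (simp add: J_def)
 define t where "t = (e / (2 * (J + 1))) powr (- (1/p))"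
 have t: "t > 0" using e J by (simp add: t_def)
 have "t powr (-p) = e / (2 * (J + 1))" using e J pq by (simp add: t_def powr_powr)
 hence "t powr (-p) * J = e / 2 * (J / (J + 1))" using J by (simp add: field_simps)
 also have "... < e / 2 * 1" using e J by (intro mult_strict_left_mono) auto
 finally have tp: "t powr (-p) * J < e / 2" by simp
 have "(%k. enn2real (Lp_int M q (%x. G k x - g x))) \<longlonglongrightarrow> enn2real 0"
  using lim by (intro tendsto_enn2real) auto
 hence "(%k. t powr q * enn2real (Lp_int M q (%x. G k x - g x))) \<longlonglongrightarrow> t powr q * 0"
  by (intro tendsto_mult tendsto_const) simp
 hence "eventually (%k. t powr q * enn2real (Lp_int M q (%x. G k x - g x)) < e / 2) sequentially"
  using e by (intro order_tendstoD) auto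
 then obtain K where K: "\<And>k. k >= K ==> t powr q * enn2real (Lp_int M q (%x. G k x - g x)) < e / 2"
  by (auto simp: eventually_sequentially)
 show "\<exists>K. \<forall>k\<ge>K. norm ((\<integral>x. f x * of_real (G k x) \<partial>M) - (\<integral>x. f x * of_real (g x) \<partial>M)) < e"
 proof (intro exI[of _ K] allI impI)
  fix k assume k: "k >= K"
  have "(\<integral>x. f x * of_real (G k x) \<partial>M) - (\<integral>x. f x * of_real (g x) \<partial>M) = (\<integral>x. f x * of_real (G k x - g x) \<partial>M)"
   using Lp_pairing(1)[OF f G[of k] pq t] Lp_pairing(1)[OF f g pq t]
   by (simp add: right_diff_distrib)
  also have "norm ... <= t powr (-p) * J + t powr q * enn2real (Lp_int M q (%x. G k x - g x))"
   unfolding J_def using G g pq by (intro Lp_pairing(2) f t in_Lp_diff) auto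
  also have "... < e" using K[OF k] tp by simp
  finally show "norm ((\<integral>x. f x * of_real (G k x) \<partial>M) - (\<integral>x. f x * of_real (g x) \<partial>M)) < e" .
 qed
qed

context radial_basis
begin

lemma exp_norm_integrable: "(\<L> x. enn (exp (- norm (x::'a)))) < \<infinity>"
proof -
 have "(\<L> x. enn (exp (- norm (x::'a)))) = ennreal om * (\<L> r. enn (r ^ (D - 1)) * indicator {0..} r * enn (exp (- r)))"
  by (rule nn_integral_radial') measurable
 also have "(\<L> r. enn (r ^ (D - 1)) * indicator {0..} r * enn (exp (- r)))
   = (\<L> t. enn (t powr (real D - 1) / exp t) * indicator {0..} t)"
 proof (rule nn_integral_cong_AE, rule AE_mp[OF AE_lborel_singleton[of 0]], intro AE_I2 impI)
  fix r :: real assume r: "r ~= 0"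
  show "enn (r ^ (D - 1)) * indicator {0..} r * enn (exp (- r)) = enn (r powr (real D - 1) / exp r) * indicator {0..} r"
  proof (cases "r > 0")
   case True
   hence "r powr (real D - 1) = r ^ (D - 1)" using dim by (simp add: powr_realpow[symmetric] of_nat_diff)
   thus ?thesis using True by (simp add: exp_minus divide_inverse flip: ennreal_mult)
  qed (use r in simp)
 qed
 also have "... = enn (Gamma (real D))"
  using dim by (intro nn_integral_has_integral_lebesgue' Gamma_integral_real) auto
 finally show ?thesis by (simp add: ennreal_mult_less_top)
qed

lemma h_in_Lp:
 assumes q: "q >= 1"
 shows "in_Lp lborel q (h n)"
proof -
 obtain C where C: "C >= 0" "\<And>r. r >= 0 ==> \<bar>F n r\<bar> <= C * exp (- r)" by (rule F_decay[of n]) blast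
 have "Lp_int lborel q (h n) <= (\<L> x. enn (C powr q) * enn (exp (- norm (x::'a))))"
  unfolding Lp_int_def
 proof (intro nn_integral_mono)
  fix x :: 'a
  have "norm (h n x) powr q <= (C * exp (- norm x)) powr q"
   using C q by (intro powr_mono2) (auto simp: h_F)
  also have "... = C powr q * exp (- (q * norm x))" by (simp add: powr_mult exp_powr_real mult.commute)
  also have "... <= C powr q * exp (- norm x)"
   using q mult_right_mono[of 1 q "norm x"] by (intro mult_left_mono) auto
  finally show "enn (norm (h n x) powr q) <= enn (C powr q) * enn (exp (- norm x))"
   by (simp add: ennreal_leI flip: ennreal_mult)
 qed
 also have "... = enn (C powr q) * (\<L> x. enn (exp (- norm (x::'a))))"
  by (rule nn_integral_cmult) measurable
 also have "... < \<top>" using exp_norm_integrable by (simp add: ennreal_mult_less_top)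
 finally show ?thesis by (simp add: in_Lp_def Lp_norm_finite_iff)
qed

text \<open>A test function chosen for two properties: it vanishes on the sphere of radius R, so one
  integration by parts has no boundary term, and differences of two such functions approximate
  indicators of balls.\<close>

definition bump :: "real => 'a => real" where
 "bump R x = max 0 (R^2 - (norm x)^2)"

definition bump_coeff :: "real => nat => real" where
 "bump_coeff R n = (\<I> x. bump R x * h n x)"

lemma bump_measurable [measurable]: "bump R \<in> borel_measurable borel"
 unfolding bump_def [abs_def] by measurable

lemma bump_coeff_radial:
 assumes R: "R > 0"
 shows "bump_coeff R n = om * integral {0..R} (%s. s ^ (D - 1) * ((R^2 - s^2) * F n s))"
proof -
 have "bump R x * h n x = (R^2 - (norm x)^2) * F n (norm x) * indicator (cball 0 R) x" for x
 proof (cases "norm x <= R")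
  case True
  hence "(norm x)^2 <= R^2" by (intro power_mono) auto
  thus ?thesis using True by (simp add: bump_def h_F max_def)
 next
  case False
  hence "R^2 <= (norm x)^2" using R by (intro power_mono) auto
  thus ?thesis using False by (simp add: bump_def max_def)
 qed
 thus ?thesis
  unfolding bump_coeff_def
  using integral_radial_cball[where 'a='a, of "%s. (R^2 - s^2) * F n s" R] R
  by (simp add: om_eq D_eq continuous_intros F_cont)
qed

text \<open>The factor lam^2 is moved onto the bump by one integration by parts, at the price of a
  single derivative of F; this is what makes the energy of the bump accessible.\<close>

lemma bump_coeff_parts:
 assumes R: "R > 0"
 shows "(lam n)^2 * bump_coeff R n = om * integral {0..R} (%s. s ^ (D - 1) * (- 2 * s * F1 n s + s^2 * (R^2 - s^2) * F n s))"
proof -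
 let ?A = "%s. s ^ (D - 1) * (- 2 * s * F1 n s + s^2 * (R^2 - s^2) * F n s)"
 let ?B = "%s. s ^ (D - 1) * ((R^2 - s^2) * F n s)"
 have "((%s. ?A s - (lam n)^2 * ?B s) has_integral ((R^2 - R^2) * P n R - (R^2 - 0^2) * P n 0)) {0..R}"
 proof (rule fundamental_theorem_of_calculus_interior)
  show "continuous_on {0..R} (%s. (R^2 - s^2) * P n s)" by (intro continuous_intros P_cont)
  fix s assume s: "s \<in> {0<..<R}"
  have "((%s. R^2 - s^2) has_real_derivative - 2 * s) (at s)"
   by (auto intro!: derivative_eq_intros)
  from DERIV_mult[OF this P_deriv[of s n]] s
  have "((%s. (R^2 - s^2) * P n s) has_real_derivative - 2 * s * P n s + s ^ (D - 1) * (s^2 - (lam n)^2) * F n s * (R^2 - s^2)) (at s)"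
   by simp
  also have "- 2 * s * P n s + s ^ (D - 1) * (s^2 - (lam n)^2) * F n s * (R^2 - s^2) = ?A s - (lam n)^2 * ?B s"
   unfolding P_def by (simp add: algebra_simps)
  finally show "((%s. (R^2 - s^2) * P n s) has_vector_derivative ?A s - (lam n)^2 * ?B s) (at s)"
   by (simp add: has_real_derivative_iff_has_vector_derivative)
 qed (use R in simp)
 hence "integral {0..R} (%s. ?A s - (lam n)^2 * ?B s) = 0" by (simp add: P_0 integral_unique)
 moreover have "integral {0..R} (%s. ?A s - (lam n)^2 * ?B s) = integral {0..R} ?A - integral {0..R} (%s. (lam n)^2 * ?B s)"
  by (intro Henstock_Kurzweil_Integration.integral_diff integrable_continuous_real continuous_intros F_cont F1_cont)
 ultimately have "integral {0..R} ?A = (lam n)^2 * integral {0..R} ?B" by simp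
 thus ?thesis unfolding bump_coeff_radial[OF R] by simp
qed

text \<open>By the previous identity the energy is an integral linear in the partial sum and its
  derivative. Young's inequality bounds it by a fixed quantity plus half of the energy, which is
  absorbed; the bound is independent of I.\<close>

lemma bump_energy:
 assumes R: "R > 0" and I: "finite I"
 shows "energy I (bump_coeff R) <= om * (R ^ (D + 2) * (4 + R ^ 4))"
proof -
 define c where "c = bump_coeff R"
 let ?f = "comb I c" and ?f1 = "comb1 I c"
 let ?q = "%s. s ^ (D - 1) * (4 * s^2 + s^2 * (R^2 - s^2)^2)"
 let ?e = "%s. s ^ (D - 1) * ((?f1 s)^2 + s^2 * (?f s)^2)"
 have "energy I c = (\<Sum>n\<in>I. c n * ((lam n)^2 * bump_coeff R n))"
  unfolding energy_def c_def by (simp add: power2_eq_square mult_ac)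
 also have "... = (\<Sum>n\<in>I. om * integral {0..R} (%s. c n * (s ^ (D - 1) * (- 2 * s * F1 n s + s^2 * (R^2 - s^2) * F n s))))"
  unfolding bump_coeff_parts[OF R] by (simp add: mult_ac)
 also have "... = om * integral {0..R} (%s. \<Sum>n\<in>I. c n * (s ^ (D - 1) * (- 2 * s * F1 n s + s^2 * (R^2 - s^2) * F n s)))"
  unfolding sum_distrib_left[symmetric]
  by (subst integral_sum[OF I]) (auto intro!: integrable_continuous_real continuous_intros F_cont F1_cont)
 finally have eq: "energy I c = ..." .
 have "integral {0..R} (%s. \<Sum>n\<in>I. c n * (s ^ (D - 1) * (- 2 * s * F1 n s + s^2 * (R^2 - s^2) * F n s)))
   = integral {0..R} (%s. s ^ (D - 1) * (- 2 * s * ?f1 s + s^2 * (R^2 - s^2) * ?f s))"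
  unfolding comb_def comb1_def
  by (intro Henstock_Kurzweil_Integration.integral_cong) (simp add: sum_distrib_left sum.distrib[symmetric] algebra_simps)
 also have "... <= integral {0..R} (%s. 1/2 * ?q s + 1/2 * ?e s)"
 proof (intro integral_le integrable_continuous_real continuous_intros)
  fix s assume s: "s \<in> {0..R}"
  have "- 2 * s * ?f1 s <= 1/2 * (4 * s^2 + (?f1 s)^2)"
   using zero_le_power2[of "2 * s + ?f1 s"] by (simp add: power2_sum power_mult_distrib)
  moreover have "(R^2 - s^2) * ?f s <= 1/2 * ((R^2 - s^2)^2 + (?f s)^2)"
  proof -
   have "a * b <= 1/2 * (a^2 + b^2)" for a b :: real using sum_squares_bound[of a b] by simp
   thus ?thesis .
  qed
  hence "s^2 * ((R^2 - s^2) * ?f s) <= s^2 * (1/2 * ((R^2 - s^2)^2 + (?f s)^2))"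
   by (intro mult_left_mono) auto
  ultimately have "- 2 * s * ?f1 s + s^2 * (R^2 - s^2) * ?f s <= 1/2 * (4 * s^2 + s^2 * (R^2 - s^2)^2) + 1/2 * ((?f1 s)^2 + s^2 * (?f s)^2)"
   by (simp add: algebra_simps)
  hence "s ^ (D - 1) * (- 2 * s * ?f1 s + s^2 * (R^2 - s^2) * ?f s) <= s ^ (D - 1) * (1/2 * (4 * s^2 + s^2 * (R^2 - s^2)^2) + 1/2 * ((?f1 s)^2 + s^2 * (?f s)^2))"
   using s by (intro mult_left_mono) auto
  thus "s ^ (D - 1) * (- 2 * s * ?f1 s + s^2 * (R^2 - s^2) * ?f s) <= 1/2 * ?q s + 1/2 * ?e s"
   by (simp add: algebra_simps)
 qed
 also have "... = integral {0..R} (%s. 1/2 * ?q s) + integral {0..R} (%s. 1/2 * ?e s)"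
  by (intro Henstock_Kurzweil_Integration.integral_add integrable_continuous_real continuous_intros)
 also have "... = 1/2 * integral {0..R} ?q + 1/2 * integral {0..R} ?e"
  by (simp only: integral_mult_right)
 also have "... <= 1/2 * (R ^ (D + 2) * (4 + R ^ 4)) + 1/2 * (energy I c / om)"
 proof (intro add_mono mult_left_mono comb_energy_le I)
  have "norm (integral (cbox 0 R) ?q) <= R ^ (D - 1) * (R^2 * (4 + R ^ 4)) * measure lborel (cbox 0 R)"
  proof (rule has_integral_bound[OF _ integrable_integral])
   show "?q integrable_on cbox 0 R" unfolding box_real by (intro integrable_continuous_real continuous_intros)
   show "0 <= R ^ (D - 1) * (R^2 * (4 + R ^ 4))" using R by auto
   fix s assume "s \<in> cbox 0 R"
   hence s: "0 <= s" "s <= R" by auto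
   have s2: "s^2 <= R^2" using s by (intro power_mono) auto
   have "(R^2 - s^2)^2 <= (R^2)^2" using s2 by (intro power_mono) auto
   hence "4 + (R^2 - s^2)^2 <= 4 + R ^ 4" by (simp flip: power_mult)
   hence "s ^ (D - 1) * (s^2 * (4 + (R^2 - s^2)^2)) <= R ^ (D - 1) * (R^2 * (4 + R ^ 4))"
    using s s2 R by (intro mult_mono power_mono) auto
   moreover have "norm (?q s) = s ^ (D - 1) * (s^2 * (4 + (R^2 - s^2)^2))"
    using s by (simp add: algebra_simps)
   ultimately show "norm (?q s) <= R ^ (D - 1) * (R^2 * (4 + R ^ 4))" by simp
  qed
  hence "integral {0..R} ?q <= R ^ (D - 1) * (R^2 * (4 + R ^ 4)) * R"
   using R by simp
  also have "... = R ^ (D + 2) * (4 + R ^ 4)"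
  proof -
   have "R ^ (D - 1) * R = R ^ D" using dim power_minus_mult[of D R] by simp
   moreover have "R ^ (D - 1) * (R^2 * (4 + R ^ 4)) * R = (R ^ (D - 1) * R) * R^2 * (4 + R ^ 4)"
    by (simp only: mult_ac)
   ultimately show ?thesis by (simp only: power_add)
  qed
  finally show "integral {0..R} ?q <= ..." .
 qed auto
 finally have "om * integral {0..R} (%s. \<Sum>n\<in>I. c n * (s ^ (D - 1) * (- 2 * s * F1 n s + s^2 * (R^2 - s^2) * F n s)))
   <= om * (1/2 * (R ^ (D + 2) * (4 + R ^ 4)) + 1/2 * (energy I c / om))"
  using om_pos by (intro mult_left_mono) auto
 hence "energy I c <= om * (1/2 * (R ^ (D + 2) * (4 + R ^ 4)) + 1/2 * (energy I c / om))"
  unfolding eq[symmetric] .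
 also have "... = 1/2 * (om * (R ^ (D + 2) * (4 + R ^ 4))) + 1/2 * energy I c"
  using om_pos by (simp add: algebra_simps)
 finally show ?thesis unfolding c_def[symmetric] by simp
qed

lemma comb_weighted:
 assumes I: "finite I"
 shows "(\<L> x. enn ((norm (x::'a))^2 * (comb I c (norm x))^2)) <= enn (energy I c)"
proof -
 have [measurable]: "comb I c \<in> borel_measurable borel"
  by (intro borel_measurable_continuous_onI comb_cont)
 let ?g = "%r. r ^ (D - 1) * ((comb1 I c r)^2 + r^2 * (comb I c r)^2)"
 have "(\<L> x. enn ((norm (x::'a))^2 * (comb I c (norm x))^2))
   = ennreal om * (\<L> r. enn (r ^ (D - 1)) * indicator {0..} r * enn (r^2 * (comb I c r)^2))"
  by (rule nn_integral_radial') measurable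
 also have "(\<L> r. enn (r ^ (D - 1)) * indicator {0..} r * enn (r^2 * (comb I c r)^2))
   = (\<L> r. enn (r ^ (D - 1)) * enn (r^2 * (comb I c r)^2) * indicator {0..} r)"
  by (intro nn_integral_cong) (auto simp: indicator_def)
 also have "... <= enn (energy I c / om)"
 proof (rule nn_integral_cutoff_le)
  fix k :: nat
  have "(\<L> r. enn (r ^ (D - 1)) * enn (r^2 * (comb I c r)^2) * indicator {0..real k} r)
    <= (\<L> r. enn (?g r) * indicator {0..real k} r)"
  proof (intro nn_integral_mono)
   fix r
   have "r ^ (D - 1) * (r^2 * (comb I c r)^2) <= ?g r" if "r >= 0" using that by (intro mult_left_mono) auto
   thus "enn (r ^ (D - 1)) * enn (r^2 * (comb I c r)^2) * indicator {0..real k} r <= enn (?g r) * indicator {0..real k} r"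
    by (auto simp: indicator_def ennreal_leI simp flip: ennreal_mult)
  qed
  also have "... = enn (integral {0..real k} ?g)"
   by (intro nn_integral_has_integral_lebesgue' integrable_integral integrable_continuous_real continuous_intros) auto
  also have "... <= enn (energy I c / om)" by (intro ennreal_leI comb_energy_le I)
  finally show "(\<L> r. enn (r ^ (D - 1)) * enn (r^2 * (comb I c r)^2) * indicator {0..real k} r) <= ..." .
 qed measurable
 also have "ennreal om * enn (energy I c / om) = enn (energy I c)"
  using om_pos by (subst ennreal_mult''[symmetric]) (auto simp: energy_def intro!: divide_nonneg_pos sum_nonneg)
 finally show ?thesis by (simp add: mult_left_mono)
qed

definition bump_sum :: "real => nat => 'a => real" where
 "bump_sum R N x = (\<Sum>n\<le>N. bump_coeff R n * h n x)"

lemma bump_sum_measurable [measurable]: "bump_sum R N \<in> borel_measurable borel"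
 unfolding bump_sum_def [abs_def] by (intro borel_measurable_continuous_onI continuous_intros h_cont)

lemma bump_bound: "0 <= bump R x" "bump R x <= R^2" "x \<notin> cball 0 \<bar>R\<bar> ==> bump R x = 0"
proof -
 assume "x \<notin> cball 0 \<bar>R\<bar>"
 hence "\<bar>R\<bar>^2 <= (norm x)^2" by (intro power_mono) auto
 thus "bump R x = 0" by (simp add: bump_def)
qed (auto simp: bump_def)

lemma bounded_support_in_Lp:
 fixes f :: "'a => 'b::real_normed_vector"
 assumes q: "q > 0" and [measurable]: "f \<in> borel_measurable lborel"
  and B: "\<And>x. norm (f x) <= B" and s: "\<And>x. x \<notin> cball 0 R ==> f x = 0" and R: "R >= 0"
 shows "in_Lp lborel q f"
proof -
 have "Lp_int lborel q f <= (\<L> x. enn (B powr q) * indicator (cball (0::'a) R) x)"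
  unfolding Lp_int_def
 proof (intro nn_integral_mono)
  fix x
  have "norm (f x) powr q <= B powr q" using B q by (intro powr_mono2) auto
  thus "enn (norm (f x) powr q) <= enn (B powr q) * indicator (cball (0::'a) R) x"
   using s[of x] by (auto simp: indicator_def ennreal_leI)
 qed
 also have "... = enn (B powr q) * emeasure lborel (cball (0::'a) R)"
  by (simp add: nn_integral_cmult_indicator)
 also have "... < \<top>" using R by (simp add: emeasure_cball ennreal_mult_less_top)
 finally show ?thesis by (simp add: in_Lp_def Lp_norm_finite_iff)
qed

lemma bump_in_Lp: "q > 0 ==> in_Lp lborel q (bump R)"
 by (rule bounded_support_in_Lp[where B="R^2" and R="\<bar>R\<bar>"]) (use bump_bound in auto)

text \<open>Completeness of the eigenfunctions among radial functions enters here, applied to the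
  bump regarded as complex-valued.\<close>

lemma bump_L2: "(%N. (\<L> x. enn ((bump R x - bump_sum R N x)^2))) \<longlonglongrightarrow> 0"
proof -
 define f :: "'a => complex" where "f x = of_real (bump R x)" for x
 have rad: "radial f" unfolding radial_def f_def bump_def by simp
 have "Lp_int lborel 2 f = Lp_int lborel 2 (bump R)" unfolding Lp_int_def f_def by simp
 hence "in_Lp lborel 2 f"
  using bump_in_Lp[of 2 R] by (simp add: in_Lp_def Lp_norm_finite_iff f_def [abs_def])
 with rad have "(%N. Lp_norm lborel 2 (%x. f x - (\<Sum>n\<le>N. (\<I> y. f y * of_real (h n y)) * of_real (h n x)))) \<longlonglongrightarrow> 0"
  using basis unfolding radial_eigenbasis_def by blast
 moreover have "(%x. f x - (\<Sum>n\<le>N. (\<I> y. f y * of_real (h n y)) * of_real (h n x))) = (%x. of_real (bump R x - bump_sum R N x))" for N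
  unfolding f_def bump_sum_def bump_coeff_def by (simp flip: of_real_mult)
 ultimately have L: "(%N. Lp_norm lborel 2 (%x. complex_of_real (bump R x - bump_sum R N x))) \<longlonglongrightarrow> 0"
  by simp
 have "(%N. Lp_int lborel 2 (%x. complex_of_real (bump R x - bump_sum R N x))) \<longlonglongrightarrow> 0"
 proof (rule order_tendstoI)
  fix c :: ennreal assume "0 < c"
  then obtain e where e: "e > 0" "enn e < c"
  proof (cases c)
   case (real x)
   hence "0 < x / 2" "enn (x / 2) < c" using \<open>0 < c\<close> by (auto simp: ennreal_less_iff)
   thus ?thesis by (rule that)
  next
   case top
   thus ?thesis using that[of 1] by simp
  qed
  have "0 < enn (sqrt e)" using e by simp
  hence "\<forall>\<^sub>F N in sequentially. Lp_norm lborel 2 (%x. complex_of_real (bump R x - bump_sum R N x)) < enn (sqrt e)"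
   by (rule order_tendstoD(2)[OF L])
  thus "\<forall>\<^sub>F N in sequentially. Lp_int lborel 2 (%x. complex_of_real (bump R x - bump_sum R N x)) < c"
  proof (rule eventually_mono)
   fix N assume "Lp_norm lborel 2 (%x. complex_of_real (bump R x - bump_sum R N x)) < enn (sqrt e)"
   hence "Lp_int lborel 2 (%x. complex_of_real (bump R x - bump_sum R N x)) <= enn (sqrt e powr 2)" (is "?a <= _")
    using e by (intro Lp_norm_le_iff[THEN iffD1]) auto
   also have "... < c" using e by (simp add: powr_numeral)
   finally show "?a < c" .
  qed
 qed auto
 thus ?thesis
  unfolding Lp_int_def norm_of_real by (simp add: powr_numeral)
qed

end

lemma in_Lp_add:
 fixes f g :: "'a => 'b::{real_normed_vector, second_countable_topology}"
 assumes "in_Lp M p f" "in_Lp M p g" "p >= 1"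
 shows "in_Lp M p (%x. f x + g x)"
proof -
 have "Lp_norm M p (%x. f x + g x) <= Lp_norm M p f + Lp_norm M p g"
  by (rule Lp_norm_triangle) (use assms in \<open>auto simp: in_Lp_def\<close>)
 also have "... < \<infinity>" using assms by (simp add: in_Lp_def)
 finally show ?thesis using assms by (simp add: in_Lp_def borel_measurable_add)
qed

lemma in_Lp_scaled:
 assumes "in_Lp M p g" "p > 0" "f \<in> borel_measurable M" "\<And>x. norm (f x) = c * norm (g x)" "c >= 0"
 shows "in_Lp M p f"
proof -
 have [measurable]: "g \<in> borel_measurable M" using assms by (simp add: in_Lp_def)
 have "Lp_int M p f = (\<integral>\<^sup>+x. enn (c powr p) * enn (norm (g x) powr p) \<partial>M)"
  unfolding Lp_int_def by (intro nn_integral_cong) (simp add: assms(4) powr_mult ennreal_mult)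
 also have "... = enn (c powr p) * Lp_int M p g"
  unfolding Lp_int_def by (rule nn_integral_cmult) measurable
 finally have "Lp_int M p f < \<top>"
  using assms(1) by (simp add: in_Lp_def Lp_norm_finite_iff ennreal_mult_less_top)
 thus ?thesis using assms by (simp add: in_Lp_def Lp_norm_finite_iff)
qed

lemma tendsto_ennreal_0I:
 fixes f :: "nat => ennreal"
 assumes "\<And>e::real. e > 0 ==> \<forall>\<^sub>F n in sequentially. f n <= enn e"
 shows "f \<longlonglongrightarrow> 0"
proof (rule order_tendstoI)
 fix c :: ennreal assume "0 < c"
 then obtain e where e: "e > 0" "enn e < c"
 proof (cases c)
  case (real x)
  hence "0 < x / 2" "enn (x / 2) < c" using \<open>0 < c\<close> by (auto simp: ennreal_less_iff)
  thus ?thesis by (rule that)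
 next
  case top
  thus ?thesis using that[of 1] by simp
 qed
 show "\<forall>\<^sub>F n in sequentially. f n < c"
  using assms[OF e(1)] by (rule eventually_mono) (use e in auto)
qed auto

lemma sum_atMost_split:
 fixes f :: "nat => 'b::comm_monoid_add"
 assumes "N <= K"
 shows "sum f {..K} = sum f {..N} + sum f {N<..K}"
proof -
 have "{..K} = {..N} \<union> {N<..K}" using assms by auto
 moreover have "{..N} \<inter> {N<..K} = {}" by auto
 ultimately show ?thesis using sum.union_disjoint[of "{..N}" "{N<..K}" f] by simp
qed

context radial_basis
begin

lemma field_in_Lp:
 assumes q: "q >= 1" and I: "finite I"
 shows "in_Lp lborel q (field I u)"
 using I
proof (induction I)
 case empty
 thus ?case
  using q by (simp add: field_def [abs_def] in_Lp_def Lp_norm_Lp_int Lp_int_def)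
next
 case (insert n I)
 have "in_Lp lborel q (%x. u n * of_real (h n x))"
 proof (rule in_Lp_scaled[OF h_in_Lp[OF q]])
  show "norm (u n * of_real (h n x)) = cmod (u n) * norm (h n x)" for x by (simp add: norm_mult)
 qed (use q in \<open>auto intro!: borel_measurable_continuous_onI continuous_intros h_cont\<close>)
 from in_Lp_add[OF this insert.IH q] show ?case
  using insert.hyps by (simp add: field_def [abs_def])
qed

lemma bump_sum_comb: "bump_sum R N x = comb {..N} (bump_coeff R) (norm x)"
 unfolding bump_sum_def comb_def by (simp add: h_F)

lemma bump_sum_in_Lp:
 assumes q: "q >= 1"
 shows "in_Lp lborel q (bump_sum R N)"
proof -
 have L: "in_Lp lborel q (field {..N} (%n. of_real (bump_coeff R n)))" by (rule field_in_Lp[OF q]) simp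
 have eq: "field {..N} (%n. of_real (bump_coeff R n)) x = of_real (bump_sum R N x)" for x
  unfolding field_def bump_sum_def by simp
 show ?thesis
 proof (rule in_Lp_scaled[OF L, where c=1])
  show "norm (bump_sum R N x) = 1 * norm (field {..N} (%n. of_real (bump_coeff R n)) x)" for x
   unfolding eq by simp
 qed (use q in simp_all)
qed

definition bump_tail :: "real => nat => real" where
 "bump_tail R N = (\<Sum>n. (lam n)^2 * (bump_coeff R n)^2) - (\<Sum>n\<le>N. (lam n)^2 * (bump_coeff R n)^2)"

lemma bump_summable: "R > 0 ==> summable (%n. (lam n)^2 * (bump_coeff R n)^2)"
 using bump_energy[of R "{..<n}" for n]
 by (intro summableI_nonneg_bounded[where x="om * (R ^ (D + 2) * (4 + R ^ 4))"]) (auto simp: energy_def)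

lemma bump_tail_tendsto:
 assumes "R > 0" shows "bump_tail R \<longlonglongrightarrow> 0"
proof -
 have "(%N. \<Sum>n\<le>N. (lam n)^2 * (bump_coeff R n)^2) \<longlonglongrightarrow> (\<Sum>n. (lam n)^2 * (bump_coeff R n)^2)"
  by (rule summable_LIMSEQ'[OF bump_summable[OF assms]])
 from tendsto_diff[OF tendsto_const[of "\<Sum>n. (lam n)^2 * (bump_coeff R n)^2"] this] show ?thesis
  unfolding bump_tail_def [abs_def] by simp
qed

lemma bump_tail_energy:
 assumes R: "R > 0"
 shows "energy {N<..K} (bump_coeff R) <= bump_tail R N"
proof (cases "N <= K")
 case True
 have "(\<Sum>n\<le>K. (lam n)^2 * (bump_coeff R n)^2) = (\<Sum>n\<le>N. (lam n)^2 * (bump_coeff R n)^2) + energy {N<..K} (bump_coeff R)"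
  unfolding energy_def by (rule sum_atMost_split[OF True])
 moreover have "(\<Sum>n\<le>K. (lam n)^2 * (bump_coeff R n)^2) <= (\<Sum>n. (lam n)^2 * (bump_coeff R n)^2)"
  by (rule sum_le_suminf[OF bump_summable[OF R]]) auto
 ultimately show ?thesis by (simp add: bump_tail_def)
next
 case False
 have "(\<Sum>n\<le>N. (lam n)^2 * (bump_coeff R n)^2) <= (\<Sum>n. (lam n)^2 * (bump_coeff R n)^2)"
  by (rule sum_le_suminf[OF bump_summable[OF R]]) auto
 thus ?thesis using False by (simp add: bump_tail_def energy_def)
qed

text \<open>The partial sums converge almost everywhere along a subsequence, so Fatou's lemma
  transfers the weighted bound for finite differences to the full remainder.\<close>

lemma bump_weighted:
 assumes R: "R > 0"
 shows "(\<L> x. enn ((norm x)^2 * (bump R x - bump_sum R N x)^2)) <= enn (bump_tail R N)"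
proof -
 have "in_Lp lborel 2 (%x. bump R x - bump_sum R n x)" for n
  by (intro in_Lp_diff bump_in_Lp bump_sum_in_Lp) auto
 hence fin: "(\<L> x. enn ((bump R x - bump_sum R n x)^2)) < \<top>" for n
  by (simp add: in_Lp_def Lp_norm_finite_iff Lp_int_def powr_numeral)
 hence int: "integrable lborel (%x. (bump R x - bump_sum R n x)^2)" for n
  by (intro integrableI_nonneg) auto
 have L1: "(%n. \<integral>x. norm ((bump R x - bump_sum R n x)^2) \<partial>lborel) \<longlonglongrightarrow> 0"
 proof -
  have "(\<I> x. norm ((bump R x - bump_sum R n x)^2)) = enn2real (\<L> x. enn ((bump R x - bump_sum R n x)^2))" for n
   by (subst integral_eq_nn_integral) auto
  moreover have "(%n. enn2real (\<L> x. enn ((bump R x - bump_sum R n x)^2))) \<longlonglongrightarrow> enn2real 0"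
   using bump_L2[of R] by (intro tendsto_enn2real) auto
  ultimately show ?thesis by simp
 qed
 from tendsto_L1_AE_subseq[OF int L1] obtain r
  where r: "strict_mono r" "AE x in lborel. (%k. (bump R x - bump_sum R (r k) x)^2) \<longlonglongrightarrow> 0" by blast
 have "(\<L> x. enn ((norm x)^2 * (bump R x - bump_sum R N x)^2))
   <= (\<L> x. liminf (%k. enn ((norm x)^2 * (bump_sum R (r k) x - bump_sum R N x)^2)))"
 proof (rule nn_integral_mono_AE, rule AE_mp[OF r(2)], intro AE_I2 impI)
  fix x assume "(%k. (bump R x - bump_sum R (r k) x)^2) \<longlonglongrightarrow> 0"
  hence "(%k. sqrt ((bump R x - bump_sum R (r k) x)^2)) \<longlonglongrightarrow> sqrt 0" by (rule tendsto_real_sqrt)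
  hence "(%k. bump R x - bump_sum R (r k) x) \<longlonglongrightarrow> 0" by (simp add: tendsto_rabs_zero_iff)
  from tendsto_diff[OF tendsto_const[of "bump R x"] this]
  have "(%k. bump_sum R (r k) x) \<longlonglongrightarrow> bump R x" by simp
  hence "(%k. enn ((norm x)^2 * (bump_sum R (r k) x - bump_sum R N x)^2)) \<longlonglongrightarrow> enn ((norm x)^2 * (bump R x - bump_sum R N x)^2)"
   by (intro tendsto_ennrealI tendsto_intros)
  from lim_imp_Liminf[OF trivial_limit_sequentially this]
  show "enn ((norm x)^2 * (bump R x - bump_sum R N x)^2) <= liminf (%k. enn ((norm x)^2 * (bump_sum R (r k) x - bump_sum R N x)^2))"
   by simp
 qed
 also have "... <= liminf (%k. (\<L> x. enn ((norm x)^2 * (bump_sum R (r k) x - bump_sum R N x)^2)))"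
  by (rule nn_integral_liminf) measurable
 also have "... <= liminf (%k::nat. enn (bump_tail R N))"
 proof (rule Liminf_mono, rule eventually_sequentiallyI[of N])
  fix k assume "N <= k"
  hence Nr: "N <= r k" using seq_suble[OF r(1), of k] by simp
  have "bump_sum R (r k) x - bump_sum R N x = comb {N<..r k} (bump_coeff R) (norm x)" for x
   by (simp only: bump_sum_comb comb_def sum_atMost_split[OF Nr] add_diff_cancel_left')
  hence "(\<L> x. enn ((norm x)^2 * (bump_sum R (r k) x - bump_sum R N x)^2)) <= enn (energy {N<..r k} (bump_coeff R))" (is "?a <= _")
   by (simp add: comb_weighted)
  also have "... <= enn (bump_tail R N)" by (intro ennreal_leI bump_tail_energy R)
  finally show "?a <= ..." .
 qed
 finally show ?thesis by (simp add: Liminf_const)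
qed

lemma weight_integrable:
 assumes e: "e > real D"
 shows "(\<L> x. enn ((1 + norm (x::'a)) powr (- e))) < \<top>"
proof -
 have "(\<L> x. enn ((1 + norm (x::'a)) powr (- e)))
   <= (\<L> x. indicator (cball (0::'a) 1) x + enn (norm x powr (- e)) * indicator {1..} (norm x))"
 proof (intro nn_integral_mono)
  fix x :: 'a
  show "enn ((1 + norm x) powr (- e)) <= indicator (cball (0::'a) 1) x + enn (norm x powr (- e)) * indicator {1..} (norm x)"
  proof (cases "norm x < 1")
   case True
   have "(1 + norm x) powr (- e) <= (1 + norm x) powr 0" using e by (intro powr_mono) auto
   also have "... = 1" by (simp add: add_nonneg_eq_0_iff)
   finally have "enn ((1 + norm x) powr (- e)) <= 1" by (metis ennreal_1 ennreal_leI)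
   thus ?thesis using True by simp
  next
   case False
   hence "(1 + norm x) powr (- e) <= norm x powr (- e)" using e by (intro powr_mono2') auto
   hence "enn ((1 + norm x) powr (- e)) <= enn (norm x powr (- e)) * indicator {1..} (norm x)"
    using False by (simp add: ennreal_leI)
   thus ?thesis by (rule order_trans) simp
  qed
 qed
 also have "... = emeasure lborel (cball (0::'a) 1) + (\<L> x. enn (norm (x::'a) powr (- e)) * indicator {1..} (norm x))"
  by (subst nn_integral_add) (auto intro!: borel_measurable_indicator)
 also have "... < \<top>" using e by (simp add: nn_integral_norm_powr_far emeasure_cball)
 finally show ?thesis .
qed

text \<open>Convergence in the energy norm implies convergence in \<open>L\<^sup>q\<close>, because \<open>1/(1+|x|)\<close> lies in
 \<open>L\<^bsup>2q/(2-q)\<^esup>\<close>.\<close>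

lemma bump_Lq:
 assumes R: "R > 0" and q: "1 < q" "q < 2" "2 * q / (2 - q) > real D"
 shows "(%N. Lp_int lborel q (%x. bump_sum R N x - bump R x)) \<longlonglongrightarrow> 0"
proof (rule tendsto_ennreal_0I)
 fix e :: real assume e: "e > 0"
 define J where "J = enn2real (\<L> x. enn ((1 + norm (x::'a)) powr (- (2 * q / (2 - q)))))"
 have J0: "J >= 0" by (simp add: J_def)
 have J: "(\<L> x. enn ((1 + norm (x::'a)) powr (- (2 * q / (2 - q))))) = enn J"
  unfolding J_def using weight_integrable[OF q(3)] by (simp add: less_top)
 \<comment> \<open>The conjugate exponent of 2/q: the weight 1/(1+|x|)^q, raised to it, becomes the
   integrable power with exponent -2q/(2-q).\<close>
 define q' where "q' = 2 / (2 - q)"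
 have q': "q' > 1" "2 / q > 1" "1 / (2/q) + 1 / q' = 1" using q by (auto simp: q'_def field_simps)
 define t where "t = (e / (2 * (J + 1))) powr (1 / q')"
 have t: "t > 0" using e J0 by (simp add: t_def)
 have tq: "t powr q' * J <= e / 2"
 proof -
  have "t powr q' = e / (2 * (J + 1))" using e J0 q' by (simp add: t_def powr_powr)
  hence "t powr q' * J = e / 2 * (J / (J + 1))" using J0 by (simp add: field_simps)
  also have "... <= e / 2 * 1" using e J0 by (intro mult_left_mono) auto
  finally show ?thesis by simp
 qed
 define A where "A = t powr (- (2 / q)) * 2"
 have A: "A > 0" using t by (simp add: A_def)
 define \<psi> where "\<psi> N x = bump_sum R N x - bump R x" for N x
 have [measurable]: "\<psi> N \<in> borel_measurable borel" for N unfolding \<psi>_def by measurable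
 have pt: "\<bar>\<psi> N x\<bar> powr q <= A * ((\<psi> N x)^2 + (norm x)^2 * (\<psi> N x)^2) + t powr q' * (1 + norm x) powr (- (2 * q / (2 - q)))" for N x
 proof -
  let ?w = "1 + norm x"
  have w: "?w > 0" by (simp add: add_pos_nonneg)
  have "\<bar>\<psi> N x\<bar> powr q = (?w * \<bar>\<psi> N x\<bar>) powr q * ?w powr (- q)"
   using w by (simp add: powr_mult powr_minus)
  also have "... <= t powr (- (2/q)) * ((?w * \<bar>\<psi> N x\<bar>) powr q) powr (2/q) + t powr q' * (?w powr (- q)) powr q'"
   by (rule Young_scaled[OF q'(2,1,3)]) (use t in auto)
  also have "((?w * \<bar>\<psi> N x\<bar>) powr q) powr (2/q) = (?w * \<bar>\<psi> N x\<bar>)^2"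
   using q w by (simp add: powr_powr powr_numeral)
  also have "... = ?w^2 * (\<psi> N x)^2" by (simp add: power_mult_distrib)
  also have "(?w powr (- q)) powr q' = ?w powr (- (2 * q / (2 - q)))"
   by (simp add: powr_powr q'_def mult.commute)
  also have "t powr (- (2/q)) * (?w^2 * (\<psi> N x)^2) <= t powr (- (2/q)) * ((2 + 2 * (norm x)^2) * (\<psi> N x)^2)"
  proof (intro mult_left_mono mult_right_mono)
   show "?w^2 <= 2 + 2 * (norm x)^2" using sum_squares_bound[of 1 "norm x"] by (simp add: power2_sum)
  qed auto
  finally show ?thesis by (simp add: A_def algebra_simps)
 qed
 have main: "Lp_int lborel q (\<psi> N) <= enn A * ((\<L> x. enn ((bump R x - bump_sum R N x)^2)) + enn (bump_tail R N)) + enn (e / 2)" for N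
 proof -
  have "Lp_int lborel q (\<psi> N) <= (\<L> x. enn A * (enn ((\<psi> N x)^2) + enn ((norm x)^2 * (\<psi> N x)^2)) + enn (t powr q') * enn ((1 + norm x) powr (- (2 * q / (2 - q)))))"
   unfolding Lp_int_def using A pt
   by (intro nn_integral_mono) (simp flip: ennreal_mult ennreal_plus)
  also have "... = enn A * ((\<L> x. enn ((\<psi> N x)^2)) + (\<L> x. enn ((norm x)^2 * (\<psi> N x)^2))) + enn (t powr q') * enn J"
   unfolding J[symmetric] by (simp add: nn_integral_add nn_integral_cmult)
  also have "... <= enn A * ((\<L> x. enn ((bump R x - bump_sum R N x)^2)) + enn (bump_tail R N)) + enn (e / 2)"
  proof (intro add_mono mult_left_mono)
   show "(\<L> x. enn ((\<psi> N x)^2)) <= (\<L> x. enn ((bump R x - bump_sum R N x)^2))"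
    by (simp add: \<psi>_def power2_commute)
   show "(\<L> x. enn ((norm x)^2 * (\<psi> N x)^2)) <= enn (bump_tail R N)"
    using bump_weighted[OF R, of N] by (simp add: \<psi>_def power2_commute)
   show "enn (t powr q') * enn J <= enn (e / 2)"
    using tq J0 by (simp add: ennreal_leI flip: ennreal_mult)
  qed auto
  finally show ?thesis .
 qed
 have "(%N. enn A * ((\<L> x. enn ((bump R x - bump_sum R N x)^2)) + enn (bump_tail R N))) \<longlonglongrightarrow> enn A * (0 + enn 0)"
  by (intro ennreal_tendsto_cmult tendsto_add bump_L2 tendsto_ennrealI bump_tail_tendsto R) simp
 hence "\<forall>\<^sub>F N in sequentially. enn A * ((\<L> x. enn ((bump R x - bump_sum R N x)^2)) + enn (bump_tail R N)) < enn (e / 2)"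
  using e by (intro order_tendstoD(2)) auto
 hence "\<forall>\<^sub>F N in sequentially. Lp_int lborel q (\<psi> N) <= enn e"
 proof (rule eventually_mono)
  fix N assume "enn A * ((\<L> x. enn ((bump R x - bump_sum R N x)^2)) + enn (bump_tail R N)) < enn (e / 2)"
  hence "Lp_int lborel q (\<psi> N) <= enn (e / 2) + enn (e / 2)"
   by (intro order_trans[OF main] add_mono) auto
  also have "... = enn e" using e by (simp flip: ennreal_plus)
  finally show "Lp_int lborel q (\<psi> N) <= ..." .
 qed
 thus "\<forall>\<^sub>F N in sequentially. Lp_int lborel q (%x. bump_sum R N x - bump R x) <= enn e"
  unfolding \<psi>_def .
qed

end

lemma enn2real_inject_finite:
 assumes "enn2real a = enn2real b" "a < \<top>" "b < \<top>"
 shows "a = b"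
 using assms by (metis ennreal_enn2real)

lemma radial_compose:
 assumes "radial f"
 shows "radial (%x. k (f x))"
 unfolding radial_def
proof (intro allI impI)
 fix x y :: 'a assume "norm x = norm y"
 hence "f x = f y" using assms unfolding radial_def by blast
 thus "k (f x) = k (f y)" by simp
qed

lemma radial_add:
 assumes "radial f" "radial g"
 shows "radial (%x. f x + g x)"
 unfolding radial_def
proof (intro allI impI)
 fix x y :: 'a assume "norm x = norm y"
 hence "f x = f y" "g x = g y" using assms unfolding radial_def by blast+
 thus "f x + g x = f y + g y" by simp
qed

lemma radial_diff:
 assumes "radial f" "radial g"
 shows "radial (%x. f x - g x)"
 unfolding radial_def
proof (intro allI impI)
 fix x y :: 'a assume "norm x = norm y"
 hence "f x = f y" "g x = g y" using assms unfolding radial_def by blast+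
 thus "f x - g x = f y - g y" by simp
qed

context radial_basis
begin

text \<open>Inside the smaller ball both bumps are paraboloids whose difference is constant.
  Normalized, the difference is a continuous cutoff between the radii R and R + e.\<close>

lemma bump_diff_bounds:
 assumes R: "R > 0" and e: "e > 0"
 defines "\<psi> \<equiv> %x. (bump (R + e) x - bump R x) / ((R + e)^2 - R^2)"
 shows "norm x <= R ==> \<psi> x = 1" "norm x >= R + e ==> \<psi> x = 0" "0 <= \<psi> x" "\<psi> x <= 1"
proof -
 have d: "(R + e)^2 - R^2 > 0" using R e power_strict_mono[of R "R + e" 2] by simp
 have in1: "bump (R + e) x = (R + e)^2 - (norm x)^2" if "norm x <= R + e"
 proof -
  have "(norm x)^2 <= (R + e)^2" using that by (intro power_mono) auto
  thus ?thesis by (simp add: bump_def)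
 qed
 have in2: "bump R x = R^2 - (norm x)^2" if "norm x <= R"
 proof -
  have "(norm x)^2 <= R^2" using that by (intro power_mono) auto
  thus ?thesis by (simp add: bump_def)
 qed
 have out1: "bump (R + e) x = 0" if "norm x >= R + e"
 proof -
  have "(R + e)^2 <= (norm x)^2" using that R e by (intro power_mono) auto
  thus ?thesis by (simp add: bump_def)
 qed
 have out2: "bump R x = 0" if "norm x >= R"
 proof -
  have "R^2 <= (norm x)^2" using that R by (intro power_mono) auto
  thus ?thesis by (simp add: bump_def)
 qed
 show a: "\<psi> x = 1" if "norm x <= R" using in1 in2 that d e by (simp add: \<psi>_def)
 show b: "\<psi> x = 0" if "norm x >= R + e" using out1 out2 that e by (simp add: \<psi>_def)
 have c: "0 <= \<psi> x \<and> \<psi> x <= 1" if "R < norm x" "norm x < R + e"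
 proof -
  have "R^2 <= (norm x)^2" "(norm x)^2 <= (R + e)^2" using that R by (auto intro!: power_mono)
  thus ?thesis using in1 out2 that d by (simp add: \<psi>_def)
 qed
 show "0 <= \<psi> x" "\<psi> x <= 1"
  using a b c by (cases "norm x <= R"; cases "norm x >= R + e"; simp)+
qed

text \<open>Vanishing integrals against bumps give vanishing integrals over all centred balls. For a
  radial function, balls determine everything, since the function factors through the norm.\<close>

lemma radial_nonpos:
 fixes g :: "'a => real"
 assumes rad: "radial g" and meas: "g \<in> borel_measurable lborel"
  and int: "\<And>R. integrable lborel (%x. g x * indicator (cball 0 R) x)"
  and zero: "\<And>R. R > 0 ==> (\<I> x. g x * bump R x) = 0"
 shows "AE x in lborel. g x <= 0"
proof -
 have [measurable]: "g \<in> borel_measurable borel" using meas by simp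
 have cb [measurable]: "cball (0::'a) R \<in> sets borel" for R by simp
 have int_bump: "integrable lborel (%x. g x * bump R x)" for R
 proof (rule Bochner_Integration.integrable_bound)
  show "integrable lborel (%x. R^2 * (g x * indicator (cball 0 \<bar>R\<bar>) x))" by (intro integrable_mult_right int)
  show "AE x in lborel. norm (g x * bump R x) <= norm (R^2 * (g x * indicator (cball 0 \<bar>R\<bar>) x))"
  proof (intro AE_I2)
   fix x
   show "norm (g x * bump R x) <= norm (R^2 * (g x * indicator (cball 0 \<bar>R\<bar>) x))"
   proof (cases "x \<in> cball 0 \<bar>R\<bar>")
    case True
    have "\<bar>g x\<bar> * bump R x <= \<bar>g x\<bar> * R^2" by (intro mult_left_mono bump_bound) auto
    thus ?thesis using True bump_bound(1)[of R x] by (simp add: abs_mult mult.commute)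
   next
    case False
    thus ?thesis using bump_bound(3)[of x R] by simp
   qed
  qed
 qed measurable
 have ball0: "(\<I> x. g x * indicator (cball 0 R) x) = 0" if R: "R > 0" for R
 proof -
  define e where "e k = 1 / (real k + 1)" for k :: nat
  have e: "e k > 0" "e k <= 1" for k by (auto simp: e_def)
  have e0: "e \<longlonglongrightarrow> 0" unfolding e_def using LIMSEQ_inverse_real_of_nat by (simp add: inverse_eq_divide add.commute)
  define \<psi> where "\<psi> k x = (bump (R + e k) x - bump R x) / ((R + e k)^2 - R^2)" for k x
  have [measurable]: "\<psi> k \<in> borel_measurable borel" for k unfolding \<psi>_def [abs_def] by measurable
  note b = bump_diff_bounds[OF R e(1), folded \<psi>_def]
  have "(%k. (\<I> x. g x * \<psi> k x)) \<longlonglongrightarrow> (\<I> x. g x * indicator (cball 0 R) x)"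
  proof (rule integral_dominated_convergence[where w="%x. norm (g x * indicator (cball 0 (R + 1)) x)"])
   show "integrable lborel (%x. norm (g x * indicator (cball 0 (R + 1)) x))" by (intro integrable_norm int)
   show "AE x in lborel. (%k. g x * \<psi> k x) \<longlonglongrightarrow> g x * indicator (cball 0 R) x"
   proof (intro AE_I2 tendsto_mult tendsto_const tendsto_eventually)
    fix x :: 'a
    show "\<forall>\<^sub>F k in sequentially. \<psi> k x = indicator (cball 0 R) x"
    proof (cases "norm x <= R")
     case True
     thus ?thesis using b(1)[of x] by simp
    next
     case False
     hence "\<forall>\<^sub>F k in sequentially. e k < norm x - R"
      by (intro order_tendstoD(2)[OF e0]) simp
     thus ?thesis
     proof (rule eventually_mono)
      fix k assume "e k < norm x - R"
      hence "norm x >= R + e k" by simp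
      thus "\<psi> k x = indicator (cball 0 R) x" using b(2)[of k x] False by simp
     qed
    qed
   qed
   show "AE x in lborel. norm (g x * \<psi> k x) <= norm (g x * indicator (cball 0 (R + 1)) x)" for k
   proof (intro AE_I2)
    fix x :: 'a
    show "norm (g x * \<psi> k x) <= norm (g x * indicator (cball 0 (R + 1)) x)"
    proof (cases "norm x <= R + 1")
     case True
     have "\<bar>g x\<bar> * \<psi> k x <= \<bar>g x\<bar> * 1" by (intro mult_left_mono b(4)) auto
     thus ?thesis using True b(3)[of k x] by (simp add: abs_mult)
    next
     case False
     hence "norm x >= R + e k" using e(2)[of k] by simp
     thus ?thesis using b(2)[of k x] by simp
    qed
   qed
  qed measurable
  moreover have "(\<I> x. g x * \<psi> k x) = 0" for k
  proof -
   have "(\<I> x. g x * \<psi> k x) = (\<I> x. (g x * bump (R + e k) x - g x * bump R x) / ((R + e k)^2 - R^2))"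
    unfolding \<psi>_def by (simp add: right_diff_distrib)
   also have "... = ((\<I> x. g x * bump (R + e k) x) - (\<I> x. g x * bump R x)) / ((R + e k)^2 - R^2)"
    by (simp add: int_bump)
   also have "... = 0" using zero[of R] zero[of "R + e k"] R e(1)[of k] by simp
   finally show ?thesis .
  qed
  ultimately show ?thesis by (simp add: LIMSEQ_const_iff)
 qed
 \<comment> \<open>The positive and the negative part are pushed forward under the norm. Their
   agreement on half-lines, which are the ball integrals, makes the two measures equal.\<close>
 define M1 where "M1 = distr (density lborel (%x. enn (g x))) borel norm"
 define M2 where "M2 = distr (density lborel (%x. enn (- g x))) borel norm"
 have M1: "emeasure M1 A = (\<L> x. enn (g x) * indicator A (norm x))" if [measurable]: "A \<in> sets borel" for A
 proof -
  have [measurable]: "(norm -` A :: 'a set) \<in> sets borel"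
   using measurable_sets[of norm "borel :: 'a measure" borel A] that by simp
  have "emeasure M1 A = emeasure (density lborel (%x. enn (g x))) (norm -` A)"
   unfolding M1_def by (subst emeasure_distr) auto
  also have "... = (\<L> x. enn (g x) * indicator (norm -` A) x)"
   by (subst emeasure_density) auto
  finally show ?thesis by (simp add: indicator_def)
 qed
 have M2: "emeasure M2 A = (\<L> x. enn (- g x) * indicator A (norm x))" if [measurable]: "A \<in> sets borel" for A
 proof -
  have [measurable]: "(norm -` A :: 'a set) \<in> sets borel"
   using measurable_sets[of norm "borel :: 'a measure" borel A] that by simp
  have "emeasure M2 A = emeasure (density lborel (%x. enn (- g x))) (norm -` A)"
   unfolding M2_def by (subst emeasure_distr) auto
  also have "... = (\<L> x. enn (- g x) * indicator (norm -` A) x)"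
   by (subst emeasure_density) auto
  finally show ?thesis by (simp add: indicator_def)
 qed
 have fin_eq: "emeasure M1 {..R} = emeasure M2 {..R} \<and> emeasure M1 {..R} < \<infinity>" for R
 proof (cases "R > 0")
  case True
  let ?f = "%x. g x * indicator (cball 0 R) x"
  have 1: "emeasure M1 {..R} = (\<L> x. enn (?f x))"
   by (subst M1) (auto simp: indicator_def intro!: nn_integral_cong)
  have 2: "emeasure M2 {..R} = (\<L> x. enn (- ?f x))"
   by (subst M2) (auto simp: indicator_def intro!: nn_integral_cong)
  have f1: "(\<L> x. enn (?f x)) < \<infinity>" and f2: "(\<L> x. enn (- ?f x)) < \<infinity>"
   using int[of R] by (auto simp: real_integrable_def less_top)
  have "enn2real (\<L> x. enn (?f x)) - enn2real (\<L> x. enn (- ?f x)) = 0"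
   using real_lebesgue_integral_def[OF int[of R]] ball0[OF True] by simp
  hence "enn2real (\<L> x. enn (?f x)) = enn2real (\<L> x. enn (- ?f x))"
   by simp
  hence "(\<L> x. enn (?f x)) = (\<L> x. enn (- ?f x))"
   using f1[unfolded infinity_ennreal_def] f2[unfolded infinity_ennreal_def] by (rule enn2real_inject_finite)
  thus ?thesis using 1 2 f1 by simp
 next
  case False
  have z: "indicator {..R} (norm x) = (0::ennreal)" if "norm x > 0" for x :: 'a
  proof -
   have "\<not> norm x <= R" using that False by linarith
   thus ?thesis by (simp add: indicator_def)
  qed
  have "emeasure M1 {..R} = 0"
  proof -
   have "emeasure M1 {..R} = (\<integral>\<^sup>+x. 0 \<partial>(lborel::'a measure))"
    by (subst M1, simp) (intro nn_integral_cong_AE eventually_mono[OF AE_norm_pos], simp add: z)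
   thus ?thesis by simp
  qed
  moreover have "emeasure M2 {..R} = 0"
  proof -
   have "emeasure M2 {..R} = (\<integral>\<^sup>+x. 0 \<partial>(lborel::'a measure))"
    by (subst M2, simp) (intro nn_integral_cong_AE eventually_mono[OF AE_norm_pos], simp add: z)
   thus ?thesis by simp
  qed
  ultimately show ?thesis by simp
 qed
 have "M1 = M2"
 proof (rule measure_eqI_generator_eq[where E="range (%a::real. {..a})" and \<Omega>="UNIV::real set" and A="%i. {..real i}"])
  show "Int_stable (range (%a::real. {..a}))" by (auto simp: Int_stable_def)
  show "sets M1 = sigma_sets UNIV (range (%a::real. {..a}))" "sets M2 = sigma_sets UNIV (range (%a::real. {..a}))"
   by (simp_all add: M1_def M2_def borel_eq_atMost)
  show "(\<Union>i. {..real i}) = UNIV" using real_arch_simple by (auto simp: set_eq_iff)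
  show "emeasure M1 A = emeasure M2 A" if "A \<in> range (%a::real. {..a})" for A using that fin_eq by auto
  show "emeasure M1 {..real i} ~= \<infinity>" for i using fin_eq[of "real i"] by auto
 qed auto
 define G where "G r = g (r *\<^sub>R unit)" for r
 have [measurable]: "G \<in> borel_measurable borel" unfolding G_def [abs_def] by measurable
 have gG: "g x = G (norm x)" for x
 proof -
  have "norm x = norm (norm x *\<^sub>R unit)" by simp
  thus ?thesis unfolding G_def using rad unfolding radial_def by blast
 qed
 \<comment> \<open>The negative part of g vanishes over B, so \<open>M2 B\<close> is 0; equality of
   the measures then makes the positive part vanish almost everywhere.\<close>
 define B where "B = {r. G r > 0}"
 have [measurable]: "B \<in> sets borel" unfolding B_def by measurable
 have z: "enn (- g x) * indicator B (norm x) = 0" for x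
  by (cases "g x > 0") (auto simp: B_def indicator_def ennreal_neg simp flip: gG)
 have "emeasure M2 B = 0" by (subst M2, measurable) (simp only: z nn_integral_const mult_zero_left)
 hence "emeasure M1 B = 0" using \<open>M1 = M2\<close> by simp
 hence "(\<L> x. enn (g x) * indicator B (norm x)) = 0" by (simp add: M1)
 hence "AE x in lborel. enn (g x) * indicator B (norm x) = 0"
  by (subst (asm) nn_integral_0_iff_AE) auto
 thus ?thesis
 proof (rule eventually_mono)
  fix x assume a: "enn (g x) * indicator B (norm x) = 0"
  show "g x <= 0"
  proof (rule ccontr)
   assume "\<not> g x <= 0"
   hence "norm x \<in> B" "enn (g x) ~= 0" by (auto simp: B_def simp flip: gG)
   with a show False by simp
  qed
 qed
qed

text \<open>The Sobolev condition p < 2D/(D-2) multiplied out; in this form it holds automatically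
  for D = 2.\<close>

definition valid :: "real => bool" where
 "valid p \<longleftrightarrow> p > 2 \<and> p * (real D - 2) < 2 * real D"

lemma valid_dual:
 assumes p: "valid p"
 defines "q \<equiv> p / (p - 1)"
 shows "p > 1" "1 < q" "q < 2" "1 / p + 1 / q = 1" "2 * q / (2 - q) > real D"
proof -
 have p2: "p > 2" and pd: "p * (real D - 2) < 2 * real D" using p by (auto simp: valid_def)
 show "p > 1" "1 < q" "q < 2" "1 / p + 1 / q = 1" using p2 by (auto simp: q_def field_simps)
 have "2 * q / (2 - q) = 2 * p / (p - 2)" 
 proof -
  have "2 - q = (p - 2) / (p - 1)" using p2 by (simp add: q_def field_simps)
  thus ?thesis using p2 by (simp add: q_def)
 qed
 also have "... > real D" using pd p2 by (simp add: field_simps)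
 finally show "2 * q / (2 - q) > real D" .
qed

text \<open>The partial sums of a bump converge in the dual space L^q, which is exactly where p <
  2D/(D-2) is used. Hence f annihilates all bumps, and \<open>radial_nonpos\<close> applies to both
  signs of its real and imaginary parts.\<close>

lemma radial_zero:
 fixes f :: "'a => complex"
 assumes p: "valid p" and rad: "radial f" and f: "in_Lp lborel p f"
  and zero: "\<And>n. (\<I> x. f x * of_real (h n x)) = 0"
 shows "AE x in lborel. f x = 0"
proof -
 define q where "q = p / (p - 1)"
 note q = valid_dual[OF p, folded q_def]
 have q1: "q >= 1" "q > 0" using q by auto
 have fm [measurable]: "f \<in> borel_measurable borel" using f by (simp add: in_Lp_def)
 have bump0: "(\<I> x. f x * of_real (bump R x)) = 0" if R: "R > 0" for R
 proof -
  have "(%N. (\<I> x. f x * of_real (bump_sum R N x))) \<longlonglongrightarrow> (\<I> x. f x * of_real (bump R x))"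
   by (rule Lp_pairing_tendsto_right[OF f bump_sum_in_Lp[OF q1(1)] bump_in_Lp[OF q1(2)] q(1,2,4) bump_Lq[OF R q(2,3,5)]])
  moreover have "(\<I> x. f x * of_real (bump_sum R N x)) = 0" for N
  proof -
   have "f x * of_real (bump_sum R N x) = (\<Sum>n\<le>N. of_real (bump_coeff R n) * (f x * of_real (h n x)))" for x
    unfolding bump_sum_def by (simp add: sum_distrib_left mult_ac)
   hence "(\<I> x. f x * of_real (bump_sum R N x)) = (\<Sum>n\<le>N. of_real (bump_coeff R n) * (\<I> x. f x * of_real (h n x)))"
    using Lp_pairing(1)[OF f h_in_Lp[OF q1(1)] q(1,2,4) zero_less_one]
    by (simp add: Bochner_Integration.integral_sum)
   thus ?thesis by (simp add: zero)
  qed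
  ultimately show ?thesis by (simp add: LIMSEQ_const_iff)
 qed
 have ind: "in_Lp lborel q (indicator (cball (0::'a) R) :: 'a => real)" for R
  by (rule bounded_support_in_Lp[where B=1 and R="max 0 R"])
   (use q1 in \<open>auto simp: indicator_def intro!: borel_measurable_indicator\<close>)
 have int: "integrable lborel (%x. f x * of_real (indicator (cball 0 R) x))" for R
  by (rule Lp_pairing(1)[OF f ind q(1,2,4) zero_less_one])
 have intb: "integrable lborel (%x. f x * of_real (bump R x))" for R
  by (rule Lp_pairing(1)[OF f bump_in_Lp[OF q1(2)] q(1,2,4) zero_less_one])
 have ReIm: "AE x in lborel. Re (f x) <= 0" "AE x in lborel. - Re (f x) <= 0" "AE x in lborel. Im (f x) <= 0" "AE x in lborel. - Im (f x) <= 0"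
 proof -
  have c: "Re (z * of_real r) = Re z * r" "Im (z * of_real r) = Im z * r" for z r by simp_all
  have iR: "integrable lborel (%x. Re (f x) * indicator (cball 0 R) x)" "integrable lborel (%x. Im (f x) * indicator (cball 0 R) x)" for R
   using integrable_Re[OF int[of R]] integrable_Im[OF int[of R]] by (simp_all only: c)
  have zR: "(\<I> x. Re (f x) * bump R x) = 0" "(\<I> x. Im (f x) * bump R x) = 0" if "R > 0" for R
   using integral_Re[OF intb[of R]] integral_Im[OF intb[of R]] bump0[OF that] by (simp_all only: c complex.sel zero_complex.sel)
  have r: "radial (%x. Re (f x))" "radial (%x. Im (f x))" "radial (%x. - Re (f x))" "radial (%x. - Im (f x))"
   by (rule radial_compose[OF rad])+
  show "AE x in lborel. Re (f x) <= 0" by (rule radial_nonpos[OF r(1) _ iR(1) zR(1)]) measurable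
  show "AE x in lborel. Im (f x) <= 0" by (rule radial_nonpos[OF r(2) _ iR(2) zR(2)]) measurable
  show "AE x in lborel. - Re (f x) <= 0"
  proof (rule radial_nonpos[OF r(3)])
   show "integrable lborel (%x. - Re (f x) * indicator (cball 0 R) x)" for R
    using integrable_minus[OF iR(1)[of R]] by simp
   show "(\<I> x. - Re (f x) * bump R x) = 0" if "R > 0" for R using zR(1)[OF that] by simp
  qed measurable
  show "AE x in lborel. - Im (f x) <= 0"
  proof (rule radial_nonpos[OF r(4)])
   show "integrable lborel (%x. - Im (f x) * indicator (cball 0 R) x)" for R
    using integrable_minus[OF iR(2)[of R]] by simp
   show "(\<I> x. - Im (f x) * bump R x) = 0" if "R > 0" for R using zR(2)[OF that] by simp
  qed measurable
 qed
 thus ?thesis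
  by eventually_elim (simp add: complex_eq_iff)
qed

section \<open>The \<open>L\<^sup>p\<close> norm of a distribution\<close>

text \<open>With I = UNIV this is the set in \<open>Lp_norm_distribution\<close>. Finite I
  prescribes finitely many coefficients, for which the minimal norm is finite and depends
  continuously on u.\<close>

definition representatives :: "real => nat set => (nat => complex) => ('a => complex) set" where
 "representatives p I u = {f. radial f \<and> in_Lp lborel p f \<and>
   (\<forall>n\<in>I. has_bochner_integral lborel (%x. f x * of_real (h n x)) (u n))}"

definition min_norm :: "real => nat set => (nat => complex) => ennreal" where
 "min_norm p I u = (INF f\<in>representatives p I u. Lp_norm lborel p f)"

lemma Lp_norm_distribution_min_norm: "Lp_norm_distribution h p u = min_norm p UNIV u"
 unfolding Lp_norm_distribution_def min_norm_def representatives_def by simp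

lemma Lp_norm_distribution_eq:
 assumes p: "valid p" and f: "f \<in> representatives p UNIV u"
 shows "Lp_norm_distribution h p u = Lp_norm lborel p f"
proof -
 have "Lp_norm lborel p f' = Lp_norm lborel p f" if f': "f' \<in> representatives p UNIV u" for f'
 proof -
  have "AE x in lborel. f' x - f x = 0"
  proof (rule radial_zero[OF p])
   show "radial (%x. f' x - f x)" using f f' by (intro radial_diff) (simp_all add: representatives_def)
   show "in_Lp lborel p (%x. f' x - f x)"
    using f f' valid_dual(1)[OF p] by (intro in_Lp_diff) (auto simp: representatives_def)
   fix n
   have "has_bochner_integral lborel (%x. f' x * of_real (h n x) - f x * of_real (h n x)) (u n - u n)"
    using f f' by (intro has_bochner_integral_diff) (auto simp: representatives_def)
   thus "(\<I> x. (f' x - f x) * of_real (h n x)) = 0"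
    by (simp add: has_bochner_integral_iff left_diff_distrib)
  qed
  thus ?thesis by (intro Lp_norm_cong_AE) auto
 qed
 hence "min_norm p UNIV u = (INF f'\<in>representatives p UNIV u. Lp_norm lborel p f)"
  unfolding min_norm_def by (intro INF_cong) auto
 also have "... = Lp_norm lborel p f" using f by (intro cINF_const) auto
 finally show ?thesis unfolding Lp_norm_distribution_min_norm .
qed

lemma field_coeff:
 assumes I: "finite I"
 shows "has_bochner_integral lborel (%x. field I u x * of_real (h n x)) (if n \<in> I then u n else 0)"
proof -
 have hb: "has_bochner_integral lborel (%x. u m * of_real (h m x * h n x)) (u m * of_real (if m = n then 1 else 0))" for m
  using has_bochner_integral_integrable[OF h_prod_integrable[of m n]] unfolding h_props(5)
  by (intro has_bochner_integral_mult_right has_bochner_integral_of_real) auto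
 have "has_bochner_integral lborel (%x. \<Sum>m\<in>I. u m * of_real (h m x * h n x)) (\<Sum>m\<in>I. u m * of_real (if m = n then 1 else 0))"
  by (intro has_bochner_integral_sum hb)
 moreover have "(\<Sum>m\<in>I. u m * of_real (if m = n then 1 else 0)) = (if n \<in> I then u n else 0)"
  using I by (simp add: if_distrib sum.delta cong: if_cong)
 moreover have "field I u x * of_real (h n x) = (\<Sum>m\<in>I. u m * of_real (h m x * h n x))" for x
  by (simp only: field_def sum_distrib_right of_real_mult mult.assoc)
 ultimately show ?thesis by simp
qed

lemma field_representative:
 assumes "finite I" "p >= 1"
 shows "field I u \<in> representatives p I u"
 unfolding representatives_def
proof (intro CollectI conjI ballI field_radial field_in_Lp assms)
 fix n assume "n \<in> I"
 thus "has_bochner_integral lborel (%x. field I u x * of_real (h n x)) (u n)"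
  using field_coeff[OF assms(1), of u n] by simp
qed

lemma min_norm_finite:
 assumes "finite I" "p >= 1"
 shows "min_norm p I u < \<top>"
proof -
 have "min_norm p I u <= Lp_norm lborel p (field I u)"
  unfolding min_norm_def by (intro INF_lower field_representative assms)
 also have "... < \<top>" using field_in_Lp[OF assms(2,1)] by (simp add: in_Lp_def)
 finally show ?thesis .
qed

lemma Lp_norm_field_le:
 assumes I: "finite I" and p: "p >= 1"
 shows "Lp_norm lborel p (field I w) <= enn (\<Sum>n\<in>I. cmod (w n) * enn2real (Lp_norm lborel p (h n)))"
 using I
proof (induction I)
 case empty
 thus ?case using p by (simp add: field_def [abs_def] Lp_norm_Lp_int Lp_int_def)
next
 case (insert n I)
 have [measurable]: "h n \<in> borel_measurable lborel" by simp
 obtain A where A: "Lp_norm lborel p (h n) = enn A" "A >= 0"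
  using h_in_Lp[OF p, of n] by (cases "Lp_norm lborel p (h n)") (auto simp: in_Lp_def)
 have "Lp_norm lborel p (%x. w n * of_real (h n x)) <= enn (cmod (w n) * A)"
 proof (subst Lp_norm_le_iff)
  have "Lp_int lborel p (%x. w n * of_real (h n x)) = (\<L> x. enn (cmod (w n) powr p) * enn (norm (h n x) powr p))" (is "?a = _")
   unfolding Lp_int_def by (intro nn_integral_cong) (simp add: norm_mult powr_mult ennreal_mult)
  also have "... = enn (cmod (w n) powr p) * Lp_int lborel p (h n)"
   unfolding Lp_int_def by (rule nn_integral_cmult) measurable
  also have "... = enn ((cmod (w n) * A) powr p)"
   using p Lp_int_eq_norm_powr[OF _ A] by (simp add: powr_mult ennreal_mult)
  finally show "?a <= ..." by simp
 qed (use p A in auto)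
 moreover have "Lp_norm lborel p (%x. w n * of_real (h n x) + field I w x) <= Lp_norm lborel p (%x. w n * of_real (h n x)) + Lp_norm lborel p (field I w)"
  by (rule Lp_norm_triangle) (use p in \<open>auto intro!: borel_measurable_continuous_onI continuous_intros h_cont\<close>)
 moreover have "field (insert n I) w = (%x. w n * of_real (h n x) + field I w x)"
  using insert.hyps by (simp add: field_def [abs_def])
 ultimately have "Lp_norm lborel p (field (insert n I) w) <= enn (cmod (w n) * A) + enn (\<Sum>n\<in>I. cmod (w n) * enn2real (Lp_norm lborel p (h n)))"
  using insert.IH by (auto intro: order_trans[OF _ add_mono])
 also have "... = enn (\<Sum>n\<in>insert n I. cmod (w n) * enn2real (Lp_norm lborel p (h n)))"
  using insert.hyps A by (simp add: ennreal_plus sum_nonneg)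
 finally show ?case .
qed

text \<open>Adding the finite sum with coefficients u - v turns a representative of v into one of u,
  so the minimal norms differ by at most the norm of that sum.\<close>

lemma min_norm_Lipschitz:
 assumes I: "finite I" and p: "p >= 1"
 shows "\<bar>enn2real (min_norm p I u) - enn2real (min_norm p I v)\<bar> <= (\<Sum>n\<in>I. cmod (u n - v n) * enn2real (Lp_norm lborel p (h n)))"
proof -
 let ?S = "%u v. \<Sum>n\<in>I. cmod (u n - v n) * enn2real (Lp_norm lborel p (h n))"
 have S0: "?S u v >= 0" for u v by (intro sum_nonneg) auto
 have le: "min_norm p I u <= min_norm p I v + enn (?S u v)" for u v
 proof -
  have "min_norm p I u <= Lp_norm lborel p f + enn (?S u v)" if f: "f \<in> representatives p I v" for f
  proof -
   define w where "w n = u n - v n" for n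
   have fm: "f \<in> borel_measurable lborel" using f by (simp add: representatives_def in_Lp_def)
   have "(%x. f x + field I w x) \<in> representatives p I u"
    unfolding representatives_def
   proof (intro CollectI conjI ballI)
    show "radial (%x. f x + field I w x)" using f by (intro radial_add field_radial) (simp add: representatives_def)
    show "in_Lp lborel p (%x. f x + field I w x)"
     using f by (intro in_Lp_add field_in_Lp p I) (simp add: representatives_def)
    fix n assume n: "n \<in> I"
    have "has_bochner_integral lborel (%x. f x * of_real (h n x) + field I w x * of_real (h n x)) (v n + (if n \<in> I then w n else 0))"
     using f n by (intro has_bochner_integral_add field_coeff I) (simp add: representatives_def)
    thus "has_bochner_integral lborel (%x. (f x + field I w x) * of_real (h n x)) (u n)"
     using n by (simp add: distrib_right w_def)
   qed
   hence "min_norm p I u <= Lp_norm lborel p (%x. f x + field I w x)"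
    unfolding min_norm_def by (rule INF_lower)
   also have "... <= Lp_norm lborel p f + Lp_norm lborel p (field I w)"
    by (rule Lp_norm_triangle[OF fm _ p]) simp
   also have "... <= Lp_norm lborel p f + enn (?S u v)"
    using Lp_norm_field_le[OF I p, of w] by (intro add_left_mono) (simp add: w_def)
   finally show ?thesis .
  qed
  note * = this
  show ?thesis
  proof (rule ennreal_le_epsilon)
   fix e :: real assume e: "e > 0"
   obtain b where b: "min_norm p I v = enn b" "b >= 0"
    using min_norm_finite[OF I p, of v] by (cases "min_norm p I v") auto
   have "(INF f\<in>representatives p I v. Lp_norm lborel p f) < enn (b + e)"
    using b e unfolding min_norm_def[symmetric] by (simp add: ennreal_less_iff)
   then obtain f where f: "f \<in> representatives p I v" "Lp_norm lborel p f < enn (b + e)"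
    by (auto simp: INF_less_iff)
   have "min_norm p I u <= Lp_norm lborel p f + enn (?S u v)" by (rule *[OF f(1)])
   also have "... <= enn (b + e) + enn (?S u v)" using f(2) by (intro add_right_mono) simp
   also have "... = min_norm p I v + enn (?S u v) + enn e"
    using b e by (simp add: ennreal_plus add_ac)
   finally show "min_norm p I u <= ..." .
  qed
 qed
 have sym: "?S v u = ?S u v" by (simp add: norm_minus_commute)
 obtain a b where "min_norm p I u = enn a" "a >= 0" "min_norm p I v = enn b" "b >= 0"
  using min_norm_finite[OF I p, of u] min_norm_finite[OF I p, of v]
  by (cases "min_norm p I u"; cases "min_norm p I v") auto
 thus ?thesis using le[of u v] le[of v u] S0[of u v] unfolding sym
  by (simp add: abs_le_iff flip: ennreal_plus)
qed

text \<open>The Lipschitz bound gives continuity in the product topology, whose Borel sets form the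
  product sigma-algebra.\<close>

lemma min_norm_measurable:
 assumes I: "finite I" and p: "p >= 1"
 shows "min_norm p I \<in> borel_measurable (PiM UNIV (%_. borel))"
proof -
 have "continuous_on UNIV (%u. enn2real (min_norm p I u))"
  unfolding continuous_on_eq_continuous_at[OF open_UNIV] isCont_def
 proof
  fix u :: "nat => complex"
  have "((%v. \<Sum>n\<in>I. cmod (v n - u n) * enn2real (Lp_norm lborel p (h n))) \<longlongrightarrow> (\<Sum>n\<in>I. cmod (u n - u n) * enn2real (Lp_norm lborel p (h n)))) (at u)"
  proof (intro tendsto_intros)
   fix n
   have "isCont (%v::nat => complex. v n) u"
   proof -
    have "continuous_on UNIV (%v::nat => complex. v n)" by (rule continuous_on_product_coordinates)
    from this[unfolded continuous_on_eq_continuous_at[OF open_UNIV]] show ?thesis by blast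
   qed
   thus "((%v. v n) \<longlongrightarrow> u n) (at u)" by (simp add: isCont_def)
  qed
  hence "((%v. \<Sum>n\<in>I. cmod (v n - u n) * enn2real (Lp_norm lborel p (h n))) \<longlongrightarrow> 0) (at u)" by simp
  hence "((%v. enn2real (min_norm p I v) - enn2real (min_norm p I u)) \<longlongrightarrow> 0) (at u)"
   by (rule Lim_null_comparison[rotated]) (use min_norm_Lipschitz[OF I p] in simp)
  thus "((%v. enn2real (min_norm p I v)) \<longlongrightarrow> enn2real (min_norm p I u)) (at u)"
   by (simp add: LIM_zero_iff)
 qed
 hence "(%u. enn2real (min_norm p I u)) \<in> borel_measurable borel" by (rule borel_measurable_continuous_onI)
 hence "(%u. enn (enn2real (min_norm p I u))) \<in> borel_measurable (PiM UNIV (%_. borel))"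
  by (simp add: measurable_cong_sets[OF sets_PiM_equal_borel refl])
 also have "(%u. enn (enn2real (min_norm p I u))) = min_norm p I"
  using min_norm_finite[OF I p] by (auto simp: fun_eq_iff)
 finally show ?thesis .
qed

text \<open>Representatives matching the first \<open>N\<close> coefficients with nearly minimal norm form a Cauchy
 sequence by Clarkson's inequality, since the midpoint of two of them is again such a representative.\<close>

lemma Lp_norm_distribution_SUP:
 assumes p: "p >= 2"
 shows "Lp_norm_distribution h p u = (SUP N. min_norm p {..N} u)"
proof (rule antisym)
 show "(SUP N. min_norm p {..N} u) <= Lp_norm_distribution h p u"
  unfolding Lp_norm_distribution_min_norm min_norm_def
  by (intro SUP_least INF_superset_mono) (auto simp: representatives_def)
 show "Lp_norm_distribution h p u <= (SUP N. min_norm p {..N} u)"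
 proof (cases "(SUP N. min_norm p {..N} u) = \<top>")
  case False
  have p1: "p >= 1" "p > 0" "p > 1" using p by auto
  obtain s where s: "(SUP N. min_norm p {..N} u) = enn s" "s >= 0"
   using False by (cases "SUP N. min_norm p {..N} u") auto
  define \<tau> where "\<tau> N = enn2real (min_norm p {..N} u)" for N
  have \<tau>: "min_norm p {..N} u = enn (\<tau> N)" "\<tau> N >= 0" for N
   using min_norm_finite[of "{..N}" p u] p1 by (auto simp: \<tau>_def)
  have \<tau>s: "\<tau> N <= s" for N
  proof -
   have "enn (\<tau> N) <= enn s" unfolding \<tau>(1)[symmetric] s(1)[symmetric] by (rule SUP_upper) simp
   thus ?thesis using s(2) by simp
  qed
  have mono: "\<tau> M <= \<tau> N" if "M <= N" for M N
  proof -
   have "min_norm p {..M} u <= min_norm p {..N} u"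
    unfolding min_norm_def using that by (intro INF_superset_mono) (auto simp: representatives_def)
   thus ?thesis using \<tau>[of M] \<tau>[of N] by simp
  qed
  have \<tau>_lim: "\<tau> \<longlonglongrightarrow> s"
  proof -
   have "(%N. min_norm p {..N} u) \<longlonglongrightarrow> (SUP N. min_norm p {..N} u)"
    by (intro LIMSEQ_SUP) (auto simp: incseq_def \<tau> mono intro!: ennreal_leI)
   hence "(%N. min_norm p {..N} u) \<longlonglongrightarrow> enn s" unfolding s(1) .
   hence "(%N. enn (\<tau> N)) \<longlonglongrightarrow> enn s" unfolding \<tau>(1) .
   thus ?thesis using \<tau>(2) s(2) by (simp add: tendsto_ennreal_iff)
  qed
  define de where "de N = 1 / (real N + 1)" for N :: nat
  have de: "de N > 0" for N by (simp add: de_def)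
  have de_mono: "de N <= de M" if "M <= N" for M N using that by (simp add: de_def frac_le)
  have de_lim: "de \<longlonglongrightarrow> 0"
   unfolding de_def using LIMSEQ_inverse_real_of_nat by (simp add: inverse_eq_divide add.commute)
  have "\<exists>f. f \<in> representatives p {..N} u \<and> Lp_norm lborel p f < enn (\<tau> N + de N)" for N
  proof -
   have "(INF f\<in>representatives p {..N} u. Lp_norm lborel p f) < enn (\<tau> N + de N)"
    using \<tau>[of N] de[of N] unfolding min_norm_def by (simp add: ennreal_lessI)
   thus ?thesis by (auto simp: INF_less_iff)
  qed
  then obtain f where f: "\<And>N. f N \<in> representatives p {..N} u" "\<And>N. Lp_norm lborel p (f N) < enn (\<tau> N + de N)"
   by metis
  have fm [measurable]: "f N \<in> borel_measurable lborel" for N using f(1)[of N] by (simp add: representatives_def in_Lp_def)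
  have fLp: "in_Lp lborel p (f N)" for N using f(1)[of N] by (simp add: representatives_def)
  have f_int: "Lp_int lborel p (f N) <= enn ((s + de N) powr p)" for N
  proof -
   have "Lp_int lborel p (f N) <= enn ((\<tau> N + de N) powr p)"
    using f(2)[of N] \<tau>(2)[of N] de[of N] p1 by (intro Lp_norm_le_iff[THEN iffD1]) auto
   also have "... <= enn ((s + de N) powr p)"
    using \<tau>s[of N] \<tau>(2)[of N] de[of N] p1 by (intro ennreal_leI powr_mono2) auto
   finally show ?thesis .
  qed
  define ep where "ep k = 2 powr p * ((s + de k) powr p - \<tau> k powr p)" for k
  have ep_lim: "ep \<longlonglongrightarrow> 0"
  proof -
   have "(%k. (s + de k) powr p) \<longlonglongrightarrow> (s + 0) powr p"
    using s(2) de p1 by (intro tendsto_powr' tendsto_add tendsto_const de_lim) (auto intro!: always_eventually simp: less_imp_le)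
   moreover have "(%k. \<tau> k powr p) \<longlonglongrightarrow> s powr p"
    using \<tau>(2) p1 by (intro tendsto_powr' \<tau>_lim tendsto_const) (auto intro!: always_eventually)
   ultimately have "ep \<longlonglongrightarrow> 2 powr p * ((s + 0) powr p - s powr p)"
    unfolding ep_def by (intro tendsto_mult tendsto_diff tendsto_const)
   thus ?thesis by simp
  qed
  \<comment> \<open>For k <= j also \<open>f j\<close> competes at level k. Clarkson turns the gap
    between the upper bound s + de k and the lower bound \<tau> k into \<open>ep k\<close>; the
    factor 2^p in \<open>ep\<close> undoes the halving of the difference.\<close>
  have close: "Lp_int lborel p (%x. f j x - f k x) <= enn (ep k)" if jk: "k <= j" for j k
  proof -
   have mid: "(%x. (1/2) *\<^sub>R (f j x + f k x)) \<in> representatives p {..k} u"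
    unfolding representatives_def
   proof (intro CollectI conjI ballI)
    show "radial (%x. (1/2) *\<^sub>R (f j x + f k x))"
     using f(1)[of j] f(1)[of k]
     by (intro radial_compose[where k="%a. (1/2) *\<^sub>R a" and f="%x. f j x + f k x"] radial_add) (simp_all add: representatives_def)
    show "in_Lp lborel p (%x. (1/2) *\<^sub>R (f j x + f k x))"
     by (rule in_Lp_scaled[OF in_Lp_add[OF fLp[of j] fLp[of k] p1(1)] p1(2), where c="1/2"]) auto
    fix n assume n: "n \<in> {..k}"
    have "has_bochner_integral lborel (%x. (1/2) *\<^sub>R (f j x * of_real (h n x) + f k x * of_real (h n x))) ((1/2) *\<^sub>R (u n + u n))"
     using f(1)[of j] f(1)[of k] n jk
     by (intro has_bochner_integral_scaleR_right has_bochner_integral_add) (auto simp: representatives_def)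
    thus "has_bochner_integral lborel (%x. (1/2) *\<^sub>R (f j x + f k x) * of_real (h n x)) (u n)"
     by (simp add: distrib_right scaleR_add_right[symmetric] flip: scaleR_2)
   qed
   have "enn (\<tau> k powr p) <= Lp_int lborel p (%x. (1/2) *\<^sub>R (f j x + f k x))"
   proof (rule ccontr)
    assume "\<not> ?thesis"
    hence lt: "Lp_int lborel p (%x. (1/2) *\<^sub>R (f j x + f k x)) < enn (\<tau> k powr p)" by simp
    then obtain y where y: "Lp_int lborel p (%x. (1/2) *\<^sub>R (f j x + f k x)) = enn y" "y >= 0"
     by (cases "Lp_int lborel p (%x. (1/2) *\<^sub>R (f j x + f k x))") auto
    have "y < \<tau> k powr p" using lt y by (simp add: ennreal_less_iff)
    hence "y powr (1/p) < (\<tau> k powr p) powr (1/p)" using y p1 by (intro powr_less_mono2) auto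
    also have "... = \<tau> k" using p1 \<tau>(2)[of k] by (simp add: powr_powr)
    finally have a: "y powr (1/p) < \<tau> k" .
    have "Lp_norm lborel p (%x. (1/2) *\<^sub>R (f j x + f k x)) <= enn (y powr (1/p))"
     unfolding Lp_norm_Lp_int y(1) using y(2) by simp
    moreover have "min_norm p {..k} u <= Lp_norm lborel p (%x. (1/2) *\<^sub>R (f j x + f k x))"
     unfolding min_norm_def by (rule INF_lower[OF mid])
    ultimately have "enn (\<tau> k) <= enn (y powr (1/p))" unfolding \<tau>(1) by (rule order_trans[rotated])
    thus False using a by simp
   qed
   hence "enn (\<tau> k powr p) + Lp_int lborel p (%x. (1/2) *\<^sub>R (f j x - f k x))
     <= enn (1/2) * (Lp_int lborel p (f j) + Lp_int lborel p (f k))"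
    using Clarkson[OF fm[of j] fm[of k] p] by (meson add_right_mono order_trans)
   also have "... <= enn (1/2) * (enn ((s + de k) powr p) + enn ((s + de k) powr p))"
   proof (intro mult_left_mono add_mono f_int)
    have "(s + de j) powr p <= (s + de k) powr p" using de_mono[OF jk] s(2) de[of j] p1 by (intro powr_mono2) auto
    thus "Lp_int lborel p (f j) <= enn ((s + de k) powr p)"
     using f_int[of j] by (meson ennreal_leI order_trans)
   qed auto
   also have "... = enn ((s + de k) powr p)"
   proof -
    have "enn z + enn z = enn (2 * z)" if "z >= 0" for z using that by (simp flip: ennreal_plus)
    moreover have "enn (1/2) * enn (2 * z) = enn (1/2 * (2 * z))" if "z >= 0" for z
     using that by (intro ennreal_mult[symmetric]) auto
    ultimately show ?thesis by simp
   qed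
   finally have c: "enn (\<tau> k powr p) + Lp_int lborel p (%x. (1/2) *\<^sub>R (f j x - f k x)) <= ..." .
   obtain y where y: "Lp_int lborel p (%x. (1/2) *\<^sub>R (f j x - f k x)) = enn y" "y >= 0"
    using c by (cases "Lp_int lborel p (%x. (1/2) *\<^sub>R (f j x - f k x))") (auto simp: top_unique)
   have yle: "y <= (s + de k) powr p - \<tau> k powr p"
    using c unfolding y(1) using y(2) by (simp flip: ennreal_plus)
   have "Lp_int lborel p (%x. f j x - f k x) = enn (2 powr p) * Lp_int lborel p (%x. (1/2) *\<^sub>R (f j x - f k x))"
    by (rule Lp_norm_mult_const) (use p1 in auto)
   also have "... = enn (2 powr p * y)" unfolding y(1) using y(2) by (simp add: ennreal_mult)
   also have "... <= enn (ep k)" unfolding ep_def using yle by (intro ennreal_leI mult_left_mono) auto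
   finally show ?thesis .
  qed
  have "\<exists>K. \<forall>j\<ge>K. \<forall>k\<ge>K. Lp_int lborel p (%x. f j x - f k x) <= enn e" if e: "e > 0" for e
  proof -
   have "\<forall>\<^sub>F k in sequentially. ep k < e" by (rule order_tendstoD(2)[OF ep_lim e])
   then obtain K where K: "\<And>k. k >= K ==> ep k < e" by (auto simp: eventually_sequentially)
   have "Lp_int lborel p (%x. f j x - f k x) <= enn e" if "j >= K" "k >= K" for j k
   proof (cases "k <= j")
    case True
    thus ?thesis using close[OF True] K[OF that(2)] by (meson ennreal_leI less_imp_le order_trans)
   next
    case False
    have "Lp_int lborel p (%x. f j x - f k x) = Lp_int lborel p (%x. f k x - f j x)"
     unfolding Lp_int_def by (simp add: norm_minus_commute)
    thus ?thesis using close[of j k] False K[OF that(1)] by (metis ennreal_leI less_imp_le nle_le order_trans)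
   qed
   thus ?thesis by blast
  qed
  then obtain r where r: "strict_mono r" "AE x in lborel. (%k. f (r k) x) \<longlonglongrightarrow> lim (%k. f (r k) x)"
   "(%x. lim (%k. f (r k) x)) \<in> borel_measurable lborel"
   "(%k. Lp_int lborel p (%x. f k x - lim (%k. f (r k) x))) \<longlonglongrightarrow> 0"
   by (rule Lp_int_complete[OF fm p1(1)]) blast
  define g where "g x = lim (%k. f (r k) x)" for x
  have "Lp_int lborel p g <= liminf (%k. Lp_int lborel p (f (r k)))"
   using r(2) p1 unfolding g_def by (intro Lp_int_Fatou) auto
  also have "... <= liminf (%k. enn ((s + de k) powr p))"
  proof (intro Liminf_mono always_eventually allI)
   fix k
   have "(s + de (r k)) powr p <= (s + de k) powr p"
    using de_mono[OF seq_suble[OF r(1), of k]] s(2) de[of "r k"] p1 by (intro powr_mono2) auto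
   thus "Lp_int lborel p (f (r k)) <= enn ((s + de k) powr p)"
    using f_int[of "r k"] by (meson ennreal_leI order_trans)
  qed
  also have "liminf (%k. enn ((s + de k) powr p)) = enn ((s + 0) powr p)"
  proof (rule lim_imp_Liminf[OF trivial_limit_sequentially], rule tendsto_ennrealI)
   show "(%k. (s + de k) powr p) \<longlonglongrightarrow> (s + 0) powr p"
    using s(2) de p1 by (intro tendsto_powr' tendsto_add tendsto_const de_lim) (auto intro!: always_eventually simp: less_imp_le)
  qed
  finally have gs: "Lp_norm lborel p g <= enn s"
   using p1 s(2) by (subst Lp_norm_le_iff) auto
  have gm: "g \<in> borel_measurable lborel" using r(3) unfolding g_def [abs_def] .
  have gLp: "in_Lp lborel p g"
   unfolding in_Lp_def using gm gs by (auto intro: le_less_trans)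
  have "g \<in> representatives p UNIV u"
   unfolding representatives_def
  proof (intro CollectI conjI ballI gLp)
   \<comment> \<open>Radiality is required at every point, not almost everywhere; it survives
     because \<open>lim\<close> depends only on the sequence of values, even where that sequence
     diverges.\<close>
   show "radial g"
    unfolding radial_def g_def
   proof (intro allI impI)
    fix x y :: 'a assume "norm x = norm y"
    hence "f (r k) x = f (r k) y" for k
     using f(1)[of "r k"] unfolding representatives_def radial_def by blast
    thus "lim (%k. f (r k) x) = lim (%k. f (r k) y)" by simp
   qed
   fix n :: nat
   define q where "q = p / (p - 1)"
   have q: "q > 1" "q >= 1" "1/p + 1/q = 1" using p by (auto simp: q_def field_simps)
   have "(%k. (\<I> x. f k x * of_real (h n x))) \<longlonglongrightarrow> (\<I> x. g x * of_real (h n x))"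
    using r(4) unfolding g_def[symmetric]
    by (intro Lp_pairing_tendsto[OF fLp gLp h_in_Lp[OF q(2)] p1(3) q(1,3)])
   moreover have "\<forall>\<^sub>F k in sequentially. (\<I> x. f k x * of_real (h n x)) = u n"
   proof (rule eventually_sequentiallyI[of n])
    fix k assume "n <= k"
    thus "(\<I> x. f k x * of_real (h n x)) = u n"
     using f(1)[of k] by (auto simp: representatives_def has_bochner_integral_iff)
   qed
   hence "(%k. (\<I> x. f k x * of_real (h n x))) \<longlonglongrightarrow> u n" by (rule tendsto_eventually)
   ultimately have "(\<I> x. g x * of_real (h n x)) = u n" by (rule LIMSEQ_unique)
   thus "has_bochner_integral lborel (%x. g x * of_real (h n x)) (u n)"
    using Lp_pairing(1)[OF gLp h_in_Lp[OF q(2)] p1(3) q(1,3) zero_less_one] by (simp add: has_bochner_integral_iff)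
  qed
  hence "min_norm p UNIV u <= Lp_norm lborel p g" unfolding min_norm_def by (rule INF_lower)
  thus ?thesis using gs unfolding s(1) Lp_norm_distribution_min_norm by simp
 next
  case True
  thus ?thesis by (simp only: top_greatest)
 qed
qed

lemma Lp_norm_distribution_measurable:
 assumes p: "p >= 2"
 shows "Lp_norm_distribution h p \<in> borel_measurable (PiM UNIV (%_. borel))"
proof -
 have "(%u. SUP N. min_norm p {..N} u) \<in> borel_measurable (PiM UNIV (%_. borel))"
  using p by (intro borel_measurable_SUP min_norm_measurable) auto
 moreover have "Lp_norm_distribution h p = (%u. SUP N. min_norm p {..N} u)"
  by (rule ext) (rule Lp_norm_distribution_SUP[OF p])
 ultimately show ?thesis by (simp only:)
qed

end

section \<open>The Gaussian field\<close>

text \<open>The constant is the maximum of a ln z - z/2, attained at z = 2a; the proof is the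
  tangent inequality for the logarithm at that point.\<close>

lemma powr_le_exp:
 fixes z a :: real
 assumes "a > 0" "z >= 0"
 shows "z powr a <= exp (a * ln (2 * a) - a) * exp (z / 2)"
proof (cases "z = 0")
 case False
 hence z: "z > 0" using assms by simp
 have "ln (z / (2 * a)) <= z / (2 * a) - 1" using z assms by (intro ln_le_minus_one) auto
 hence "ln z - ln (2 * a) <= z / (2 * a) - 1" using z assms by (simp add: ln_div)
 hence "a * (ln z - ln (2 * a)) <= a * (z / (2 * a) - 1)" using assms by (intro mult_left_mono) auto
 also have "a * (z / (2 * a) - 1) = z / 2 - a" using assms by (simp add: field_simps)
 finally have "a * ln z <= (a * ln (2 * a) - a) + z / 2" by (simp add: algebra_simps)
 hence "exp (a * ln z) <= exp ((a * ln (2 * a) - a) + z / 2)" by simp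
 thus ?thesis using z by (simp add: powr_def exp_add)
qed (use assms in simp)

text \<open>The shift by \<open>t\<^sub>0\<close> moves the argument into the range where \<open>t \<mapsto> exp (t\<^sup>\<alpha>/2)\<close> is convex.\<close>

lemma convex_exp_powr:
 fixes al t0 :: real
 assumes al: "0 < al" "al < 1" and t0: "t0 > 0" "t0 powr al >= 2 * (1 - al) / al"
 shows "convex_on {t0<..} (%t. exp (t powr al / 2))"
proof (rule f''_ge0_imp_convex)
 show "convex {t0<..}" by (rule convex_real_interval)
 fix t assume "t \<in> {t0<..}"
 hence t: "t > 0" "t0 < t" using t0 by auto
 show "((%t. exp (t powr al / 2)) has_real_derivative exp (t powr al / 2) * (al / 2 * t powr (al - 1))) (at t)"
  using t by (auto intro!: derivative_eq_intros)
 have "((%t. exp (t powr al / 2) * (al / 2 * t powr (al - 1))) has_real_derivative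
   (exp (t powr al / 2) * (al / 2 * t powr (al - 1))) * (al / 2 * t powr (al - 1)) + exp (t powr al / 2) * (al / 2 * ((al - 1) * t powr (al - 1 - 1)))) (at t)"
  using t by (auto intro!: derivative_eq_intros)
 thus "((%t. exp (t powr al / 2) * (al / 2 * t powr (al - 1))) has_real_derivative
   (exp (t powr al / 2) * (al / 2 * t powr (al - 1))) * (al / 2 * t powr (al - 1)) + exp (t powr al / 2) * (al / 2 * ((al - 1) * t powr (al - 1 - 1)))) (at t)" .
 have "t0 powr al <= t powr al" using t t0 al by (intro powr_mono2) auto
 hence "2 * (1 - al) / al <= t powr al" using t0 by linarith
 hence "al / 2 * t powr al + (al - 1) >= 0" using al by (simp add: field_simps)
 hence "0 <= exp (t powr al / 2) * (al / 2) * t powr (al - 2) * (al / 2 * t powr al + (al - 1))"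
  using al by (intro mult_nonneg_nonneg) auto
 also have "... = (exp (t powr al / 2) * (al / 2 * t powr (al - 1))) * (al / 2 * t powr (al - 1)) + exp (t powr al / 2) * (al / 2 * ((al - 1) * t powr (al - 1 - 1)))"
 proof -
  have "t powr (al - 1) = t powr al / t" "t powr (al - 2) = t powr al / t^2" "t powr (al - 1 - 1) = t powr al / t^2"
   using t by (simp_all add: powr_diff power2_eq_square)
  thus ?thesis using t by (simp only:) (simp add: field_simps power2_eq_square)
 qed
 finally show "0 <= ..." .
qed

text \<open>Jensen for t -> exp (t^(2/p) / 2) at the shifted variable s + Z^(p/2), whose values lie
  in the range of convexity. Subadditivity of t^(2/p) confines the effect of the shift to the factor
  K.\<close>

lemma Jensen_exp_powr:
 fixes p :: real
 assumes p: "p > 2"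
 obtains K where "K > 0"
  "\<And>(\<nu> :: 'a measure) Z. [|prob_space \<nu>; Z \<in> borel_measurable \<nu>; \<And>x. Z x >= 0|] ==>
    enn (exp (enn2real (\<integral>\<^sup>+x. enn (Z x powr (p / 2)) \<partial>\<nu>) powr (2 / p) / 2))
     <= enn K * (\<integral>\<^sup>+x. enn (exp (Z x / 2)) \<partial>\<nu>)"
proof -
 define al where "al = 2 / p"
 have al: "0 < al" "al < 1" using p by (auto simp: al_def)
 define t0 where "t0 = (2 * (1 - al) / al) powr (1 / al)"
 have t0: "t0 > 0" "t0 powr al >= 2 * (1 - al) / al"
  using al by (auto simp: t0_def powr_powr)
 define s where "s = t0 + 1"
 define K where "K = exp (s powr al / 2)"
 show ?thesis
 proof (rule that[of K])
  show "K > 0" by (simp add: K_def)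
  fix \<nu> :: "'a measure" and Z :: "'a => real"
  assume "prob_space \<nu>" and Zm [measurable]: "Z \<in> borel_measurable \<nu>" and Z: "\<And>x. Z x >= 0"
  interpret prob_space \<nu> by fact
  have sub: "(a + b) powr al <= a powr al + b powr al" if "a >= 0" "b >= 0" for a b :: real
  proof (cases "a + b = 0")
   case False
   hence c: "a + b > 0" using that by simp
   have "a / (a+b) <= (a / (a+b)) powr al" "b / (a+b) <= (b / (a+b)) powr al"
    using that c al powr_mono'[of al 1 "a / (a+b)"] powr_mono'[of al 1 "b / (a+b)"] by auto
   hence "a / (a+b) + b / (a+b) <= (a powr al + b powr al) / (a+b) powr al"
    by (simp add: powr_divide add_divide_distrib)
   moreover have "a / (a+b) + b / (a+b) = 1" using c by (simp flip: add_divide_distrib)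
   ultimately show ?thesis using c by (simp add: field_simps)
  next
   case True
   hence "a = 0" "b = 0" using that by auto
   thus ?thesis by simp
  qed
  show "enn (exp (enn2real (\<integral>\<^sup>+x. enn (Z x powr (p / 2)) \<partial>\<nu>) powr (2 / p) / 2))
     <= enn K * (\<integral>\<^sup>+x. enn (exp (Z x / 2)) \<partial>\<nu>)"
  proof (cases "(\<integral>\<^sup>+x. enn (exp (Z x / 2)) \<partial>\<nu>) = \<top>")
   case True
   thus ?thesis using \<open>K > 0\<close> by (simp add: ennreal_mult_top)
  next
   case False
   have ie: "integrable \<nu> (%x. exp (Z x / 2))"
    by (rule integrableI_nonneg) (use False in \<open>auto simp: less_top\<close>)
   have iz: "integrable \<nu> (%x. Z x powr (p / 2))"
   proof (rule Bochner_Integration.integrable_bound)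
    show "integrable \<nu> (%x. exp (p / 2 * ln (2 * (p / 2)) - p / 2) * exp (Z x / 2))" by (intro integrable_mult_right ie)
    show "AE x in \<nu>. norm (Z x powr (p / 2)) <= norm (exp (p / 2 * ln (2 * (p / 2)) - p / 2) * exp (Z x / 2))"
    proof (intro AE_I2)
     fix x
     have "Z x powr (p / 2) <= exp (p / 2 * ln (2 * (p / 2)) - p / 2) * exp (Z x / 2)"
      using p Z by (intro powr_le_exp) auto
     thus "norm (Z x powr (p / 2)) <= norm (exp (p / 2 * ln (2 * (p / 2)) - p / 2) * exp (Z x / 2))" by simp
    qed
   qed measurable
   define X where "X x = s + Z x powr (p / 2)" for x
   have Xm [measurable]: "X \<in> borel_measurable \<nu>" unfolding X_def by measurable
   have iX: "integrable \<nu> X" unfolding X_def using iz by simp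
   have Xb: "exp (X x powr al / 2) <= K * exp (Z x / 2)" for x
   proof -
    have "X x powr al <= s powr al + (Z x powr (p / 2)) powr al" unfolding X_def using t0 by (intro sub) (auto simp: s_def)
    also have "(Z x powr (p / 2)) powr al = Z x" using p Z[of x] by (simp add: powr_powr al_def)
    finally have "exp (X x powr al / 2) <= exp (s powr al / 2 + Z x / 2)" by simp
    thus ?thesis by (simp add: K_def exp_add)
   qed
   have iq: "integrable \<nu> (%x. exp (X x powr al / 2))"
   proof (rule Bochner_Integration.integrable_bound)
    show "integrable \<nu> (%x. K * exp (Z x / 2))" by (intro integrable_mult_right ie)
    show "AE x in \<nu>. norm (exp (X x powr al / 2)) <= norm (K * exp (Z x / 2))"
     using Xb \<open>K > 0\<close> by (intro AE_I2) simp
   qed measurable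
   have XI: "AE x in \<nu>. X x \<in> {t0<..}"
    by (intro AE_I2) (simp add: X_def s_def add_pos_nonneg add_strict_increasing)
   have J: "exp (expectation X powr al / 2) <= expectation (%x. exp (X x powr al / 2))"
    by (rule jensens_inequality[OF iX XI _ iq convex_exp_powr[OF al t0]]) auto
   have E: "enn2real (\<integral>\<^sup>+x. enn (Z x powr (p / 2)) \<partial>\<nu>) = expectation (%x. Z x powr (p / 2))"
    by (subst integral_eq_nn_integral) auto
   have "expectation (%x. Z x powr (p / 2)) powr al <= expectation X powr al"
   proof (rule powr_mono2)
    show "0 <= expectation (%x. Z x powr (p / 2))" by (intro Bochner_Integration.integral_nonneg) simp
    have "expectation X = s + expectation (%x. Z x powr (p / 2))"
     unfolding X_def using iz by (simp add: prob_space)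
    thus "expectation (%x. Z x powr (p / 2)) <= expectation X" using t0 by (simp add: s_def)
   qed (use al in simp)
   hence "exp (expectation (%x. Z x powr (p / 2)) powr al / 2) <= exp (expectation X powr al / 2)" by simp
   also note J
   also have "expectation (%x. exp (X x powr al / 2)) <= expectation (%x. K * exp (Z x / 2))"
    using Xb by (intro integral_mono iq integrable_mult_right ie)
   also have "... = K * expectation (%x. exp (Z x / 2))" by simp
   finally have "enn (exp (enn2real (\<integral>\<^sup>+x. enn (Z x powr (p / 2)) \<partial>\<nu>) powr (2 / p) / 2)) <= enn (K * expectation (%x. exp (Z x / 2)))"
    unfolding E al_def by (rule ennreal_leI)
   also have "... = enn K * (\<integral>\<^sup>+x. enn (exp (Z x / 2)) \<partial>\<nu>)"
    using ie \<open>K > 0\<close> by (simp add: ennreal_mult nn_integral_eq_integral)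
   finally show ?thesis .
  qed
 qed
qed

text \<open>The sequence space itself serves as the probability space; the coordinates multiplied by
  the frequencies are the independent standard Gaussians.\<close>

locale gibbs = radial_basis h D om + gaussian_sequence \<mu> "%n u. of_real (ho_freq D n) * u n"
 for h :: "nat => 'a::euclidean_space => real" and D :: nat and om :: real and \<mu> :: "(nat => complex) measure" +
 assumes sets_\<mu>: "sets \<mu> = sets (PiM UNIV (%_. borel))"
begin

lemma coord_measurable [measurable]: "(%u. u n) \<in> borel_measurable \<mu>"
 by (subst measurable_cong_sets[OF sets_\<mu> refl]) (rule measurable_component_singleton, simp)

lemma field_measurable2 [measurable]: "(%(u, x). field I u x) \<in> borel_measurable (\<mu> \<Otimes>\<^sub>M lborel)"
proof -
 have "(%q. \<Sum>n\<in>I. (fst q) n * of_real (h n (snd q))) \<in> borel_measurable (\<mu> \<Otimes>\<^sub>M (lborel :: 'a measure))"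
 proof (intro borel_measurable_sum borel_measurable_times)
  fix n
  show "(%q. (fst q) n) \<in> borel_measurable (\<mu> \<Otimes>\<^sub>M (lborel :: 'a measure))"
   by (rule measurable_compose[OF measurable_fst coord_measurable])
  have "(%q. h n (snd q)) \<in> borel_measurable (\<mu> \<Otimes>\<^sub>M (lborel :: 'a measure))"
   by (rule measurable_compose[OF measurable_snd]) (use h_measurable in simp)
  thus "(%q. complex_of_real (h n (snd q))) \<in> borel_measurable (\<mu> \<Otimes>\<^sub>M (lborel :: 'a measure))"
   by measurable
 qed
 thus ?thesis unfolding field_def by (simp add: case_prod_beta)
qed

lemma field_measurable_u [measurable]: "(%u. field I u x) \<in> borel_measurable \<mu>"
 unfolding field_def by (intro borel_measurable_sum borel_measurable_times coord_measurable borel_measurable_const)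

definition nrm :: "real => nat set => (nat => complex) => real" where
 "nrm p I u = enn2real (Lp_norm lborel p (field I u))"

lemma nrm_nonneg [simp]: "nrm p I u >= 0"
 by (simp add: nrm_def)

lemma Lp_int_field_measurable [measurable]: "(%u. Lp_int lborel p (field I u)) \<in> borel_measurable \<mu>"
proof -
 have "(%u. \<integral>\<^sup>+x. enn (norm (case (u, x) of (u, x) => field I u x) powr p) \<partial>lborel) \<in> borel_measurable \<mu>"
  by measurable
 thus ?thesis unfolding Lp_int_def by simp
qed

lemma Lp_norm_field_measurable [measurable]: "(%u. Lp_norm lborel p (field I u)) \<in> borel_measurable \<mu>"
 unfolding Lp_norm_Lp_int by measurable

lemma nrm_measurable [measurable]: "nrm p I \<in> borel_measurable \<mu>"
 unfolding nrm_def [abs_def] by measurable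

lemma Lp_norm_field_nrm:
 assumes "finite I" "p >= 1"
 shows "Lp_norm lborel p (field I u) = enn (nrm p I u)"
 using field_in_Lp[OF assms(2,1), of u] unfolding nrm_def by (simp add: in_Lp_def)

lemma Lp_int_field_nrm:
 assumes "finite I" "p >= 1"
 shows "Lp_int lborel p (field I u) = enn (nrm p I u powr p)"
 using Lp_norm_field_nrm[OF assms, of u] assms(2) by (intro Lp_int_eq_norm_powr) auto

text \<open>The parameter t = 1 / (2 kern) makes the product with the variance equal to 1/2, hence
  the moment exactly 2. At a point of zero variance, division by zero gives the exponent 0 and the
  moment 1.\<close>

lemma field_exp_moment:
 assumes I: "finite I"
 shows "(\<E> u. enn (exp ((cmod (field I u x))^2 / kern I x / 2))) <= 2"
proof (cases "kern I x > 0")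
 case True
 define c where "c n = h n x / lam n" for n
 have "field I u x = (\<Sum>n\<in>I. of_real (c n) * (of_real (lam n) * u n))" for u
  unfolding field_def c_def by (intro sum.cong refl) (simp add: lam_nz)
 moreover have "kern I x = (\<Sum>n\<in>I. (c n)^2)"
  unfolding kern_def c_def by (simp add: power_divide)
 ultimately show ?thesis
  using exp_square_moment[OF I, of "kern I x" c "1 / (2 * kern I x)"] True by (simp add: mult.commute)
next
 case False
 hence "kern I x = 0" using kern_nonneg[of I x] by simp
 hence "(\<E> u. enn (exp ((cmod (field I u x))^2 / kern I x / 2))) = 1"
  by (simp add: emeasure_space_1)
 thus ?thesis by (simp only: one_le_numeral)
qed

lemma field_zero:
 assumes I: "finite I" and "kern I x = 0"
 shows "field I u x = 0"
proof -
 have "(h n x)^2 / (lam n)^2 = 0" if "n \<in> I" for n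
  by (rule sum_nonneg_0[OF I _ assms(2)[unfolded kern_def] that]) simp
 hence "h n x = 0" if "n \<in> I" for n using that lam_nz[of n] by force
 thus ?thesis unfolding field_def by simp
qed

text \<open>With respect to the probability density \<open>\<sigma>\<^bsup>p/2\<^esup>/\<integral>\<sigma>\<^bsup>p/2\<^esup>\<close> in \<open>x\<close>, the \<open>p\<close>-th power of the norm is an average
 of \<open>(|Y(x)|\<^sup>2/\<sigma>(x))\<^bsup>p/2\<^esup>\<close>, to which Jensen's inequality applies.\<close>

lemma nrm_exp_moment:
 assumes p: "p > 2"
 obtains K where "K > 0"
  "\<And>I A. [|finite I; A > 0; (\<L> x. enn (kern I x powr (p / 2))) <= enn (A powr p)|] ==>
    (\<E> u. enn (exp ((nrm p I u)^2 / (2 * A^2)))) <= enn K"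
proof -
 obtain K where K: "K > 0"
  "\<And>(\<nu> :: 'a measure) Z. [|prob_space \<nu>; Z \<in> borel_measurable \<nu>; \<And>x. Z x >= 0|] ==>
    enn (exp (enn2real (\<integral>\<^sup>+x. enn (Z x powr (p / 2)) \<partial>\<nu>) powr (2 / p) / 2))
     <= enn K * (\<integral>\<^sup>+x. enn (exp (Z x / 2)) \<partial>\<nu>)"
  using Jensen_exp_powr[OF p, where 'a='a] by blast
 show ?thesis
 proof (rule that[of "max 1 (2 * K)"])
  show "max 1 (2 * K) > 0" by simp
  fix I A assume I: "finite I" and A: "A > 0" and SA: "(\<L> x. enn (kern I x powr (p / 2))) <= enn (A powr p)"
  obtain s where s: "(\<L> x. enn (kern I x powr (p / 2))) = enn s" "s >= 0"
   using SA by (cases "(\<L> x. enn (kern I x powr (p / 2)))") (auto simp: top_unique)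
  have sA: "s <= A powr p" using SA s by simp
  have p1: "p >= 1" "p > 0" using p by auto
  show "(\<E> u. enn (exp ((nrm p I u)^2 / (2 * A^2)))) <= enn (max 1 (2 * K))"
  \<comment> \<open>If the covariance vanishes almost everywhere, there is no density to normalize;
    then all norms are 0 and the moment is 1.\<close>
  proof (cases "s = 0")
   case True
   hence "(\<L> x. enn (kern I x powr (p / 2))) = 0" using s(1) by simp
   hence "AE x in lborel. enn (kern I x powr (p / 2)) = 0"
    by (subst (asm) nn_integral_0_iff_AE) simp_all
   hence k0: "AE x in lborel. kern I x = 0" by (rule eventually_mono) simp
   have "nrm p I u = 0" for u
   proof -
    have "Lp_norm lborel p (field I u) = Lp_norm lborel p (%x :: 'a. 0 :: complex)"
     by (rule Lp_norm_cong_AE) (use k0 field_zero[OF I] in auto)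
    also have "... = 0" using p1 by (simp add: Lp_norm_Lp_int Lp_int_def)
    finally show ?thesis by (simp add: nrm_def)
   qed
   hence "(\<E> u. enn (exp ((nrm p I u)^2 / (2 * A^2)))) = 1" by (simp add: emeasure_space_1)
   thus ?thesis by (simp add: ennreal_leI flip: ennreal_1)
  next
   case False
   hence s0: "s > 0" using s by simp
   define w where "w x = kern I x powr (p / 2) / s" for x
   have [measurable]: "w \<in> borel_measurable borel" unfolding w_def by measurable
   have w0: "w x >= 0" for x using s0 by (simp add: w_def)
   define \<nu> where "\<nu> = density lborel (%x. enn (w x))"
   have [measurable_cong, simp]: "sets \<nu> = sets borel" by (simp add: \<nu>_def)
   interpret nu: prob_space \<nu>
   proof
    have "emeasure \<nu> (space \<nu>) = (\<L> x. enn (w x))" (is "?a = _") by (simp add: \<nu>_def emeasure_density)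
    also have "... = (\<L> x. enn (1 / s) * enn (kern I x powr (p / 2)))"
     unfolding w_def using s0 by (intro nn_integral_cong) (simp flip: ennreal_mult)
    also have "... = enn (1 / s) * enn s" by (subst nn_integral_cmult) (auto simp: s)
    also have "... = 1" using s0 by (simp flip: ennreal_mult)
    finally show "?a = 1" .
   qed
   interpret pr: pair_sigma_finite \<mu> \<nu>
    by (intro pair_sigma_finite.intro sigma_finite_measure_axioms nu.sigma_finite_measure_axioms)
   define Z where "Z u x = (cmod (field I u x))^2 / kern I x" for u x
   have Z0: "Z u x >= 0" for u x using kern_nonneg[of I x] by (simp add: Z_def)
   have Zm [measurable]: "Z u \<in> borel_measurable borel" for u unfolding Z_def by measurable
   have fm: "(%(u, x). field I u x) \<in> borel_measurable (\<mu> \<Otimes>\<^sub>M \<nu>)"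
    using field_measurable2[of I] by (simp add: measurable_cong_sets[OF sets_pair_measure_cong[OF refl, of lborel \<nu>] refl])
   have Zm2: "(%(u, x). Z u x) \<in> borel_measurable (\<mu> \<Otimes>\<^sub>M \<nu>)"
   proof -
    have "(%q. (cmod (case q of (u, x) => field I u x))^2 / kern I (snd q)) \<in> borel_measurable (\<mu> \<Otimes>\<^sub>M \<nu>)"
     using fm by measurable
    thus ?thesis by (simp add: Z_def case_prod_beta)
   qed
   have int_p: "nrm p I u powr p = s * enn2real (\<integral>\<^sup>+x. enn (Z u x powr (p / 2)) \<partial>\<nu>)" for u
   proof -
    have e: "cmod (field I u x) powr p = s * (w x * Z u x powr (p / 2))" for x
    proof (cases "kern I x = 0")
     case True
     thus ?thesis using field_zero[OF I True, of u] p1 by (simp add: Z_def)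
    next
     case False
     hence k: "kern I x > 0" using kern_nonneg[of I x] by simp
     have "s * (w x * Z u x powr (p / 2)) = (kern I x * Z u x) powr (p / 2)"
      using s0 by (simp add: w_def powr_mult)
     also have "kern I x * Z u x = (cmod (field I u x))^2" using k by (simp add: Z_def)
     also have "... powr (p / 2) = cmod (field I u x) powr p"
     proof (cases "field I u x = 0")
      case False
      hence "(cmod (field I u x))^2 = cmod (field I u x) powr 2" by (simp add: powr_numeral)
      hence "(cmod (field I u x))\<^sup>2 powr (p / 2) = cmod (field I u x) powr (2 * (p / 2))" by (simp only: powr_powr)
      thus ?thesis by simp
     qed simp
     finally show ?thesis by simp
    qed
    have "enn (nrm p I u powr p) = (\<L> x. enn s * (enn (w x) * enn (Z u x powr (p / 2))))"
     unfolding Lp_int_field_nrm[OF I p1(1), symmetric] Lp_int_def e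
     using s0 w0 by (intro nn_integral_cong) (simp add: ennreal_mult)
    also have "... = enn s * (\<L> x. enn (w x) * enn (Z u x powr (p / 2)))"
     by (rule nn_integral_cmult) measurable
    also have "(\<L> x. enn (w x) * enn (Z u x powr (p / 2))) = (\<integral>\<^sup>+x. enn (Z u x powr (p / 2)) \<partial>\<nu>)"
     unfolding \<nu>_def by (rule nn_integral_density[symmetric]) measurable
    finally have "enn2real (enn (nrm p I u powr p)) = enn2real (enn s * (\<integral>\<^sup>+x. enn (Z u x powr (p / 2)) \<partial>\<nu>))" by simp
    thus ?thesis using s0 by (simp add: enn2real_mult)
   qed
   have bound: "(nrm p I u)^2 / (2 * A^2) <= enn2real (\<integral>\<^sup>+x. enn (Z u x powr (p / 2)) \<partial>\<nu>) powr (2 / p) / 2" for u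
   proof -
    let ?J = "enn2real (\<integral>\<^sup>+x. enn (Z u x powr (p / 2)) \<partial>\<nu>)"
    have "nrm p I u powr p <= A powr p * ?J" unfolding int_p using sA by (intro mult_right_mono) auto
    hence "(nrm p I u powr p) powr (2 / p) <= (A powr p * ?J) powr (2 / p)" using p1 by (intro powr_mono2) auto
    also have "... = (A powr p) powr (2 / p) * ?J powr (2 / p)" by (rule powr_mult)
    also have "(A powr p) powr (2 / p) = A^2" using A p1 by (simp add: powr_powr powr_numeral)
    also have "(nrm p I u powr p) powr (2 / p) = (nrm p I u)^2" using p1 by (cases "nrm p I u = 0") (auto simp: powr_powr powr_numeral less_le)
    finally show ?thesis using A by (simp add: field_simps)
   qed
   have "(\<E> u. enn (exp ((nrm p I u)^2 / (2 * A^2)))) <= (\<E> u. enn K * (\<integral>\<^sup>+x. enn (exp (Z u x / 2)) \<partial>\<nu>))" (is "?a <= _")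
   proof (intro nn_integral_mono)
    fix u
    have "enn (exp ((nrm p I u)^2 / (2 * A^2))) <= enn (exp (enn2real (\<integral>\<^sup>+x. enn (Z u x powr (p / 2)) \<partial>\<nu>) powr (2 / p) / 2))" (is "?a <= _")
     using bound[of u] by (intro ennreal_leI) simp
    also have "... <= enn K * (\<integral>\<^sup>+x. enn (exp (Z u x / 2)) \<partial>\<nu>)"
     by (rule K(2)[OF nu.prob_space_axioms _ Z0]) measurable
    finally show "?a <= ..." .
   qed
   also have "... = enn K * (\<E> u. (\<integral>\<^sup>+x. enn (exp (Z u x / 2)) \<partial>\<nu>))"
   proof (rule nn_integral_cmult)
    have "(%u. \<integral>\<^sup>+x. enn (exp ((case (u, x) of (u, x) => Z u x) / 2)) \<partial>\<nu>) \<in> borel_measurable \<mu>"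
     using Zm2 by measurable
    thus "(%u. \<integral>\<^sup>+x. enn (exp (Z u x / 2)) \<partial>\<nu>) \<in> borel_measurable \<mu>" by simp
   qed
   also have "(\<E> u. (\<integral>\<^sup>+x. enn (exp (Z u x / 2)) \<partial>\<nu>)) = (\<integral>\<^sup>+x. (\<E> u. enn (exp (Z u x / 2))) \<partial>\<nu>)"
   proof (rule pr.Fubini'[symmetric])
    have "(%q. enn (exp ((case q of (u, x) => Z u x) / 2))) \<in> borel_measurable (\<mu> \<Otimes>\<^sub>M \<nu>)"
     using Zm2 by measurable
    thus "(%(u, x). enn (exp (Z u x / 2))) \<in> borel_measurable (\<mu> \<Otimes>\<^sub>M \<nu>)" by (simp add: case_prod_beta)
   qed
   also have "... <= (\<integral>\<^sup>+x. 2 \<partial>\<nu>)"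
    unfolding Z_def by (intro nn_integral_mono field_exp_moment I)
   also have "... = 2" by (simp add: nu.emeasure_space_1)
   finally have "?a <= enn K * 2" by (simp add: mult_left_mono)
   also have "enn K * 2 = enn (2 * K)" using K(1) by (simp add: ennreal_mult mult.commute)
   also have "... <= enn (max 1 (2 * K))" by (intro ennreal_leI) simp
   finally show ?thesis .
  qed
 qed
qed

end

section \<open>Second moments and exponential estimates for the Wick-ordered mass\<close>

context gaussian_sequence
begin

text \<open>The second moment is the limit of the difference quotients of the exponential moments.\<close>

lemma second_moment:
 assumes I: "finite I"
 shows "(\<E> u. enn ((cmod (\<Sum>n\<in>I. of_real (c n) * G n u))^2)) = enn (\<Sum>n\<in>I. (c n)^2)"
proof -
 define Y where "Y u = (cmod (\<Sum>n\<in>I. of_real (c n) * G n u))^2" for u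
 have [measurable]: "Y \<in> borel_measurable \<mu>" unfolding Y_def by measurable
 have Y0: "Y u >= 0" for u by (simp add: Y_def)
 define s where "s = (\<Sum>n\<in>I. (c n)^2)"
 define b where "b = s + 1"
 have s0: "s >= 0" unfolding s_def by (intro sum_nonneg) auto
 \<comment> \<open>The shift keeps the parameters 1/(k + K) at most 1/(4b), with b above the
   variance s. All difference quotients are then dominated by a multiple of exp (Y / (2b)), which is
   integrable.\<close>
 define K where "K = Suc (nat \<lceil>4 * b\<rceil>)"
 have "real K >= 4 * b" unfolding K_def using real_nat_ceiling_ge[of "4 * b"] by linarith
 hence K1: "real (k + K) >= 4 * b" for k by simp
 have b: "b > 0" using s0 by (simp add: b_def)
 have sb: "s < b" by (simp add: b_def)
 have bb: "b <= 4 * b" using b by simp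
 have K2: "real (k + K) > s" for k by (rule order.strict_trans2[OF sb order_trans[OF bb K1]])
 note K = K1 K2
 have mom: "(\<E> u. enn (exp (t * Y u))) = enn (1 / (1 - t * s))" if "0 <= t" "t * s < 1" for t
  unfolding Y_def using exp_square_moment[OF I s_def that] .
 define f where "f k y = real (k + K) * (exp (1 / real (k + K) * y) - 1)" for k :: nat and y
 have f: "y <= f k y" "f k y <= y * exp (1 / real (k + K) * y)" "f k y <= 4 * b * exp (1 / (2 * b) * y)" if y: "y >= 0" for k y
 proof -
  define z where "z = 1 / real (k + K) * y"
  have k: "real (k + K) > 0" using K(2)[of k] s0 by linarith
  have yz: "y = real (k + K) * z" using k by (simp add: z_def)
  have "z <= exp z - 1" using exp_ge_add_one_self[of z] by linarith
  hence "real (k + K) * z <= real (k + K) * (exp z - 1)" using k by (intro mult_left_mono) auto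
  thus "y <= f k y" unfolding f_def z_def[symmetric] yz[symmetric] .
  have "exp z * (1 - z) <= exp z * exp (- z)" using exp_ge_add_one_self[of "- z"] by (intro mult_left_mono) auto
  hence "exp z - 1 <= z * exp z" by (simp add: exp_minus algebra_simps)
  thus 1: "f k y <= y * exp (1 / real (k + K) * y)"
   unfolding f_def z_def[symmetric] using k by (subst yz) (simp only: mult.assoc, rule mult_left_mono, auto)
  define w where "w = 1 / (4 * b) * y"
  have "z <= w" unfolding z_def w_def using K(1)[of k] b y by (intro mult_right_mono divide_left_mono) auto
  moreover have "y <= 4 * b * exp w" using exp_ge_add_one_self[of w] b by (simp add: w_def pos_divide_le_eq field_simps)
  ultimately have "y * exp z <= 4 * b * exp w * exp w" using b y by (intro mult_mono) auto
  also have "... = 4 * b * exp (1 / (2 * b) * y)" using b by (simp add: w_def mult.assoc flip: exp_add)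
  finally show "f k y <= ..." using 1 by (simp add: z_def)
 qed
 have Ef: "(\<E> u. enn (f k (Y u))) = enn (s / (1 - 1 / real (k + K) * s))" for k
 proof -
  define t where "t = 1 / real (k + K)"
  have t: "t > 0" "t * s < 1" "real (k + K) = 1 / t" using K(2)[of k] s0 by (auto simp: t_def)
  have i: "integrable \<mu> (%u. exp (t * Y u))" using mom[of t] t by (intro integrableI_nonneg) auto
  have v: "(\<integral>u. exp (t * Y u) \<partial>\<mu>) = 1 / (1 - t * s)"
   using mom[of t] t by (subst integral_eq_nn_integral) auto
  have "(\<E> u. enn (f k (Y u))) = enn (\<integral>u. f k (Y u) \<partial>\<mu>)"
   using i f(1)[OF Y0] Y0 by (intro nn_integral_eq_integral) (auto simp: f_def t_def intro: order_trans)
  also have "(\<integral>u. f k (Y u) \<partial>\<mu>) = 1 / t * (1 / (1 - t * s) - 1)"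
   unfolding f_def t_def[symmetric] t(3) using i v by (simp add: prob_space)
  also have "... = s / (1 - t * s)" using t by (simp add: field_simps)
  finally show ?thesis by (simp add: t_def)
 qed
 have inv: "(%k. 1 / real (k + K)) \<longlonglongrightarrow> 0"
  using LIMSEQ_ignore_initial_segment[OF lim_1_over_n, of K] by simp
 have "(%k. \<integral>\<^sup>+u. enn (f k (Y u)) \<partial>\<mu>) \<longlonglongrightarrow> (\<E> u. enn (Y u))"
 proof (rule nn_integral_dominated_convergence[where w="%u. enn (4 * b) * enn (exp (1 / (2 * b) * Y u))"])
  show "AE u in \<mu>. enn (f j (Y u)) <= enn (4 * b) * enn (exp (1 / (2 * b) * Y u))" for j
   using f(3)[OF Y0] b by (auto simp flip: ennreal_mult intro!: ennreal_leI)
  have "1 / (2 * b) * s < 1" using b s0 by (simp add: b_def)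
  thus "(\<E> u. enn (4 * b) * enn (exp (1 / (2 * b) * Y u))) < \<infinity>"
   using mom[of "1 / (2 * b)"] b by (simp add: nn_integral_cmult ennreal_mult_less_top)
  show "AE u in \<mu>. (%k. enn (f k (Y u))) \<longlonglongrightarrow> enn (Y u)"
  proof (intro AE_I2 tendsto_ennrealI)
   fix u
   have "(%k. Y u * exp (1 / real (k + K) * Y u)) \<longlonglongrightarrow> Y u * exp (0 * Y u)" by (intro tendsto_intros inv)
   hence up: "(%k. Y u * exp (1 / real (k + K) * Y u)) \<longlonglongrightarrow> Y u" by simp
   show "(%k. f k (Y u)) \<longlonglongrightarrow> Y u"
    by (rule tendsto_sandwich[OF _ _ tendsto_const up]) (intro always_eventually allI f(1,2) Y0)+
  qed
 qed (simp_all add: f_def)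
 moreover have "(%k. s / (1 - 1 / real (k + K) * s)) \<longlonglongrightarrow> s / (1 - 0 * s)" by (intro tendsto_intros inv) auto
 ultimately have "(\<E> u. enn (Y u)) = enn s"
  unfolding Ef by (intro LIMSEQ_unique[OF _ tendsto_ennrealI[of _ s]]) auto
 thus ?thesis unfolding Y_def s_def .
qed

end

context gibbs
begin

text \<open>The Wick-ordered mass in coefficients, which orthonormality identifies with
  \<open>wick_mass\<close> for I = {..N}. General index sets allow the frequencies to be split into
  blocks.\<close>

definition wick :: "nat set => (nat => complex) => real" where
 "wick I u = (\<Sum>n\<in>I. (cmod (u n))^2 - 1 / (lam n)^2)"

lemma wick_measurable [measurable]: "wick I \<in> borel_measurable \<mu>"
 unfolding wick_def [abs_def]
 by (intro borel_measurable_sum borel_measurable_diff borel_measurable_power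
  measurable_compose[OF coord_measurable borel_measurable_norm] borel_measurable_const)

lemma wick_G: "wick I u = (\<Sum>n\<in>I. 1 / (lam n)^2 * ((cmod (of_real (lam n) * u n))^2 - 1))"
 unfolding wick_def by (intro sum.cong refl) (simp add: norm_mult power_mult_distrib lam_nz field_simps)

lemma field_second_moment:
 assumes I: "finite I"
 shows "(\<E> u. enn ((cmod (field I u x))^2)) = enn (kern I x)"
proof -
 have "field I u x = (\<Sum>n\<in>I. of_real (h n x / lam n) * (of_real (lam n) * u n))" for u
  unfolding field_def by (intro sum.cong refl) (simp add: lam_nz)
 thus ?thesis using second_moment[OF I, of "%n. h n x / lam n"]
  by (simp add: kern_def power_divide)
qed

lemma proj_field: "proj h N u = field {..N} u"
 by (rule ext) (simp add: proj_def field_def)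

lemma wick_var_kern: "wick_var h \<mu> N x = kern {..N} x"
proof -
 have "(\<integral>u. (cmod (field {..N} u x))^2 \<partial>\<mu>) = enn2real (\<E> u. enn ((cmod (field {..N} u x))^2))"
  by (intro integral_eq_nn_integral) auto
 thus ?thesis unfolding wick_var_def proj_field by (simp add: field_second_moment kern_nonneg)
qed

lemma kern_integrable:
 assumes "finite I"
 shows "integrable lborel (kern I)" "(\<I> x. kern I x) = (\<Sum>n\<in>I. 1 / (lam n)^2)"
proof -
 have i: "integrable lborel (%x. (h n x)^2)" for n
  using h_prod_integrable[of n n] by (simp add: power2_eq_square)
 have o: "(\<I> x. (h n x)^2) = 1" for n
  using basis by (simp add: radial_eigenbasis_def power2_eq_square)
 show "integrable lborel (kern I)" unfolding kern_def [abs_def] using i by simp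
 show "(\<I> x. kern I x) = (\<Sum>n\<in>I. 1 / (lam n)^2)" unfolding kern_def using i o by simp
qed

lemma wick_mass_wick: "wick_mass h \<mu> N = wick {..N}"
proof (rule ext)
 fix u
 have "wick_mass h \<mu> N u = (\<I> x. (cmod (field {..N} u x))^2 - kern {..N} x)"
  unfolding wick_mass_def wick_var_kern proj_field ..
 also have "... = wick {..N} u"
  unfolding wick_def using field_mass[of "{..N}" u] kern_integrable[of "{..N}"] by (simp add: sum_subtractf)
 finally show "wick_mass h \<mu> N u = ..." .
qed

text \<open>Telescoping: with x = lam_n^2 >= 2 the next square is x + 4, and 1/x^2 <= 3 / (x (x+4)),
  which is 3/4 of the difference of the reciprocals.\<close>

lemma sum_inverse_lam4:
 assumes I: "finite I" and Lm: "Lm > 0" "\<And>n. n \<in> I ==> Lm <= lam n"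
 shows "(\<Sum>n\<in>I. (1 / (lam n)^2)^2) <= 3 / (4 * Lm^2)"
proof (cases "I = {}")
 case False
 define n0 where "n0 = Min I"
 define N where "N = Max I"
 have n0: "n0 \<in> I" unfolding n0_def using I False by (rule Min_in)
 have sub: "I \<subseteq> {n0..<Suc N}" unfolding n0_def N_def using I False by (auto simp: less_Suc_eq_le)
 have n0N: "n0 <= Suc N" using n0 sub by auto
 define f where "f n = - (3 / 4) * (1 / (lam n)^2)" for n
 have "(\<Sum>n\<in>I. (1 / (lam n)^2)^2) <= (\<Sum>n = n0..<Suc N. (1 / (lam n)^2)^2)"
  using sub by (intro sum_mono2) auto
 also have "... <= (\<Sum>n = n0..<Suc N. f (Suc n) - f n)"
 proof (intro sum_mono)
  fix n
  define x where "x = (lam n)^2"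
  have x: "x >= 2" "(lam (Suc n))^2 = x + 4" using dim by (auto simp: x_def lam_sq)
  have "(1 / x)^2 = 1 / (x * x)" by (simp add: power2_eq_square)
  also have "... <= 3 / (x * (x + 4))"
  proof -
   have "1 * (x * (x + 4)) <= 3 * (x * x)" using x(1) mult_left_mono[OF x(1), of x] by (simp add: algebra_simps)
   thus ?thesis using x(1) by (simp add: frac_le_eq divide_le_eq pos_le_divide_eq)
  qed
  also have "... = f (Suc n) - f n" using x(1) unfolding f_def x_def[symmetric] x(2) by (simp add: divide_simps)
  finally show "(1 / (lam n)^2)^2 <= ..." by (simp add: x_def)
 qed
 also have "... = f (Suc N) - f n0" by (rule sum_Suc_diff'[OF n0N])
 also have "... <= 3 / 4 * (1 / (lam n0)^2)" by (simp add: f_def)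
 also have "... <= 3 / 4 * (1 / Lm^2)"
  using Lm(1) Lm(2)[OF n0] by (intro mult_left_mono divide_left_mono power_mono) (auto simp: lam_nz)
 finally show ?thesis by simp
qed simp

text \<open>In a block above frequency Lm all weights are at most 1/Lm^2. This enlarges the range of
  parameters \<tau> allowed in \<open>exp_wick_sum\<close> and makes the sum of the squared weights
  of order 1/Lm^2.\<close>

lemma wick_exp_moment:
 assumes I: "finite I" and Lm: "Lm > 0" "\<And>n. n \<in> I ==> Lm <= lam n" and \<tau>: "\<bar>\<tau>\<bar> <= Lm^2 / 2"
 shows "(\<E> u. enn (exp (\<tau> * wick I u))) <= enn (exp (3 * \<tau>^2 / (2 * Lm^2)))"
proof -
 have "(\<E> u. enn (exp (\<tau> * wick I u))) <= enn (exp (2 * \<tau>^2 * (\<Sum>n\<in>I. (1 / (lam n)^2)^2)))"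
  unfolding wick_G
 proof (rule exp_wick_sum[OF I])
  fix n assume n: "n \<in> I"
  have "\<bar>\<tau> * (1 / (lam n)^2)\<bar> = \<bar>\<tau>\<bar> / (lam n)^2" (is "?a = _") by (simp add: abs_mult)
  also have "... <= (Lm^2 / 2) / Lm^2" using \<tau> Lm(1) Lm(2)[OF n] by (intro frac_le power_mono) auto
  finally show "?a <= 1 / 2" using Lm(1) by simp
 qed
 also have "... <= enn (exp (2 * \<tau>^2 * (3 / (4 * Lm^2))))"
 proof (rule ennreal_leI)
  have "2 * \<tau>^2 * (\<Sum>n\<in>I. (1 / (lam n)^2)^2) <= 2 * \<tau>^2 * (3 / (4 * Lm^2))"
   by (intro mult_left_mono sum_inverse_lam4[OF I Lm]) auto
  thus "exp (2 * \<tau>^2 * (\<Sum>n\<in>I. (1 / (lam n)^2)^2)) <= exp (2 * \<tau>^2 * (3 / (4 * Lm^2)))" by simp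
 qed
 finally show ?thesis by simp
qed

lemma exp_Markov:
 assumes [measurable]: "f \<in> borel_measurable \<mu>" and "(\<E> u. enn (exp (f u))) <= enn C" "C >= 0"
 shows "emeasure \<mu> {u \<in> space \<mu>. f u >= t} <= enn (C * exp (- t))"
proof -
 have "emeasure \<mu> {u \<in> space \<mu>. f u >= t} = (\<E> u. indicator {u \<in> space \<mu>. f u >= t} u)" by simp
 also have "... <= (\<E> u. enn (exp (- t)) * enn (exp (f u)))"
 proof (intro nn_integral_mono)
  fix u
  have "enn 1 <= enn (exp (- t) * exp (f u))" if "t <= f u"
   using that by (intro ennreal_leI) (simp flip: exp_add)
  thus "indicator {u \<in> space \<mu>. f u >= t} u <= enn (exp (- t)) * enn (exp (f u))"
   by (auto simp: indicator_def ennreal_mult)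
 qed
 also have "... = enn (exp (- t)) * (\<E> u. enn (exp (f u)))" by (rule nn_integral_cmult) auto
 also have "... <= enn (exp (- t)) * enn C" using assms(2) by (intro mult_left_mono) auto
 also have "... = enn (C * exp (- t))" using assms(3) by (simp add: mult.commute flip: ennreal_mult)
 finally show ?thesis .
qed

lemma wick_tail:
 assumes I: "finite I" and Lm: "Lm > 0" "\<And>n. n \<in> I ==> Lm <= lam n"
 shows "emeasure \<mu> {u \<in> space \<mu>. \<bar>wick I u\<bar> >= 1} <= enn (2 * exp (- Lm\<^sup>2 / 8))"
proof -
 \<comment> \<open>The largest parameter allowed; the moment contributes 3/8 Lm^2 and Markov's
   inequality -1/2 Lm^2, which leaves -1/8 Lm^2.\<close>
 define \<tau> where "\<tau> = Lm^2 / 2"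
 have e: "3 * \<tau>^2 / (2 * Lm^2) = 3 * Lm^2 / 8" using Lm(1) by (simp add: \<tau>_def power2_eq_square)
 have tail: "emeasure \<mu> {u \<in> space \<mu>. \<sigma> * \<tau> * wick I u >= \<tau>} <= enn (exp (- Lm\<^sup>2 / 8))" if "\<bar>\<sigma>\<bar> = 1" for \<sigma>
 proof -
  have sq: "(\<sigma> * \<tau>)^2 = \<tau>^2" using that by (metis abs_1 mult_1 power2_abs power_mult_distrib power_one)
  have "(\<E> u. enn (exp (\<sigma> * \<tau> * wick I u))) <= enn (exp (3 * Lm^2 / 8))"
   using wick_exp_moment[OF I Lm, of "\<sigma> * \<tau>"] that unfolding sq e by (simp add: abs_mult \<tau>_def)
  from exp_Markov[OF _ this, of \<tau>]
  have "emeasure \<mu> {u \<in> space \<mu>. \<sigma> * \<tau> * wick I u >= \<tau>} <= enn (exp (3 * Lm^2 / 8) * exp (- \<tau>))" by simp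
  also have "exp (3 * Lm^2 / 8) * exp (- \<tau>) = exp (- Lm\<^sup>2 / 8)" by (simp add: \<tau>_def flip: exp_add)
  finally show ?thesis .
 qed
 have "{u \<in> space \<mu>. \<bar>wick I u\<bar> >= 1} \<subseteq> {u \<in> space \<mu>. 1 * \<tau> * wick I u >= \<tau>} \<union> {u \<in> space \<mu>. (- 1) * \<tau> * wick I u >= \<tau>}"
 proof
  fix u assume u: "u \<in> {u \<in> space \<mu>. \<bar>wick I u\<bar> >= 1}"
  have "\<tau> * 1 <= \<tau> * wick I u" if "wick I u >= 1" using that by (intro mult_left_mono) (auto simp: \<tau>_def)
  moreover have "\<tau> * 1 <= \<tau> * (- wick I u)" if "- wick I u >= 1" using that by (intro mult_left_mono) (auto simp: \<tau>_def)
  moreover have "wick I u >= 1 \<or> - wick I u >= 1" using u by auto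
  ultimately show "u \<in> {u \<in> space \<mu>. 1 * \<tau> * wick I u >= \<tau>} \<union> {u \<in> space \<mu>. (- 1) * \<tau> * wick I u >= \<tau>}"
   using u by fastforce
 qed
 hence "emeasure \<mu> {u \<in> space \<mu>. \<bar>wick I u\<bar> >= 1} <= emeasure \<mu> ({u \<in> space \<mu>. 1 * \<tau> * wick I u >= \<tau>} \<union> {u \<in> space \<mu>. (- 1) * \<tau> * wick I u >= \<tau>})"
  by (rule emeasure_mono) measurable
 also have "... <= emeasure \<mu> {u \<in> space \<mu>. 1 * \<tau> * wick I u >= \<tau>} + emeasure \<mu> {u \<in> space \<mu>. (- 1) * \<tau> * wick I u >= \<tau>}"
  by (rule emeasure_subadditive) measurable
 also have "... <= enn (exp (- Lm\<^sup>2 / 8)) + enn (exp (- Lm\<^sup>2 / 8))"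
  by (intro add_mono tail) auto
 also have "... = enn (2 * exp (- Lm\<^sup>2 / 8))"
  by (subst ennreal_plus[symmetric]) auto
 finally show ?thesis .
qed

text \<open>The inequality x^2 <= exp x + exp (-x) turns two exponential moments into a second
  moment. With \<tau> = Lm/2 the exponents are 3/8, so each moment is at most 2, and 4 / \<tau>^2 is
  the bound.\<close>

lemma wick_second_moment:
 assumes I: "finite I" and Lm: "Lm >= 1" "\<And>n. n \<in> I ==> Lm <= lam n"
 shows "(\<E> u. enn ((wick I u)^2)) <= enn (16 / Lm^2)"
proof -
 define \<tau> where "\<tau> = Lm / 2"
 have Lm0: "Lm > 0" using Lm by simp
 have "\<tau> <= Lm * Lm / 2" using Lm by (simp add: \<tau>_def)
 hence \<tau>: "\<bar>\<tau>\<bar> <= Lm^2 / 2" "\<bar>- \<tau>\<bar> <= Lm^2 / 2" "\<tau> > 0" using Lm by (auto simp: power2_eq_square \<tau>_def)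
 have e: "exp (3 * \<tau>^2 / (2 * Lm^2)) <= 2"
 proof -
  have "3 * \<tau>^2 / (2 * Lm^2) = 3 / 8" using Lm0 by (simp add: \<tau>_def power2_eq_square)
  moreover have "exp (3 / 8 :: real) <= exp (1 / 2)" by simp
  ultimately show ?thesis using exp_half_le2 by (simp only:)
 qed
 have m: "(\<E> u. enn (exp (t * wick I u))) <= enn 2" if "t = \<tau> \<or> t = - \<tau>" for t
 proof -
  have "(\<E> u. enn (exp (t * wick I u))) <= enn (exp (3 * t^2 / (2 * Lm^2)))"
   using that \<tau> by (intro wick_exp_moment[OF I Lm0 Lm(2)]) auto
  also have "t^2 = \<tau>^2" using that by auto
  finally show ?thesis using e by (meson ennreal_leI order_trans)
 qed
 have pt: "(\<tau> * w)^2 <= exp (\<tau> * w) + exp (- \<tau> * w)" for w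
 proof -
  have c: "x^2 <= exp x + exp (- x)" if "x >= 0" for x :: real
  proof -
   obtain \<xi> where \<xi>: "exp x = (\<Sum>m<4. x ^ m / fact m) + exp \<xi> / fact 4 * x ^ 4"
    using Maclaurin_exp_le[of x 4] by blast
   obtain ze where ze: "exp (- x) = (\<Sum>m<4. (- x) ^ m / fact m) + exp ze / fact 4 * (- x) ^ 4"
    using Maclaurin_exp_le[of "- x" 4] by blast
   have "0 <= exp \<xi> / fact 4 * x ^ 4" "0 <= exp ze / fact 4 * (- x) ^ 4" by auto
   moreover have "(\<Sum>m<4. x ^ m / fact m) + (\<Sum>m<4. (- x) ^ m / fact m) = 2 + x^2"
    by (simp add: numeral_eq_Suc lessThan_Suc power2_eq_square)
   ultimately show ?thesis using \<xi> ze by linarith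
  qed
  show ?thesis using c[of "\<tau> * w"] c[of "- (\<tau> * w)"] by (cases "\<tau> * w >= 0") auto
 qed
 have "enn (\<tau>^2) * (\<E> u. enn ((wick I u)^2)) = (\<E> u. enn (\<tau>^2) * enn ((wick I u)^2))"
  by (rule nn_integral_cmult[symmetric]) measurable
 also have "... <= (\<E> u. enn (exp (\<tau> * wick I u)) + enn (exp (- \<tau> * wick I u)))"
 proof (intro nn_integral_mono)
  fix u
  have "enn (\<tau>^2) * enn ((wick I u)^2) = enn ((\<tau> * wick I u)^2)" (is "?a = _") by (simp add: power_mult_distrib ennreal_mult)
  also have "... <= enn (exp (\<tau> * wick I u) + exp (- \<tau> * wick I u))" by (intro ennreal_leI pt)
  also have "... = enn (exp (\<tau> * wick I u)) + enn (exp (- \<tau> * wick I u))" by (rule ennreal_plus) auto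
  finally show "?a <= ..." .
 qed
 also have "... = (\<E> u. enn (exp (\<tau> * wick I u))) + (\<E> u. enn (exp (- \<tau> * wick I u)))"
  by (rule nn_integral_add) measurable
 also have "... <= enn 2 + enn 2" by (intro add_mono m) auto
 also have "... = enn (\<tau>^2 * (16 / Lm^2))" using Lm0 by (subst ennreal_plus[symmetric]) (auto simp: \<tau>_def power_divide)
 also have "... = enn (\<tau>^2) * enn (16 / Lm^2)" by (rule ennreal_mult) auto
 finally show ?thesis using \<tau>(3) by (simp add: ennreal_mult_le_mult_iff)
qed

text \<open>With A^p = B, the Gaussian exponential moment of the norm at scale A dominates its p-th
  power and, by Markov's inequality, gives a Gaussian tail of the same width.\<close>

lemma nrm_moment:
 assumes p: "p > 2"
 obtains C where "C > 0"
  "\<And>I B. [|finite I; B > 0; (\<L> x. enn (kern I x powr (p / 2))) <= enn B|] ==>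
    (\<E> u. enn (nrm p I u powr p)) <= enn (C * B)"
  "\<And>I B t. [|finite I; B > 0; t >= 0; (\<L> x. enn (kern I x powr (p / 2))) <= enn B|] ==>
    emeasure \<mu> {u \<in> space \<mu>. nrm p I u >= t} <= enn (C * exp (- (t^2 / (2 * B powr (2 / p)))))"
proof -
 obtain K where K: "K > 0"
  "\<And>I A. [|finite I; A > 0; (\<L> x. enn (kern I x powr (p / 2))) <= enn (A powr p)|] ==>
    (\<E> u. enn (exp ((nrm p I u)^2 / (2 * A^2)))) <= enn K"
  using nrm_exp_moment[OF p] by blast
 define E where "E = exp (p / 2 * ln (2 * (p / 2)) - p / 2)"
 have E: "E > 0" by (simp add: E_def)
 show ?thesis
 proof (rule that[of "max K (E * K)"])
  show "max K (E * K) > 0" using K by simp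
  fix I B assume I: "finite I" and B: "B > 0" and SB: "(\<L> x. enn (kern I x powr (p / 2))) <= enn B"
  define A where "A = B powr (1 / p)"
  have A: "A > 0" "A powr p = B" "A^2 = B powr (2 / p)" using B p by (auto simp: A_def powr_powr simp flip: powr_numeral)
  have m: "(\<E> u. enn (exp ((nrm p I u)^2 / (2 * A^2)))) <= enn K"
   using SB A by (intro K(2)[OF I]) auto
  have pt: "nrm p I u powr p <= B * E * exp ((nrm p I u)^2 / (2 * A^2))" for u
  proof -
   define z where "z = (nrm p I u / A)^2"
   have nA: "nrm p I u / A >= 0" using A by simp
   have "z powr (p / 2) = (nrm p I u / A) powr p"
   proof (cases "nrm p I u = 0")
    case False
    hence "nrm p I u / A > 0" using A nrm_nonneg[of p I u] by (simp add: less_le)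
    hence "z = (nrm p I u / A) powr 2" by (simp add: z_def)
    hence "z powr (p / 2) = (nrm p I u / A) powr (2 * (p / 2))" by (simp only: powr_powr)
    thus ?thesis by simp
   qed (simp add: z_def)
   also have "... = nrm p I u powr p / B" using A by (simp add: powr_divide)
   finally have "nrm p I u powr p = B * z powr (p / 2)" using B by simp
   also have "... <= B * (E * exp (z / 2))"
    unfolding E_def using p B by (intro mult_left_mono powr_le_exp) (auto simp: z_def)
   also have "z / 2 = (nrm p I u)^2 / (2 * A^2)" by (simp add: z_def power_divide)
   finally show ?thesis by (simp add: mult.assoc)
  qed
  have "(\<E> u. enn (nrm p I u powr p)) <= (\<E> u. enn (B * E) * enn (exp ((nrm p I u)^2 / (2 * A^2))))" (is "?a <= _")
   using pt B E by (intro nn_integral_mono) (simp add: ennreal_leI flip: ennreal_mult)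
  also have "... = enn (B * E) * (\<E> u. enn (exp ((nrm p I u)^2 / (2 * A^2))))"
   by (rule nn_integral_cmult) measurable
  also have "... <= enn (B * E) * enn K" using m by (intro mult_left_mono) auto
  also have "... = enn (E * K * B)" using B E K by (simp add: mult_ac flip: ennreal_mult)
  also have "... <= enn (max K (E * K) * B)" using B by (intro ennreal_leI mult_right_mono) auto
  finally show "?a <= ..." .
  fix t :: real assume t: "t >= 0"
  have "{u \<in> space \<mu>. nrm p I u >= t} \<subseteq> {u \<in> space \<mu>. (nrm p I u)^2 / (2 * A^2) >= t^2 / (2 * A^2)}"
   using t A by (auto intro!: divide_right_mono power_mono)
  hence "emeasure \<mu> {u \<in> space \<mu>. nrm p I u >= t} <= emeasure \<mu> {u \<in> space \<mu>. (nrm p I u)^2 / (2 * A^2) >= t^2 / (2 * A^2)}" (is "?a <= _")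
   by (rule emeasure_mono) measurable
  also have "... <= enn (K * exp (- (t^2 / (2 * A^2))))" using m K by (intro exp_Markov) auto
  also have "... <= enn (max K (E * K) * exp (- (t^2 / (2 * A^2))))" by (intro ennreal_leI mult_right_mono) auto
  finally show "?a <= enn (max K (E * K) * exp (- (t^2 / (2 * B powr (2 / p)))))"
   by (simp add: A)
 qed
qed

section \<open>Independence of blocks of coordinates\<close>

text \<open>Coordinates outside I are set to 0 instead of being dropped. All blocks then live in the
  same sequence space, and \<open>field\<close>, \<open>nrm\<close> and \<open>wick\<close> apply to
  them unchanged.\<close>

definition cut :: "nat set => (nat => complex) => nat => complex" where
 "cut I u = (%n. if n \<in> I then u n else 0)"

lemma field_cut [simp]: "field I (cut I u) = field I u"
 by (rule ext) (auto simp: field_def cut_def intro!: sum.cong)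

lemma nrm_cut [simp]: "nrm p I (cut I u) = nrm p I u"
 by (simp add: nrm_def)

lemma wick_cut [simp]: "wick I (cut I u) = wick I u"
 by (auto simp: wick_def cut_def intro!: sum.cong)

lemma coords_indep: "indep_vars (%_. borel) (%n u. u n) UNIV"
proof -
 have "indep_vars (%_. borel) (%n u. (%z. z / of_real (lam n)) (of_real (lam n) * u n)) UNIV"
  by (rule indep_vars_compose2[OF indep_G]) auto
 thus ?thesis by (simp add: lam_nz)
qed

lemma cut_indep:
 assumes "I \<inter> J = {}"
 shows "indep_var \<mu> (cut I) \<mu> (cut J)"
proof -
 have iv: "indep_var (PiM I (%_. borel)) (%u. \<lambda>i\<in>I. u i) (PiM J (%_. borel)) (%u. \<lambda>i\<in>J. u i)"
  using indep_var_restrict[OF coords_indep assms] by simp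
 have m: "(%v n. if n \<in> K then v n else 0 :: complex) \<in> measurable (PiM K (%_. borel)) \<mu>" for K :: "nat set"
 proof (subst measurable_cong_sets[OF refl sets_\<mu>], rule measurable_PiM_single')
  fix i
  show "(%v. if i \<in> K then v i else 0 :: complex) \<in> borel_measurable (PiM K (%_. borel))"
   by (cases "i \<in> K") auto
 qed auto
 have c: "cut K = (%v n. if n \<in> K then v n else 0) \<circ> (%u. \<lambda>i\<in>K. u i)" for K
  by (rule ext) (auto simp: cut_def)
 show ?thesis unfolding c[of I] c[of J] by (rule indep_var_compose[OF iv m m])
qed

lemma cut_measurable [measurable]: "cut I \<in> measurable \<mu> \<mu>"
 using cut_indep[of I "{}"] indep_var_rv1 by auto

text \<open>Independence makes the joint law of the two blocks a product, so Fubini's theorem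
  freezes one block while the other is integrated.\<close>

lemma cut_integral:
 assumes IJ: "I \<inter> J = {}" and Qm: "Q \<in> borel_measurable (\<mu> \<Otimes>\<^sub>M \<mu>)"
 shows "(\<E> u. Q (cut I u, cut J u)) = (\<E> v. (\<E> u. Q (cut I u, cut J v)))"
proof -
 note Qm [measurable]
 interpret a: prob_space "distr \<mu> \<mu> (cut I)" by (rule prob_space_distr) measurable
 interpret b: prob_space "distr \<mu> \<mu> (cut J)" by (rule prob_space_distr) measurable
 interpret ab: pair_sigma_finite "distr \<mu> \<mu> (cut I)" "distr \<mu> \<mu> (cut J)"
  by (intro pair_sigma_finite.intro a.sigma_finite_measure_axioms b.sigma_finite_measure_axioms)
 have de: "distr \<mu> \<mu> (cut I) \<Otimes>\<^sub>M distr \<mu> \<mu> (cut J) = distr \<mu> (\<mu> \<Otimes>\<^sub>M \<mu>) (%u. (cut I u, cut J u))"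
  using cut_indep[OF IJ] by (simp add: indep_var_distribution_eq)
 have s: "sets (distr \<mu> \<mu> (cut I) \<Otimes>\<^sub>M distr \<mu> \<mu> (cut J)) = sets (\<mu> \<Otimes>\<^sub>M \<mu>)"
  by (intro sets_pair_measure_cong) auto
 have Qm': "Q \<in> borel_measurable (distr \<mu> \<mu> (cut I) \<Otimes>\<^sub>M distr \<mu> \<mu> (cut J))"
  using Qm by (simp cong: measurable_cong_sets add: s)
 have "(\<E> u. Q (cut I u, cut J u)) = (\<integral>\<^sup>+q. Q q \<partial>(distr \<mu> (\<mu> \<Otimes>\<^sub>M \<mu>) (%u. (cut I u, cut J u))))"
  by (subst nn_integral_distr) measurable
 also have "... = (\<integral>\<^sup>+q. Q q \<partial>(distr \<mu> \<mu> (cut I) \<Otimes>\<^sub>M distr \<mu> \<mu> (cut J)))" by (simp only: de)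
 also have "... = (\<integral>\<^sup>+v. (\<integral>\<^sup>+u. Q (u, v) \<partial>distr \<mu> \<mu> (cut I)) \<partial>distr \<mu> \<mu> (cut J))"
  by (rule ab.nn_integral_snd[OF Qm', symmetric])
 also have "... = (\<integral>\<^sup>+v. (\<E> u. Q (cut I u, v)) \<partial>distr \<mu> \<mu> (cut J))"
  by (intro nn_integral_cong nn_integral_distr) (auto intro: measurable_compose[OF _ Qm])
 also have "... = (\<E> v. (\<E> u. Q (cut I u, cut J v)))"
  by (subst nn_integral_distr) measurable
 finally show ?thesis .
qed

lemma cut_product:
 assumes IJ: "I \<inter> J = {}" and [measurable]: "f \<in> borel_measurable \<mu>" "g \<in> borel_measurable \<mu>"
 shows "(\<E> u. f (cut I u) * g (cut J u)) = (\<E> u. f (cut I u)) * (\<E> u. g (cut J u))"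
 using cut_integral[OF IJ, of "%(u, v). f u * g v"]
 by (simp add: nn_integral_multc nn_integral_cmult)

text \<open>The event is a product over coordinates; multiplication by lam n turns each factor into
  a disc for a standard Gaussian, where \<open>gauss_ball_lower\<close> applies.\<close>

lemma small_ball:
 assumes ep: "ep > 0" and I: "finite I"
 shows "emeasure \<mu> {u \<in> space \<mu>. \<forall>n\<in>I. cmod (u n - a n) <= ep}
  >= enn (\<Prod>n\<in>I. (lam n * ep)^2 * exp (- (lam n * cmod (a n) + lam n * ep)\<^sup>2))"
proof -
 define B where "B n = cball (of_real (lam n) * a n) (lam n * ep)" for n
 have [measurable]: "B n \<in> sets borel" for n by (simp add: B_def)
 have lp: "lam n > 0" for n using lam_ge(2)[of n] by simp
 have inB: "of_real (lam n) * z \<in> B n \<longleftrightarrow> cmod (z - a n) <= ep" for n z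
 proof -
  have "dist (of_real (lam n) * a n) (of_real (lam n) * z) = lam n * cmod (z - a n)"
   using lp[of n] by (simp add: dist_norm norm_minus_commute flip: right_diff_distrib norm_mult) (simp add: norm_mult norm_minus_commute)
  thus ?thesis using lp[of n] by (simp add: B_def)
 qed
 have "enn (\<Prod>n\<in>I. (lam n * ep)^2 * exp (- (lam n * cmod (a n) + lam n * ep)\<^sup>2))
   = (\<Prod>n\<in>I. enn ((lam n * ep)^2 * exp (- (lam n * cmod (a n) + lam n * ep)\<^sup>2)))"
  by (rule prod_ennreal[symmetric]) simp
 also have "... <= (\<Prod>n\<in>I. emeasure gauss (B n))"
 proof (intro prod_mono_ennreal)
  fix n
  show "enn ((lam n * ep)^2 * exp (- (lam n * cmod (a n) + lam n * ep)\<^sup>2)) <= emeasure gauss (B n)"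
   using gauss_ball_lower[of "lam n * ep" "of_real (lam n) * a n"] lp[of n] ep by (simp add: B_def norm_mult)
 qed
 also have "... = (\<Prod>n\<in>I. (\<E> u. indicator (B n) (of_real (lam n) * u n)))"
 proof (intro prod.cong refl)
  fix n
  show "emeasure gauss (B n) = (\<E> u. indicator (B n) (of_real (lam n) * u n))"
   using nn_integral_G[of "indicator (B n)" n] by (simp add: gauss_def)
 qed
 also have "... = (\<E> u. (\<Prod>n\<in>I. indicator (B n) (of_real (lam n) * u n)))"
  by (rule indep_vars_nn_integral[symmetric, OF I indep_vars_compose2[OF indep_vars_subset[OF indep_G]]]) auto
 also have "... = (\<E> u. indicator {u \<in> space \<mu>. \<forall>n\<in>I. cmod (u n - a n) <= ep} u)"
 proof (intro nn_integral_cong)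
  fix u assume u: "u \<in> space \<mu>"
  show "(\<Prod>n\<in>I. indicator (B n) (of_real (lam n) * u n)) = (indicator {u \<in> space \<mu>. \<forall>n\<in>I. cmod (u n - a n) <= ep} u :: ennreal)"
  proof (cases "\<forall>n\<in>I. cmod (u n - a n) <= ep")
   case True
   thus ?thesis using u by (simp add: indicator_def inB)
  next
   case False
   then obtain n where "n \<in> I" "\<not> cmod (u n - a n) <= ep" by blast
   hence "\<exists>n\<in>I. indicator (B n) (of_real (lam n) * u n) = (0 :: ennreal)" by (auto simp: indicator_def inB)
   hence "(\<Prod>n\<in>I. indicator (B n) (of_real (lam n) * u n)) = (0 :: ennreal)" using I by (intro prod_zero)
   moreover have "indicator {u \<in> space \<mu>. \<forall>n\<in>I. cmod (u n - a n) <= ep} u = (0 :: ennreal)" using False by simp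
   ultimately show ?thesis by (simp only:)
  qed
 qed
 also have "... = emeasure \<mu> {u \<in> space \<mu>. \<forall>n\<in>I. cmod (u n - a n) <= ep}"
  using I by (subst nn_integral_indicator) measurable
 finally show ?thesis .
qed

end

section \<open>Convergence of the truncated norms and masses\<close>

lemma Lp_norm_tendsto_0_iff:
 assumes "p > 0"
 shows "((%N. Lp_norm M p (F N)) \<longlonglongrightarrow> 0) \<longleftrightarrow> ((%N. Lp_int M p (F N)) \<longlonglongrightarrow> 0)"
proof
 assume *: "(%N. Lp_norm M p (F N)) \<longlonglongrightarrow> 0"
 show "(%N. Lp_int M p (F N)) \<longlonglongrightarrow> 0"
 proof (rule tendsto_ennreal_0I)
  fix e :: real assume e: "e > 0"
  have "\<forall>\<^sub>F N in sequentially. Lp_norm M p (F N) < enn (e powr (1 / p))"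
   using order_tendstoD(2)[OF *, of "enn (e powr (1 / p))"] e by simp
  thus "\<forall>\<^sub>F N in sequentially. Lp_int M p (F N) <= enn e"
  proof (rule eventually_mono)
   fix N assume "Lp_norm M p (F N) < enn (e powr (1 / p))"
   hence "Lp_int M p (F N) <= enn ((e powr (1 / p)) powr p)"
    using Lp_norm_le_iff[OF assms, of "e powr (1 / p)" M "F N"] by (metis less_imp_le powr_ge_zero)
   thus "Lp_int M p (F N) <= enn e" using e assms by (simp add: powr_powr)
  qed
 qed
next
 assume *: "(%N. Lp_int M p (F N)) \<longlonglongrightarrow> 0"
 show "(%N. Lp_norm M p (F N)) \<longlonglongrightarrow> 0"
 proof (rule tendsto_ennreal_0I)
  fix e :: real assume e: "e > 0"
  have "\<forall>\<^sub>F N in sequentially. Lp_int M p (F N) < enn (e powr p)"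
   using order_tendstoD(2)[OF *, of "enn (e powr p)"] e by simp
  thus "\<forall>\<^sub>F N in sequentially. Lp_norm M p (F N) <= enn e"
  proof (rule eventually_mono)
   fix N assume "Lp_int M p (F N) < enn (e powr p)"
   thus "Lp_norm M p (F N) <= enn e" using Lp_norm_le_iff[OF assms, of e M "F N"] e by (metis less_imp_le)
  qed
 qed
qed

context gibbs
begin

lemma valid_admissible:
 assumes "valid p"
 obtains a where "admissible p a"
proof -
 \<comment> \<open>The minimum of the slacks in the conditions for a, with 1/2 added to the list;
   half of it satisfies all of them strictly.\<close>
 define g where "g = min (1 / 2) (min (real D - 2 * real D / p) (2 * real D / p - real D + 2))"
 have p: "p > 2" "p * (real D - 2) < 2 * real D" using assms by (auto simp: valid_def)
 have "2 * real D < real D * p" using p dim by simp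
 hence "real D - 2 * real D / p > 0" using p by (simp add: field_simps)
 moreover have "2 * real D / p - real D + 2 > 0" using p by (simp add: field_simps)
 ultimately have g: "g > 0" by (auto simp: g_def)
 have "g <= 1 / 2" "g <= real D - 2 * real D / p" "g <= 2 * real D / p - real D + 2"
  unfolding g_def by linarith+
 hence "admissible p (g / 2)" unfolding admissible_def using g p by linarith
 thus ?thesis by (rule that)
qed

lemma admissible_high_moment:
 assumes adm: "admissible p a"
 obtains C where "C > 0"
  "\<And>I Lm. [|finite I; Lm > 0; \<And>n. n \<in> I ==> Lm <= lam n|] ==>
    (\<E> u. enn (nrm p I u powr p)) <= enn (C * Lm powr (- (a * p / 2)))"
  "\<And>I Lm t. [|finite I; Lm > 0; t >= 0; \<And>n. n \<in> I ==> Lm <= lam n|] ==>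
    emeasure \<mu> {u \<in> space \<mu>. nrm p I u >= t} <= enn (C * exp (- (t^2 * Lm powr a / C)))"
proof -
 have p: "p > 2" using adm by (simp add: admissible_def)
 obtain C1 where C1: "C1 > 0"
  "\<And>I Lm. [|finite I; Lm > 0; \<And>n. n \<in> I ==> Lm <= lam n|] ==>
    (\<L> x. enn (kern I x powr (p / 2))) <= enn (C1 * Lm powr (- (a * p / 2)))"
  using kern_integral[OF adm] by blast
 obtain C2 where C2: "C2 > 0"
  "\<And>I B. [|finite I; B > 0; (\<L> x. enn (kern I x powr (p / 2))) <= enn B|] ==>
    (\<E> u. enn (nrm p I u powr p)) <= enn (C2 * B)"
  "\<And>I B t. [|finite I; B > 0; t >= 0; (\<L> x. enn (kern I x powr (p / 2))) <= enn B|] ==>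
    emeasure \<mu> {u \<in> space \<mu>. nrm p I u >= t} <= enn (C2 * exp (- (t^2 / (2 * B powr (2 / p)))))"
  using nrm_moment[OF p] by blast
 define C3 where "C3 = 2 * C1 powr (2 / p)"
 define C where "C = max (C2 * C1) (max C2 C3)"
 have C3: "C3 > 0" using C1 by (simp add: C3_def)
 have C: "C > 0" "C2 * C1 <= C" "C2 <= C" "C3 <= C" using C1 C2 C3 by (auto simp: C_def less_max_iff_disj)
 show ?thesis
 proof (rule that[OF C(1)])
  fix I and Lm :: real assume h: "finite I" "Lm > 0" "\<And>n. n \<in> I ==> Lm <= lam n"
  define B where "B = C1 * Lm powr (- (a * p / 2))"
  have B: "B > 0" using C1 h by (simp add: B_def)
  have kB: "(\<L> x. enn (kern I x powr (p / 2))) <= enn B"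
   unfolding B_def by (rule C1(2)) (use h in auto)
  have "(\<E> u. enn (nrm p I u powr p)) <= enn (C2 * B)" (is "?a <= _") by (rule C2(2)[OF h(1) B kB])
  also have "... <= enn (C * Lm powr (- (a * p / 2)))"
   using C(2) h(2) unfolding B_def by (intro ennreal_leI) (simp add: mult_right_mono flip: mult.assoc)
  finally show "?a <= ..." .
  fix t :: real assume t: "t >= 0"
  have "B powr (2 / p) = C1 powr (2 / p) * Lm powr (- a)"
   using C1(1) h(2) p by (simp add: B_def powr_mult powr_powr)
  hence BC: "B powr (2 / p) = C1 powr (2 / p) * (1 / Lm powr a)" by (simp only: powr_minus_divide)
  have e: "t^2 / (2 * B powr (2 / p)) = t^2 * Lm powr a / C3"
   unfolding C3_def BC using h(2) by (simp only: times_divide_eq_right divide_divide_eq_right mult_1_right mult.assoc)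
  have "emeasure \<mu> {u \<in> space \<mu>. nrm p I u >= t} <= enn (C2 * exp (- (t^2 * Lm powr a / C3)))" (is "?a <= _")
   using C2(3)[OF h(1) B t kB] unfolding e .
  also have "... <= enn (C * exp (- (t^2 * Lm powr a / C)))"
  proof (intro ennreal_leI mult_mono)
   have "t^2 * Lm powr a / C <= t^2 * Lm powr a / C3" using C C3 by (intro divide_left_mono) auto
   thus "exp (- (t^2 * Lm powr a / C3)) <= exp (- (t^2 * Lm powr a / C))" by simp
  qed (use C in auto)
  finally show "?a <= ..." .
 qed
qed

lemma high_moment:
 assumes "valid p"
 obtains C b where "C > 0" "b > 0"
  "\<And>I Lm. [|finite I; Lm > 0; \<And>n. n \<in> I ==> Lm <= lam n|] ==>
    (\<E> u. enn (nrm p I u powr p)) <= enn (C * Lm powr (- b))"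
proof -
 obtain a where a: "admissible p a" using valid_admissible[OF assms] .
 have b: "a * p / 2 > 0" using a by (simp add: admissible_def)
 show ?thesis
 proof (rule admissible_high_moment[OF a])
  fix C :: real assume C: "C > 0" "\<And>I Lm. [|finite I; Lm > 0; \<And>n. n \<in> I ==> Lm <= lam n|] ==>
    (\<E> u. enn (nrm p I u powr p)) <= enn (C * Lm powr (- (a * p / 2)))"
  show ?thesis by (rule that[OF C(1) b C(2)])
 qed
qed

lemma field_split:
 assumes "finite I" "finite J" "I \<inter> J = {}"
 shows "field (I \<union> J) u x = field I u x + field J u x"
 unfolding field_def by (rule sum.union_disjoint[OF assms])

lemma nrm_union:
 assumes "finite I" "finite J" "I \<inter> J = {}" "p >= 1"
 shows "nrm p (I \<union> J) u <= nrm p I u + nrm p J u"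
proof -
 have "Lp_norm lborel p (%x. field I u x + field J u x) <= Lp_norm lborel p (field I u) + Lp_norm lborel p (field J u)"
  using assms(4) by (intro Lp_norm_triangle) auto
 hence "enn (nrm p (I \<union> J) u) <= enn (nrm p I u) + enn (nrm p J u)"
  using assms by (simp add: Lp_norm_field_nrm[symmetric] field_split[OF assms(1-3), symmetric])
 also have "... = enn (nrm p I u + nrm p J u)" by (simp add: ennreal_plus)
 finally show ?thesis by (subst (asm) ennreal_le_iff) auto
qed

lemma nrm_diff:
 assumes MN: "M <= N" and p: "p >= 1"
 shows "\<bar>nrm p {..N} u - nrm p {..M} u\<bar> <= nrm p {M<..N} u"
  "(%x. field {..N} u x - field {..M} u x) = field {M<..N} u"
proof -
 have e: "{..N} = {..M} \<union> {M<..N}" using MN by auto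
 show d: "(%x. field {..N} u x - field {..M} u x) = field {M<..N} u"
  by (rule ext, subst e, subst field_split) auto
 show "\<bar>nrm p {..N} u - nrm p {..M} u\<bar> <= nrm p {M<..N} u"
  unfolding nrm_def d[symmetric]
  using field_in_Lp[OF p, of "{M<..N}" u] field_in_Lp[OF p, of "{..M}" u] d p
  by (intro Lp_norm_triangle_real(2)) (auto simp: in_Lp_def)
qed

definition rnd :: "real => (nat => complex) => real" where
 "rnd p u = enn2real (Lp_norm_distribution h p u)"

lemma rnd_measurable:
 assumes "p >= 2"
 shows "rnd p \<in> borel_measurable \<mu>"
 unfolding rnd_def [abs_def] measurable_cong_sets[OF sets_\<mu> refl]
 using Lp_norm_distribution_measurable[OF assms] by measurable

lemma lam_ge_sqrt: "sqrt (real n) <= lam n"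
 by (simp add: ho_freq_def)

lemma lam_mono: "m <= n ==> lam m <= lam n"
 by (simp add: ho_freq_def)

text \<open>The difference of two powers in the bound is what makes the induction close exactly;
  afterwards the second power is discarded.\<close>

lemma nrm_chain:
 assumes r: "strict_mono r" and p: "p >= 1" and b: "\<And>k. nrm p {r k<..r (Suc k)} u <= b0 * (1 / 2) ^ k"
 shows "j <= i ==> nrm p {r j<..r i} u <= 2 * b0 * ((1 / 2) ^ j - (1 / 2) ^ i)"
proof (induction i rule: dec_induct)
 case base
 thus ?case using p by (simp add: nrm_def field_def [abs_def] Lp_norm_Lp_int Lp_int_def)
next
 case (step i)
 have "{r j<..r (Suc i)} = {r j<..r i} \<union> {r i<..r (Suc i)}"
  using strict_mono_less_eq[OF r, of j i] strict_mono_less_eq[OF r, of i "Suc i"] step(1) by auto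
 hence "nrm p {r j<..r (Suc i)} u <= nrm p {r j<..r i} u + nrm p {r i<..r (Suc i)} u"
  using nrm_union[of "{r j<..r i}" "{r i<..r (Suc i)}" p u] p by auto
 also have "... <= 2 * b0 * ((1 / 2) ^ j - (1 / 2) ^ i) + b0 * (1 / 2) ^ i" using step.IH b[of i] by simp
 finally show ?case by (simp add: algebra_simps)
qed

text \<open>Geometrically small blocks make the partial sums Cauchy in L^p. Pairing with each h_n
  identifies the limit as a representative, and by uniqueness its norm is the value of
  \<open>Lp_norm_distribution\<close>.\<close>

lemma representative_limit:
 assumes p: "valid p" and r: "strict_mono r" and b: "\<And>k. nrm p {r k<..r (Suc k)} u <= b0 * (1 / 2) ^ k"
 shows "Lp_norm_distribution h p u < \<infinity>" "(%k. nrm p {..r k} u) \<longlonglongrightarrow> rnd p u"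
proof -
 have p1: "p >= 1" "p > 0" using p by (auto simp: valid_def)
 have b0: "b0 >= 0" using order_trans[OF nrm_nonneg b[of 0]] by simp
 have diff: "Lp_int lborel p (%x. field {..r i} u x - field {..r j} u x) <= enn ((2 * b0 * (1 / 2) ^ j) powr p)" if "j <= i" for i j
 proof -
  have "r j <= r i" using r that by (simp add: strict_mono_less_eq)
  hence "Lp_int lborel p (%x. field {..r i} u x - field {..r j} u x) = enn (nrm p {r j<..r i} u powr p)"
   using p1 by (simp add: nrm_diff(2) Lp_int_field_nrm)
  also have "... <= enn ((2 * b0 * (1 / 2) ^ j) powr p)"
  proof (intro ennreal_leI powr_mono2)
   have "nrm p {r j<..r i} u <= 2 * b0 * ((1 / 2) ^ j - (1 / 2) ^ i)" by (rule nrm_chain[OF r p1(1) b that])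
   also have "... <= 2 * b0 * (1 / 2) ^ j" using b0 by (intro mult_left_mono) auto
   finally show "nrm p {r j<..r i} u <= ..." .
  qed (use p1 in auto)
  finally show ?thesis .
 qed
 have cauchy: "\<exists>K. \<forall>j\<ge>K. \<forall>k\<ge>K. Lp_int lborel p (%x. field {..r j} u x - field {..r k} u x) <= enn e" if e: "e > 0" for e
 proof -
  have "(%K. (2 * b0 * (1 / 2) ^ K) powr p) \<longlonglongrightarrow> (2 * b0 * 0) powr p"
   using p1 b0 by (intro tendsto_powr' tendsto_mult tendsto_const LIMSEQ_realpow_zero) auto
  hence "\<forall>\<^sub>F K in sequentially. (2 * b0 * (1 / 2) ^ K) powr p < e"
   using e by (auto dest: order_tendstoD(2))
  then obtain K where K: "(2 * b0 * (1 / 2) ^ K) powr p < e" by (auto simp: eventually_sequentially)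
  have le: "Lp_int lborel p (%x. field {..r i} u x - field {..r j} u x) <= enn e" if "K <= j" "j <= i" for i j
  proof (rule order_trans[OF diff[OF that(2)]], rule ennreal_leI)
   have "(2 * b0 * (1 / 2) ^ j) powr p <= (2 * b0 * (1 / 2) ^ K) powr p"
    using that b0 p1 by (intro powr_mono2 mult_left_mono power_decreasing) auto
   thus "(2 * b0 * (1 / 2) ^ j) powr p <= e" using K by simp
  qed
  have sw: "Lp_int lborel p (%x. field {..r i} u x - field {..r j} u x) = Lp_int lborel p (%x. field {..r j} u x - field {..r i} u x)" for i j
   unfolding Lp_int_def by (simp add: norm_minus_commute)
  show ?thesis
  proof (intro exI[of _ K] allI impI)
   fix j k assume "K <= j" "K <= k"
   thus "Lp_int lborel p (%x. field {..r j} u x - field {..r k} u x) <= enn e"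
    using le[of k j] le[of j k] sw[of j k] by (cases "k <= j") auto
  qed
 qed
 obtain s where s: "strict_mono s"
  "(%x. lim (%k. field {..r (s k)} u x)) \<in> borel_measurable lborel"
  "(%k. Lp_int lborel p (%x. field {..r k} u x - lim (%k. field {..r (s k)} u x))) \<longlonglongrightarrow> 0"
  by (rule Lp_int_complete[of "%k. field {..r k} u" lborel p]) (use p1 cauchy in auto)
 define f where "f x = lim (%k. field {..r (s k)} u x)" for x
 have fm [measurable]: "f \<in> borel_measurable lborel" using s(2) by (simp add: f_def [abs_def])
 have lim: "(%k. Lp_int lborel p (%x. field {..r k} u x - f x)) \<longlonglongrightarrow> 0" using s(3) by (simp add: f_def)
 have lim2: "(%k. Lp_norm lborel p (%x. field {..r k} u x - f x)) \<longlonglongrightarrow> 0"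
  using lim p1 by (simp add: Lp_norm_tendsto_0_iff)
 have rad: "radial f" unfolding radial_def
 proof (intro allI impI)
  fix x y :: 'a assume "norm x = norm y"
  hence "field {..r (s k)} u x = field {..r (s k)} u y" for k using field_radial unfolding radial_def by blast
  thus "f x = f y" by (simp add: f_def)
 qed
 have "\<forall>\<^sub>F k in sequentially. Lp_norm lborel p (%x. field {..r k} u x - f x) < 1"
  using order_tendstoD(2)[OF lim2, of 1] by simp
 then obtain k0 where k0: "Lp_norm lborel p (%x. field {..r k} u x - f x) < 1" if "k >= k0" for k
  by (auto simp: eventually_sequentially)
 have Fin: "in_Lp lborel p (field {..r k} u)" for k using p1 by (intro field_in_Lp) auto
 have fin: "Lp_norm lborel p f < \<infinity>"
 proof (rule Lp_norm_triangle_real(1)[OF fm _ p1(1)])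
  show "field {..r k0} u \<in> borel_measurable lborel" by simp
  show "Lp_norm lborel p (%x. f x - field {..r k0} u x) < \<infinity>"
   using order.strict_trans[OF k0, of k0 \<top>] by (subst Lp_norm_minus_commute) simp
  show "Lp_norm lborel p (field {..r k0} u) < \<infinity>" using Fin by (simp add: in_Lp_def)
 qed
 have fLp: "in_Lp lborel p f" using fin fm by (simp add: in_Lp_def)
 define q where "q = p / (p - 1)"
 note q = valid_dual[OF p, folded q_def]
 have rep: "f \<in> representatives p UNIV u"
  unfolding representatives_def
 proof (intro CollectI conjI ballI rad fLp)
  fix n
  have hq: "in_Lp lborel q (h n)" using q by (intro h_in_Lp) auto
  have "(%k. (\<I> x. field {..r k} u x * of_real (h n x))) \<longlonglongrightarrow> (\<I> x. f x * of_real (h n x))"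
   by (rule Lp_pairing_tendsto[OF Fin fLp hq q(1,2,4) lim])
  moreover have "(%k. (\<I> x. field {..r k} u x * of_real (h n x))) \<longlonglongrightarrow> u n"
  proof (rule tendsto_eventually)
   have "(\<I> x. field {..r k} u x * of_real (h n x)) = u n" if "k >= n" for k
   proof -
    have "n <= r k" using strict_mono_imp_increasing[OF r, of k] that by simp
    thus ?thesis using field_coeff[of "{..r k}" u n] by (simp add: has_bochner_integral_iff)
   qed
   thus "\<forall>\<^sub>F k in sequentially. (\<I> x. field {..r k} u x * of_real (h n x)) = u n"
    by (auto simp: eventually_sequentially)
  qed
  ultimately have "(\<I> x. f x * of_real (h n x)) = u n" by (rule LIMSEQ_unique)
  thus "has_bochner_integral lborel (%x. f x * of_real (h n x)) (u n)"
   using Lp_pairing(1)[OF fLp hq q(1,2,4), of 1] by (simp add: has_bochner_integral_iff)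
 qed
 have T: "Lp_norm_distribution h p u = Lp_norm lborel p f" by (rule Lp_norm_distribution_eq[OF p rep])
 show "Lp_norm_distribution h p u < \<infinity>" using T fin by simp
 have "(%k. enn2real (Lp_norm lborel p (%x. field {..r k} u x - f x))) \<longlonglongrightarrow> enn2real 0"
  using lim2 by (intro tendsto_enn2real) auto
 hence e0: "(%k. enn2real (Lp_norm lborel p (%x. field {..r k} u x - f x))) \<longlonglongrightarrow> 0" by simp
 have "(%k. nrm p {..r k} u - rnd p u) \<longlonglongrightarrow> 0"
 proof (rule tendsto_rabs_zero_cancel, rule tendsto_sandwich[OF _ _ tendsto_const e0])
  show "\<forall>\<^sub>F k in sequentially. \<bar>nrm p {..r k} u - rnd p u\<bar> <= enn2real (Lp_norm lborel p (%x. field {..r k} u x - f x))"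
  proof (rule eventually_sequentiallyI[of k0])
   fix k assume "k >= k0"
   hence "Lp_norm lborel p (%x. field {..r k} u x - f x) < \<infinity>"
    using order.strict_trans[OF k0, of k \<top>] by simp
   thus "\<bar>nrm p {..r k} u - rnd p u\<bar> <= enn2real (Lp_norm lborel p (%x. field {..r k} u x - f x))"
    unfolding nrm_def rnd_def T using fin p1 by (intro Lp_norm_triangle_real(2)) auto
  qed
 qed auto
 thus "(%k. nrm p {..r k} u) \<longlonglongrightarrow> rnd p u" by (rule LIM_zero_cancel)
qed

text \<open>Blocks between sparse indices have p-th moments decaying geometrically, faster than
  2^(-pk); hence almost surely their norms are at most a random multiple of 2^(-k).\<close>

lemma AE_limit:
 assumes p: "valid p"
 obtains r where "strict_mono r" "AE u in \<mu>. (%k. nrm p {..r k} u) \<longlonglongrightarrow> rnd p u"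
proof -
 have p2: "p > 2" "p >= 1" using p by (auto simp: valid_def)
 obtain C b where C: "C > 0" and b: "b > 0"
  and hm: "\<And>I Lm. [|finite I; Lm > 0; \<And>n. n \<in> I ==> Lm <= lam n|] ==>
    (\<E> u. enn (nrm p I u powr p)) <= enn (C * Lm powr (- b))"
  using high_moment[OF p] by blast
 \<comment> \<open>The moment above index 2^(mk) decays like 2^(-mbk/2), since lam_n >= sqrt n. This
   m makes the exponent at least (p+1)k: p to pay for the factor 2^(pk), and 1 for
   summability.\<close>
 define m where "m = Suc (nat \<lceil>2 * (p + 1) / b\<rceil>)"
 have "real m >= 2 * (p + 1) / b" unfolding m_def using real_nat_ceiling_ge[of "2 * (p + 1) / b"] by linarith
 hence m: "real m * b / 2 >= p + 1" "m > 0" using b by (auto simp: field_simps m_def)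
 define r where "r k = (2::nat) ^ (m * k)" for k
 have r: "strict_mono r" unfolding r_def strict_mono_def using m by simp
 define e where "e k u = nrm p {r k<..r (Suc k)} u" for k u
 have em [measurable]: "e k \<in> borel_measurable \<mu>" for k unfolding e_def [abs_def] by measurable
 have eb: "(\<E> u. enn (e k u powr p)) <= enn (C * 2 powr (- ((p + 1) * real k)))" for k
 proof -
  have "(\<E> u. enn (e k u powr p)) <= enn (C * sqrt (real (r k)) powr (- b))"
   unfolding e_def
  proof (rule hm)
   fix n assume "n \<in> {r k<..r (Suc k)}"
   hence "sqrt (real (r k)) <= sqrt (real n)" by simp
   thus "sqrt (real (r k)) <= lam n" using lam_ge_sqrt[of n] by linarith
  qed (auto simp: r_def)
  also have "sqrt (real (r k)) powr (- b) = 2 powr (- (real m * b / 2 * real k))"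
  proof -
   have "real (r k) = 2 powr (real m * real k)" by (simp add: r_def powr_realpow[symmetric] del: powr_realpow)
   hence "sqrt (real (r k)) = 2 powr (real m * real k * (1 / 2))" by (simp add: powr_half_sqrt[symmetric] powr_powr)
   thus ?thesis by (simp add: powr_powr mult_ac)
  qed
  also have "enn (C * 2 powr (- (real m * b / 2 * real k))) <= enn (C * 2 powr (- ((p + 1) * real k)))"
   using C mult_right_mono[OF m(1), of "real k"] by (intro ennreal_leI mult_left_mono powr_mono) auto
  finally show ?thesis .
 qed
 define S where "S u = (\<Sum>k. enn (2 powr (p * real k) * e k u powr p))" for u
 have [measurable]: "S \<in> borel_measurable \<mu>" unfolding S_def [abs_def] by measurable
 have "(\<E> u. S u) = (\<Sum>k. (\<E> u. enn (2 powr (p * real k) * e k u powr p)))"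
  unfolding S_def by (rule nn_integral_suminf) measurable
 also have "... <= (\<Sum>k. enn (C * (1 / 2) ^ k))"
 proof (rule suminf_le)
  fix k
  have "(\<E> u. enn (2 powr (p * real k) * e k u powr p)) = enn (2 powr (p * real k)) * (\<E> u. enn (e k u powr p))" (is "?a = _")
   by (simp add: ennreal_mult nn_integral_cmult)
  also have "... <= enn (2 powr (p * real k)) * enn (C * 2 powr (- ((p + 1) * real k)))"
   by (intro mult_left_mono eb) auto
  also have "... = enn (2 powr (p * real k) * (C * 2 powr (- ((p + 1) * real k))))"
   using C by (intro ennreal_mult[symmetric]) auto
  also have "2 powr (p * real k) * (C * 2 powr (- ((p + 1) * real k))) = C * (1 / 2) ^ k"
  proof -
   have "2 powr (p * real k) * 2 powr (- ((p + 1) * real k)) = 2 powr (p * real k + - ((p + 1) * real k))"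
    by (rule powr_add[symmetric])
   also have "p * real k + - ((p + 1) * real k) = - real k" by (simp add: algebra_simps)
   also have "2 powr (- real k) = (1 / 2 :: real) ^ k" by (simp add: powr_minus_divide powr_realpow power_divide)
   finally show ?thesis by (simp add: mult_ac)
  qed
  finally show "?a <= enn (C * (1 / 2) ^ k)" .
 qed auto
 also have "... = enn (\<Sum>k. C * (1 / 2) ^ k)"
  using C by (intro suminf_ennreal2 summable_mult summable_geometric) auto
 also have "... < \<infinity>" by simp
 finally have "AE u in \<mu>. S u ~= \<infinity>" by (intro nn_integral_noteq_infinite) auto
 hence "AE u in \<mu>. (%k. nrm p {..r k} u) \<longlonglongrightarrow> rnd p u"
 proof (rule eventually_mono)
  fix u assume "S u ~= \<infinity>"
  then obtain B where B: "S u = enn B" "B >= 0" by (cases "S u") auto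
  have "nrm p {r k<..r (Suc k)} u <= B powr (1 / p) * (1 / 2) ^ k" for k
  proof -
   have "enn (2 powr (p * real k) * e k u powr p) <= S u"
   proof -
    define f where "f k = enn (2 powr (p * real k) * e k u powr p)" for k
    have "sum f {k} <= suminf f" by (rule sum_le_suminf) auto
    hence "f k <= suminf f" by simp
    thus ?thesis unfolding f_def [abs_def] S_def .
   qed
   hence "2 powr (p * real k) * e k u powr p <= B" using B by simp
   moreover have "2 powr (p * real k) * e k u powr p = (2 ^ k * e k u) powr p"
    using p2 by (simp add: powr_mult powr_powr powr_realpow[symmetric] mult.commute e_def del: powr_realpow)
   ultimately have "((2 ^ k * e k u) powr p) powr (1 / p) <= B powr (1 / p)"
    using p2 by (intro powr_mono2) auto
   hence "2 ^ k * e k u <= B powr (1 / p)" using p2 by (simp add: powr_powr e_def)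
   thus ?thesis by (simp add: e_def field_simps power_divide)
  qed
  thus "(%k. nrm p {..r k} u) \<longlonglongrightarrow> rnd p u" by (rule representative_limit(2)[OF p r])
 qed
 thus ?thesis using that r by blast
qed

lemma low_set_measurable:
 assumes "A \<in> sets \<mu>"
 shows "(%u. indicator A (cut I u) :: ennreal) \<in> borel_measurable \<mu>"
 by (rule measurable_compose[OF cut_measurable]) (use assms in simp)

text \<open>The difference of the norms is controlled by the coordinates beyond \<open>M\<close>, which are independent of an
 event depending on the first coordinates only.\<close>

lemma rnd_close:
 assumes p: "valid p"
 obtains C b where "C > 0" "b > 0"
  "\<And>M A. A \<in> sets \<mu> ==>
    (\<E> u. indicator A (cut {..M} u) * enn (\<bar>rnd p u - nrm p {..M} u\<bar> powr p))
     <= (\<E> u. indicator A (cut {..M} u)) * enn (C * lam M powr (- b))"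
proof -
 have p2: "p > 2" "p >= 1" using p by (auto simp: valid_def)
 obtain C b where C: "C > 0" and b: "b > 0"
  and hm: "\<And>I Lm. [|finite I; Lm > 0; \<And>n. n \<in> I ==> Lm <= lam n|] ==>
    (\<E> u. enn (nrm p I u powr p)) <= enn (C * Lm powr (- b))"
  using high_moment[OF p] by blast
 obtain r where r: "strict_mono r" "AE u in \<mu>. (%k. nrm p {..r k} u) \<longlonglongrightarrow> rnd p u"
  using AE_limit[OF p] .
 show ?thesis
 proof (rule that[OF C b])
  fix M A assume A: "A \<in> sets \<mu>"
  note [measurable] = low_set_measurable[OF A]
  define g :: "_ => ennreal" where "g u = indicator A (cut {..M} u)" for u
  have [measurable]: "g \<in> borel_measurable \<mu>" unfolding g_def [abs_def] by measurable
  define de where "de = enn (C * lam M powr (- b))"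
  have step: "(\<E> u. g u * enn (\<bar>nrm p {..r k} u - nrm p {..M} u\<bar> powr p)) <= (\<E> u. g u) * de" if "k >= M" for k
  proof -
   have Mr: "M <= r k" using strict_mono_imp_increasing[OF r(1), of k] that by simp
   have "(\<E> u. g u * enn (\<bar>nrm p {..r k} u - nrm p {..M} u\<bar> powr p))
     <= (\<E> u. indicator A (cut {..M} u) * enn (nrm p {M<..r k} (cut {M<..r k} u) powr p))"
    unfolding g_def nrm_cut using nrm_diff(1)[OF Mr p2(2)] p2
    by (intro nn_integral_mono mult_left_mono ennreal_leI powr_mono2) auto
   also have "... = (\<E> u. indicator A (cut {..M} u)) * (\<E> u. enn (nrm p {M<..r k} (cut {M<..r k} u) powr p))"
    using A by (intro cut_product) auto
   also have "... <= (\<E> u. indicator A (cut {..M} u)) * de"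
    unfolding nrm_cut de_def using lam_ge(2)[of M] by (intro mult_left_mono hm lam_mono) auto
   finally show ?thesis by (simp add: g_def)
  qed
  have F1: "(\<E> u. g u * enn (\<bar>rnd p u - nrm p {..M} u\<bar> powr p))
    <= (\<E> u. liminf (%k. g u * enn (\<bar>nrm p {..r k} u - nrm p {..M} u\<bar> powr p)))"
  proof (rule nn_integral_mono_AE, rule eventually_mono[OF r(2)])
   fix u assume lim: "(%k. nrm p {..r k} u) \<longlonglongrightarrow> rnd p u"
   have "(%k. \<bar>nrm p {..r k} u - nrm p {..M} u\<bar> powr p) \<longlonglongrightarrow> \<bar>rnd p u - nrm p {..M} u\<bar> powr p"
    using p2 by (intro tendsto_powr' tendsto_rabs tendsto_diff lim tendsto_const) auto
   hence "(%k. g u * enn (\<bar>nrm p {..r k} u - nrm p {..M} u\<bar> powr p)) \<longlonglongrightarrow> g u * enn (\<bar>rnd p u - nrm p {..M} u\<bar> powr p)"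
    by (intro ennreal_tendsto_cmult tendsto_ennrealI) (auto simp: g_def indicator_def)
   thus "g u * enn (\<bar>rnd p u - nrm p {..M} u\<bar> powr p) <= liminf (%k. g u * enn (\<bar>nrm p {..r k} u - nrm p {..M} u\<bar> powr p))"
    by (simp add: lim_imp_Liminf)
  qed
  have F2: "(\<E> u. liminf (%k. g u * enn (\<bar>nrm p {..r k} u - nrm p {..M} u\<bar> powr p)))
    <= liminf (%k. \<integral>\<^sup>+u. g u * enn (\<bar>nrm p {..r k} u - nrm p {..M} u\<bar> powr p) \<partial>\<mu>)"
   by (rule nn_integral_liminf) measurable
  have F3: "liminf (%k. \<integral>\<^sup>+u. g u * enn (\<bar>nrm p {..r k} u - nrm p {..M} u\<bar> powr p) \<partial>\<mu>)
    <= limsup (%k. \<integral>\<^sup>+u. g u * enn (\<bar>nrm p {..r k} u - nrm p {..M} u\<bar> powr p) \<partial>\<mu>)"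
   by (rule Liminf_le_Limsup) simp
  have F4: "limsup (%k. \<integral>\<^sup>+u. g u * enn (\<bar>nrm p {..r k} u - nrm p {..M} u\<bar> powr p) \<partial>\<mu>) <= (\<E> u. g u) * de"
   by (rule Limsup_bounded, rule eventually_sequentiallyI[of M]) (rule step)
  show "(\<E> u. indicator A (cut {..M} u) * enn (\<bar>rnd p u - nrm p {..M} u\<bar> powr p))
     <= (\<E> u. indicator A (cut {..M} u)) * enn (C * lam M powr (- b))"
   using order_trans[OF F1 order_trans[OF F2 order_trans[OF F3 F4]]] unfolding g_def de_def .
 qed
qed

lemma lam0_ge1: "lam n >= 1"
 using dim by (simp add: ho_freq_def)

lemma mass_limit_D:
 assumes "tendsto_Lp \<mu> 2 (%N. wick {..N}) X"
 shows "X \<in> borel_measurable \<mu>" "(%N. \<integral>\<^sup>+u. enn ((X u - wick {..N} u)^2) \<partial>\<mu>) \<longlonglongrightarrow> 0"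
proof -
 show "X \<in> borel_measurable \<mu>" using assms by (simp add: tendsto_Lp_def in_Lp_def)
 have "(%N. Lp_int \<mu> 2 (%u. wick {..N} u - X u)) \<longlonglongrightarrow> 0"
  using assms by (subst Lp_norm_tendsto_0_iff[symmetric]) (auto simp: tendsto_Lp_def)
 moreover have "Lp_int \<mu> 2 (%u. wick {..N} u - X u) = (\<E> u. enn ((X u - wick {..N} u)^2))" for N
  unfolding Lp_int_def by (intro nn_integral_cong) (simp add: powr_numeral power2_commute)
 ultimately show "(%N. \<integral>\<^sup>+u. enn ((X u - wick {..N} u)^2) \<partial>\<mu>) \<longlonglongrightarrow> 0" by simp
qed

text \<open>The error beyond M splits into a block independent of A and a remainder that disappears
  as N tends to infinity. The constant 32 is twice the 16 of \<open>wick_second_moment\<close>, from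
  (a+b)^2 <= 2a^2 + 2b^2.\<close>

lemma mass_close:
 assumes X: "tendsto_Lp \<mu> 2 (%N. wick {..N}) X" and A: "A \<in> sets \<mu>"
 shows "(\<E> u. indicator A (cut {..M} u) * enn ((X u - wick {..M} u)^2))
  <= (\<E> u. indicator A (cut {..M} u)) * enn (32 / (lam M)^2)"
proof -
 note [measurable] = mass_limit_D(1)[OF X] low_set_measurable[OF A]
 note lim = mass_limit_D(2)[OF X]
 let ?P = "\<integral>\<^sup>+u. indicator A (cut {..M} u) \<partial>\<mu>"
 have step: "(\<E> u. indicator A (cut {..M} u) * enn ((X u - wick {..M} u)^2))
   <= 2 * (\<E> u. enn ((X u - wick {..N} u)^2)) + ?P * enn (32 / (lam M)^2)" if N: "N >= M" for N
 proof -
  have split: "wick {..N} u = wick {..M} u + wick {M<..N} u" for u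
   unfolding wick_def by (rule sum_atMost_split[OF N])
  have "(\<E> u. indicator A (cut {..M} u) * enn ((X u - wick {..M} u)^2))
   <= (\<E> u. 2 * enn ((X u - wick {..N} u)^2) + 2 * (indicator A (cut {..M} u) * enn ((wick {M<..N} (cut {M<..N} u))^2)))"
  proof (intro nn_integral_mono)
   fix u
   have "(X u - wick {..M} u)^2 <= 2 * (X u - wick {..N} u)^2 + 2 * (wick {M<..N} u)^2"
    using sum_squares_ge_zero[of "(X u - wick {..N} u) - wick {M<..N} u" 0] unfolding split[of u]
    by (simp add: power2_eq_square algebra_simps)
   hence "enn ((X u - wick {..M} u)^2) <= enn (2 * (X u - wick {..N} u)^2 + 2 * (wick {M<..N} u)^2)" by (rule ennreal_leI)
   also have "... = 2 * enn ((X u - wick {..N} u)^2) + 2 * enn ((wick {M<..N} u)^2)"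
    by (simp add: ennreal_plus ennreal_mult)
   finally show "indicator A (cut {..M} u) * enn ((X u - wick {..M} u)^2) <= 2 * enn ((X u - wick {..N} u)^2) + 2 * (indicator A (cut {..M} u) * enn ((wick {M<..N} (cut {M<..N} u))^2))"
    by (simp add: indicator_def)
  qed
  also have "... = 2 * (\<E> u. enn ((X u - wick {..N} u)^2)) + 2 * (\<E> u. indicator A (cut {..M} u) * enn ((wick {M<..N} (cut {M<..N} u))^2))"
  proof -
   have [measurable]: "(%u. wick {M<..N} (cut {M<..N} u)) \<in> borel_measurable \<mu>" by simp
   show ?thesis by (subst nn_integral_add) (auto simp: nn_integral_cmult)
  qed
  also have "(\<E> u. indicator A (cut {..M} u) * enn ((wick {M<..N} (cut {M<..N} u))^2)) = ?P * (\<E> u. enn ((wick {M<..N} (cut {M<..N} u))^2))"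
   using A by (intro cut_product) auto
  also have "2 * (\<E> u. enn ((X u - wick {..N} u)^2)) + 2 * (?P * (\<E> u. enn ((wick {M<..N} (cut {M<..N} u))^2)))
    <= 2 * (\<E> u. enn ((X u - wick {..N} u)^2)) + 2 * (?P * enn (16 / (lam M)^2))"
   unfolding wick_cut using lam0_ge1 by (intro add_left_mono mult_left_mono wick_second_moment lam_mono) auto
  also have "2 * (?P * enn (16 / (lam M)^2)) = ?P * (2 * enn (16 / (lam M)^2))" by (simp add: mult_ac)
  also have "2 * enn (16 / (lam M)^2) = enn (32 / (lam M)^2)"
   using ennreal_mult[of 2 "16 / (lam M)^2"] by simp
  finally show ?thesis .
 qed
 have L: "(%N. 2 * (\<E> u. enn ((X u - wick {..N} u)^2)) + ?P * enn (32 / (lam M)^2)) \<longlonglongrightarrow> 2 * 0 + ?P * enn (32 / (lam M)^2)"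
  by (intro tendsto_add tendsto_const ennreal_tendsto_cmult lim) auto
 have "(\<E> u. indicator A (cut {..M} u) * enn ((X u - wick {..M} u)^2)) <= 2 * 0 + ?P * enn (32 / (lam M)^2)"
  by (rule LIMSEQ_le_const[OF L]) (use step in blast)
 thus ?thesis by simp
qed

text \<open>With all other coordinates frozen, the event confines |u_0|^2 to an interval of length
  be - al, and \<open>gauss_annulus\<close> bounds its probability. Only coordinate 0 is used, so
  the bound does not depend on N.\<close>

lemma wick_interval:
 assumes "al <= be"
 shows "emeasure \<mu> {u \<in> space \<mu>. al <= wick {..N} u \<and> wick {..N} u <= be} <= enn ((lam 0)^2 * (be - al))"
proof -
 define J where "J = {0<..N}"
 define k where "k = 1 / (lam 0)^2"
 have l0: "(lam 0)^2 > 0" using lam_nz[of 0] by simp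
 have split: "wick {..N} u = ((cmod (u 0))^2 - k) + wick J u" for u
 proof -
  have "{..N} = insert 0 J" by (auto simp: J_def)
  thus ?thesis unfolding wick_def k_def by (simp add: J_def)
 qed
 define Q :: "_ => ennreal" where
  "Q = (%(u :: nat => complex, v). indicator {al..be} (((cmod (u 0))^2 - k) + wick J v))"
 have [measurable]: "(%q. (fst q) 0) \<in> borel_measurable (\<mu> \<Otimes>\<^sub>M \<mu>)"
  by (rule measurable_compose[OF measurable_fst coord_measurable])
 have Qm: "Q \<in> borel_measurable (\<mu> \<Otimes>\<^sub>M \<mu>)" unfolding Q_def case_prod_beta by measurable
 have "emeasure \<mu> {u \<in> space \<mu>. al <= wick {..N} u \<and> wick {..N} u <= be} = (\<E> u. indicator {u \<in> space \<mu>. al <= wick {..N} u \<and> wick {..N} u <= be} u)"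
  by simp
 also have "... = (\<E> u. Q (cut {0} u, cut J u))"
  by (intro nn_integral_cong) (auto simp: Q_def split indicator_def cut_def[of "{0}"])
 also have "... = (\<E> v. (\<E> u. Q (cut {0} u, cut J v)))"
  by (rule cut_integral[OF _ Qm]) (auto simp: J_def)
 also have "... <= (\<E> v. enn ((lam 0)^2 * (be - al)))"
 proof (intro nn_integral_mono)
  fix v
  define a b where "a = (lam 0)^2 * (al + k - wick J v)" and "b = (lam 0)^2 * (be + k - wick J v)"
  define S where "S = {z. a <= (cmod z)^2 \<and> (cmod z)^2 <= b}"
  have [measurable]: "S \<in> sets borel" unfolding S_def by measurable
  have "(\<E> u. Q (cut {0} u, cut J v)) = (\<E> u. indicator S (of_real (lam 0) * u 0))" (is "?a = _")
  proof (intro nn_integral_cong)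
   fix u :: "nat => complex"
   have "a <= (lam 0)^2 * (cmod (u 0))^2 \<longleftrightarrow> al + k - wick J v <= (cmod (u 0))^2"
    "(lam 0)^2 * (cmod (u 0))^2 <= b \<longleftrightarrow> (cmod (u 0))^2 <= be + k - wick J v"
    unfolding a_def b_def using l0 by (simp_all only: mult_le_cancel_left_pos)
   thus "Q (cut {0} u, cut J v) = indicator S (of_real (lam 0) * u 0)"
    by (auto simp: Q_def S_def indicator_def cut_def[of "{0}"] norm_mult power_mult_distrib)
  qed
  also have "... = emeasure gauss S" using nn_integral_G[of "indicator S" 0] by (simp add: gauss_def)
  also have "... <= enn (b - a)"
   unfolding S_def by (rule gauss_annulus) (use assms l0 in \<open>simp add: a_def b_def mult_left_mono\<close>)
  also have "b - a = (lam 0)^2 * (be - al)" by (simp add: a_def b_def algebra_simps)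
  finally show "?a <= enn ((lam 0)^2 * (be - al))" .
 qed
 also have "... = enn ((lam 0)^2 * (be - al))" by (simp add: emeasure_space_1)
 finally show ?thesis .
qed

text \<open>The interval bound is uniform in N and therefore survives the limit in L^2. It is needed
  because the indicator of the cutoff is discontinuous where the modulus of the mass equals
  K.\<close>

lemma mass_no_atom:
 assumes X: "tendsto_Lp \<mu> 2 (%N. wick {..N}) X"
 shows "AE u in \<mu>. \<bar>X u\<bar> ~= K"
proof -
 note [measurable] = mass_limit_D(1)[OF X]
 note lim = mass_limit_D(2)[OF X]
 define l where "l = (lam 0)^2"
 have l: "l > 0" using lam_nz[of 0] by (simp add: l_def)
 have small: "emeasure \<mu> {u \<in> space \<mu>. X u = k} <= enn (3 * l * ep)" if ep: "ep > 0" for ep k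
 proof -
  \<comment> \<open>The third power is chosen because Chebyshev's inequality divides by ep^2, and
    the result must still be of order ep.\<close>
  have "enn (l * ep ^ 3) > 0" using l ep by simp
  hence "\<forall>\<^sub>F N in sequentially. (\<E> u. enn ((X u - wick {..N} u)^2)) < enn (l * ep ^ 3)"
   using order_tendstoD(2)[OF lim] by blast
  then obtain N where N: "(\<E> u. enn ((X u - wick {..N} u)^2)) < enn (l * ep ^ 3)"
   by (auto simp: eventually_sequentially)
  define B where "B = {u \<in> space \<mu>. k - ep <= wick {..N} u \<and> wick {..N} u <= k + ep}"
  have "emeasure \<mu> {u \<in> space \<mu>. X u = k} = (\<E> u. indicator {u \<in> space \<mu>. X u = k} u)" by simp
  also have "... <= (\<E> u. indicator B u + enn (1 / ep^2) * enn ((X u - wick {..N} u)^2))"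
  proof (intro nn_integral_mono)
   fix u assume u: "u \<in> space \<mu>"
   show "indicator {u \<in> space \<mu>. X u = k} u <= indicator B u + enn (1 / ep^2) * enn ((X u - wick {..N} u)^2)"
   proof (cases "X u = k \<and> u \<notin> B")
    case True
    hence "ep <= \<bar>X u - wick {..N} u\<bar>" using u by (auto simp: B_def)
    hence "ep^2 <= (X u - wick {..N} u)^2" using ep by (metis abs_le_square_iff abs_of_pos)
    hence "1 <= 1 / ep^2 * (X u - wick {..N} u)^2" using ep by (simp add: field_simps)
    hence "enn 1 <= enn (1 / ep^2) * enn ((X u - wick {..N} u)^2)"
     by (subst ennreal_mult[symmetric]) (auto intro: ennreal_leI)
    thus ?thesis using True u by simp
   qed (auto simp: indicator_def)
  qed
  also have "... = emeasure \<mu> B + enn (1 / ep^2) * (\<E> u. enn ((X u - wick {..N} u)^2))"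
   unfolding B_def by (subst nn_integral_add) (auto simp: nn_integral_cmult)
  also have "... <= enn (l * (2 * ep)) + enn (1 / ep^2) * enn (l * ep ^ 3)"
  proof (intro add_mono mult_left_mono)
   show "emeasure \<mu> B <= enn (l * (2 * ep))"
    using wick_interval[of "k - ep" "k + ep" N] ep by (simp add: B_def l_def)
  qed (use N in auto)
  also have "enn (1 / ep^2) * enn (l * ep ^ 3) = enn (l * ep)"
   using ep l by (subst ennreal_mult[symmetric]) (auto simp: power2_eq_square power3_eq_cube)
  also have "enn (l * (2 * ep)) + enn (l * ep) = enn (3 * l * ep)"
   using ep l by (subst ennreal_plus[symmetric]) (auto simp: algebra_simps)
  finally show ?thesis .
 qed
 have null: "AE u in \<mu>. X u ~= k" for k
 proof -
  have "emeasure \<mu> {u \<in> space \<mu>. X u = k} = 0"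
  proof (rule ccontr)
   assume ne: "emeasure \<mu> {u \<in> space \<mu>. X u = k} ~= 0"
   define e where "e = measure \<mu> {u \<in> space \<mu>. X u = k}"
   have em: "emeasure \<mu> {u \<in> space \<mu>. X u = k} = enn e" by (simp add: e_def emeasure_eq_measure)
   have e: "e > 0" using ne em by (cases "e = 0") (auto simp: e_def less_le)
   have "enn e <= enn (3 * l * (e / (6 * l)))" unfolding em[symmetric] using e l by (intro small) simp
   thus False using e l by simp
  qed
  thus ?thesis by (intro AE_I[of _ _ "{u \<in> space \<mu>. X u = k}"]) auto
 qed
 show ?thesis using null[of K] null[of "- K"] by eventually_elim auto
qed

end

section \<open>Subcritical tails and uniform exponential moments\<close>

lemma powr_sequentially_at_top:
 fixes s :: real
 assumes "s > 0"
 shows "filterlim (%j. real j powr s) at_top sequentially"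
proof -
 have "(%j. real j powr (- s)) \<longlonglongrightarrow> 0"
  by (rule tendsto_neg_powr[OF _ filterlim_real_sequentially]) (use assms in simp)
 moreover have "\<forall>\<^sub>F j in sequentially. 0 < real j powr (- s)"
  by (rule eventually_sequentiallyI[of 1]) simp
 ultimately have "filterlim (%j. inverse (real j powr (- s))) at_top sequentially"
  by (rule filterlim_inverse_at_top)
 thus ?thesis by (simp add: powr_minus)
qed

lemma summable_exp_powr:
 fixes A c p q :: real
 assumes A: "A >= 0" and c: "c > 0" and pq: "1 <= p" "p < q"
 shows "summable (%j. exp (A * (real j + 1) powr p - c * real j powr q))"
proof (rule summable_comparison_test_ev)
 show "summable (%j. exp (- 1 :: real) ^ j)" by (rule summable_geometric) simp
 have "filterlim (%j. real j powr (q - p)) at_top sequentially"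
  by (rule powr_sequentially_at_top) (use pq in simp)
 hence ev: "\<forall>\<^sub>F j in sequentially. (A * 2 powr p + 1) / c <= real j powr (q - p)"
  by (simp add: filterlim_at_top)
 show "\<forall>\<^sub>F j in sequentially. norm (exp (A * (real j + 1) powr p - c * real j powr q)) <= exp (- 1 :: real) ^ j"
  using ev eventually_ge_at_top[of 1]
 proof eventually_elim
  fix j :: nat assume j: "(A * 2 powr p + 1) / c <= real j powr (q - p)" "1 <= j"
  have "(real j + 1) powr p <= (2 * real j) powr p" using j pq by (intro powr_mono2) auto
  also have "... = 2 powr p * real j powr p" by (rule powr_mult)
  finally have 1: "A * (real j + 1) powr p <= A * (2 powr p * real j powr p)" using A by (rule mult_left_mono)
  have "real j powr 1 <= real j powr p" using j pq by (intro powr_mono) auto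
  hence 2: "real j <= real j powr p" using j by simp
  have "(A * 2 powr p + 1) / c * (c * real j powr p) <= real j powr (q - p) * (c * real j powr p)"
   using j(1) c by (intro mult_right_mono) auto
  also have "... = c * (real j powr (q - p) * real j powr p)" by (simp only: mult_ac)
  also have "real j powr (q - p) * real j powr p = real j powr q" by (simp only: powr_add[symmetric]) simp
  also have "(A * 2 powr p + 1) / c * (c * real j powr p) = A * (2 powr p * real j powr p) + real j powr p"
   using c by (simp add: field_simps)
  finally have "A * (real j + 1) powr p - c * real j powr q <= - real j" using 1 2 by linarith
  hence "exp (A * (real j + 1) powr p - c * real j powr q) <= exp (real j * (- 1))" by simp
  thus "norm (exp (A * (real j + 1) powr p - c * real j powr q)) <= exp (- 1 :: real) ^ j"
   by (simp only: exp_of_nat_mult) simp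
 qed
qed

context gibbs
begin

lemma space_\<mu>: "space \<mu> = UNIV"
 using sets_eq_imp_space_eq[OF sets_\<mu>] by (simp add: space_PiM)

text \<open>The sum grows only logarithmically. Bounding it by an arbitrarily small power makes it
  comparable with the powers of the level j used in the tail estimate.\<close>

lemma sum_inverse_lam2:
 assumes \<eta>: "\<eta> > 0"
 obtains S where "S > 0"
  "\<And>I Lm. [|finite I; \<And>n. n \<in> I ==> lam n <= Lm|] ==> (\<Sum>n\<in>I. 1 / (lam n)^2) <= S * Lm powr \<eta>"
proof -
 define f where "f n = lam n powr (- (2 + \<eta>))" for n
 have "summable (%n. real n powr (- (1 + \<eta> / 2)))" using \<eta> by (subst summable_real_powr_iff) auto
 hence sf: "summable f"
 proof (rule summable_comparison_test_ev[rotated])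
  show "\<forall>\<^sub>F n in sequentially. norm (f n) <= real n powr (- (1 + \<eta> / 2))"
  proof (rule eventually_sequentiallyI[of 1])
   fix n :: nat assume n: "1 <= n"
   have "f n <= sqrt (real n) powr (- (2 + \<eta>))"
    unfolding f_def using lam_ge_sqrt[of n] n \<eta> by (intro powr_mono2') auto
   also have "sqrt (real n) = real n powr (1 / 2)" by (simp add: powr_half_sqrt)
   also have "(real n powr (1 / 2)) powr (- (2 + \<eta>)) = real n powr (- (1 + \<eta> / 2))"
   proof -
    have e: "1 / 2 * (- (2 + \<eta>)) = - (1 + \<eta> / 2)" by (simp add: field_simps)
    show ?thesis by (simp only: powr_powr e)
   qed
   finally show "norm (f n) <= ..." by (simp add: f_def)
  qed
 qed
 have f0: "f n >= 0" for n by (simp add: f_def)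
 show ?thesis
 proof (rule that[of "suminf f + 1"])
  show "suminf f + 1 > 0" using suminf_nonneg[OF sf f0] by simp
  fix I Lm assume I: "finite I" and Lm: "\<And>n. n \<in> I ==> lam n <= Lm"
  have "(\<Sum>n\<in>I. 1 / (lam n)^2) <= (\<Sum>n\<in>I. f n * Lm powr \<eta>)" (is "?a <= _")
  proof (rule sum_mono)
   fix n assume n: "n \<in> I"
   have l: "lam n > 0" using lam0_ge1[of n] by simp
   have "1 / (lam n)^2 = lam n powr (- 2)" using l by (simp add: powr_minus_divide powr_numeral)
   also have "... = f n * lam n powr \<eta>" unfolding f_def by (simp add: powr_add[symmetric])
   also have "... <= f n * Lm powr \<eta>" using l Lm[OF n] \<eta> f0 by (intro mult_left_mono powr_mono2) auto
   finally show "1 / (lam n)^2 <= ..." .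
  qed
  also have "... = sum f I * Lm powr \<eta>" by (simp add: sum_distrib_right)
  also have "... <= (suminf f + 1) * Lm powr \<eta>"
   using sum_le_suminf[OF sf I f0] by (intro mult_right_mono) auto
  finally show "?a <= ..." .
 qed
qed

text \<open>The frequencies are split at \<open>\<Lambda> = j\<^bsup>\<gamma>/2\<^esup>\<close>: the mass cutoff bounds the low frequencies by \<open>j/2\<close>,
 and the Gaussian tails of the high frequencies beat \<open>exp (j\<^sup>p)\<close>. Both require
 \<open>p < \<gamma> < 4p/(D(p - 2))\<close>, which is possible exactly in the subcritical case.\<close>

lemma subcritical_exponents:
 assumes p: "2 < p" "p < 2 + 4 / real D"
 obtains ga a \<eta> where "p < ga" "admissible p a" "p < 2 + a * ga / 2" "\<eta> > 0" "(real D - 2 + \<eta>) * (p / 2) < real D"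
  "ga / 2 * (real D * (p - 2) / 2 + \<eta> * p) < p"
proof -
 have D2: "real D >= 2" using dim by simp
 have Dp: "real D * (p - 2) < 4" using p D2 by (simp add: field_simps)
 have Dp0: "real D * (p - 2) > 0" using p D2 by simp
 \<comment> \<open>The midpoint of the open interval of possible exponents, which is nonempty
   exactly because D (p-2) < 4.\<close>
 define ga where "ga = (p + 4 * p / (real D * (p - 2))) / 2"
 have "p * (real D * (p - 2)) < 4 * p" using Dp p by simp
 hence "p < 4 * p / (real D * (p - 2))" using Dp0 by (simp add: pos_less_divide_eq)
 hence ga: "p < ga" "ga < 4 * p / (real D * (p - 2))" by (auto simp: ga_def)
 have ga2: "ga * (real D * (p - 2)) < 4 * p" using ga(2) Dp0 by (simp add: pos_less_divide_eq)
 \<comment> \<open>The upper end of the admissible gains a; the following \<open>l\<close> is the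
   value that a must exceed to give p < 2 + a ga / 2.\<close>
 define m where "m = min 1 (min (real D * (p - 2) / p) ((2 * real D - real D * p + 2 * p) / p))"
 define l where "l = 2 * (p - 2) / ga"
 have "2 * (p - 2) <= real D * (p - 2)" using D2 p by (intro mult_right_mono) auto
 hence "l < 2 * (p - 2) / p" "2 * (p - 2) / p <= real D * (p - 2) / p"
  using p ga(1) by (auto simp: l_def intro!: divide_strict_left_mono divide_right_mono)
 moreover have "2 * (p - 2) / p <= 1" using Dp D2 p mult_right_mono[OF D2, of "p - 2"] by simp
 moreover have "2 * (p - 2) / p <= (2 * real D - real D * p + 2 * p) / p"
  using Dp p by (intro divide_right_mono) (auto simp: algebra_simps)
 ultimately have lm: "l < m" by (simp add: m_def)
 have l0: "l > 0" using p ga by (simp add: l_def)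
 define a where "a = (l + m) / 2"
 have a: "l < a" "a < m" using lm by (auto simp: a_def)
 have a': "a < 1" "a < real D * (p - 2) / p" "a < (2 * real D - real D * p + 2 * p) / p" using a by (auto simp: m_def)
 have "real D * (p - 2) / p = real D - 2 * real D / p" "(2 * real D - real D * p + 2 * p) / p = 2 * real D / p - real D + 2"
  using p by (auto simp: field_simps)
 hence adm: "admissible p a" unfolding admissible_def using p a a' l0 by linarith
 have "2 * (p - 2) < a * ga" using a(1) ga(1) p by (simp add: l_def pos_divide_less_eq)
 hence p2: "p < 2 + a * ga / 2" by simp
 \<comment> \<open>Two limits for the loss \<eta>: \<open>e1\<close> keeps the low-frequency
   estimate integrable at the origin, and \<open>e2\<close> keeps the power of j produced by the low
   frequencies below p.\<close>
 define e1 where "e1 = (2 * real D - real D * p + 2 * p) / p"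
 define e2 where "e2 = (4 * p - ga * (real D * (p - 2))) / (2 * ga * p)"
 define \<eta> where "\<eta> = min e1 e2 / 2"
 have "e1 > 0" using a'(3) a l0 by (simp add: e1_def)
 moreover have "e2 > 0" unfolding e2_def using ga2 ga p by (intro divide_pos_pos) auto
 ultimately have \<eta>: "\<eta> > 0" "\<eta> < e1" "\<eta> < e2" by (auto simp: \<eta>_def)
 have "\<eta> * p < 2 * real D - real D * p + 2 * p" using \<eta>(2) p by (simp add: e1_def pos_less_divide_eq)
 hence c1: "(real D - 2 + \<eta>) * (p / 2) < real D" by (simp add: algebra_simps)
 have "\<eta> * (2 * ga * p) < 4 * p - ga * (real D * (p - 2))"
  using \<eta>(3) p ga unfolding e2_def by (subst (asm) pos_less_divide_eq) auto
 hence c2': "(ga * (real D * (p - 2)) + \<eta> * (2 * ga * p)) / 4 < p"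
 proof -
  have "(A + B) / 4 < p" if "B < 4 * p - A" for A B :: real using that by simp
  thus ?thesis using \<open>\<eta> * (2 * ga * p) < 4 * p - ga * (real D * (p - 2))\<close> by blast
 qed
 have "ga / 2 * (real D * (p - 2) / 2 + \<eta> * p) = (ga * (real D * (p - 2)) + \<eta> * (2 * ga * p)) / 4" by (simp add: field_simps)
 hence c2: "ga / 2 * (real D * (p - 2) / 2 + \<eta> * p) < p" using c2' by (simp only:)
 show ?thesis by (rule that[OF ga(1) adm p2 \<eta>(1) c1 c2])
qed

text \<open>If the cutoff holds and the norm reaches j, then either the Wick mass of the high
  frequencies is at least 1 or their norm is at least j/2. Both alternatives have stretched
  exponential tails with powers larger than p.\<close>

lemma subcritical_tail:
 assumes p: "2 < p" "p < 2 + 4 / real D" and K: "K > 0"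
 obtains C c q where "C > 0" "c > 0" "p < q"
  "\<And>N j. emeasure \<mu> {u \<in> space \<mu>. \<bar>wick {..N} u\<bar> <= K \<and> real j <= nrm p {..N} u} <= enn (C * exp (- (c * real j powr q)))"
proof -
 obtain ga a \<eta> where ga: "p < ga" and adm: "admissible p a" and p2: "p < 2 + a * ga / 2" and \<eta>: "\<eta> > 0"
  "(real D - 2 + \<eta>) * (p / 2) < real D" and \<theta>p: "ga / 2 * (real D * (p - 2) / 2 + \<eta> * p) < p"
  using subcritical_exponents[OF p] .
 obtain S where S: "S > 0" "\<And>I Lm. [|finite I; \<And>n. n \<in> I ==> lam n <= Lm|] ==> (\<Sum>n\<in>I. 1 / (lam n)^2) <= S * Lm powr \<eta>"
  using sum_inverse_lam2[OF \<eta>(1)] by blast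
 obtain C1 where C1: "C1 > 0" "\<And>I u Lm. [|finite I; Lm >= 1; \<And>n. n \<in> I ==> lam n <= Lm|] ==>
   Lp_int lborel p (field I u) <= enn (C1 * (\<Sum>n\<in>I. (cmod (u n))^2) powr (p / 2) * Lm powr (real D * (p - 2) / 2 + \<eta> * p / 2))"
  using low_frequency_Lp[OF p(1) \<eta>] by blast
 obtain C3 where C3: "C3 > 0"
  "\<And>I Lm. [|finite I; Lm > 0; \<And>n. n \<in> I ==> Lm <= lam n|] ==>
    (\<E> u. enn (nrm p I u powr p)) <= enn (C3 * Lm powr (- (a * p / 2)))"
  "\<And>I Lm t. [|finite I; Lm > 0; t >= 0; \<And>n. n \<in> I ==> Lm <= lam n|] ==>
    emeasure \<mu> {u \<in> space \<mu>. nrm p I u >= t} <= enn (C3 * exp (- (t^2 * Lm powr a / C3)))"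
  using admissible_high_moment[OF adm] by blast
 \<comment> \<open>The mass of the low frequencies is at most K from the cutoff, plus 1 from the
   Wick mass of the high ones, plus the subtracted mean, which is at most S Lm^\<eta>.\<close>
 define ka where "ka = K + 1 + S"
 define C2 where "C2 = C1 * ka powr (p / 2)"
 define \<theta> where "\<theta> = ga / 2 * (real D * (p - 2) / 2 + \<eta> * p)"
 \<comment> \<open>The smaller of the powers of j in the two tails: Lm^2 = j^ga for the Wick mass,
   and j^2 Lm^a = j^(2 + a ga/2) for the norm.\<close>
 define q where "q = min ga (2 + a * ga / 2)"
 define c where "c = min (1 / 8) (1 / (4 * C3))"
 have ka: "ka > 0" using K S by (simp add: ka_def)
 have c: "c > 0" "c <= 1 / 8" "c <= 1 / (4 * C3)" using C3(1) by (auto simp: c_def)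
 have q: "p < q" "q <= ga" "q <= 2 + a * ga / 2" using ga p2 by (auto simp: q_def)
 have p1: "p >= 1" "p > 0" using p by auto
 have "filterlim (%j. real j powr (p - \<theta>)) at_top sequentially"
  by (rule powr_sequentially_at_top) (use \<theta>p in \<open>simp add: \<theta>_def\<close>)
 hence "\<forall>\<^sub>F j in sequentially. C2 * 2 powr p < real j powr (p - \<theta>)"
  by (simp add: filterlim_at_top_dense)
 then obtain j1 where j1: "\<And>j. j >= j1 ==> C2 * 2 powr p < real j powr (p - \<theta>)"
  by (auto simp: eventually_sequentially)
 define j0 where "j0 = max 1 j1"
 have large: "emeasure \<mu> {u \<in> space \<mu>. \<bar>wick {..N} u\<bar> <= K \<and> real j <= nrm p {..N} u} <= enn ((2 + C3) * exp (- (c * real j powr q)))"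
  if j: "j >= j0" for N j
 proof -
  have j': "real j >= 1" "j >= j1" using j by (auto simp: j0_def)
  define Lm where "Lm = real j powr (ga / 2)"
  define L where "L = {n \<in> {..N}. lam n <= Lm}"
  define H where "H = {n \<in> {..N}. \<not> lam n <= Lm}"
  have LH: "finite L" "finite H" "L \<inter> H = {}" "{..N} = L \<union> H" by (auto simp: L_def H_def)
  have Lm: "Lm >= 1" using j' ga p by (simp add: Lm_def ge_one_powr_ge_zero)
  have Lm2: "Lm^2 = real j powr ga"
  proof -
   have "Lm^2 = Lm powr 2" using Lm by (simp add: powr_numeral)
   also have "... = real j powr (ga / 2 * 2)" by (simp only: Lm_def powr_powr)
   finally show ?thesis by simp
  qed
  have low: "nrm p L u < real j / 2" if u: "\<bar>wick {..N} u\<bar> <= K" "\<bar>wick H u\<bar> < 1" for u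
  proof -
   have wsum: "wick {..N} u = wick L u + wick H u" unfolding wick_def LH(4) by (rule sum.union_disjoint[OF LH(1-3)])
   have "(\<Sum>n\<in>L. (cmod (u n))^2) = wick L u + (\<Sum>n\<in>L. 1 / (lam n)^2)" (is "?a = _") by (simp add: wick_def sum_subtractf)
   also have "... <= (K + 1) * 1 + S * Lm powr \<eta>"
    using u wsum S(2)[OF LH(1), of Lm] by (auto simp: L_def)
   also have "... <= (K + 1) * Lm powr \<eta> + S * Lm powr \<eta>"
    using Lm \<eta> K S(1) by (intro add_mono mult_left_mono ge_one_powr_ge_zero order_refl) auto
   finally have mass: "?a <= ka * Lm powr \<eta>" by (simp add: ka_def algebra_simps)
   have "enn (nrm p L u powr p) <= enn (C1 * (\<Sum>n\<in>L. (cmod (u n))^2) powr (p / 2) * Lm powr (real D * (p - 2) / 2 + \<eta> * p / 2))"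
    unfolding Lp_int_field_nrm[OF LH(1) p1(1), symmetric] by (rule C1(2)) (use LH(1) Lm in \<open>auto simp: L_def\<close>)
   hence "nrm p L u powr p <= C1 * (\<Sum>n\<in>L. (cmod (u n))^2) powr (p / 2) * Lm powr (real D * (p - 2) / 2 + \<eta> * p / 2)"
    using C1(1) by (subst (asm) ennreal_le_iff) auto
   also have "... <= C1 * (ka * Lm powr \<eta>) powr (p / 2) * Lm powr (real D * (p - 2) / 2 + \<eta> * p / 2)"
    using mass C1(1) p1 by (intro mult_right_mono mult_left_mono powr_mono2 sum_nonneg) auto
   also have "(ka * Lm powr \<eta>) powr (p / 2) = ka powr (p / 2) * Lm powr (\<eta> * p / 2)" by (simp add: powr_mult powr_powr)
   also have "C1 * (ka powr (p / 2) * Lm powr (\<eta> * p / 2)) * Lm powr (real D * (p - 2) / 2 + \<eta> * p / 2)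
     = C2 * (Lm powr (\<eta> * p / 2) * Lm powr (real D * (p - 2) / 2 + \<eta> * p / 2))" by (simp add: C2_def)
   also have "Lm powr (\<eta> * p / 2) * Lm powr (real D * (p - 2) / 2 + \<eta> * p / 2) = Lm powr (real D * (p - 2) / 2 + \<eta> * p)"
   proof -
    have e: "\<eta> * p / 2 + (real D * (p - 2) / 2 + \<eta> * p / 2) = real D * (p - 2) / 2 + \<eta> * p" by simp
    show ?thesis by (simp only: powr_add[symmetric] e)
   qed
   also have "Lm powr (real D * (p - 2) / 2 + \<eta> * p) = real j powr \<theta>" by (simp only: Lm_def powr_powr \<theta>_def)
   finally have 1: "nrm p L u powr p <= C2 * real j powr \<theta>" .
   have "C2 * 2 powr p * real j powr \<theta> < real j powr (p - \<theta>) * real j powr \<theta>"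
    using j1[OF j'(2)] j' by (intro mult_strict_right_mono) auto
   also have "... = real j powr p" by (simp only: powr_add[symmetric]) simp
   finally have "C2 * real j powr \<theta> < real j powr p / 2 powr p" by (simp add: field_simps)
   also have "... = (real j / 2) powr p" by (simp add: powr_divide)
   finally have "nrm p L u powr p < ..." using 1 by simp
   hence lt: "\<not> (real j / 2) powr p <= nrm p L u powr p" by simp
   show ?thesis
   proof (rule ccontr)
    assume "\<not> nrm p L u < real j / 2"
    hence "(real j / 2) powr p <= nrm p L u powr p" using p1 by (intro powr_mono2) auto
    with lt show False by blast
   qed
  qed
  define A where "A = {u \<in> space \<mu>. \<bar>wick H u\<bar> >= 1}"
  define B where "B = {u \<in> space \<mu>. nrm p H u >= real j / 2}"
  have "{u \<in> space \<mu>. \<bar>wick {..N} u\<bar> <= K \<and> real j <= nrm p {..N} u} \<subseteq> A \<union> B"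
  proof
   fix u assume u: "u \<in> {u \<in> space \<mu>. \<bar>wick {..N} u\<bar> <= K \<and> real j <= nrm p {..N} u}"
   have "nrm p {..N} u <= nrm p L u + nrm p H u" using nrm_union[OF LH(1-3) p1(1), of u] LH(4) by simp
   thus "u \<in> A \<union> B" using u low[of u] by (cases "\<bar>wick H u\<bar> < 1") (auto simp: A_def B_def)
  qed
  hence "emeasure \<mu> {u \<in> space \<mu>. \<bar>wick {..N} u\<bar> <= K \<and> real j <= nrm p {..N} u} <= emeasure \<mu> (A \<union> B)"
   by (rule emeasure_mono) (auto simp: A_def B_def)
  also have "... <= emeasure \<mu> A + emeasure \<mu> B" by (rule emeasure_subadditive) (auto simp: A_def B_def)
  also have "... <= enn (2 * exp (- Lm\<^sup>2 / 8)) + enn (C3 * exp (- ((real j / 2)^2 * Lm powr a / C3)))"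
   unfolding A_def B_def using Lm by (intro add_mono wick_tail C3(3) LH(2)) (auto simp: H_def)
  also have "... = enn (2 * exp (- Lm\<^sup>2 / 8) + C3 * exp (- ((real j / 2)^2 * Lm powr a / C3)))"
   using C3(1) by (intro ennreal_plus[symmetric]) auto
  also have "... <= enn ((2 + C3) * exp (- (c * real j powr q)))"
  proof (rule ennreal_leI)
   have "c * real j powr q <= 1 / 8 * real j powr ga" using c q j' by (intro mult_mono powr_mono) auto
   hence 1: "exp (- Lm\<^sup>2 / 8) <= exp (- (c * real j powr q))" by (simp add: Lm2)
   have "real j powr (2 + a * ga / 2) = (real j)^2 * Lm powr a"
   proof -
    have "Lm powr a = real j powr (a * ga / 2)" by (simp add: Lm_def powr_powr mult.commute)
    thus ?thesis using j' by (simp add: powr_add powr_numeral)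
   qed
   moreover have "c * real j powr q <= 1 / (4 * C3) * real j powr (2 + a * ga / 2)"
    using c q j' C3(1) by (intro mult_mono powr_mono) auto
   ultimately have "c * real j powr q <= (real j / 2)^2 * Lm powr a / C3" using C3(1) by (simp add: power_divide)
   hence 2: "exp (- ((real j / 2)^2 * Lm powr a / C3)) <= exp (- (c * real j powr q))" by simp
   have "2 * exp (- Lm\<^sup>2 / 8) + C3 * exp (- ((real j / 2)^2 * Lm powr a / C3)) <= 2 * exp (- (c * real j powr q)) + C3 * exp (- (c * real j powr q))"
    using 1 2 C3(1) by (intro add_mono mult_left_mono) auto
   thus "2 * exp (- Lm\<^sup>2 / 8) + C3 * exp (- ((real j / 2)^2 * Lm powr a / C3)) <= (2 + C3) * exp (- (c * real j powr q))"
    by (simp add: algebra_simps)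
  qed
  finally show ?thesis .
 qed
 \<comment> \<open>For the finitely many levels below j0 the trivial bound 1 is used, and the second
   entry of the maximum makes the right side at least 1 there.\<close>
 define C where "C = max (2 + C3) (exp (c * real j0 powr q))"
 have C: "C > 0" "2 + C3 <= C" "exp (c * real j0 powr q) <= C" using C3(1) by (auto simp: C_def less_max_iff_disj)
 show ?thesis
 proof (rule that[OF C(1) c(1) q(1)])
  fix N j
  show "emeasure \<mu> {u \<in> space \<mu>. \<bar>wick {..N} u\<bar> <= K \<and> real j <= nrm p {..N} u} <= enn (C * exp (- (c * real j powr q)))"
  proof (cases "j >= j0")
   case True
   show ?thesis by (rule order_trans[OF large[OF True]], rule ennreal_leI, rule mult_right_mono[OF C(2)]) simp
  next
   case False
   have "emeasure \<mu> {u \<in> space \<mu>. \<bar>wick {..N} u\<bar> <= K \<and> real j <= nrm p {..N} u} <= 1" by (rule emeasure_le_1)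
   also have "1 <= enn (C * exp (- (c * real j powr q)))"
   proof -
    have "c * real j powr q <= c * real j0 powr q" using False c q p1 by (intro mult_left_mono powr_mono2) auto
    hence "1 <= exp (c * real j0 powr q + - (c * real j powr q))" by simp
    also have "... = exp (c * real j0 powr q) * exp (- (c * real j powr q))" by (rule exp_add)
    also have "... <= C * exp (- (c * real j powr q))" by (rule mult_right_mono[OF C(3)]) simp
    finally show ?thesis by simp
   qed
   finally show ?thesis .
  qed
 qed
qed

text \<open>The space is sliced by the integer part of the norm. On the slice j the weight is at
  most exp (A (j+1)^p), and the tail with q > p makes the series converge independently of
  N.\<close>

lemma uniform_moment:
 assumes p: "2 < p" "p < 2 + 4 / real D" and K: "K > 0" and A: "A >= 0"
 obtains C where "C >= 0"
  "\<And>N. (\<E> u. indicator {u. \<bar>wick {..N} u\<bar> <= K} u * enn (exp (A * nrm p {..N} u powr p))) <= enn C"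
proof -
 obtain C c q where C: "C > 0" "c > 0" "p < q"
  and tail: "\<And>N j. emeasure \<mu> {u \<in> space \<mu>. \<bar>wick {..N} u\<bar> <= K \<and> real j <= nrm p {..N} u} <= enn (C * exp (- (c * real j powr q)))"
  using subcritical_tail[OF p K] by blast
 define g where "g j = C * exp (A * (real j + 1) powr p - c * real j powr q)" for j
 have sg: "summable g" unfolding g_def [abs_def] using A C p by (intro summable_mult summable_exp_powr) auto
 have g0: "g j >= 0" for j using C by (simp add: g_def)
 show ?thesis
 proof (rule that[of "suminf g"])
  show "suminf g >= 0" by (rule suminf_nonneg[OF sg g0])
  fix N
  define E where "E j = {u \<in> space \<mu>. \<bar>wick {..N} u\<bar> <= K \<and> real j <= nrm p {..N} u}" for j
  have [measurable]: "E j \<in> sets \<mu>" for j unfolding E_def by measurable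
  define f where "f j u = enn (exp (A * (real j + 1) powr p)) * indicator (E j) u" for j u
  have [measurable]: "f j \<in> borel_measurable \<mu>" for j unfolding f_def [abs_def] by measurable
  have "(\<E> u. indicator {u. \<bar>wick {..N} u\<bar> <= K} u * enn (exp (A * nrm p {..N} u powr p))) <= (\<E> u. (\<Sum>j. f j u))" (is "?a <= _")
  proof (rule nn_integral_mono)
   fix u
   define j where "j = nat \<lfloor>nrm p {..N} u\<rfloor>"
   have j: "real j <= nrm p {..N} u" "nrm p {..N} u <= real j + 1"
    unfolding j_def using nrm_nonneg[of p "{..N}" u] by linarith+
   have "indicator {u. \<bar>wick {..N} u\<bar> <= K} u * enn (exp (A * nrm p {..N} u powr p)) <= f j u"
   proof (cases "\<bar>wick {..N} u\<bar> <= K")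
    case True
    have "A * nrm p {..N} u powr p <= A * (real j + 1) powr p" using A p j by (intro mult_left_mono powr_mono2) auto
    hence "enn (exp (A * nrm p {..N} u powr p)) <= enn (exp (A * (real j + 1) powr p))" by (intro ennreal_leI) simp
    thus ?thesis using True j by (simp add: f_def E_def space_\<mu>)
   qed simp
   also have "f j u <= (\<Sum>j. f j u)"
   proof -
    have "sum (%j. f j u) {j} <= (\<Sum>j. f j u)" by (rule sum_le_suminf) auto
    thus ?thesis by simp
   qed
   finally show "indicator {u. \<bar>wick {..N} u\<bar> <= K} u * enn (exp (A * nrm p {..N} u powr p)) <= (\<Sum>j. f j u)" .
  qed
  also have "... = (\<Sum>j. (\<E> u. f j u))" by (rule nn_integral_suminf) measurable
  also have "... <= (\<Sum>j. enn (g j))"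
  proof (rule suminf_le)
   fix j
   have "(\<E> u. f j u) = enn (exp (A * (real j + 1) powr p)) * emeasure \<mu> (E j)" (is "?a = _")
    unfolding f_def by (rule nn_integral_cmult_indicator) measurable
   also have "... <= enn (exp (A * (real j + 1) powr p)) * enn (C * exp (- (c * real j powr q)))"
    unfolding E_def by (intro mult_left_mono tail) auto
   also have "... = enn (exp (A * (real j + 1) powr p) * (C * exp (- (c * real j powr q))))"
    using C by (intro ennreal_mult[symmetric]) auto
   also have "exp (A * (real j + 1) powr p) * (C * exp (- (c * real j powr q))) = g j"
    by (simp add: g_def exp_diff exp_minus field_simps)
   finally show "?a <= enn (g j)" .
  qed auto
  also have "... = enn (suminf g)" by (rule suminf_ennreal2[OF g0 sg])
  finally show "?a <= ..." .
 qed
qed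

text \<open>A set of the first M coordinates is independent of the later ones, so Chebyshev's
  inequality holds relative to its own probability, however small that is. Hence one M0 serves all
  A, and lower bounds for cylinders carry over to the limiting mass and norm.\<close>

lemma ball_typical:
 assumes p: "valid p" and X: "tendsto_Lp \<mu> 2 (%N. wick {..N}) X" and K: "K > 0"
 obtains M0 where "\<And>M A. [|M >= M0; A \<in> sets \<mu>; \<And>u. cut {..M} u \<in> A \<longleftrightarrow> u \<in> A|] ==>
   emeasure \<mu> A <= 2 * emeasure \<mu> {u \<in> A. \<bar>X u - wick {..M} u\<bar> <= K / 2 \<and> \<bar>rnd p u - nrm p {..M} u\<bar> <= 1}"
proof -
 have p2: "p > 2" using p by (simp add: valid_def)
 note [measurable] = mass_limit_D(1)[OF X] rnd_measurable[of p]
 have [measurable]: "rnd p \<in> borel_measurable \<mu>" using p2 by (intro rnd_measurable) simp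
 obtain C b where C: "C > 0" "b > 0" and close: "\<And>M A. A \<in> sets \<mu> ==>
    (\<E> u. indicator A (cut {..M} u) * enn (\<bar>rnd p u - nrm p {..M} u\<bar> powr p))
     <= (\<E> u. indicator A (cut {..M} u)) * enn (C * lam M powr (- b))"
  using rnd_close[OF p] by blast
 have lam_inf: "filterlim lam at_top sequentially"
  by (rule filterlim_at_top_mono[OF filterlim_compose[OF sqrt_at_top filterlim_real_sequentially]])
   (simp add: lam_ge_sqrt)
 \<comment> \<open>The sum of the two relative failure probabilities: 32/lam^2 divided by (K/2)^2
   for the mass, and the p-th moment for the norm, whose threshold is 1.\<close>
 have "((%M. 4 / K^2 * (32 * inverse (lam M) ^ 2) + C * lam M powr (- b)) \<longlongrightarrow> 4 / K^2 * (32 * 0 ^ 2) + C * 0) sequentially"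
  by (intro tendsto_intros filterlim_compose[OF tendsto_inverse_0_at_top] filterlim_compose[OF tendsto_neg_powr[of "- b" lam]] tendsto_inverse_0_at_top tendsto_neg_powr lam_inf) (use C in auto)
 hence "\<forall>\<^sub>F M in sequentially. 4 / K^2 * (32 * inverse (lam M) ^ 2) + C * lam M powr (- b) < 1 / 2"
  by (rule order_tendstoD) simp
 then obtain M0 where M0: "\<And>M. M >= M0 ==> 4 / K^2 * (32 * inverse (lam M) ^ 2) + C * lam M powr (- b) < 1 / 2"
  by (auto simp: eventually_sequentially)
 show ?thesis
 proof (rule that[of M0])
  fix M A assume M: "M >= M0" and A [measurable]: "A \<in> sets \<mu>" and cutA: "\<And>u. cut {..M} u \<in> A \<longleftrightarrow> u \<in> A"
  define G where "G = {u \<in> A. \<bar>X u - wick {..M} u\<bar> <= K / 2 \<and> \<bar>rnd p u - nrm p {..M} u\<bar> <= 1}"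
  have "G = A \<inter> {u \<in> space \<mu>. \<bar>X u - wick {..M} u\<bar> <= K / 2 \<and> \<bar>rnd p u - nrm p {..M} u\<bar> <= 1}"
   by (auto simp: G_def space_\<mu>)
  hence [measurable]: "G \<in> sets \<mu>" by simp
  have ind: "indicator A (cut {..M} u) = (indicator A u :: ennreal)" for u using cutA[of u] by (simp add: indicator_def)
  define P where "P = measure \<mu> A"
  have P: "emeasure \<mu> A = enn P" "P >= 0" by (simp_all add: P_def emeasure_eq_measure)
  have "emeasure \<mu> A = (\<E> u. indicator A u)" by simp
  also have "... <= (\<E> u. indicator G u + (enn (4 / K^2) * (indicator A u * enn ((X u - wick {..M} u)^2)) + indicator A u * enn (\<bar>rnd p u - nrm p {..M} u\<bar> powr p)))"
  proof (rule nn_integral_mono)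
   fix u
   show "indicator A u <= indicator G u + (enn (4 / K^2) * (indicator A u * enn ((X u - wick {..M} u)^2)) + indicator A u * enn (\<bar>rnd p u - nrm p {..M} u\<bar> powr p))"
   proof (cases "u \<in> A \<and> u \<notin> G")
    case True
    then consider "\<bar>X u - wick {..M} u\<bar> > K / 2" | "\<bar>rnd p u - nrm p {..M} u\<bar> > 1" by (fastforce simp: G_def)
    thus ?thesis
    proof cases
     case 1
     have "(K / 2)^2 <= \<bar>X u - wick {..M} u\<bar>^2" using 1 K by (intro power_mono) auto
     hence "1 <= 4 / K^2 * (X u - wick {..M} u)^2" using K by (simp add: field_simps power2_eq_square)
     hence "enn 1 <= enn (4 / K^2 * (X u - wick {..M} u)^2)" by (rule ennreal_leI)
     also have "... = enn (4 / K^2) * enn ((X u - wick {..M} u)^2)" by (rule ennreal_mult) auto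
     finally show ?thesis using True by (simp add: add_increasing2)
    next
     case 2
     have "1 powr p <= \<bar>rnd p u - nrm p {..M} u\<bar> powr p" using 2 p2 by (intro powr_mono2) auto
     hence "enn 1 <= enn (\<bar>rnd p u - nrm p {..M} u\<bar> powr p)" by (intro ennreal_leI) simp
     thus ?thesis using True by (simp add: add_increasing)
    qed
   qed (auto simp: indicator_def)
  qed
  also have "... = emeasure \<mu> G + (enn (4 / K^2) * (\<E> u. indicator A u * enn ((X u - wick {..M} u)^2)) + (\<E> u. indicator A u * enn (\<bar>rnd p u - nrm p {..M} u\<bar> powr p)))"
   by (simp add: nn_integral_add nn_integral_cmult)
  also have "... <= emeasure \<mu> G + (enn (4 / K^2) * (enn P * enn (32 / (lam M)^2)) + enn P * enn (C * lam M powr (- b)))"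
   using mass_close[OF X A, of M] close[OF A, of M] by (intro add_mono mult_left_mono order_refl) (auto simp: ind P)
  also have "enn (4 / K^2) * (enn P * enn (32 / (lam M)^2)) + enn P * enn (C * lam M powr (- b))
    = enn (P * (4 / K^2 * (32 * inverse (lam M) ^ 2) + C * lam M powr (- b)))"
  proof -
   have "enn (4 / K^2) * (enn P * enn (32 / (lam M)^2)) = enn (4 / K^2 * (P * (32 / (lam M)^2)))"
    using P(2) by (simp add: ennreal_mult[symmetric])
   moreover have "enn P * enn (C * lam M powr (- b)) = enn (P * (C * lam M powr (- b)))"
    using P(2) C by (simp add: ennreal_mult[symmetric])
   moreover have "enn (4 / K^2 * (P * (32 / (lam M)^2))) + enn (P * (C * lam M powr (- b))) = enn (4 / K^2 * (P * (32 / (lam M)^2)) + P * (C * lam M powr (- b)))"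
    using P(2) C by (intro ennreal_plus[symmetric]) auto
   moreover have "4 / K^2 * (P * (32 / (lam M)^2)) + P * (C * lam M powr (- b)) = P * (4 / K^2 * (32 * inverse (lam M) ^ 2) + C * lam M powr (- b))"
    by (simp add: field_simps power_inverse)
   ultimately show ?thesis by (simp only:)
  qed
  also have "... <= enn (P * (1 / 2))" using M0[OF M] P(2) by (intro ennreal_leI mult_left_mono) auto
  finally have fin: "emeasure \<mu> A <= emeasure \<mu> G + enn (P * (1 / 2))" by (simp only: add_left_mono)
  have "enn P <= enn (measure \<mu> G) + enn (P * (1 / 2))"
   using fin unfolding P(1) emeasure_eq_measure[of G] .
  also have "... = enn (measure \<mu> G + P * (1 / 2))" using P(2) by (intro ennreal_plus[symmetric]) auto
  finally have "P <= measure \<mu> G + P * (1 / 2)" using P(2) by (subst (asm) ennreal_le_iff) auto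
  hence "P <= 2 * measure \<mu> G" by simp
  hence "enn P <= enn (2 * measure \<mu> G)" by (rule ennreal_leI)
  thus "emeasure \<mu> A <= 2 * emeasure \<mu> {u \<in> A. \<bar>X u - wick {..M} u\<bar> <= K / 2 \<and> \<bar>rnd p u - nrm p {..M} u\<bar> <= 1}"
   unfolding G_def[symmetric] P(1) by (simp add: emeasure_eq_measure ennreal_mult)
 qed
qed

text \<open>The centre has exactly the mean mass, so its Wick mass is 0. Each |a_n| is at most M +
  2, hence |u_n| + |a_n| <= 2M + 5, and the M + 1 terms change by at most ep times this.\<close>

lemma ball_wick:
 assumes mass: "(\<Sum>n\<le>M. (cmod (a n))^2) = (\<Sum>n\<le>M. 1 / (lam n)^2)"
  and ep: "0 <= ep" "ep <= 1" "ep * ((real M + 1) * (2 * real M + 5)) <= K"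
  and u: "\<forall>n\<in>{..M}. cmod (u n - a n) <= ep"
 shows "\<bar>wick {..M} u\<bar> <= K"
proof -
 have "(\<Sum>n\<le>M. 1 / (lam n)^2) <= (\<Sum>n\<le>M. 1)"
  using lam0_ge1 by (intro sum_mono) (simp add: divide_le_eq_1 one_le_power)
 hence m: "(\<Sum>n\<le>M. (cmod (a n))^2) <= real M + 1" using mass by simp
 have an: "cmod (a n) <= real M + 2" if "n <= M" for n
 proof -
  have "(cmod (a n))^2 <= (\<Sum>n\<le>M. (cmod (a n))^2)" using that by (intro member_le_sum) auto
  moreover have "real M + 1 <= (real M + 2)^2" by (simp add: power2_eq_square algebra_simps add_increasing2)
  ultimately have "(cmod (a n))^2 <= (real M + 2)^2" using m by linarith
  thus ?thesis by (rule power2_le_imp_le) simp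
 qed
 have "wick {..M} u = (\<Sum>n\<le>M. (cmod (u n))^2 - (cmod (a n))^2)"
  using mass by (simp add: wick_def sum_subtractf)
 hence "\<bar>wick {..M} u\<bar> <= (\<Sum>n\<le>M. \<bar>(cmod (u n))^2 - (cmod (a n))^2\<bar>)" by (simp add: sum_abs)
 also have "... <= (\<Sum>n\<le>M. ep * (2 * real M + 5))"
 proof (rule sum_mono)
  fix n assume n: "n \<in> {..M}"
  have d: "cmod (u n - a n) <= ep" using u n by blast
  have 1: "\<bar>cmod (u n) - cmod (a n)\<bar> <= ep" using norm_triangle_ineq3[of "u n" "a n"] d by linarith
  have 2: "cmod (u n) + cmod (a n) <= 2 * real M + 5" using 1 an[of n] n ep(2) by auto
  have "(cmod (u n))^2 - (cmod (a n))^2 = (cmod (u n) - cmod (a n)) * (cmod (u n) + cmod (a n))"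
   by (simp add: power2_eq_square algebra_simps)
  hence "\<bar>(cmod (u n))^2 - (cmod (a n))^2\<bar> = \<bar>cmod (u n) - cmod (a n)\<bar> * (cmod (u n) + cmod (a n))" (is "?a = _")
   by (simp add: abs_mult)
  also have "... <= ep * (2 * real M + 5)" using 1 2 ep by (intro mult_mono) auto
  finally show "?a <= ..." .
 qed
 also have "... = ep * ((real M + 1) * (2 * real M + 5))" by (simp add: algebra_simps)
 finally show ?thesis using ep(3) by linarith
qed

definition cyl :: "nat => (nat => complex) => real => (nat => complex) set" where
 "cyl M a ep = {u. \<forall>n\<in>{..M}. cmod (u n - a n) <= ep}"

lemma cyl_sets [measurable]: "cyl M a ep \<in> sets \<mu>"
proof -
 have "{u \<in> space \<mu>. \<forall>n\<in>{..M}. cmod (u n - a n) <= ep} \<in> sets \<mu>" by measurable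
 thus ?thesis by (simp add: cyl_def space_\<mu>)
qed

lemma cyl_cut: "cut {..M} u \<in> cyl M a ep \<longleftrightarrow> u \<in> cyl M a ep"
 by (simp add: cyl_def cut_def)

lemma cyl_pos:
 assumes "ep > 0"
 shows "emeasure \<mu> (cyl M a ep) > 0"
proof -
 have "0 < enn (\<Prod>n\<in>{..M}. (lam n * ep)^2 * exp (- (lam n * cmod (a n) + lam n * ep)\<^sup>2))"
  using assms lam_nz by (simp add: prod_pos)
 also have "... <= emeasure \<mu> (cyl M a ep)"
  using small_ball[OF assms, of "{..M}" a] by (simp add: cyl_def space_\<mu>)
 finally show ?thesis .
qed

text \<open>This makes the partition functions nonzero, so that normalization is meaningful. A small
  cylinder around a centre of mean mass lies inside the truncated cutoff, and
  \<open>ball_typical\<close> passes to the limiting mass.\<close>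

lemma mass_cutoff_pos:
 assumes K: "K > 0"
 shows "emeasure \<mu> {u. \<bar>wick {..N} u\<bar> <= K} > 0"
  "[|tendsto_Lp \<mu> 2 (%N. wick {..N}) X; valid p|] ==> emeasure \<mu> {u. \<bar>X u\<bar> <= K} > 0"
proof -
 define a where "a n = complex_of_real (1 / lam n)" for n
 have a: "(\<Sum>n\<le>M. (cmod (a n))^2) = (\<Sum>n\<le>M. 1 / (lam n)^2)" for M
  by (intro sum.cong refl) (simp only: a_def norm_of_real power2_abs power_divide power_one)
 define ep where "ep M = min 1 (K / 2 / ((real M + 1) * (2 * real M + 5)))" for M
 have ep: "ep M > 0" "ep M <= 1" "ep M * ((real M + 1) * (2 * real M + 5)) <= K / 2" for M
 proof -
  have pos: "(real M + 1) * (2 * real M + 5) > 0" by (intro mult_pos_pos) auto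
  thus "ep M > 0" "ep M <= 1" using K by (auto simp: ep_def)
  have "ep M <= K / 2 / ((real M + 1) * (2 * real M + 5))" by (simp add: ep_def)
  thus "ep M * ((real M + 1) * (2 * real M + 5)) <= K / 2" using pos by (simp only: pos_le_divide_eq)
 qed
 have w: "\<bar>wick {..M} u\<bar> <= K / 2" if "u \<in> cyl M a (ep M)" for u M
  by (rule ball_wick[OF a less_imp_le[OF ep(1)] ep(2,3)]) (use that in \<open>simp add: cyl_def\<close>)
 have "{u \<in> space \<mu>. \<bar>wick {..N} u\<bar> <= K} \<in> sets \<mu>" by measurable
 hence m: "{u. \<bar>wick {..N} u\<bar> <= K} \<in> sets \<mu>" by (simp add: space_\<mu>)
 have "cyl N a (ep N) \<subseteq> {u. \<bar>wick {..N} u\<bar> <= K}"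
 proof
  fix u assume "u \<in> cyl N a (ep N)"
  hence "\<bar>wick {..N} u\<bar> <= K / 2" by (rule w)
  hence "\<bar>wick {..N} u\<bar> <= K" using K by linarith
  thus "u \<in> {u. \<bar>wick {..N} u\<bar> <= K}" by simp
 qed
 hence "emeasure \<mu> (cyl N a (ep N)) <= emeasure \<mu> {u. \<bar>wick {..N} u\<bar> <= K}" by (rule emeasure_mono[OF _ m])
 thus "emeasure \<mu> {u. \<bar>wick {..N} u\<bar> <= K} > 0"
  by (rule order.strict_trans2[OF cyl_pos[OF ep(1)]])
 assume X: "tendsto_Lp \<mu> 2 (%N. wick {..N}) X" and p: "valid p"
 note [measurable] = mass_limit_D(1)[OF X]
 have "{u \<in> space \<mu>. \<bar>X u\<bar> <= K} \<in> sets \<mu>" by measurable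
 hence mX: "{u. \<bar>X u\<bar> <= K} \<in> sets \<mu>" by (simp add: space_\<mu>)
 obtain M where M: "\<And>M' A. [|M' >= M; A \<in> sets \<mu>; \<And>u. cut {..M'} u \<in> A \<longleftrightarrow> u \<in> A|] ==>
   emeasure \<mu> A <= 2 * emeasure \<mu> {u \<in> A. \<bar>X u - wick {..M'} u\<bar> <= K / 2 \<and> \<bar>rnd p u - nrm p {..M'} u\<bar> <= 1}"
  using ball_typical[OF p X K] by blast
 have "0 < 2 * emeasure \<mu> {u \<in> cyl M a (ep M). \<bar>X u - wick {..M} u\<bar> <= K / 2 \<and> \<bar>rnd p u - nrm p {..M} u\<bar> <= 1}"
  by (rule order.strict_trans2[OF cyl_pos[OF ep(1)] M[OF order_refl cyl_sets cyl_cut]])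
 also have "... <= 2 * emeasure \<mu> {u. \<bar>X u\<bar> <= K}"
 proof (intro mult_left_mono emeasure_mono mX subsetI)
  fix u assume "u \<in> {u \<in> cyl M a (ep M). \<bar>X u - wick {..M} u\<bar> <= K / 2 \<and> \<bar>rnd p u - nrm p {..M} u\<bar> <= 1}"
  hence "\<bar>X u - wick {..M} u\<bar> <= K / 2" "\<bar>wick {..M} u\<bar> <= K / 2" using w[of u M] by auto
  hence "\<bar>X u\<bar> <= K" by linarith
  thus "u \<in> {u. \<bar>X u\<bar> <= K}" by simp
 qed simp
 finally show "emeasure \<mu> {u. \<bar>X u\<bar> <= K} > 0" by (simp add: ennreal_zero_less_mult_iff)
qed

end

section \<open>Vitali convergence and convergence of the Gibbs measures\<close>

text \<open>Boundedness in the exponent 2r gives uniform integrability in the exponent r, and the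
  condition on subsequences expresses convergence in probability. A subsequence violating the
  conclusion is contradicted along a further one.\<close>

lemma Lp_Vitali:
 fixes f :: "nat => 'b => real" and F :: "'b => real"
 assumes "prob_space M" and f [measurable]: "\<And>n. f n \<in> borel_measurable M" and F [measurable]: "F \<in> borel_measurable M"
  and r: "r > 0" and C: "C >= 0" "\<And>n. Lp_int M (2 * r) (f n) <= enn C"
  and sub: "\<And>s :: nat => nat. strict_mono s ==> \<exists>t. strict_mono t \<and> (AE x in M. (%k. f (s (t k)) x) \<longlonglongrightarrow> F x)"
 shows "Lp_int M (2 * r) F <= enn C" "(%n. Lp_int M r (%x. f n x - F x)) \<longlonglongrightarrow> 0"
proof -
 interpret prob_space M by fact
 obtain t where t: "strict_mono t" "AE x in M. (%k. f (t k) x) \<longlonglongrightarrow> F x"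
  using sub[of "%k. k"] by (auto simp: strict_mono_def)
 have F1: "Lp_int M (2 * r) F <= liminf (%k. Lp_int M (2 * r) (f (t k)))"
  by (rule Lp_int_Fatou[OF _ _ t(2)]) (use r in auto)
 have F2: "liminf (%k. Lp_int M (2 * r) (f (t k))) <= limsup (%k. Lp_int M (2 * r) (f (t k)))"
  by (rule Liminf_le_Limsup) simp
 have F3: "limsup (%k. Lp_int M (2 * r) (f (t k))) <= enn C"
  by (rule Limsup_bounded) (simp add: C(2))
 show FC: "Lp_int M (2 * r) F <= enn C" by (rule order_trans[OF F1 order_trans[OF F2 F3]])
 define g where "g n x = \<bar>f n x - F x\<bar> powr r" for n x
 have [measurable]: "g n \<in> borel_measurable M" for n unfolding g_def [abs_def] by measurable
 have g0: "g n x >= 0" for n x by (simp add: g_def)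
 define C' where "C' = 2 powr (2 * r) * (C + C)"
 have C': "C' >= 0" using C by (simp add: C'_def)
 have g2: "(\<integral>\<^sup>+x. enn ((g n x)^2) \<partial>M) <= enn C'" for n
 proof -
  have "(\<integral>\<^sup>+x. enn ((g n x)^2) \<partial>M) <= (\<integral>\<^sup>+x. enn (2 powr (2 * r)) * (enn (norm (f n x) powr (2 * r)) + enn (norm (F x) powr (2 * r))) \<partial>M)"
  proof (rule nn_integral_mono)
   fix x
   have "(g n x)^2 = g n x * g n x" by (rule power2_eq_square)
   also have "... = \<bar>f n x - F x\<bar> powr (2 * r)" by (simp only: g_def powr_add[symmetric] mult_2)
   also have "... <= (2 * max \<bar>f n x\<bar> \<bar>F x\<bar>) powr (2 * r)" using r by (intro powr_mono2) auto
   also have "... = 2 powr (2 * r) * max \<bar>f n x\<bar> \<bar>F x\<bar> powr (2 * r)" by (rule powr_mult)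
   also have "... <= 2 powr (2 * r) * (\<bar>f n x\<bar> powr (2 * r) + \<bar>F x\<bar> powr (2 * r))"
    by (intro mult_left_mono) (auto simp: max_def)
   finally have "enn ((g n x)^2) <= enn (2 powr (2 * r) * (\<bar>f n x\<bar> powr (2 * r) + \<bar>F x\<bar> powr (2 * r)))" by (rule ennreal_leI)
   also have "... = enn (2 powr (2 * r)) * enn (\<bar>f n x\<bar> powr (2 * r) + \<bar>F x\<bar> powr (2 * r))" by (rule ennreal_mult) auto
   also have "enn (\<bar>f n x\<bar> powr (2 * r) + \<bar>F x\<bar> powr (2 * r)) = enn (norm (f n x) powr (2 * r)) + enn (norm (F x) powr (2 * r))"
    by (simp add: ennreal_plus)
   finally show "enn ((g n x)^2) <= enn (2 powr (2 * r)) * (enn (norm (f n x) powr (2 * r)) + enn (norm (F x) powr (2 * r)))" .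
  qed
  also have "... = enn (2 powr (2 * r)) * (Lp_int M (2 * r) (f n) + Lp_int M (2 * r) F)"
   unfolding Lp_int_def by (simp add: nn_integral_cmult nn_integral_add)
  also have "... <= enn (2 powr (2 * r)) * (enn C + enn C)"
   using C(2) FC by (intro mult_left_mono add_mono) auto
  also have "... = enn C'" by (simp only: C'_def ennreal_mult[OF powr_ge_zero add_nonneg_nonneg[OF C(1) C(1)]] ennreal_plus[OF C(1) C(1)])
  finally show ?thesis .
 qed
 have Lg: "Lp_int M r (%x. f n x - F x) = (\<integral>\<^sup>+x. enn (g n x) \<partial>M)" for n by (simp add: Lp_int_def g_def)
 show "(%n. Lp_int M r (%x. f n x - F x)) \<longlonglongrightarrow> 0"
  unfolding Lg
 proof (rule tendsto_ennreal_0I)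
  fix e :: real assume e: "e > 0"
  show "\<forall>\<^sub>F n in sequentially. (\<integral>\<^sup>+x. enn (g n x) \<partial>M) <= enn e"
  proof (rule ccontr)
   assume "\<not> ?thesis"
   hence "\<forall>N. \<exists>n\<ge>N. n \<in> {n. \<not> (\<integral>\<^sup>+x. enn (g n x) \<partial>M) <= enn e}" by (simp add: eventually_sequentially)
   hence "infinite {n. \<not> (\<integral>\<^sup>+x. enn (g n x) \<partial>M) <= enn e}" unfolding infinite_nat_iff_unbounded_le by blast
   then obtain s :: "nat => nat" where s: "strict_mono s" "\<And>n. \<not> (\<integral>\<^sup>+x. enn (g (s n) x) \<partial>M) <= enn e"
    using infinite_enumerate[of "{n. \<not> (\<integral>\<^sup>+x. enn (g n x) \<partial>M) <= enn e}"] by blast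
   obtain t where t: "strict_mono t" "AE x in M. (%k. f (s (t k)) x) \<longlonglongrightarrow> F x" using sub[OF s(1)] by blast
   \<comment> \<open>The truncation level: g exceeds min g B by at most g^2 / B, and the
     second-moment bound C' makes the integral of that at most e/2.\<close>
   define B where "B = 2 * C' / e + 1"
   have B: "B > 0" "C' / B <= e / 2"
   proof -
    show "B > 0" using C' e by (simp add: B_def add_nonneg_pos)
    thus "C' / B <= e / 2" using e by (simp add: pos_divide_le_eq) (simp add: B_def field_simps)
   qed
   have "(%k. \<integral>\<^sup>+x. enn (min (g (s (t k)) x) B) \<partial>M) \<longlonglongrightarrow> (\<integral>\<^sup>+x. 0 \<partial>M)"
   proof (rule nn_integral_dominated_convergence[where w="%_. enn B"])
    show "AE x in M. (%k. enn (min (g (s (t k)) x) B)) \<longlonglongrightarrow> 0"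
    proof (rule eventually_mono[OF t(2)])
     fix x assume "(%k. f (s (t k)) x) \<longlonglongrightarrow> F x"
     hence "(%k. \<bar>f (s (t k)) x - F x\<bar>) \<longlonglongrightarrow> 0"
      using tendsto_rabs[OF tendsto_diff[OF _ tendsto_const[of "F x"]], of "%k. f (s (t k)) x" "F x"] by simp
     hence "(%k. g (s (t k)) x) \<longlonglongrightarrow> 0 powr r"
      unfolding g_def using r by (intro tendsto_powr' tendsto_const) auto
     hence "(%k. min (g (s (t k)) x) B) \<longlonglongrightarrow> min 0 B" by (intro tendsto_min tendsto_const) simp
     hence "(%k. min (g (s (t k)) x) B) \<longlonglongrightarrow> 0" using B by simp
     thus "(%k. enn (min (g (s (t k)) x) B)) \<longlonglongrightarrow> 0" using tendsto_ennrealI by force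
    qed
   qed (auto simp: emeasure_space_1 intro!: ennreal_leI)
   hence "\<forall>\<^sub>F k in sequentially. (\<integral>\<^sup>+x. enn (min (g (s (t k)) x) B) \<partial>M) < enn (e / 2)"
    by (rule order_tendstoD(2)) (use e in simp)
   then obtain k where k: "(\<integral>\<^sup>+x. enn (min (g (s (t k)) x) B) \<partial>M) < enn (e / 2)"
    by (auto simp: eventually_sequentially)
   define G where "G = g (s (t k))"
   have [measurable]: "G \<in> borel_measurable M" by (simp add: G_def)
   have "(\<integral>\<^sup>+x. enn (G x) \<partial>M) <= (\<integral>\<^sup>+x. enn (min (G x) B) + enn (1 / B) * enn ((G x)^2) \<partial>M)"
   proof (rule nn_integral_mono)
    fix x
    have "G x <= min (G x) B + 1 / B * (G x)^2"
    proof (cases "G x <= B")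
     case False
     hence "B * G x <= G x * G x" using B by (intro mult_right_mono) auto
     hence "G x <= 1 / B * (G x)^2" using B by (simp add: field_simps power2_eq_square)
     thus ?thesis using False B by simp
    qed (use B in simp)
    hence "enn (G x) <= enn (min (G x) B + 1 / B * (G x)^2)" by (rule ennreal_leI)
    also have "... = enn (min (G x) B) + enn (1 / B * (G x)^2)" using B g0[of "s (t k)" x] by (intro ennreal_plus) (auto simp: G_def)
    also have "enn (1 / B * (G x)^2) = enn (1 / B) * enn ((G x)^2)" using B by (intro ennreal_mult) auto
    finally show "enn (G x) <= enn (min (G x) B) + enn (1 / B) * enn ((G x)^2)" .
   qed
   also have "... = (\<integral>\<^sup>+x. enn (min (G x) B) \<partial>M) + enn (1 / B) * (\<integral>\<^sup>+x. enn ((G x)^2) \<partial>M)"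
    by (simp add: nn_integral_add nn_integral_cmult)
   also have "... <= enn (e / 2) + enn (1 / B) * enn C'"
    using k g2[of "s (t k)"] by (intro add_mono mult_left_mono) (auto simp: G_def)
   also have "enn (1 / B) * enn C' = enn (C' / B)" using B C' by (subst ennreal_mult[symmetric]) auto
   also have "enn (e / 2) + enn (C' / B) = enn (e / 2 + C' / B)" using B C' e by (intro ennreal_plus[symmetric]) auto
   also have "... <= enn e" using B(2) by (intro ennreal_leI) linarith
   finally show False using s(2)[of "t k"] by (simp add: G_def)
  qed
 qed
qed

lemma gibbs_measure_density:
 fixes W :: "'b => real"
 assumes W: "integrable M W" "\<And>x. W x >= 0" and z: "(\<integral>x. W x \<partial>M) > 0"
 shows "partition_fun M W = enn (\<integral>x. W x \<partial>M)"
  "gibbs_measure M W = density M (%x. enn (W x / (\<integral>x. W x \<partial>M)))"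
  "A \<in> sets M ==> measure (gibbs_measure M W) A = (\<integral>x. W x / (\<integral>x. W x \<partial>M) * indicator A x \<partial>M)"
  "prob_space (gibbs_measure M W)"
proof -
 define c where "c = (\<integral>x. W x \<partial>M)"
 have c: "c > 0" using z by (simp add: c_def)
 have [measurable]: "W \<in> borel_measurable M" using W(1) by simp
 show pf: "partition_fun M W = enn (\<integral>x. W x \<partial>M)"
  unfolding partition_fun_def using W by (intro nn_integral_eq_integral) auto
 have "inverse (enn c) * enn (W x) = enn (W x / c)" for x
  using c W(2)[of x] by (simp add: inverse_ennreal ennreal_mult[symmetric] field_simps)
 thus gd: "gibbs_measure M W = density M (%x. enn (W x / (\<integral>x. W x \<partial>M)))"
  unfolding gibbs_measure_def pf c_def[symmetric] by simp
 have em: "emeasure (gibbs_measure M W) A = enn (\<integral>x. W x / c * indicator A x \<partial>M)" if A: "A \<in> sets M" for A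
 proof -
  have "emeasure (gibbs_measure M W) A = (\<integral>\<^sup>+x. enn (W x / c) * indicator A x \<partial>M)"
   unfolding gd c_def[symmetric] using A by (intro emeasure_density) auto
  also have "... = (\<integral>\<^sup>+x. enn (W x / c * indicator A x) \<partial>M)"
   by (intro nn_integral_cong) (simp add: indicator_def)
  also have "... = enn (\<integral>x. W x / c * indicator A x \<partial>M)"
   using W c A by (intro nn_integral_eq_integral integrable_real_mult_indicator integrable_divide) auto
  finally show ?thesis .
 qed
 have nn: "(\<integral>x. W x / c * indicator A x \<partial>M) >= 0" for A using W(2) c by (intro integral_nonneg_AE) auto
 show "A \<in> sets M ==> measure (gibbs_measure M W) A = (\<integral>x. W x / (\<integral>x. W x \<partial>M) * indicator A x \<partial>M)"
  using em[of A] nn[of A] unfolding c_def by (simp add: measure_def)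
 show "prob_space (gibbs_measure M W)"
 proof
  have sp: "space (gibbs_measure M W) = space M" by (simp add: gibbs_measure_def)
  have "(\<integral>x. W x / c * indicator (space M) x \<partial>M) = (\<integral>x. W x / c \<partial>M)" by (intro Bochner_Integration.integral_cong) auto
  also have "... = 1" using c by (simp add: c_def)
  finally show "emeasure (gibbs_measure M W) (space (gibbs_measure M W)) = 1"
   unfolding sp using em[of "space M"] by simp
 qed
qed

text \<open>The normalized densities differ by |V - W| / c plus a term from the normalizing
  constants; the latter integrates to |d - c| / c, which is again at most the L^1 distance over
  c.\<close>

lemma tv_dist_gibbs:
 fixes W :: "'b => real"
 assumes "\<And>N. integrable M (V N)" "integrable M W" "\<And>N x. V N x >= 0" "\<And>x. W x >= 0"
  and zN: "\<And>N. (\<integral>x. V N x \<partial>M) > 0" and z: "(\<integral>x. W x \<partial>M) > 0"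
  and lim: "(%N. Lp_int M 1 (%x. V N x - W x)) \<longlonglongrightarrow> 0"
 shows "(%N. tv_dist (gibbs_measure M (V N)) (gibbs_measure M W)) \<longlonglongrightarrow> 0"
proof -
 define c where "c = (\<integral>x. W x \<partial>M)"
 define d where "d N = (\<integral>x. V N x \<partial>M)" for N
 define de where "de N = (\<integral>x. \<bar>V N x - W x\<bar> \<partial>M)" for N
 have c: "c > 0" "d N > 0" for N using z zN by (auto simp: c_def d_def)
 have L: "Lp_int M 1 (%x. V N x - W x) = enn (de N)" for N
  unfolding Lp_int_def de_def using assms(1,2) by (simp add: nn_integral_eq_integral)
 have bound: "tv_dist (gibbs_measure M (V N)) (gibbs_measure M W) <= enn (2 / c) * enn (de N)" for N
  unfolding tv_dist_def
 proof (rule SUP_least)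
  fix A assume "A \<in> sets (gibbs_measure M (V N))"
  hence A: "A \<in> sets M" by (simp add: gibbs_measure_def)
  have i1: "integrable M (%x. V N x / d N * indicator A x)" "integrable M (%x. W x / c * indicator A x)"
   using assms(1,2) A by (intro integrable_real_mult_indicator integrable_divide; simp)+
  have i2: "integrable M (%x. \<bar>V N x - W x\<bar> / c + V N x / d N * (\<bar>d N - c\<bar> / c))"
   using assms(1,2) by simp
  have "measure (gibbs_measure M (V N)) A - measure (gibbs_measure M W) A
    = (\<integral>x. V N x / d N * indicator A x - W x / c * indicator A x \<partial>M)"
   using gibbs_measure_density(3)[OF assms(1,3) zN A] gibbs_measure_density(3)[OF assms(2,4) z A] i1
   unfolding c_def d_def by simp
  also have "\<bar>...\<bar> <= (\<integral>x. \<bar>V N x / d N * indicator A x - W x / c * indicator A x\<bar> \<partial>M)"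
   by (rule integral_abs_bound)
  also have "... <= (\<integral>x. \<bar>V N x - W x\<bar> / c + V N x / d N * (\<bar>d N - c\<bar> / c) \<partial>M)"
  proof (rule integral_mono)
   show "integrable M (%x. \<bar>V N x / d N * indicator A x - W x / c * indicator A x\<bar>)" using i1 by simp
   fix x
   have "V N x / d N - W x / c = (V N x - W x) / c + V N x / d N * ((c - d N) / c)"
    using c(1) c(2)[of N] by (simp add: field_simps)
   hence "\<bar>V N x / d N - W x / c\<bar> <= \<bar>(V N x - W x) / c\<bar> + \<bar>V N x / d N * ((c - d N) / c)\<bar>" by (simp only: abs_triangle_ineq)
   also have "... = \<bar>V N x - W x\<bar> / c + V N x / d N * (\<bar>d N - c\<bar> / c)"
    using c(1) c(2)[of N] assms(3)[of N x] by (simp add: abs_mult abs_divide abs_minus_commute)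
   finally have *: "\<bar>V N x / d N - W x / c\<bar> <= \<bar>V N x - W x\<bar> / c + V N x / d N * (\<bar>d N - c\<bar> / c)" .
   hence "0 <= \<bar>V N x - W x\<bar> / c + V N x / d N * (\<bar>d N - c\<bar> / c)" by linarith
   thus "\<bar>V N x / d N * indicator A x - W x / c * indicator A x\<bar> <= \<bar>V N x - W x\<bar> / c + V N x / d N * (\<bar>d N - c\<bar> / c)"
    using * by (cases "x \<in> A") auto
  qed (rule i2)
  also have "... = de N / c + d N / d N * (\<bar>d N - c\<bar> / c)"
   using assms(1,2) by (simp add: de_def d_def)
  also have "... <= de N / c + de N / c"
  proof -
   have "d N - c = (\<integral>x. V N x - W x \<partial>M)" using assms(1,2) by (simp add: c_def d_def)
   hence "\<bar>d N - c\<bar> <= de N" unfolding de_def by (simp add: integral_abs_bound)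
   hence "\<bar>d N - c\<bar> / c <= de N / c" using c(1) by (simp add: divide_right_mono)
   thus ?thesis using c(2)[of N] by simp
  qed
  also have "... = 2 / c * de N" by simp
  finally have "enn \<bar>measure (gibbs_measure M (V N)) A - measure (gibbs_measure M W) A\<bar> <= enn (2 / c * de N)" by (rule ennreal_leI)
  also have "... = enn (2 / c) * enn (de N)" using c(1) by (intro ennreal_mult) (auto simp: de_def)
  finally show "enn \<bar>measure (gibbs_measure M (V N)) A - measure (gibbs_measure M W) A\<bar> <= ..." .
 qed
 have "(%N. enn (2 / c) * enn (de N)) \<longlonglongrightarrow> enn (2 / c) * 0"
  using lim unfolding L by (intro ennreal_tendsto_cmult) auto
 hence up: "(%N. enn (2 / c) * enn (de N)) \<longlonglongrightarrow> 0" by simp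
 show ?thesis by (rule tendsto_sandwich[OF _ _ tendsto_const up]) (auto simp: bound)
qed

context gibbs
begin

text \<open>Both errors are put into one nonnegative variable that tends to 0 in probability, so a
  single subsequence serves the mass and the norm simultaneously.\<close>

lemma AE_subsequence:
 assumes p: "valid p" and X: "tendsto_Lp \<mu> 2 (%N. wick {..N}) X" and s: "strict_mono (s :: nat => nat)"
 shows "\<exists>t. strict_mono t \<and> (AE u in \<mu>. (%k. wick {..s (t k)} u) \<longlonglongrightarrow> X u \<and> (%k. nrm p {..s (t k)} u) \<longlonglongrightarrow> rnd p u)"
proof -
 have p2: "p > 2" using p by (simp add: valid_def)
 note [measurable] = mass_limit_D(1)[OF X]
 have [measurable]: "rnd p \<in> borel_measurable \<mu>" using p2 by (intro rnd_measurable) simp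
 obtain C b where C: "C > 0" "b > 0" and close: "\<And>M A. A \<in> sets \<mu> ==>
    (\<E> u. indicator A (cut {..M} u) * enn (\<bar>rnd p u - nrm p {..M} u\<bar> powr p))
     <= (\<E> u. indicator A (cut {..M} u)) * enn (C * lam M powr (- b))"
  using rnd_close[OF p] by blast
 define v where "v n u = (X u - wick {..n} u)^2 + \<bar>rnd p u - nrm p {..n} u\<bar> powr p" for n u
 have [measurable]: "v n \<in> borel_measurable \<mu>" for n unfolding v_def [abs_def] by measurable
 have v0: "v n u >= 0" for n u by (simp add: v_def)
 have lam_inf: "filterlim lam at_top sequentially"
  by (rule filterlim_at_top_mono[OF filterlim_compose[OF sqrt_at_top filterlim_real_sequentially]])
   (simp add: lam_ge_sqrt)
 have "(%n. C * lam n powr (- b)) \<longlonglongrightarrow> C * 0"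
  by (intro tendsto_mult tendsto_const tendsto_neg_powr lam_inf) (use C in auto)
 hence lim2: "(%n. enn (C * lam n powr (- b))) \<longlonglongrightarrow> enn 0" by (intro tendsto_ennrealI) simp
 have up: "(%n. (\<E> u. enn ((X u - wick {..n} u)^2)) + enn (C * lam n powr (- b))) \<longlonglongrightarrow> 0"
  using tendsto_add[OF mass_limit_D(2)[OF X] lim2] by simp
 have lim: "(%n. \<integral>\<^sup>+u. enn (min 1 (v n u)) \<partial>\<mu>) \<longlonglongrightarrow> 0"
 proof (rule tendsto_sandwich[OF _ _ tendsto_const up])
  show "\<forall>\<^sub>F n in sequentially. (\<E> u. enn (min 1 (v n u))) <= (\<E> u. enn ((X u - wick {..n} u)^2)) + enn (C * lam n powr (- b))"
  proof (rule always_eventually, rule allI)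
   fix n
   have "(\<E> u. enn (min 1 (v n u))) <= (\<E> u. enn ((X u - wick {..n} u)^2) + enn (\<bar>rnd p u - nrm p {..n} u\<bar> powr p))" (is "?a <= _")
    by (rule nn_integral_mono) (simp add: v_def ennreal_leI flip: ennreal_plus)
   also have "... = (\<E> u. enn ((X u - wick {..n} u)^2)) + (\<E> u. enn (\<bar>rnd p u - nrm p {..n} u\<bar> powr p))"
    by (rule nn_integral_add) measurable
   also have "... <= (\<E> u. enn ((X u - wick {..n} u)^2)) + enn (C * lam n powr (- b))"
    using close[OF sets.top, of n] by (intro add_left_mono) (simp add: space_\<mu> emeasure_space_1[unfolded space_\<mu>])
   finally show "?a <= ..." .
  qed
 qed simp
 \<comment> \<open>Truncation at 1 supplies integrability without changing what convergence to 0
   means along a sequence of values.\<close>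
 have int: "integrable \<mu> (%u. min 1 (v n u))" for n
  by (rule integrable_const_bound[of _ 1]) (use v0 in auto)
 have "(%n. \<integral>u. norm (min 1 (v (s n) u)) \<partial>\<mu>) \<longlonglongrightarrow> 0"
 proof -
  have "(\<integral>u. norm (min 1 (v n u)) \<partial>\<mu>) = enn2real (\<E> u. enn (min 1 (v n u)))" for n
   using v0 by (subst integral_eq_nn_integral) auto
  moreover have "(%n. enn2real (\<E> u. enn (min 1 (v n u)))) \<longlonglongrightarrow> enn2real 0"
   using lim by (intro tendsto_enn2real) auto
  ultimately have "(%n. \<integral>u. norm (min 1 (v n u)) \<partial>\<mu>) \<longlonglongrightarrow> 0" by simp
  from LIMSEQ_subseq_LIMSEQ[OF this s] show ?thesis by (simp add: o_def)
 qed
 then obtain t where t: "strict_mono t" "AE u in \<mu>. (%k. min 1 (v (s (t k)) u)) \<longlonglongrightarrow> 0"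
  using tendsto_L1_AE_subseq[of \<mu> "%n u. min 1 (v (s n) u)"] int by blast
 have "AE u in \<mu>. (%k. wick {..s (t k)} u) \<longlonglongrightarrow> X u \<and> (%k. nrm p {..s (t k)} u) \<longlonglongrightarrow> rnd p u"
 proof (rule eventually_mono[OF t(2)])
  fix u assume l: "(%k. min 1 (v (s (t k)) u)) \<longlonglongrightarrow> 0"
  have "\<forall>\<^sub>F k in sequentially. min 1 (v (s (t k)) u) < 1" using order_tendstoD(2)[OF l, of 1] by simp
  hence "\<forall>\<^sub>F k in sequentially. min 1 (v (s (t k)) u) = v (s (t k)) u" by (rule eventually_mono) auto
  hence vl: "(%k. v (s (t k)) u) \<longlonglongrightarrow> 0" by (rule Lim_transform_eventually[OF l])
  have "(%k. (X u - wick {..s (t k)} u)^2) \<longlonglongrightarrow> 0"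
   by (rule tendsto_sandwich[OF _ _ tendsto_const vl]) (auto simp: v_def)
  hence "(%k. sqrt ((X u - wick {..s (t k)} u)^2)) \<longlonglongrightarrow> sqrt 0" by (rule tendsto_real_sqrt)
  hence "(%k. \<bar>X u - wick {..s (t k)} u\<bar>) \<longlonglongrightarrow> 0" by simp
  hence "(%k. X u - wick {..s (t k)} u) \<longlonglongrightarrow> 0" by (rule tendsto_rabs_zero_cancel)
  from tendsto_diff[OF tendsto_const[of "X u"] this] have 1: "(%k. wick {..s (t k)} u) \<longlonglongrightarrow> X u" by simp
  have "(%k. \<bar>rnd p u - nrm p {..s (t k)} u\<bar> powr p) \<longlonglongrightarrow> 0"
   by (rule tendsto_sandwich[OF _ _ tendsto_const vl]) (auto simp: v_def)
  hence "(%k. (\<bar>rnd p u - nrm p {..s (t k)} u\<bar> powr p) powr (1 / p)) \<longlonglongrightarrow> 0 powr (1 / p)"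
   using p2 by (intro tendsto_powr' tendsto_const) auto
  hence "(%k. \<bar>rnd p u - nrm p {..s (t k)} u\<bar>) \<longlonglongrightarrow> 0" using p2 by (simp add: powr_powr)
  hence "(%k. rnd p u - nrm p {..s (t k)} u) \<longlonglongrightarrow> 0" by (rule tendsto_rabs_zero_cancel)
  from tendsto_diff[OF tendsto_const[of "rnd p u"] this] have 2: "(%k. nrm p {..s (t k)} u) \<longlonglongrightarrow> rnd p u" by simp
  show "(%k. wick {..s (t k)} u) \<longlonglongrightarrow> X u \<and> (%k. nrm p {..s (t k)} u) \<longlonglongrightarrow> rnd p u" using 1 2 by simp
 qed
 thus ?thesis using t(1) by blast
qed

lemma weight_trunc_eq:
 "gibbs_weight_trunc h \<mu> K p N u = indicator {v. \<bar>wick {..N} v\<bar> <= K} u * exp (1 / p * nrm p {..N} u powr p)"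
 unfolding gibbs_weight_trunc_def wick_mass_wick proj_field nrm_def ..

lemma weight_eq: "gibbs_weight h X K p u = indicator {v. \<bar>X v\<bar> <= K} u * exp (1 / p * rnd p u powr p)"
 unfolding gibbs_weight_def rnd_def ..

lemma weight_trunc_measurable [measurable]: "gibbs_weight_trunc h \<mu> K p N \<in> borel_measurable \<mu>"
proof -
 have [measurable]: "{v. \<bar>wick {..N} v\<bar> <= K} \<in> sets \<mu>"
  using measurable_sets[of "%v. \<bar>wick {..N} v\<bar>" \<mu> borel "{..K}"] by (simp add: vimage_def space_\<mu>)
 show ?thesis unfolding weight_trunc_eq [abs_def] by measurable
qed

lemma weight_measurable:
 assumes X [measurable]: "X \<in> borel_measurable \<mu>" and p: "p >= 2"
 shows "gibbs_weight h X K p \<in> borel_measurable \<mu>"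
proof -
 note [measurable] = rnd_measurable[OF p]
 have [measurable]: "{v. \<bar>X v\<bar> <= K} \<in> sets \<mu>"
  using measurable_sets[of "%v. \<bar>X v\<bar>" \<mu> borel "{..K}"] by (simp add: vimage_def space_\<mu>)
 show ?thesis unfolding weight_eq [abs_def] by measurable
qed

lemma weight_limit:
 assumes "(%k. wick {..s k} u) \<longlonglongrightarrow> X u" "(%k. nrm p {..s k} u) \<longlonglongrightarrow> rnd p u" "\<bar>X u\<bar> ~= K" "p > 0"
 shows "(%k. gibbs_weight_trunc h \<mu> K p (s k) u) \<longlonglongrightarrow> gibbs_weight h X K p u"
proof -
 have e: "(%k. exp (1 / p * nrm p {..s k} u powr p)) \<longlonglongrightarrow> exp (1 / p * rnd p u powr p)"
  using assms(4) by (intro tendsto_exp tendsto_mult tendsto_const tendsto_powr' assms(2)) auto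
 have a: "(%k. \<bar>wick {..s k} u\<bar>) \<longlonglongrightarrow> \<bar>X u\<bar>" by (rule tendsto_rabs[OF assms(1)])
 have "(%k. indicator {v. \<bar>wick {..s k} v\<bar> <= K} u :: real) \<longlonglongrightarrow> indicator {v. \<bar>X v\<bar> <= K} u"
 proof (rule tendsto_eventually)
  show "\<forall>\<^sub>F k in sequentially. (indicator {v. \<bar>wick {..s k} v\<bar> <= K} u :: real) = indicator {v. \<bar>X v\<bar> <= K} u"
  proof (cases "\<bar>X u\<bar> < K")
   case True
   show ?thesis by (rule eventually_mono[OF order_tendstoD(2)[OF a True]]) (use True in \<open>simp add: indicator_def\<close>)
  next
   case False
   hence "K < \<bar>X u\<bar>" using assms(3) by simp
   show ?thesis by (rule eventually_mono[OF order_tendstoD(1)[OF a \<open>K < \<bar>X u\<bar>\<close>]]) (use \<open>K < \<bar>X u\<bar>\<close> in \<open>simp add: indicator_def\<close>)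
  qed
 qed
 thus ?thesis unfolding weight_trunc_eq weight_eq by (rule tendsto_mult[OF _ e])
qed

text \<open>A power of the weight only changes the constant in the exponential, so all finite
  exponents r are covered by \<open>uniform_moment\<close> with A = r/p.\<close>

lemma weight_Lp_int:
 assumes "r > 0"
 shows "Lp_int \<mu> r (gibbs_weight_trunc h \<mu> K p N)
  = (\<E> u. indicator {u. \<bar>wick {..N} u\<bar> <= K} u * enn (exp (r / p * nrm p {..N} u powr p)))"
 unfolding Lp_int_def weight_trunc_eq
proof (rule nn_integral_cong)
 fix u
 have "exp (1 / p * nrm p {..N} u powr p) powr r = exp (r / p * nrm p {..N} u powr p)"
  by (simp add: powr_def mult_ac)
 thus "enn (norm (indicator {v. \<bar>wick {..N} v\<bar> <= K} u * exp (1 / p * nrm p {..N} u powr p)) powr r)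
   = indicator {u. \<bar>wick {..N} u\<bar> <= K} u * enn (exp (r / p * nrm p {..N} u powr p))"
  using assms by (simp add: indicator_def)
qed

lemma weight_Lp_bound:
 assumes p: "2 < p" "p < 2 + 4 / real D" and K: "K > 0" and r: "r > 0"
 obtains C where "C >= 0" "\<And>N. Lp_int \<mu> r (gibbs_weight_trunc h \<mu> K p N) <= enn C"
proof -
 have "r / p >= 0" using p r by simp
 from uniform_moment[OF p K this] obtain C where "C >= 0"
  "\<And>N. (\<E> u. indicator {u. \<bar>wick {..N} u\<bar> <= K} u * enn (exp (r / p * nrm p {..N} u powr p))) <= enn C"
  by blast
 thus ?thesis using that[of C] unfolding weight_Lp_int[OF r] by blast
qed

lemma subcritical_valid:
 assumes "2 < p" "p < 2 + 4 / real D"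
 shows "valid p"
proof -
 have D2: "real D >= 2" using dim by simp
 have "p * (real D - 2) <= (2 + 4 / real D) * (real D - 2)" using assms D2 by (intro mult_right_mono) auto
 also have "... = 2 * real D - 8 / real D" using D2 by (simp add: field_simps)
 also have "... < 2 * real D" using D2 by simp
 finally show ?thesis using assms by (simp add: valid_def)
qed

lemma integrable_Lp_int_1:
 assumes "f \<in> borel_measurable \<mu>" "Lp_int \<mu> 1 f < \<infinity>"
 shows "integrable \<mu> (f :: _ => real)"
 using assms by (intro integrableI_bounded) (auto simp: Lp_int_def)

lemma ge_indicator_integral_pos:
 fixes W :: "_ => real"
 assumes W: "integrable \<mu> W" and S: "emeasure \<mu> S > 0" and ge: "\<And>u. W u >= indicator S u"
 shows "(\<integral>u. W u \<partial>\<mu>) > 0"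
proof -
 have Sm: "S \<in> sets \<mu>" using S emeasure_notin_sets[of S \<mu>] by (cases "S \<in> sets \<mu>") auto
 have W0: "W u >= 0" for u by (rule order_trans[OF indicator_pos_le ge])
 have "emeasure \<mu> S = (\<E> u. indicator S u)" using Sm by simp
 also have "... <= (\<E> u. enn (W u))"
  by (intro nn_integral_mono) (simp add: ge ennreal_leI flip: ennreal_indicator)
 also have "... = enn (\<integral>u. W u \<partial>\<mu>)" using W W0 by (intro nn_integral_eq_integral) auto
 finally have le: "emeasure \<mu> S <= ..." .
 show ?thesis using order.strict_trans2[OF S le] by simp
qed

lemma subcritical:
 assumes p: "2 < p" "p < 2 + 4 / real D" and K: "K > 0" and X: "tendsto_Lp \<mu> 2 (%N. wick {..N}) X"
 shows "r >= 1 ==> (SUP N. Lp_norm \<mu> r (gibbs_weight_trunc h \<mu> K p N)) < \<infinity>"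
  "r >= 1 ==> tendsto_Lp \<mu> r (gibbs_weight_trunc h \<mu> K p) (gibbs_weight h X K p)"
  "prob_space (gibbs_measure \<mu> (gibbs_weight_trunc h \<mu> K p N))"
  "prob_space (gibbs_measure \<mu> (gibbs_weight h X K p))"
  "(%N. tv_dist (gibbs_measure \<mu> (gibbs_weight_trunc h \<mu> K p N)) (gibbs_measure \<mu> (gibbs_weight h X K p))) \<longlonglongrightarrow> 0"
  "absolutely_continuous \<mu> (gibbs_measure \<mu> (gibbs_weight h X K p))"
proof -
 let ?V = "gibbs_weight_trunc h \<mu> K p" and ?W = "gibbs_weight h X K p"
 have valid: "valid p" by (rule subcritical_valid[OF p])
 have Wm [measurable]: "?W \<in> borel_measurable \<mu>" using p by (intro weight_measurable mass_limit_D(1)[OF X]) simp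
 have sub: "\<exists>t. strict_mono t \<and> (AE u in \<mu>. (%k. ?V (s (t k)) u) \<longlonglongrightarrow> ?W u)" if s: "strict_mono s" for s :: "nat => nat"
 proof -
  obtain t where t: "strict_mono t" "AE u in \<mu>. (%k. wick {..s (t k)} u) \<longlonglongrightarrow> X u \<and> (%k. nrm p {..s (t k)} u) \<longlonglongrightarrow> rnd p u"
   using AE_subsequence[OF valid X s] by blast
  have "AE u in \<mu>. (%k. ?V (s (t k)) u) \<longlonglongrightarrow> ?W u"
   using t(2) mass_no_atom[OF X, of K]
  proof eventually_elim
   case (elim u)
   thus ?case using p by (intro weight_limit) auto
  qed
  thus ?thesis using t(1) by blast
 qed
 have fin: "in_Lp \<mu> r (?V N)" if r: "r >= 1" for r N
 proof -
  obtain C where C: "C >= 0" "\<And>N. Lp_int \<mu> r (?V N) <= enn C" using weight_Lp_bound[OF p K, of r] r by auto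
  have "Lp_int \<mu> r (?V N) < \<infinity>" using C(2)[of N] by (simp add: le_less_trans)
  thus ?thesis by (simp add: in_Lp_def Lp_norm_finite_iff)
 qed
 have conv: "in_Lp \<mu> r ?W" "(%N. Lp_int \<mu> r (%u. ?V N u - ?W u)) \<longlonglongrightarrow> 0" if r: "r >= 1" for r
 proof -
  obtain C where C: "C >= 0" "\<And>N. Lp_int \<mu> (2 * r) (?V N) <= enn C" using weight_Lp_bound[OF p K, of "2 * r"] r by auto
  have r0: "r > 0" using r by simp
  note V = Lp_Vitali[OF prob_space_axioms weight_trunc_measurable Wm r0 C sub]
  show "(%N. Lp_int \<mu> r (%u. ?V N u - ?W u)) \<longlonglongrightarrow> 0" by (rule V(2))
  have "Lp_int \<mu> r ?W <= (\<E> u. 1 + enn (norm (?W u) powr (2 * r)))"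
   unfolding Lp_int_def
  proof (rule nn_integral_mono)
   fix u
   have "norm (?W u) powr r <= 1 + norm (?W u) powr (2 * r)"
   proof (cases "norm (?W u) <= 1")
    case True
    hence "norm (?W u) powr r <= 1 powr r" using r by (intro powr_mono2) auto
    thus ?thesis by (simp add: add_increasing2)
   next
    case False
    hence "norm (?W u) powr r <= norm (?W u) powr (2 * r)" using r by (intro powr_mono) auto
    thus ?thesis by simp
   qed
   hence "enn (norm (?W u) powr r) <= enn (1 + norm (?W u) powr (2 * r))" (is "?a <= _") by (rule ennreal_leI)
   also have "... = enn 1 + enn (norm (?W u) powr (2 * r))" by (rule ennreal_plus) auto
   also have "enn 1 = 1" by simp
   finally show "?a <= 1 + enn (norm (?W u) powr (2 * r))" .
  qed
  also have "... = 1 + Lp_int \<mu> (2 * r) ?W" unfolding Lp_int_def by (simp add: nn_integral_add emeasure_space_1)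
  also have "... <= 1 + enn C" using V(1) by (rule add_left_mono)
  also have "... < \<infinity>" by simp
  finally show "in_Lp \<mu> r ?W" by (simp add: in_Lp_def Lp_norm_finite_iff)
 qed
 show "(SUP N. Lp_norm \<mu> r (?V N)) < \<infinity>" if r: "r >= 1"
 proof -
  obtain C where C: "C >= 0" "\<And>N. Lp_int \<mu> r (?V N) <= enn C" using weight_Lp_bound[OF p K, of r] r by auto
  have "Lp_norm \<mu> r (?V N) <= enn (C powr (1 / r))" for N
   using C r by (subst Lp_norm_le_iff) (auto simp: powr_powr)
  hence "(SUP N. Lp_norm \<mu> r (?V N)) <= enn (C powr (1 / r))" by (intro SUP_least)
  thus ?thesis by (simp add: le_less_trans)
 qed
 show "tendsto_Lp \<mu> r ?V ?W" if r: "r >= 1"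
  unfolding tendsto_Lp_def using fin[OF r] conv[OF r] r by (subst Lp_norm_tendsto_0_iff) auto
 have Vi: "integrable \<mu> (?V N)" for N
  using fin[of 1 N] by (intro integrable_Lp_int_1) (auto simp: in_Lp_def Lp_norm_finite_iff)
 have Wi: "integrable \<mu> ?W"
  using conv(1)[of 1] by (intro integrable_Lp_int_1) (auto simp: in_Lp_def Lp_norm_finite_iff)
 have V0: "?V N u >= 0" for N u by (simp add: weight_trunc_eq)
 have W0: "?W u >= 0" for u by (simp add: weight_eq)
 have zN: "(\<integral>u. ?V N u \<partial>\<mu>) > 0" for N
  \<comment> \<open>The exponential factor is at least 1, so the weight dominates the indicator of
    the cutoff event.\<close>
  by (rule ge_indicator_integral_pos[OF Vi mass_cutoff_pos(1)[OF K, of N]]) (use p in \<open>simp add: weight_trunc_eq indicator_def\<close>)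
 have z: "(\<integral>u. ?W u \<partial>\<mu>) > 0"
  by (rule ge_indicator_integral_pos[OF Wi mass_cutoff_pos(2)[OF K X valid]]) (use p in \<open>simp add: weight_eq indicator_def\<close>)
 show "prob_space (gibbs_measure \<mu> (?V N))" by (rule gibbs_measure_density(4)[OF Vi V0 zN])
 show "prob_space (gibbs_measure \<mu> ?W)" by (rule gibbs_measure_density(4)[OF Wi W0 z])
 show "(%N. tv_dist (gibbs_measure \<mu> (?V N)) (gibbs_measure \<mu> ?W)) \<longlonglongrightarrow> 0"
  by (rule tv_dist_gibbs[OF Vi Wi V0 W0 zN z]) (rule conv(2), simp)
 show "absolutely_continuous \<mu> (gibbs_measure \<mu> ?W)"
  unfolding gibbs_measure_def by (rule absolutely_continuousI_density) measurable
qed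

end

section \<open>Divergence at and above the critical exponent\<close>

text \<open>Hoelder's inequality without its equality case: \<open>y\<^sup>2 \<le> l\<^sup>2 + l\<^bsup>2 - p\<^esup> y\<^sup>p\<close>, with \<open>l\<close> chosen so that the first term
 contributes half of the mass.\<close>

lemma concentrated_Lp_lower:
 fixes f :: "'b => complex"
 assumes f [measurable]: "f \<in> borel_measurable M" and B [measurable]: "B \<in> sets M"
  and V: "emeasure M B = enn V" "V > 0" and p: "p > 2" and i: "i > 0"
  and mass: "enn i <= (\<integral>\<^sup>+x. enn ((cmod (f x))^2) * indicator B x \<partial>M)"
 shows "enn (i / 2 * (i / (2 * V)) powr ((p - 2) / 2)) <= Lp_int M p f"
proof (cases "Lp_int M p f")
 case (real y)
 define l where "l = (i / (2 * V)) powr (1 / 2)"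
 have l: "l > 0" "l^2 = i / (2 * V)" using i V(2) by (auto simp: l_def powr_half_sqrt)
 have pt: "y^2 <= l^2 + l powr (2 - p) * y powr p" if y: "y >= 0" for y :: real
 proof (cases "y <= l")
  case True
  hence "y^2 <= l^2" using y by (intro power_mono)
  thus ?thesis by (simp add: add_increasing2)
 next
  case False
  hence "l powr (p - 2) <= y powr (p - 2)" using l p by (intro powr_mono2) auto
  hence "l powr (2 - p) * l powr (p - 2) * y^2 <= l powr (2 - p) * y powr (p - 2) * y^2" by (intro mult_right_mono mult_left_mono) auto
  moreover have "l powr (2 - p) * l powr (p - 2) = 1" using l by (simp add: powr_add[symmetric])
  moreover have "y powr (p - 2) * y^2 = y powr p" using False l y by (simp add: powr_diff powr_numeral)
  ultimately have "y^2 <= l powr (2 - p) * y powr p" by (simp add: mult.assoc)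
  thus ?thesis by (simp add: add_increasing)
 qed
 have "enn i <= (\<integral>\<^sup>+x. enn ((cmod (f x))^2) * indicator B x \<partial>M)" by (rule mass)
 also have "... <= (\<integral>\<^sup>+x. enn (l^2) * indicator B x + enn (l powr (2 - p)) * enn (norm (f x) powr p) \<partial>M)"
 proof (rule nn_integral_mono)
  fix x
  have "enn ((cmod (f x))^2) <= enn (l^2 + l powr (2 - p) * cmod (f x) powr p)" by (intro ennreal_leI pt) simp
  also have "... = enn (l^2) + enn (l powr (2 - p) * cmod (f x) powr p)" by (rule ennreal_plus) auto
  also have "enn (l powr (2 - p) * cmod (f x) powr p) = enn (l powr (2 - p)) * enn (norm (f x) powr p)" by (rule ennreal_mult) auto
  finally show "enn ((cmod (f x))^2) * indicator B x <= enn (l^2) * indicator B x + enn (l powr (2 - p)) * enn (norm (f x) powr p)"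
   by (simp add: indicator_def)
 qed
 also have "... = enn (l^2) * enn V + enn (l powr (2 - p)) * enn y"
  using real by (simp add: nn_integral_add nn_integral_cmult nn_integral_cmult_indicator V(1) Lp_int_def)
 also have "... = enn (l^2 * V + l powr (2 - p) * y)"
 proof -
  have "enn (l^2) * enn V = enn (l^2 * V)" using V by (intro ennreal_mult[symmetric]) auto
  moreover have "enn (l powr (2 - p)) * enn y = enn (l powr (2 - p) * y)" using real by (intro ennreal_mult[symmetric]) auto
  moreover have "enn (l^2 * V) + enn (l powr (2 - p) * y) = enn (l^2 * V + l powr (2 - p) * y)"
   using V real by (intro ennreal_plus[symmetric]) auto
  ultimately show ?thesis by (simp only:)
 qed
 finally have "i <= l^2 * V + l powr (2 - p) * y"
  using V real by (subst (asm) ennreal_le_iff) auto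
 hence "i / 2 <= l powr (2 - p) * y" using V(2) by (simp add: l)
 hence "i / 2 * l powr (p - 2) <= l powr (2 - p) * y * l powr (p - 2)" by (intro mult_right_mono) auto
 also have "... = y * (l powr (2 - p) * l powr (p - 2))" by (simp only: mult_ac)
 also have "l powr (2 - p) * l powr (p - 2) = 1" using l by (simp add: powr_add[symmetric])
 finally have "i / 2 * l powr (p - 2) <= y" by simp
 moreover have "l powr (p - 2) = (i / (2 * V)) powr ((p - 2) / 2)" by (simp add: l_def powr_powr)
 ultimately show ?thesis using real by (simp add: ennreal_leI)
qed simp

context radial_basis
begin

lemma emeasure_ball: "r >= 0 ==> emeasure lborel (cball (0::'a) r) = enn (unit_ball_vol (real D) * r ^ D)"
 by (simp add: emeasure_cball D_eq)

lemma bump_mass_integrals: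
 shows "integrable lborel (%x. (bump R x)^2)" "integrable lborel (%x. (bump R x - bump_sum R N x)^2)"
  "(\<I> x. (bump R x - bump_sum R N x)^2) = (\<I> x. (bump R x)^2) - (\<Sum>n\<le>N. (bump_coeff R n)^2)"
proof -
 have "Lp_int lborel 2 (bump R) < \<infinity>" using bump_in_Lp[of 2 R] by (simp add: in_Lp_def Lp_norm_finite_iff)
 thus b: "integrable lborel (%x. (bump R x)^2)"
  by (intro integrableI_nonneg) (auto simp: Lp_int_def powr_numeral)
 have bh: "integrable lborel (%x. bump R x * h n x)" for n
 proof (rule Bochner_Integration.integrable_bound)
  show "integrable lborel (%x. (bump R x)^2 + h n x * h n x)" using b h_prod_integrable[of n n] by simp
  show "(%x. bump R x * h n x) \<in> borel_measurable lborel" using h_measurable by measurable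
  show "AE x in lborel. norm (bump R x * h n x) <= norm ((bump R x)^2 + h n x * h n x)"
  proof (rule AE_I2)
   fix x
   have "0 <= (\<bar>bump R x\<bar> - \<bar>h n x\<bar>)^2" "0 <= \<bar>bump R x\<bar> * \<bar>h n x\<bar>" by auto
   hence "\<bar>bump R x\<bar> * \<bar>h n x\<bar> <= (bump R x)^2 + h n x * h n x"
    by (simp add: power2_eq_square algebra_simps) (simp add: abs_mult[symmetric] abs_mult_self_eq)
   thus "norm (bump R x * h n x) <= norm ((bump R x)^2 + h n x * h n x)" by (simp add: abs_mult)
  qed
 qed
 define c where "c n = complex_of_real (bump_coeff R n)" for n
 have fs: "(cmod (field {..N} c x))^2 = (bump_sum R N x)^2" for x
 proof -
  have "field {..N} c x = of_real (bump_sum R N x)" by (simp add: field_def bump_sum_def c_def)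
  thus ?thesis by simp
 qed
 have s: "integrable lborel (%x. (bump_sum R N x)^2)" "(\<I> x. (bump_sum R N x)^2) = (\<Sum>n\<le>N. (bump_coeff R n)^2)"
  using field_mass[of "{..N}" c] unfolding fs by (auto simp: c_def)
 have e: "bump R x * bump_sum R N x = (\<Sum>n\<le>N. bump_coeff R n * (bump R x * h n x))" for x
  by (simp add: bump_sum_def sum_distrib_left mult_ac)
 have x: "integrable lborel (%x. bump R x * bump_sum R N x)" unfolding e using bh by simp
 have xv: "(\<I> x. bump R x * bump_sum R N x) = (\<Sum>n\<le>N. (bump_coeff R n)^2)"
  unfolding e using bh by (simp add: bump_coeff_def power2_eq_square)
 have d: "(bump R x - bump_sum R N x)^2 = ((bump R x)^2 + (bump_sum R N x)^2) - 2 * (bump R x * bump_sum R N x)" for x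
  by (simp add: power2_eq_square algebra_simps)
 show "integrable lborel (%x. (bump R x - bump_sum R N x)^2)" unfolding d using b s(1) x by simp
 show "(\<I> x. (bump R x - bump_sum R N x)^2) = (\<I> x. (bump R x)^2) - (\<Sum>n\<le>N. (bump_coeff R n)^2)"
  unfolding d using b s x xv by simp
qed

text \<open>Frequencies above M have lam >= lam M, so the mass of the remainder is at most the
  energy divided by lam_M^2; the full mass is reached in the limit by completeness.\<close>

lemma bump_tail_mass:
 assumes R: "R > 0"
 shows "(\<I> x. (bump R x - bump_sum R M x)^2) <= om * (R ^ (D + 2) * (4 + R ^ 4)) / (lam M)^2"
proof -
 define b2 where "b2 = (\<I> x. (bump R x)^2)"
 define S where "S N = (\<Sum>n\<le>N. (bump_coeff R n)^2)" for N
 define E where "E = om * (R ^ (D + 2) * (4 + R ^ 4))"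
 have dN: "(\<L> x. enn ((bump R x - bump_sum R N x)^2)) = enn (b2 - S N)" for N
  using bump_mass_integrals(2,3)[of R N] by (simp add: nn_integral_eq_integral b2_def S_def)
 have nn: "b2 - S N >= 0" for N unfolding b2_def S_def bump_mass_integrals(3)[of R N, symmetric] by (intro integral_nonneg_AE) simp
 have "(%N. enn (b2 - S N)) \<longlonglongrightarrow> enn 0" using bump_L2[of R] unfolding dN by simp
 hence "(%N. b2 - S N) \<longlonglongrightarrow> 0" using nn by (subst (asm) tendsto_ennreal_iff) auto
 from tendsto_diff[OF tendsto_const[of b2] this] have S: "S \<longlonglongrightarrow> b2" by simp
 have l: "(lam M)^2 > 0" using lam_nz[of M] by simp
 have "b2 <= S M + E / (lam M)^2"
 proof (rule LIMSEQ_le_const2[OF S], intro exI[of _ M] allI impI)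
  fix N assume N: "M <= N"
  have "S N = S M + (\<Sum>n\<in>{M<..N}. (bump_coeff R n)^2)" unfolding S_def by (rule sum_atMost_split[OF N])
  also have "(\<Sum>n\<in>{M<..N}. (bump_coeff R n)^2) <= (\<Sum>n\<in>{M<..N}. (lam n)^2 * (bump_coeff R n)^2 / (lam M)^2)"
  proof (rule sum_mono)
   fix n assume "n \<in> {M<..N}"
   hence "(lam M)^2 <= (lam n)^2" by (simp add: lam_sq)
   hence "(lam M)^2 * (bump_coeff R n)^2 <= (lam n)^2 * (bump_coeff R n)^2" by (intro mult_right_mono) auto
   thus "(bump_coeff R n)^2 <= (lam n)^2 * (bump_coeff R n)^2 / (lam M)^2" using l by (simp add: pos_le_divide_eq mult.commute)
  qed
  also have "... = energy {M<..N} (bump_coeff R) / (lam M)^2" by (simp add: energy_def sum_divide_distrib)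
  also have "... <= E / (lam M)^2" unfolding E_def using l by (intro divide_right_mono bump_energy R) auto
  finally show "S N <= S M + E / (lam M)^2" by simp
 qed
 thus ?thesis unfolding bump_mass_integrals(3) b2_def S_def E_def by simp
qed

lemma bump_mass_lower:
 assumes R: "R > 0"
 shows "9 / 16 * R ^ 4 * (unit_ball_vol (real D) * (R / 2) ^ D) <= (\<I> x. (bump R x)^2)"
proof -
 have "enn (9 / 16 * R ^ 4 * (unit_ball_vol (real D) * (R / 2) ^ D)) = enn (9 / 16 * R ^ 4) * enn (unit_ball_vol (real D) * (R / 2) ^ D)"
  using R by (intro ennreal_mult) (auto intro: mult_nonneg_nonneg unit_ball_vol_nonneg)
 also have "... = (\<L> x. enn (9 / 16 * R ^ 4) * indicator (cball (0::'a) (R / 2)) x)"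
  using R by (subst nn_integral_cmult_indicator) (auto simp: emeasure_ball)
 also have "... <= (\<L> x. enn ((bump R (x::'a))^2))"
 proof (rule nn_integral_mono)
  fix x :: 'a
  show "enn (9 / 16 * R ^ 4) * indicator (cball (0::'a) (R / 2)) x <= enn ((bump R x)^2)"
  proof (cases "x \<in> cball 0 (R / 2)")
   case True
   hence "norm x <= R / 2" by simp
   hence "(norm x)^2 <= (R / 2)^2" by (intro power_mono) auto
   hence "3 / 4 * R^2 <= R^2 - (norm x)^2" by (simp add: power_divide)
   hence "3 / 4 * R^2 <= bump R x" unfolding bump_def by (rule max.coboundedI2)
   hence "(3 / 4 * R^2)^2 <= (bump R x)^2" by (intro power_mono) auto
   hence "9 / 16 * R ^ 4 <= (bump R x)^2" by (simp add: power_mult_distrib power_divide flip: power_mult)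
   thus ?thesis using True by (simp add: ennreal_leI)
  qed simp
 qed
 also have "... = enn (\<I> x. (bump R (x::'a))^2)" using bump_mass_integrals(1) by (intro nn_integral_eq_integral) auto
 finally show ?thesis by (subst (asm) ennreal_le_iff) (auto intro: integral_nonneg_AE)
qed

text \<open>The bump of radius \<open>R \<sim> 1/\<lambda>\<^sub>M\<close> is, up to a quarter of its mass, spanned by the first eigenfunctions.\<close>

lemma concentrated_profile:
 assumes p: "p > 2"
 obtains c M1 where "c > 0"
  "\<And>M m. [|M >= M1; m > 0|] ==> \<exists>a. (\<Sum>n\<le>M. (cmod (a n))^2) = m \<and>
    enn (c * m powr (p / 2) * lam M powr (real D * (p - 2) / 2)) <= Lp_int lborel p (field {..M} a)"
proof -
 define v where "v = unit_ball_vol (real D)"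
 have v: "v > 0" unfolding v_def by (rule unit_ball_vol_pos) simp
 have D0: "real D > 0" using dim by simp
 have om: "om = real D * v" by (simp add: om_eq sphere_vol_def v_def D_eq)
 \<comment> \<open>Chosen so that the remainder has mass at most 5/36 q while the bump has at least
   9/16 q, which leaves the remainder less than a quarter. It is also at least the square of the
   ratio R lam M, so that R <= 1.\<close>
 define M1 where "M1 = 36 * D * 2 ^ D"
 define ka where "ka = sqrt (real M1)"
 have M1: "real M1 > 0" using dim by (simp add: M1_def)
 have ka: "ka > 0" "ka^2 = real M1" using M1 by (auto simp: ka_def)
 define c where "c = (1 / 8) powr (p / 2) * (v * ka ^ D) powr (- ((p - 2) / 2))"
 have c: "c > 0" using v ka by (simp add: c_def)
 show ?thesis
 proof (rule that[OF c])
  fix M :: nat and m :: real assume M: "M >= M1" and m: "m > 0"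
  have l: "lam M > 0" using lam_ge(2)[of M] by simp
  have "ka <= sqrt (real M)" using M by (simp add: ka_def)
  also have "... <= lam M" by (simp add: ho_freq_def)
  finally have kal: "ka <= lam M" .
  define R where "R = ka / lam M"
  have R: "R > 0" "R <= 1" using ka l kal by (auto simp: R_def)
  define b2 where "b2 = (\<integral>x. (bump R x)^2 \<partial>(lborel :: 'a measure))"
  define d where "d = (\<I> x. (bump R x - bump_sum R M x)^2)"
  define S where "S = (\<Sum>n\<le>M. (bump_coeff R n)^2)"
  define q where "q = v * R ^ (D + 4) / 2 ^ D"
  have q: "q > 0" using v R by (simp add: q_def)
  have b2: "9 / 16 * q <= b2"
  proof -
   have "9 / 16 * q = 9 / 16 * R ^ 4 * (v * (R / 2) ^ D)" by (simp add: q_def power_add power_divide)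
   thus ?thesis using bump_mass_lower[OF R(1)] by (simp add: b2_def v_def)
  qed
  have d: "d <= 5 / 36 * q"
  proof -
   have "d <= om * (R ^ (D + 2) * (4 + R ^ 4)) / (lam M)^2" unfolding d_def by (rule bump_tail_mass[OF R(1)])
   also have "... <= om * (R ^ (D + 2) * 5) / (lam M)^2"
    using R power_le_one[of R 4] om_pos by (intro divide_right_mono mult_left_mono) auto
   also have "... = om * (R ^ (D + 2) * 5) * (R^2 / real M1)"
    using l ka M1 by (simp add: R_def power_divide)
   also have "... = 5 / 36 * q"
    using D0 by (simp add: om M1_def q_def power_add power2_eq_square power4_eq_xxxx)
   finally show ?thesis .
  qed
  have S: "S = b2 - d" unfolding S_def b2_def d_def bump_mass_integrals(3) by simp
  have d0: "d >= 0" unfolding d_def by (intro integral_nonneg_AE) simp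
  have SS: "S > 0" "S <= b2" "d <= b2 / 4" using S b2 d q d0 by auto
  define B where "B = cball (0::'a) R"
  have bsi: "integrable lborel (%x. (bump_sum R M x)^2)"
  proof (rule Bochner_Integration.integrable_bound)
   show "integrable lborel (%x. 2 * (bump R x)^2 + 2 * (bump R x - bump_sum R M x)^2)"
    using bump_mass_integrals(1,2) by simp
   show "AE x in lborel. norm ((bump_sum R M x)^2) <= norm (2 * (bump R x)^2 + 2 * (bump R x - bump_sum R M x)^2)"
   proof (rule AE_I2)
    fix x
    have "0 <= (2 * bump R x - bump_sum R M x)^2" by simp
    thus "norm ((bump_sum R M x)^2) <= norm (2 * (bump R x)^2 + 2 * (bump R x - bump_sum R M x)^2)"
     by (simp add: power2_eq_square algebra_simps)
   qed
  qed simp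
  define J where "J = (\<I> x. (bump_sum R M x)^2 * indicator B x)"
  have Ji: "integrable lborel (%x. (bump_sum R M x)^2 * indicator B x)"
   by (intro integrable_real_mult_indicator bsi) (simp add: B_def)
  \<comment> \<open>The bump is supported in B. From b^2 <= 2 s^2 + 2 (b-s)^2 and the small
    remainder, the partial sum keeps at least a quarter of the mass inside B.\<close>
  have "b2 <= (\<I> x. 2 * ((bump_sum R M x)^2 * indicator B x) + 2 * (bump R x - bump_sum R M x)^2)"
   unfolding b2_def
  proof (rule integral_mono)
   show "integrable lborel (%x. 2 * ((bump_sum R M x)^2 * indicator B x) + 2 * (bump R x - bump_sum R M x)^2)"
    using Ji bump_mass_integrals(2) by simp
   fix x :: 'a
   show "(bump R x)^2 <= 2 * ((bump_sum R M x)^2 * indicator B x) + 2 * (bump R x - bump_sum R M x)^2"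
   proof (cases "x \<in> B")
    case True
    have "0 <= (bump R x - 2 * bump_sum R M x)^2" by simp
    thus ?thesis using True by (simp add: power2_eq_square algebra_simps)
   next
    case False
    hence "bump R x = 0" using bump_bound(3)[of x R] R by (simp add: B_def)
    thus ?thesis using False by simp
   qed
  qed (rule bump_mass_integrals(1))
  also have "... = 2 * J + 2 * d" using Ji bump_mass_integrals(2)[of R M] by (simp add: J_def d_def)
  finally have J: "b2 / 4 <= J" using SS(3) by simp
  \<comment> \<open>Rescaling by sqrt (m/S) prescribes the mass exactly. A quarter of m on a ball of
    volume of order lam_M^(-D) then forces the stated L^p size.\<close>
  define a where "a n = complex_of_real (sqrt (m / S) * bump_coeff R n)" for n
  have rt: "(sqrt (m / S))^2 = m / S" using m SS by simp
  have "(\<Sum>n\<le>M. (cmod (a n))^2) = (\<Sum>n\<le>M. m / S * (bump_coeff R n)^2)" (is "?a = _")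
   unfolding a_def norm_of_real power2_abs power_mult_distrib rt ..
  also have "... = m / S * S" unfolding S_def by (rule sum_distrib_left[symmetric])
  also have "... = m" using SS(1) by simp
  finally have mass: "?a = m" .
  have fa: "(cmod (field {..M} a x))^2 = m / S * (bump_sum R M x)^2" for x
  proof -
   have "field {..M} a x = of_real (sqrt (m / S) * bump_sum R M x)"
    by (simp add: field_def a_def bump_sum_def sum_distrib_left mult.assoc)
   thus ?thesis unfolding norm_of_real power2_abs power_mult_distrib rt by (simp only: norm_of_real power2_abs power_mult_distrib rt)
  qed
  have "enn (m / 4) <= enn (m / S * J)"
  proof (rule ennreal_leI)
   have "m / S * (S / 4) <= m / S * J" using J SS m by (intro mult_left_mono) auto
   thus "m / 4 <= m / S * J" using SS(1) by simp
  qed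
  also have "... = (\<L> x. enn (m / S * ((bump_sum R M x)^2 * indicator B x)))"
  proof -
   have "(\<L> x. enn (m / S * ((bump_sum R M x)^2 * indicator B x))) = enn (\<I> x. m / S * ((bump_sum R M x)^2 * indicator B x))"
    using Ji m SS(1) by (intro nn_integral_eq_integral integrable_mult_right) auto
   thus ?thesis by (simp add: J_def)
  qed
  also have "... = (\<L> x. enn ((cmod (field {..M} a x))^2) * indicator B x)"
   unfolding fa by (intro nn_integral_cong) (simp add: indicator_def)
  finally have fm: "enn (m / 4) <= ..." .
  have V: "emeasure lborel B = enn (v * R ^ D)" "v * R ^ D > 0"
   using R v by (auto simp: B_def v_def emeasure_ball)
  have "enn (m / 4 / 2 * (m / 4 / (2 * (v * R ^ D))) powr ((p - 2) / 2)) <= Lp_int lborel p (field {..M} a)"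
   by (rule concentrated_Lp_lower[OF _ _ V p _ fm]) (use m in \<open>auto simp: B_def\<close>)
  also have "m / 4 / 2 * (m / 4 / (2 * (v * R ^ D))) powr ((p - 2) / 2) = c * m powr (p / 2) * lam M powr (real D * (p - 2) / 2)"
  proof -
   have e1: "m / 4 / (2 * (v * R ^ D)) = (1 / 8 * m) * ((1 / (v * ka ^ D)) * lam M ^ D)"
    using l v ka by (simp add: R_def power_divide)
   have e2: "(lam M ^ D) powr ((p - 2) / 2) = lam M powr (real D * (p - 2) / 2)"
    using l by (simp add: powr_realpow[symmetric] powr_powr)
   have e3: "(1 / (v * ka ^ D)) powr ((p - 2) / 2) = (v * ka ^ D) powr (- ((p - 2) / 2))"
    using v ka by (simp add: powr_minus_divide powr_divide)
   have e4: "m / 4 / 2 * (1 / 8 * m) powr ((p - 2) / 2) = (1 / 8 * m) powr (p / 2)"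
   proof -
    have "(1 / 8 * m) powr (p / 2) = (1 / 8 * m) powr (1 + (p - 2) / 2)" by (simp add: field_simps)
    also have "... = (1 / 8 * m) powr 1 * (1 / 8 * m) powr ((p - 2) / 2)" by (rule powr_add)
    finally show ?thesis using m by simp
   qed
   have "m / 4 / 2 * (m / 4 / (2 * (v * R ^ D))) powr ((p - 2) / 2)
     = (m / 4 / 2 * (1 / 8 * m) powr ((p - 2) / 2)) * ((1 / (v * ka ^ D)) powr ((p - 2) / 2) * (lam M ^ D) powr ((p - 2) / 2))"
    unfolding e1 powr_mult by (simp only: mult.assoc)
   also have "... = (1 / 8 * m) powr (p / 2) * ((v * ka ^ D) powr (- ((p - 2) / 2)) * lam M powr (real D * (p - 2) / 2))"
    by (simp only: e2 e3 e4)
   also have "... = c * m powr (p / 2) * lam M powr (real D * (p - 2) / 2)"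
    unfolding c_def powr_mult by (simp only: mult_ac)
   finally show ?thesis .
  qed
  finally show "\<exists>a. (\<Sum>n\<le>M. (cmod (a n))^2) = m \<and>
    enn (c * m powr (p / 2) * lam M powr (real D * (p - 2) / 2)) <= Lp_int lborel p (field {..M} a)"
   using mass by blast
 qed
qed

end

context gibbs
begin

text \<open>The covariance estimate applied to the single frequency n with Lm = 1, since |h_n|^2 =
  lam_n^2 times that covariance. The bound is crude, but only a polynomial loss matters for the
  perturbation of the profile.\<close>

lemma h_norm_bound:
 assumes p: "valid p"
 obtains C where "C > 0" "\<And>n. enn2real (Lp_norm lborel p (h n)) <= C * lam n"
proof -
 have p0: "p > 0" using p by (simp add: valid_def)
 obtain a where a: "admissible p a" using valid_admissible[OF p] .
 obtain C where C: "C > 0" "\<And>I Lm. [|finite I; Lm > 0; \<And>n. n \<in> I ==> Lm <= lam n|] ==>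
    (\<L> x. enn (kern I x powr (p / 2))) <= enn (C * Lm powr (- (a * p / 2)))"
  using kern_integral[OF a] by blast
 show ?thesis
 proof (rule that[of "C powr (1 / p)"])
  show "C powr (1 / p) > 0" using C(1) by simp
  fix n
  have l: "lam n > 0" using lam0_ge1[of n] by simp
  have e: "norm (h n x) powr p = lam n powr p * kern {n} x powr (p / 2)" for x
  proof -
   have "kern {n} x = (\<bar>h n x\<bar> / lam n)^2" by (simp add: kern_def power_divide)
   moreover have "((\<bar>h n x\<bar> / lam n)^2) powr (p / 2) = (\<bar>h n x\<bar> / lam n) powr p"
   proof (cases "h n x = 0")
    case False
    hence "(\<bar>h n x\<bar> / lam n)^2 = (\<bar>h n x\<bar> / lam n) powr 2" using l by (simp add: powr_numeral)
    hence "((\<bar>h n x\<bar> / lam n)^2) powr (p / 2) = (\<bar>h n x\<bar> / lam n) powr (2 * (p / 2))" by (simp only: powr_powr)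
    thus ?thesis by simp
   qed simp
   ultimately show ?thesis using l by (simp add: powr_divide)
  qed
  have "Lp_int lborel p (h n) = enn (lam n powr p) * (\<L> x. enn (kern {n} x powr (p / 2)))"
   unfolding Lp_int_def e by (simp add: ennreal_mult nn_integral_cmult)
  also have "... <= enn (lam n powr p) * enn (C * 1 powr (- (a * p / 2)))"
   using lam0_ge1 by (intro mult_left_mono C(2)) auto
  also have "... = enn (lam n powr p) * enn C" by simp
  also have "... = enn (lam n powr p * C)" using C(1) by (intro ennreal_mult[symmetric]) auto
  also have "lam n powr p * C = (C powr (1 / p) * lam n) powr p" using C(1) p0 l by (simp add: powr_mult powr_powr)
  finally have "Lp_norm lborel p (h n) <= enn (C powr (1 / p) * lam n)"
   using l by (subst Lp_norm_le_iff[OF p0]) auto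
  thus "enn2real (Lp_norm lborel p (h n)) <= C powr (1 / p) * lam n"
   using l by (intro enn2real_leI) auto
 qed
qed

lemma nrm_perturb:
 assumes p: "p >= 1" and C: "C >= 0" "\<And>n. enn2real (Lp_norm lborel p (h n)) <= C * lam n"
  and u: "u \<in> cyl M a ep" and ep: "ep >= 0"
 shows "nrm p {..M} a - nrm p {..M} u <= (real M + 1) * (ep * (C * lam M))"
proof -
 have d: "(%x. field {..M} a x - field {..M} u x) = field {..M} (%n. a n - u n)"
  by (rule ext) (simp add: field_def sum_subtractf left_diff_distrib)
 have fin: "in_Lp lborel p (field {..M} w)" for w using p by (intro field_in_Lp) auto
 have "nrm p {..M} a - nrm p {..M} u <= \<bar>nrm p {..M} a - nrm p {..M} u\<bar>" by simp
 also have "... <= enn2real (Lp_norm lborel p (%x. field {..M} a x - field {..M} u x))"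
  unfolding nrm_def using fin[of u] fin[of "%n. a n - u n"] p
  by (intro Lp_norm_triangle_real(2)) (auto simp: in_Lp_def d)
 also have "... <= (\<Sum>n\<le>M. cmod (a n - u n) * enn2real (Lp_norm lborel p (h n)))"
  unfolding d using Lp_norm_field_le[of "{..M}" p "%n. a n - u n"] p
  by (intro enn2real_leI sum_nonneg) auto
 also have "... <= (\<Sum>n\<le>M. ep * (C * lam M))"
 proof (rule sum_mono)
  fix n assume n: "n \<in> {..M}"
  have "cmod (a n - u n) <= ep" using u n by (simp add: cyl_def norm_minus_commute)
  moreover have "C * lam n <= C * lam M" using lam_mono[of n M] n C(1) by (intro mult_left_mono) auto
  ultimately show "cmod (a n - u n) * enn2real (Lp_norm lborel p (h n)) <= ep * (C * lam M)"
   using C(2)[of n] ep by (intro mult_mono) auto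
 qed
 also have "... = (real M + 1) * (ep * (C * lam M))" by simp
 finally show ?thesis .
qed

text \<open>Comparison with the harmonic series. In this direction it allows every logarithm of M to
  be paid for by a multiple of the mass.\<close>

lemma mass_divergence: "ln (real M + 1) <= (4 + real D) * (\<Sum>n\<le>M. 1 / (lam n)^2)"
proof -
 have "ln (real M + 1) <= harm (Suc M)"
  using ln_le_harm[of "Suc M"] by (smt (verit) ln_le_cancel_iff of_nat_0_le_iff of_nat_Suc)
 also have "harm (Suc M) = (\<Sum>n\<le>M. 1 / (real n + 1))"
  by (induction M) (simp_all add: harm_Suc harm_expand inverse_eq_divide add.commute)
 also have "... <= (\<Sum>n\<le>M. (4 + real D) * (1 / (lam n)^2))"
 proof (rule sum_mono)
  fix n
  have "(lam n)^2 <= (4 + real D) * (real n + 1)" by (simp add: lam_sq algebra_simps)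
  moreover have "(lam n)^2 > 0" using lam_nz[of n] by simp
  ultimately show "1 / (real n + 1) <= (4 + real D) * (1 / (lam n)^2)" by (simp add: field_simps)
 qed
 also have "... = (4 + real D) * (\<Sum>n\<le>M. 1 / (lam n)^2)" by (rule sum_distrib_left[symmetric])
 finally show ?thesis .
qed

text \<open>The Gaussian cost splits into a part for the radius, with 2 ln ep - 2 for each
  coordinate, and a part for the centre, at most 2 lam_M^2 times its mass, by (x+z)^2 <= 2x^2 +
  2z^2.\<close>

lemma cyl_lower:
 assumes ep: "ep > 0" "lam M * ep <= 1"
 shows "enn (exp ((real M + 1) * (2 * ln ep - 2) - 2 * (lam M)^2 * (\<Sum>n\<le>M. (cmod (a n))^2))) <= emeasure \<mu> (cyl M a ep)"
proof -
 have "exp ((real M + 1) * (2 * ln ep - 2) - 2 * (lam M)^2 * (\<Sum>n\<le>M. (cmod (a n))^2))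
   = exp (\<Sum>n\<in>{..M}. (2 * ln ep - 2) - 2 * (lam M)^2 * (cmod (a n))^2)"
  by (simp add: sum_subtractf sum_distrib_left)
 also have "... = (\<Prod>n\<in>{..M}. exp ((2 * ln ep - 2) - 2 * (lam M)^2 * (cmod (a n))^2))" by (rule exp_sum) simp
 also have "... <= (\<Prod>n\<in>{..M}. (lam n * ep)^2 * exp (- (lam n * cmod (a n) + lam n * ep)\<^sup>2))"
 proof (intro prod_mono conjI)
  fix n assume n: "n \<in> {..M}"
  have ln: "1 <= lam n" "lam n <= lam M" using lam0_ge1 lam_mono[of n M] n by auto
  have "lam n * ep <= lam M * ep" using ln ep by (intro mult_right_mono) auto
  hence y: "0 <= lam n * ep" "lam n * ep <= 1" using ln(1) ep by (simp, linarith)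
  define x where "x = lam n * cmod (a n)"
  define z where "z = lam n * ep"
  have "0 <= (x - z)^2" by simp
  hence "(x + z)^2 <= 2 * x^2 + 2 * z^2" by (simp add: power2_eq_square algebra_simps)
  moreover have "z^2 <= 1" using y by (simp add: z_def power_le_one)
  moreover have "x^2 <= (lam M)^2 * (cmod (a n))^2"
   unfolding x_def power_mult_distrib using ln by (intro mult_right_mono power_mono) auto
  ultimately have e: "(x + z)^2 <= 2 * (lam M)^2 * (cmod (a n))^2 + 2" by linarith
  have "exp ((2 * ln ep - 2) - 2 * (lam M)^2 * (cmod (a n))^2) <= exp (2 * ln ep + - (x + z)\<^sup>2)" (is "?a <= _") using e by simp
  also have "... = exp (2 * ln ep) * exp (- (x + z)\<^sup>2)" by (rule exp_add)
  also have "exp (2 * ln ep) = ep^2" using ep by (simp add: exp_double)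
  also have "ep^2 * exp (- (x + z)\<^sup>2) <= z^2 * exp (- (x + z)\<^sup>2)"
   using ln ep mult_right_mono[OF ln(1), of ep] by (intro mult_right_mono power_mono) (auto simp: z_def)
  finally show "?a <= (lam n * ep)^2 * exp (- (lam n * cmod (a n) + lam n * ep)\<^sup>2)"
   by (simp add: x_def z_def)
 qed simp
 finally have "enn (exp ((real M + 1) * (2 * ln ep - 2) - 2 * (lam M)^2 * (\<Sum>n\<le>M. (cmod (a n))^2)))
   <= enn (\<Prod>n\<in>{..M}. (lam n * ep)^2 * exp (- (lam n * cmod (a n) + lam n * ep)\<^sup>2))" by (rule ennreal_leI)
 also have "... <= emeasure \<mu> (cyl M a ep)"
  using small_ball[OF ep(1), of "{..M}" a] by (simp add: cyl_def space_\<mu>)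
 finally show ?thesis .
qed

text \<open>The factor 2 in the hypothesis is the loss in \<open>ball_typical\<close>; it reappears
  as the 1/2 in the conclusion and is negligible beside the exponentials.\<close>

lemma partition_lower:
 fixes W :: "_ => real"
 assumes G: "G \<in> sets \<mu>" and W: "\<And>u. u \<in> G ==> exp w <= W u" and P: "enn (exp e) <= 2 * emeasure \<mu> G"
 shows "enn (exp (w + e) / 2) <= partition_fun \<mu> W"
proof -
 have "enn (exp (w + e) / 2) = enn (exp w / 2) * enn (exp e)" by (simp add: exp_add ennreal_mult[symmetric])
 also have "... <= enn (exp w / 2) * (2 * emeasure \<mu> G)" by (rule mult_left_mono[OF P]) simp
 also have "... = (enn (exp w / 2) * 2) * emeasure \<mu> G" by (simp only: mult.assoc)
 also have "enn (exp w / 2) * 2 = enn (exp w)"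
  using ennreal_mult[of "exp w / 2" 2] by simp
 also have "enn (exp w) * emeasure \<mu> G = (\<E> u. enn (exp w) * indicator G u)"
  using G by (simp add: nn_integral_cmult_indicator)
 also have "... <= (\<E> u. enn (W u))"
  by (intro nn_integral_mono) (auto simp: indicator_def intro!: ennreal_leI W)
 finally show ?thesis by (simp add: partition_fun_def)
qed

text \<open>A single event bounds both weights from below: on it the truncated and the limiting
  quantities satisfy the cutoff and have norm at least half of that of the profile. The gain is of
  order T m^(p/2) with T = M + 1, the cost only of order T m.\<close>

lemma supercritical:
 assumes p: "valid p" "p >= 2 + 4 / real D" and K: "K > 0" and X: "tendsto_Lp \<mu> 2 (%N. wick {..N}) X"
 shows "\<exists>M. enn B <= partition_fun \<mu> (gibbs_weight_trunc h \<mu> K p M) \<and> enn B <= partition_fun \<mu> (gibbs_weight h X K p)"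
proof -
 have p2: "p > 2" "p >= 1" "p > 0" using p(1) by (auto simp: valid_def)
 note [measurable] = mass_limit_D(1)[OF X]
 have rm [measurable]: "rnd p \<in> borel_measurable \<mu>" using p2 by (intro rnd_measurable) simp
 obtain c M1 where c: "c > 0" and prof: "\<And>M m. [|M >= M1; m > 0|] ==> \<exists>a. (\<Sum>n\<le>M. (cmod (a n))^2) = m \<and>
    enn (c * m powr (p / 2) * lam M powr (real D * (p - 2) / 2)) <= Lp_int lborel p (field {..M} a)"
  using concentrated_profile[OF p2(1)] by blast
 obtain C where C: "C > 0" "\<And>n. enn2real (Lp_norm lborel p (h n)) <= C * lam n" using h_norm_bound[OF p(1)] by blast
 obtain M0 where typical: "\<And>M A. [|M >= M0; A \<in> sets \<mu>; \<And>u. cut {..M} u \<in> A \<longleftrightarrow> u \<in> A|] ==>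
   emeasure \<mu> A <= 2 * emeasure \<mu> {u \<in> A. \<bar>X u - wick {..M} u\<bar> <= K / 2 \<and> \<bar>rnd p u - nrm p {..M} u\<bar> <= 1}"
  using ball_typical[OF p(1) X K] by blast
 define d where "d = 4 + real D"
 \<comment> \<open>The entries serve, in order, ep <= 1, the cutoff at K/2, a change of the norm by
   at most 1, and lam M * ep <= 1 in \<open>cyl_lower\<close>.\<close>
 define e0 where "e0 = min (min 1 (K / 10)) (min (1 / (C * d)) (1 / d))"
 have d: "d >= 4" by (simp add: d_def)
 have e0: "e0 > 0" "e0 <= 1" "e0 <= K / 10" "e0 * (C * d) <= 1" "e0 * d <= 1"
 proof -
  have Cd: "C * d > 0" using C d by simp
  show "e0 > 0" using K Cd d by (simp add: e0_def)
  have "e0 <= 1 / (C * d)" "e0 <= 1 / d" by (auto simp: e0_def)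
  thus "e0 * (C * d) <= 1" "e0 * d <= 1" using Cd d by (simp_all only: pos_le_divide_eq)
 qed (auto simp: e0_def)
 define c' where "c' = c * (1 / 2) powr p / p"
 have c': "c' > 0" using c p2 by (simp add: c'_def)
 \<comment> \<open>Of the 8d, six come from the radius T^(-3), since -2 ln ep contains 6 ln T <= 6 d
   m, and two from the centre. The rest pays for the constants and leaves a surplus of at least
   m.\<close>
 define Q where "Q = 8 * d + 3 + 2 * \<bar>ln e0\<bar>"
 have Q: "Q >= 1" using d by (simp add: Q_def)
 define s where "s = p / 2 - 1"
 have s: "s > 0" using p2 by (simp add: s_def)
 define mm where "mm M = (\<Sum>n\<le>M. 1 / (lam n)^2)" for M
 \<comment> \<open>A mass above m0 gives a profile norm of at least 4, gain above cost in the form Q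
   m <= c' m^(p/2), and finally the prescribed lower bound B.\<close>
 define m0 where "m0 = max (max 1 (2 powr p)) (max ((Q / c') powr (1 / s)) (2 * \<bar>B\<bar>))"
 have "filterlim (%M. ln (real M + 1)) at_top sequentially"
  by (rule filterlim_compose[OF ln_at_top]) (rule filterlim_at_top_mono[OF filterlim_real_sequentially], simp)
 hence "\<forall>\<^sub>F M in sequentially. d * m0 <= ln (real M + 1)" by (simp add: filterlim_at_top)
 hence "\<forall>\<^sub>F M in sequentially. d * m0 <= ln (real M + 1) \<and> M0 <= M \<and> M1 <= M"
  using eventually_ge_at_top[of M0] eventually_ge_at_top[of M1] by eventually_elim simp
 then obtain M where M: "d * m0 <= ln (real M + 1)" "M0 <= M" "M1 <= M" by (auto simp: eventually_sequentially)
 define m where "m = mm M"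
 define T where "T = real M + 1"
 have T: "T >= 1" by (simp add: T_def)
 have lnT: "ln T <= d * m" using mass_divergence[of M] by (simp add: T_def d_def m_def mm_def)
 have "d * m0 <= d * m" using M(1) lnT by (simp add: T_def)
 hence mm0: "m0 <= m" using d by simp
 hence m: "m >= 1" "m >= 2 powr p" "m >= (Q / c') powr (1 / s)" "m >= 2 * B" by (auto simp: m0_def)
 have ms: "Q * m <= c' * m powr (p / 2)"
 proof -
  have "((Q / c') powr (1 / s)) powr s <= m powr s" using m s by (intro powr_mono2) auto
  hence "Q / c' <= m powr s" using s Q c' by (simp add: powr_powr)
  hence "Q <= c' * m powr s" using c' by (simp add: field_simps)
  hence "Q * m <= c' * m powr s * m" using m by (intro mult_right_mono) auto
  also have "... = c' * (m powr s * m powr 1)" using m by simp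
  also have "m powr s * m powr 1 = m powr (p / 2)" by (simp only: powr_add[symmetric] s_def) simp
  finally show ?thesis .
 qed
 have l2: "(lam M)^2 <= d * T" "T <= (lam M)^2" using dim by (auto simp: lam_sq d_def T_def algebra_simps)
 have l1: "lam M >= 1" by (rule lam0_ge1)
 have ld: "lam M <= d * T"
 proof -
  have "lam M * 1 <= lam M * lam M" using l1 by (intro mult_left_mono) auto
  thus ?thesis using l2 by (simp add: power2_eq_square)
 qed
 obtain a where a: "(\<Sum>n\<le>M. (cmod (a n))^2) = m"
  "enn (c * m powr (p / 2) * lam M powr (real D * (p - 2) / 2)) <= Lp_int lborel p (field {..M} a)"
  using prof[OF M(3), of m] m by auto
 \<comment> \<open>This is where criticality enters: D (p-2) / 2 >= 2 makes the concentration factor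
   at least lam_M^2, which is at least T. At p = 2 + 4/D nothing is gained beyond that, and the
   power of m decides.\<close>
 have na: "c * m powr (p / 2) * T <= nrm p {..M} a powr p"
 proof -
  have "real D * (p - 2) >= real D * (4 / real D)" using p(2) by (intro mult_left_mono) auto
  hence "2 <= real D * (p - 2) / 2" using dim by simp
  hence "lam M powr 2 <= lam M powr (real D * (p - 2) / 2)" using l1 by (intro powr_mono) auto
  moreover have "lam M powr 2 = (lam M)^2" using l1 by (simp add: powr_numeral)
  ultimately have "T <= lam M powr (real D * (p - 2) / 2)" using l2 by linarith
  hence "c * m powr (p / 2) * T <= c * m powr (p / 2) * lam M powr (real D * (p - 2) / 2)" using c by (intro mult_left_mono) auto
  also have "... <= nrm p {..M} a powr p"
   using a(2) p2 by (subst (asm) Lp_int_field_nrm) (auto simp: ennreal_le_iff)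
  finally show ?thesis .
 qed
 have cc: "c * m powr (p / 2) = c' * m powr (p / 2) * (p * 2 powr p)" using p2 by (simp add: c'_def powr_divide)
 \<comment> \<open>The norm may drop by 1 in passing to a point of the cylinder and by 1 more in
   passing to the limit; starting from at least 4, half of it remains.\<close>
 have n4: "nrm p {..M} a >= 4"
 proof (rule ccontr)
  assume "\<not> nrm p {..M} a >= 4"
  hence lt: "nrm p {..M} a powr p < 4 powr p" using p2 by (intro powr_less_mono2) auto
  have "2 powr p * 2 powr p = (2 * 2) powr p" by (rule powr_mult[symmetric])
  hence f: "4 powr p = 2 powr p * 2 powr p" by simp
  have "1 * m <= Q * m" using Q m by (intro mult_right_mono) auto
  hence "2 powr p <= c' * m powr (p / 2)" using m ms by linarith
  hence "2 powr p * (1 * 2 powr p) <= c' * m powr (p / 2) * (p * 2 powr p)" using p2 c' by (intro mult_mono) auto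
  hence "4 powr p <= c * m powr (p / 2)" by (simp only: cc f mult_1)
  also have "... <= c * m powr (p / 2) * T" using mult_left_mono[OF T, of "c * m powr (p / 2)"] c by simp
  finally show False using na lt by linarith
 qed
 \<comment> \<open>A polynomially small radius beats all polynomial losses in M, yet costs only a
   logarithm per coordinate, which is bounded by a multiple of the mass.\<close>
 define ep where "ep = e0 / T ^ 3"
 have ep: "ep > 0" using e0 T by (simp add: ep_def)
 have epT: "ep * (T * T) <= e0" "ep * T <= e0" "ep <= e0"
 proof -
  have t: "1 <= T * T" using T mult_mono[of 1 T 1 T] by simp
  have e: "ep * (T * T) * T = e0" using T by (simp add: ep_def power3_eq_cube)
  have nn: "0 <= ep * (T * T)" using ep T by simp
  show 1: "ep * (T * T) <= e0" using mult_left_mono[OF T nn] e by simp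
  have "ep * T <= ep * T * T" using mult_left_mono[OF T, of "ep * T"] T ep by simp
  thus 2: "ep * T <= e0" using 1 by (simp add: mult.assoc)
  have "ep <= ep * T" using mult_left_mono[OF T, of ep] ep by simp
  thus "ep <= e0" using 2 by simp
 qed
 have ep1: "ep <= 1" using epT e0 by linarith
 have epK: "ep * ((real M + 1) * (2 * real M + 5)) <= K / 2"
 proof -
  have "(real M + 1) * (2 * real M + 5) <= T * (5 * T)" unfolding T_def by (intro mult_mono) auto
  hence "ep * ((real M + 1) * (2 * real M + 5)) <= ep * (T * (5 * T))" using ep by (intro mult_left_mono) auto
  also have "... = 5 * (ep * (T * T))" by (simp only: mult_ac)
  also have "... <= K / 2" using epT(1) e0(3) by linarith
  finally show ?thesis .
 qed
 have lep: "lam M * ep <= 1"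
 proof -
  have "lam M * ep <= d * T * ep" using ld ep by (intro mult_right_mono) auto
  also have "... = d * (ep * T)" by (simp only: mult_ac)
  also have "... <= d * e0" using epT d by (intro mult_left_mono) auto
  finally show ?thesis using e0(5) by (simp add: mult.commute)
 qed
 have pert: "(real M + 1) * (ep * (C * lam M)) <= 1"
 proof -
  have "(real M + 1) * (ep * (C * lam M)) <= T * (ep * (C * (d * T)))"
   unfolding T_def[symmetric] using ld ep C T by (intro mult_left_mono) auto
  also have "... = (ep * (T * T)) * (C * d)" by (simp only: mult_ac)
  also have "... <= e0 * (C * d)" using epT C d by (intro mult_right_mono) auto
  finally show ?thesis using e0(4) by linarith
 qed
 define w where "w = 1 / p * (nrm p {..M} a / 2) powr p"
 define e where "e = (real M + 1) * (2 * ln ep - 2) - 2 * (lam M)^2 * (\<Sum>n\<le>M. (cmod (a n))^2)"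
 define G where "G = {u \<in> cyl M a ep. \<bar>X u - wick {..M} u\<bar> <= K / 2 \<and> \<bar>rnd p u - nrm p {..M} u\<bar> <= 1}"
 have "G = cyl M a ep \<inter> {u \<in> space \<mu>. \<bar>X u - wick {..M} u\<bar> <= K / 2 \<and> \<bar>rnd p u - nrm p {..M} u\<bar> <= 1}"
  by (auto simp: G_def space_\<mu>)
 hence Gm: "G \<in> sets \<mu>" by simp
 have GP: "enn (exp e) <= 2 * emeasure \<mu> G"
  unfolding G_def e_def by (rule order_trans[OF cyl_lower[OF ep lep] typical[OF M(2) cyl_sets cyl_cut]])
 have inG: "\<bar>wick {..M} u\<bar> <= K" "\<bar>X u\<bar> <= K" "nrm p {..M} a / 2 <= nrm p {..M} u" "nrm p {..M} a / 2 <= rnd p u" if u: "u \<in> G" for u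
 proof -
  have uc: "u \<in> cyl M a ep" and ut: "\<bar>X u - wick {..M} u\<bar> <= K / 2" "\<bar>rnd p u - nrm p {..M} u\<bar> <= 1" using u by (auto simp: G_def)
  have wu: "\<bar>wick {..M} u\<bar> <= K / 2"
   by (rule ball_wick[OF _ less_imp_le[OF ep] ep1 epK]) (use a(1) uc in \<open>auto simp: m_def mm_def cyl_def\<close>)
  thus "\<bar>wick {..M} u\<bar> <= K" "\<bar>X u\<bar> <= K" using ut(1) K by linarith+
  have "nrm p {..M} a - nrm p {..M} u <= 1"
   using nrm_perturb[OF p2(2) less_imp_le[OF C(1)] C(2) uc less_imp_le[OF ep]] pert by linarith
  thus "nrm p {..M} a / 2 <= nrm p {..M} u" "nrm p {..M} a / 2 <= rnd p u" using ut(2) n4 by linarith+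
 qed
 have wt: "exp w <= gibbs_weight_trunc h \<mu> K p M u" "exp w <= gibbs_weight h X K p u" if u: "u \<in> G" for u
 proof -
  have "w <= 1 / p * nrm p {..M} u powr p" "w <= 1 / p * rnd p u powr p"
   unfolding w_def using inG(3,4)[OF u] p2 by (intro mult_left_mono powr_mono2; simp)+
  thus "exp w <= gibbs_weight_trunc h \<mu> K p M u" "exp w <= gibbs_weight h X K p u"
   unfolding weight_trunc_eq weight_eq using inG(1,2)[OF u] by simp_all
 qed
 have big: "m <= w + e"
 proof -
  have w: "c' * m powr (p / 2) * T <= w"
  proof -
   have "w = (1 / 2) powr p / p * nrm p {..M} a powr p" by (simp add: w_def powr_divide)
   moreover have "(1 / 2) powr p / p * (c * m powr (p / 2) * T) <= (1 / 2) powr p / p * nrm p {..M} a powr p"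
    using na p2 by (intro mult_left_mono) auto
   moreover have "(1 / 2) powr p / p * (c * m powr (p / 2) * T) = c' * m powr (p / 2) * T" by (simp add: c'_def)
   ultimately show ?thesis by linarith
  qed
  have "ln ep = ln e0 - 3 * ln T" using e0 T by (simp add: ep_def ln_div ln_realpow)
  hence le: "2 * ln ep - 2 >= - (2 * \<bar>ln e0\<bar> + 6 * (d * m) + 2)" using lnT by linarith
  have "2 * (lam M)^2 * m <= 2 * (d * T) * m" using l2 m by (intro mult_right_mono mult_left_mono) auto
  moreover have "T * - (2 * \<bar>ln e0\<bar> + 6 * (d * m) + 2) <= T * (2 * ln ep - 2)" using le T by (intro mult_left_mono) auto
  moreover have "e = T * (2 * ln ep - 2) - 2 * (lam M)^2 * m" by (simp add: e_def T_def a(1))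
  ultimately have e: "T * - (2 * \<bar>ln e0\<bar> + 6 * (d * m) + 2) - 2 * (d * T) * m <= e" by linarith
  have "2 * \<bar>ln e0\<bar> * 1 <= 2 * \<bar>ln e0\<bar> * m" using m by (intro mult_left_mono) auto
  moreover have "Q * m = 8 * (d * m) + 3 * m + 2 * \<bar>ln e0\<bar> * m" by (simp add: Q_def algebra_simps)
  ultimately have "m <= Q * m - (2 * \<bar>ln e0\<bar> + 6 * (d * m) + 2) - 2 * (d * m)" using m by linarith
  also have "... <= c' * m powr (p / 2) - (2 * \<bar>ln e0\<bar> + 6 * (d * m) + 2) - 2 * (d * m)" using ms by linarith
  finally have br: "m <= ..." .
  have "m * 1 <= m * T" using T m by (intro mult_left_mono) auto
  also have "... <= (c' * m powr (p / 2) - (2 * \<bar>ln e0\<bar> + 6 * (d * m) + 2) - 2 * (d * m)) * T" using br T by (intro mult_right_mono) auto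
  also have "... = c' * m powr (p / 2) * T + (T * - (2 * \<bar>ln e0\<bar> + 6 * (d * m) + 2) - 2 * (d * T) * m)" by (simp add: algebra_simps)
  also have "... <= w + e" using w e by (rule add_mono)
  finally show ?thesis by simp
 qed
 have "B <= exp (w + e) / 2"
 proof -
  have "2 * B <= w + e" using big m(4) by linarith
  also have "... <= exp (w + e)" using exp_ge_add_one_self[of "w + e"] by linarith
  finally show ?thesis by simp
 qed
 hence B: "enn B <= enn (exp (w + e) / 2)" by (rule ennreal_leI)
 show ?thesis
  using order_trans[OF B partition_lower[where W="gibbs_weight_trunc h \<mu> K p M", OF Gm wt(1) GP]]
   order_trans[OF B partition_lower[where W="gibbs_weight h X K p", OF Gm wt(2) GP]] by blast
qed

end

section \<open>The law of the random series and the final assembly\<close>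

text \<open>Division by the frequencies followed by multiplication is the identity, so under the
  image measure the scaled coordinates have the same joint law as g; independence and the Gaussian
  densities transfer with it.\<close>

lemma gaussian_law_gibbs:
 fixes h :: "nat => 'a::euclidean_space => real"
 assumes dim: "DIM('a) >= 2" and basis: "radial_eigenbasis h" and prob: "prob_space M"
  and indep: "prob_space.indep_vars M (%_. borel) g UNIV" and gauss: "\<And>n. std_complex_gaussian M (g n)"
 shows "gibbs h DIM('a) (sphere_vol TYPE('a)) (gaussian_law DIM('a) M g)"
proof -
 interpret prob_space M by (rule prob)
 define \<mu> where "\<mu> = gaussian_law DIM('a) M g"
 define l where "l n = complex_of_real (ho_freq DIM('a) n)" for n
 define T where "T = (%om n. g n om / l n)"
 have l0: "l n ~= 0" for n using dim by (simp add: l_def ho_freq_def add_nonneg_eq_0_iff)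
 have gm [measurable]: "g n \<in> borel_measurable M" for n using indep by (auto simp: indep_vars_def)
 have Tm: "T \<in> measurable M (PiM UNIV (%_. borel))"
 proof (rule measurable_PiM_single')
  fix n show "(%om. T om n) \<in> borel_measurable M" unfolding T_def by simp
 qed auto
 have mu: "\<mu> = distr M (PiM UNIV (%_. borel)) T" by (simp add: \<mu>_def gaussian_law_def T_def l_def)
 have sets: "sets \<mu> = sets (PiM UNIV (%_. borel))" by (simp add: mu)
 interpret \<mu>: prob_space \<mu> unfolding mu by (rule prob_space_distr[OF Tm])
 have Xm: "(%u. l n * u n) \<in> borel_measurable (PiM UNIV (%_. borel))" for n
  by (intro borel_measurable_times borel_measurable_const measurable_component_singleton) simp
 have Xmu: "(%u. l n * u n) \<in> borel_measurable \<mu>" for n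
  using Xm by (simp cong: measurable_cong_sets add: sets)
 have XT: "(%u. l n * u n) \<circ> T = g n" for n by (rule ext) (simp add: T_def l0)
 have law: "distr \<mu> borel (%u. l n * u n) = distr M borel (g n)" for n
  unfolding mu by (subst distr_distr[OF Xm Tm]) (simp only: XT)
 have ind: "\<mu>.indep_vars (%_. borel) (%n u. l n * u n) UNIV"
 proof (subst \<mu>.indep_vars_iff_distr_eq_PiM)
  have Fm: "(%u. \<lambda>i\<in>UNIV. l i * u i) \<in> measurable (PiM UNIV (%_. borel)) (PiM UNIV (%_. borel))"
   by (intro measurable_restrict Xm)
  have "distr \<mu> (PiM UNIV (%_. borel)) (%u. \<lambda>i\<in>UNIV. l i * u i) = distr M (PiM UNIV (%_. borel)) ((%u. \<lambda>i\<in>UNIV. l i * u i) \<circ> T)" (is "?a = _")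
   unfolding mu by (rule distr_distr[OF Fm Tm])
  also have "(%u. \<lambda>i\<in>UNIV. l i * u i) \<circ> T = (%om. \<lambda>i\<in>UNIV. g i om)" by (rule ext) (simp add: T_def l0)
  also have "distr M (PiM UNIV (%_. borel)) (%om. \<lambda>i\<in>UNIV. g i om) = PiM UNIV (%i. distr M borel (g i))"
   using indep by (subst (asm) indep_vars_iff_distr_eq_PiM) auto
  finally show "?a = PiM UNIV (%i. distr \<mu> borel (%u. l i * u i))"
   by (simp only: law)
 qed (use Xmu in auto)
 have gs: "std_complex_gaussian \<mu> (%u. l n * u n)" for n
 proof -
  have "distr \<mu> lborel (%u. l n * u n) = distr M lborel (g n)"
   using law[of n] by (metis distr_cong sets_lborel)
  thus ?thesis using gauss[of n] Xmu[of n] by (simp add: std_complex_gaussian_def distributed_def)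
 qed
 have gsq: "gaussian_sequence \<mu> (%n u. l n * u n)"
  by (intro gaussian_sequence.intro gaussian_sequence_axioms.intro \<mu>.prob_space_axioms ind gs)
 have rb: "radial_basis h DIM('a) (sphere_vol TYPE('a))"
  by (rule radial_basis.intro) (use dim basis in auto)
 show ?thesis unfolding \<mu>_def[symmetric]
  by (intro gibbs.intro gibbs_axioms.intro rb gsq[unfolded l_def] sets)
qed

lemma Lp_norm_1_nonneg:
 fixes W :: "'b => real"
 assumes "\<And>x. W x >= 0"
 shows "Lp_norm M 1 W = partition_fun M W"
proof -
 have "Lp_int M 1 W = partition_fun M W" unfolding Lp_int_def partition_fun_def using assms by simp
 thus ?thesis by (cases "partition_fun M W") (simp_all add: Lp_norm_Lp_int)
qed

theorem theorem1p6:
  fixes h :: "nat \<Rightarrow> 'a::euclidean_space \<Rightarrow> real"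
    and M :: "'w measure"
    and g :: "nat \<Rightarrow> 'w \<Rightarrow> complex"
    and \<mu> :: "(nat \<Rightarrow> complex) measure"
    and X :: "(nat \<Rightarrow> complex) \<Rightarrow> real"
    and d pstar :: real
  assumes dim: "DIM('a) \<ge> 2"
    and d_eq: "d = real DIM('a)"
    and pstar_eq: "pstar = 2 + 4 / d"
    and basis: "radial_eigenbasis h"
    and prob: "prob_space M"
    and indep: "prob_space.indep_vars M (\<lambda>_. borel) g UNIV"
    and gauss: "\<And>n. std_complex_gaussian M (g n)"
    and mu_eq: "\<mu> = gaussian_law DIM('a) M g"
    and mass_limit: "tendsto_Lp \<mu> 2 (wick_mass h \<mu>) X"
  shows
    "(\<forall>K p. K > 0 \<and> 2 < p \<and> p < pstar \<longrightarrow>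
        (\<forall>r\<ge>1.
           (\<forall>N. gibbs_weight_trunc h \<mu> K p N \<in> borel_measurable \<mu>) \<and>
           (SUP N. Lp_norm \<mu> r (gibbs_weight_trunc h \<mu> K p N)) < \<infinity> \<and>
           tendsto_Lp \<mu> r (gibbs_weight_trunc h \<mu> K p) (gibbs_weight h X K p)) \<and>
        (\<forall>N. prob_space (gibbs_measure \<mu> (gibbs_weight_trunc h \<mu> K p N))) \<and>
        prob_space (gibbs_measure \<mu> (gibbs_weight h X K p)) \<and>
        (\<lambda>N. tv_dist (gibbs_measure \<mu> (gibbs_weight_trunc h \<mu> K p N))
                      (gibbs_measure \<mu> (gibbs_weight h X K p))) \<longlonglongrightarrow> 0 \<and>
        absolutely_continuous \<mu> (gibbs_measure \<mu> (gibbs_weight h X K p)))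
     \<and>
     (\<forall>p. pstar \<le> p \<and> (DIM('a) \<ge> 3 \<longrightarrow> p < 2 * d / (d - 2)) \<longrightarrow>
        (\<forall>K>0.
           (\<forall>N. gibbs_weight_trunc h \<mu> K p N \<in> borel_measurable \<mu>) \<and>
           gibbs_weight h X K p \<in> borel_measurable \<mu> \<and>
           (SUP N. partition_fun \<mu> (gibbs_weight_trunc h \<mu> K p N))
             = (SUP N. Lp_norm \<mu> 1 (gibbs_weight_trunc h \<mu> K p N)) \<and>
           (SUP N. partition_fun \<mu> (gibbs_weight_trunc h \<mu> K p N)) = \<infinity> \<and>
           partition_fun \<mu> (gibbs_weight h X K p) = \<infinity> \<and>
           (\<forall>c. \<not> prob_space (scale_measure c (density \<mu> (\<lambda>u. ennreal (gibbs_weight h X K p u)))))))"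
proof -
 interpret gibbs h "DIM('a)" "sphere_vol TYPE('a)" \<mu>
  unfolding mu_eq by (rule gaussian_law_gibbs[OF dim basis prob indep gauss])
 have X: "tendsto_Lp \<mu> 2 (%N. wick {..N}) X"
  using mass_limit unfolding wick_mass_wick [abs_def] .
 note Xm = mass_limit_D(1)[OF X]
 show ?thesis
 proof (rule conjI, intro allI impI, goal_cases)
  case (1 K p)
  hence h: "2 < p" "p < 2 + 4 / real DIM('a)" "K > 0" by (simp_all add: pstar_eq d_eq)
  show ?case using subcritical[OF h X] weight_trunc_measurable by blast
 next
  case 2
  show ?case
  proof (intro allI impI)
   fix p K :: real
   assume a: "pstar <= p \<and> (DIM('a) >= 3 \<longrightarrow> p < 2 * d / (d - 2))" and K: "K > 0"
   have p: "p >= 2 + 4 / real DIM('a)" using a by (simp add: pstar_eq d_eq)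
   have p2: "p > 2" using p dim by (smt (verit) divide_pos_pos of_nat_0_less_iff DIM_positive)
   \<comment> \<open>For dimension 2 there is no upper bound on p, and the condition degenerates to
     0 < 4.\<close>
   have valid: "valid p"
   proof (cases "DIM('a) >= 3")
    case True
    hence "p < 2 * d / (d - 2)" using a by blast
    moreover have "d - 2 > 0" using True by (simp add: d_eq)
    ultimately have "p * (d - 2) < 2 * d" by (simp add: pos_less_divide_eq)
    thus ?thesis using p2 unfolding valid_def d_eq by simp
   next
    case False
    hence "DIM('a) = 2" using dim by simp
    thus ?thesis using p2 unfolding valid_def by simp
   qed
   let ?Z = "partition_fun \<mu> (gibbs_weight h X K p)"
   note low = supercritical[OF valid p K X]
   \<comment> \<open>\<open>supercritical\<close> holds for every B, so a finite value z is
     contradicted with B = z + 1; the supremum over N is treated in the same way.\<close>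
   have Z: "?Z = \<infinity>"
   proof (rule ccontr)
    assume "?Z ~= \<infinity>"
    then obtain z where z: "?Z = ennreal z" "z >= 0" by (cases ?Z) auto
    have "ennreal (z + 1) <= ennreal z" using low[of "z + 1"] z by auto
    thus False using z(2) by simp
   qed
   have S: "(SUP N. partition_fun \<mu> (gibbs_weight_trunc h \<mu> K p N)) = \<infinity>" (is "?S = _")
   proof (rule ccontr)
    assume "?S ~= \<infinity>"
    then obtain z where z: "?S = ennreal z" "z >= 0" by (cases ?S) auto
    obtain N where "ennreal (z + 1) <= partition_fun \<mu> (gibbs_weight_trunc h \<mu> K p N)" using low[of "z + 1"] by blast
    also have "... <= ?S" by (rule SUP_upper) simp
    finally show False using z by simp
   qed
   have L: "Lp_norm \<mu> 1 (gibbs_weight_trunc h \<mu> K p N) = partition_fun \<mu> (gibbs_weight_trunc h \<mu> K p N)" for N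
    by (rule Lp_norm_1_nonneg) (simp add: weight_trunc_eq)
   have Wm: "gibbs_weight h X K p \<in> borel_measurable \<mu>" using p2 by (intro weight_measurable Xm) simp
   \<comment> \<open>The total mass is infinite, so its multiples by constants in [0, \<infinity>]
     are 0 or \<infinity>, never 1.\<close>
   have np: "\<not> prob_space (scale_measure c (density \<mu> (%u. ennreal (gibbs_weight h X K p u))))" for c
   proof
    assume "prob_space (scale_measure c (density \<mu> (%u. ennreal (gibbs_weight h X K p u))))"
    from prob_space.emeasure_space_1[OF this]
    have "c * emeasure (density \<mu> (%u. ennreal (gibbs_weight h X K p u))) (space \<mu>) = 1"
     by (simp add: space_scale_measure)
    moreover have "emeasure (density \<mu> (%u. ennreal (gibbs_weight h X K p u))) (space \<mu>) = \<infinity>"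
     using Wm Z by (subst emeasure_density) (auto simp: partition_fun_def cong: nn_integral_cong)
    ultimately show False by (cases "c = 0") (simp_all add: ennreal_mult_top)
   qed
   show "(\<forall>N. gibbs_weight_trunc h \<mu> K p N \<in> borel_measurable \<mu>) \<and>
      gibbs_weight h X K p \<in> borel_measurable \<mu> \<and>
      (SUP N. partition_fun \<mu> (gibbs_weight_trunc h \<mu> K p N))
       = (SUP N. Lp_norm \<mu> 1 (gibbs_weight_trunc h \<mu> K p N)) \<and>
      (SUP N. partition_fun \<mu> (gibbs_weight_trunc h \<mu> K p N)) = \<infinity> \<and>
      partition_fun \<mu> (gibbs_weight h X K p) = \<infinity> \<and>
      (\<forall>c. \<not> prob_space (scale_measure c (density \<mu> (%u. ennreal (gibbs_weight h X K p u)))))"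
    unfolding L using weight_trunc_measurable Wm S Z np by blast
  qed
 qed
qed

end
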